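(* Let $\dim X<\infty$, $\mathbf X=l^p(\mathbb Z^N,X)$ and $A\in\mathcal L(\mathbf X,\mathcal P)$. Then $$\nu_{\rm ess,c}(A\oplus A^* )=\nu_{\rm ess}(A\oplus A^* )=\mu(A)=\|(A+\mathcal K(\mathbf X,\mathcal P))^{-1}\|^{-1}=\|(A+\mathcal K(\mathbf X))^{-1}\|^{-1}.$$ Moreover, if $A$ is Fredholm of index zero, then $$\nu_{\rm ess,c}(A)=\nu_{\rm ess,c}(A^* )=\nu_{\rm ess}(A)=\nu_{\rm ess}(A^* )=\mu(A)=\tilde\mu(A)=\tilde\mu(A^* )>0.$$ Conversely, if $\nu_{\rm ess,c}(A)>0$ and $\nu_{\rm ess,c}(A^* )>0$, then $A$ is Fredholm of index zero.
   Context: Let $N\in\mathbb N$, $p\in\{0\}\cup[1,\infty]$, and let $X\ne\{0\}$ be a complex Banach space (here finite-dimensional). $\mathbf X=l^p(\mathbb Z^N,X)$ is the space of sequences $x=(x_i)_{i\in\mathbb Z^N}$, $x_i\in X$, with the usual $p$-norm for $1\le p\le\infty$; $l^0(\mathbb Z^N,X)$ denotes the closure in $l^\infty(\mathbb Z^N,X)$ of the finitely supported sequences. $P_n:=\chi_{\{-n,\dots,n\}^N}I$ (multiplication by the characteristic function), $Q_n:=I-P_n$ ($n\in\mathbb N$), $\mathcal P:=(P_n)$, and $\mathcal P^*:=(P_n^* )$ on the dual space $\mathbf X^*$. For a Banach space $\mathbf Y$, $\mathcal L(\mathbf Y)$ and $\mathcal K(\mathbf Y)$ denote the bounded, respectively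 compact, linear operators on $\mathbf Y$. For a Banach space $\mathbf Y$ with a sequence $\mathcal R=(R_n)$ of projections: $\mathcal K(\mathbf Y,\mathcal R):=\{K\in\mathcal L(\mathbf Y):\|(I-R_n)K\|+\|K(I-R_n)\|\to0\}$ and $\mathcal L(\mathbf Y,\mathcal R):=\{A\in\mathcal L(\mathbf Y):AK,KA\in\mathcal K(\mathbf Y,\mathcal R)\ \forall K\in\mathcal K(\mathbf Y,\mathcal R)\}$. $\mathcal L(\mathbf X,\mathcal P)$ is a closed subalgebra of $\mathcal L(\mathbf X)$ containing $\mathcal K(\mathbf X,\mathcal P)$ as a closed two-sided ideal. $(A+\mathcal K(\mathbf X,\mathcal P))^{-1}$ is the inverse in $\mathcal L(\mathbf X,\mathcal P)/\mathcal K(\mathbf X,\mathcal P)$, $(A+\mathcal K(\mathbf X))^{-1}$ is the inverse in $\mathcal L(\mathbf X)/\mathcal K(\mathbf X)$, with quotient norms; convention: $\|b^{-1}\|^{-1}:=0$ if $b$ is not invertible. $\mathbf X\oplus\mathbf X^*$ is the space of pairs $(x,f)\in\mathbf X\times\mathbf X^*$ with norm $\max\{\|x\|,\|f\|\}$, equipped with $\mathcal P\oplus\mathcal P^*=(P_n\oplus P_n^* )$, and $(A\oplus A^* )(x,f):=(Ax,A^*f)$. Lower norm: $\nu(B):=\inf\{\|Bx\|:\|x\|=1\}$. $\tilde\mu(A):=\lim_{m\to\infty}\nu(A|_{\mathrm{im}\,Q_m})$ and $\tilde\mu(A^* ):=\lim_{m\to\infty}\nu(A^*|_{\mathrm{im}\,Q_m^*})$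 (limits exist by monotonicity), $\mu(A):=\min\{\tilde\mu(A),\tilde\mu(A^* )\}$. For an operator $B$ on $\mathbf Y$ with associated projections $\mathcal R$ (where $(\mathbf Y,\mathcal R)$ is $(\mathbf X,\mathcal P)$, $(\mathbf X^*,\mathcal P^* )$ or $(\mathbf X\oplus\mathbf X^*,\mathcal P\oplus\mathcal P^* )$): $\nu_{\rm ess}(B):=\sup\{\nu(B+K):K\in\mathcal K(\mathbf Y,\mathcal R)\}$ and $\nu_{\rm ess,c}(B):=\sup\{\nu(B+K):K\in\mathcal K(\mathbf Y)\}$. Fredholm means finite-dimensional kernel and finite-codimensional range; the index is $\dim\ker A-\dim(\mathbf X/\mathrm{im}\,A)$. *)

theory Defs
  imports
    "HOL-Analysis.Analysis"
    "HOL-Algebra.QuotRing"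
    "HOL-Library.Function_Algebras"
begin

section \<open>Complex vector spaces\<close>

class scaleC =
  fixes scaleC :: "complex \<Rightarrow> 'a \<Rightarrow> 'a" (infixr "*\<^sub>C" 75)

class complex_vector = scaleC + ab_group_add +
  assumes scaleC_add_right: "a *\<^sub>C (x + y) = a *\<^sub>C x + a *\<^sub>C y"
    and scaleC_add_left: "(a + b) *\<^sub>C x = a *\<^sub>C x + b *\<^sub>C x"
    and scaleC_scaleC: "a *\<^sub>C b *\<^sub>C x = (a * b) *\<^sub>C x"
    and scaleC_one: "1 *\<^sub>C x = x"

class complex_normed_vector = complex_vector + real_normed_vector +
  assumes scaleR_scaleC: "r *\<^sub>R x = complex_of_real r *\<^sub>C x"
    and norm_scaleC: "norm (a *\<^sub>C x) = cmod a * norm x"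

global_interpretation complex_vector:
  vector_space "scaleC :: complex \<Rightarrow> 'a \<Rightarrow> 'a::complex_vector"
  defines cspan = complex_vector.span
    and cdim = complex_vector.dim
  by unfold_locales
    (simp_all add: scaleC_add_right scaleC_add_left scaleC_scaleC scaleC_one)

instantiation complex :: complex_normed_vector
begin
definition scaleC_complex :: "complex \<Rightarrow> complex \<Rightarrow> complex"
  where "scaleC_complex a x = a * x"
instance
  by standard (simp_all add: scaleC_complex_def algebra_simps norm_mult scaleR_conv_of_real)
end

instantiation "fun" :: (type, complex_vector) complex_vector
begin
definition scaleC_fun :: "complex \<Rightarrow> ('a \<Rightarrow> 'b) \<Rightarrow> 'a \<Rightarrow> 'b"
  where "scaleC_fun a f = (\<lambda>i. a *\<^sub>C f i)"
instance
  by standard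
    (simp_all add: scaleC_fun_def fun_eq_iff scaleC_add_right scaleC_add_left scaleC_scaleC scaleC_one)
end

instantiation prod :: (complex_vector, complex_vector) complex_vector
begin
definition scaleC_prod :: "complex \<Rightarrow> 'a \<times> 'b \<Rightarrow> 'a \<times> 'b"
  where "scaleC_prod a x = (a *\<^sub>C fst x, a *\<^sub>C snd x)"
instance
  by standard
    (simp_all add: scaleC_prod_def prod_eq_iff scaleC_add_right scaleC_add_left scaleC_scaleC scaleC_one)
end


section \<open>Normed spaces and bounded operators\<close>

text \<open>
  A normed space is a linear subspace \<open>pts\<close> of an ambient complex vector space together with a
  norm that is only meaningful on that subspace.  Linear maps defined on such a subspace are
  represented by functions on the ambient type that vanish outside the subspace, so that two
  operators are equal iff they agree on the subspace, and sums, multiples and compositions of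
  operators are the ordinary pointwise sums, multiples and compositions of functions.
\<close>

record 'a cnspace =
  pts :: "'a set"
  nrm :: "'a \<Rightarrow> real"

definition scalars :: "complex cnspace"
  where "scalars = \<lparr>pts = UNIV, nrm = cmod\<rparr>"

definition bounded_ops ::
    "'a::complex_vector cnspace \<Rightarrow> 'b::complex_vector cnspace \<Rightarrow> ('a \<Rightarrow> 'b) set"
  where "bounded_ops Y Z = {T.
     (\<forall>x\<in>pts Y. T x \<in> pts Z) \<and>
     (\<forall>x. x \<notin> pts Y \<longrightarrow> T x = 0) \<and>
     (\<forall>x\<in>pts Y. \<forall>y\<in>pts Y. T (x + y) = T x + T y) \<and>
     (\<forall>a. \<forall>x\<in>pts Y. T (a *\<^sub>C x) = a *\<^sub>C T x) \<and>
     (\<exists>c. \<forall>x\<in>pts Y. nrm Z (T x) \<le> c * nrm Y x)}"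

definition op_norm :: "'a cnspace \<Rightarrow> 'b cnspace \<Rightarrow> ('a \<Rightarrow> 'b) \<Rightarrow> real"
  where "op_norm Y Z T = (SUP x\<in>{x\<in>pts Y. nrm Y x \<le> 1}. nrm Z (T x))"

abbreviation ops :: "'a::complex_vector cnspace \<Rightarrow> ('a \<Rightarrow> 'a) set"
  where "ops Y \<equiv> bounded_ops Y Y"

definition id_op :: "'a::complex_vector cnspace \<Rightarrow> 'a \<Rightarrow> 'a"
  where "id_op Y x = (if x \<in> pts Y then x else 0)"

definition dual :: "'a::complex_vector cnspace \<Rightarrow> ('a \<Rightarrow> complex) cnspace"
  where "dual Y = \<lparr>pts = bounded_ops Y scalars, nrm = op_norm Y scalars\<rparr>"

definition adj :: "'a::complex_vector cnspace \<Rightarrow> ('a \<Rightarrow> 'a) \<Rightarrow> ('a \<Rightarrow> complex) \<Rightarrow> ('a \<Rightarrow> complex)"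
  where "adj Y T f = (if f \<in> pts (dual Y) then f \<circ> T else 0)"

definition sum_space ::
    "'a::complex_vector cnspace \<Rightarrow> 'b::complex_vector cnspace \<Rightarrow> ('a \<times> 'b) cnspace"
  where "sum_space Y Z =
    \<lparr>pts = pts Y \<times> pts Z, nrm = (\<lambda>(x, f). max (nrm Y x) (nrm Z f))\<rparr>"

definition sum_op ::
    "'a::complex_vector cnspace \<Rightarrow> 'b::complex_vector cnspace \<Rightarrow>
     ('a \<Rightarrow> 'a) \<Rightarrow> ('b \<Rightarrow> 'b) \<Rightarrow> ('a \<times> 'b) \<Rightarrow> ('a \<times> 'b)"
  where "sum_op Y Z S T = (\<lambda>(x, f). if x \<in> pts Y \<and> f \<in> pts Z then (S x, T f) else 0)"

definition compact_ops :: "'a::complex_vector cnspace \<Rightarrow> ('a \<Rightarrow> 'a) set"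
  where "compact_ops Y = {K \<in> ops Y.
     \<forall>x :: nat \<Rightarrow> 'a. (\<forall>n. x n \<in> pts Y \<and> nrm Y (x n) \<le> 1) \<longrightarrow>
       (\<exists>y\<in>pts Y. \<exists>r. strict_mono r \<and> (\<lambda>n. nrm Y (K (x (r n)) - y)) \<longlonglongrightarrow> 0)}"

text \<open>The sets written \<open>K(Y, R)\<close> and \<open>L(Y, R)\<close> for a sequence \<open>R\<close> of projections on \<open>Y\<close>.\<close>

definition proj_compact_ops ::
    "'a::complex_vector cnspace \<Rightarrow> (nat \<Rightarrow> 'a \<Rightarrow> 'a) \<Rightarrow> ('a \<Rightarrow> 'a) set"
  where "proj_compact_ops Y R = {K \<in> ops Y.
     (\<lambda>n. op_norm Y Y ((id_op Y - R n) \<circ> K) + op_norm Y Y (K \<circ> (id_op Y - R n))) \<longlonglongrightarrow> 0}"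

definition proj_ops ::
    "'a::complex_vector cnspace \<Rightarrow> (nat \<Rightarrow> 'a \<Rightarrow> 'a) \<Rightarrow> ('a \<Rightarrow> 'a) set"
  where "proj_ops Y R = {T \<in> ops Y.
     \<forall>K\<in>proj_compact_ops Y R. T \<circ> K \<in> proj_compact_ops Y R \<and> K \<circ> T \<in> proj_compact_ops Y R}"


section \<open>Quotient algebras\<close>

definition op_ring :: "'a::complex_vector cnspace \<Rightarrow> ('a \<Rightarrow> 'a) set \<Rightarrow> ('a \<Rightarrow> 'a) ring"
  where "op_ring Y L =
    \<lparr>carrier = L, mult = (\<circ>), one = id_op Y, zero = 0, add = (+)\<rparr>"

text \<open>
  An element of \<open>op_ring Y L Quot J\<close> is a set of operators (a coset of \<open>J\<close>), and its quotient norm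
  is the infimum of the norms of its members.
\<close>

definition coset_norm :: "'a::complex_vector cnspace \<Rightarrow> ('a \<Rightarrow> 'a) set \<Rightarrow> real"
  where "coset_norm Y C = (INF T\<in>C. op_norm Y Y T)"

text \<open>The number \<open>\<parallel>(T + J)\<^sup>-\<^sup>1\<parallel>\<^sup>-\<^sup>1\<close>, for the inverse taken in \<open>L / J\<close>.\<close>

definition inv_coset_norm_inv ::
    "'a::complex_vector cnspace \<Rightarrow> ('a \<Rightarrow> 'a) set \<Rightarrow> ('a \<Rightarrow> 'a) set \<Rightarrow> ('a \<Rightarrow> 'a) \<Rightarrow> real"
  where "inv_coset_norm_inv Y L J T =
    (let R = op_ring Y L; Q = R Quot J; C = J +>\<^bsub>R\<^esub> T
     in if C \<in> Units Q then inverse (coset_norm Y (inv\<^bsub>Q\<^esub> C)) else 0)"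


section \<open>Lower norms and Fredholm operators\<close>

text \<open>The lower norm of the restriction of \<open>T\<close> to a subspace \<open>M\<close> of \<open>Y\<close>.\<close>

definition lower_norm_on :: "'a cnspace \<Rightarrow> 'a set \<Rightarrow> ('a \<Rightarrow> 'a) \<Rightarrow> real"
  where "lower_norm_on Y M T = (INF x\<in>{x\<in>M. nrm Y x = 1}. nrm Y (T x))"

definition lower_norm :: "'a cnspace \<Rightarrow> ('a \<Rightarrow> 'a) \<Rightarrow> real"
  where "lower_norm Y T = lower_norm_on Y (pts Y) T"

definition nu_ess ::
    "'a::complex_vector cnspace \<Rightarrow> (nat \<Rightarrow> 'a \<Rightarrow> 'a) \<Rightarrow> ('a \<Rightarrow> 'a) \<Rightarrow> real"
  where "nu_ess Y R T = (SUP K\<in>proj_compact_ops Y R. lower_norm Y (T + K))"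

definition nu_ess_c :: "'a::complex_vector cnspace \<Rightarrow> ('a \<Rightarrow> 'a) \<Rightarrow> real"
  where "nu_ess_c Y T = (SUP K\<in>compact_ops Y. lower_norm Y (T + K))"

definition mu_tilde :: "'a cnspace \<Rightarrow> (nat \<Rightarrow> 'a \<Rightarrow> 'a) \<Rightarrow> ('a \<Rightarrow> 'a) \<Rightarrow> real"
  where "mu_tilde Y Q T = lim (\<lambda>m. lower_norm_on Y (Q m ` pts Y) T)"

definition fin_dim :: "'a::complex_vector set \<Rightarrow> bool"
  where "fin_dim V \<longleftrightarrow> (\<exists>B. finite B \<and> V \<subseteq> cspan B)"

text \<open>
  For a subspace \<open>U\<close> of \<open>V\<close>, the cosets of the elements of \<open>B \<subseteq> V\<close> span \<open>V / U\<close> iff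
  \<open>V \<subseteq> cspan (U \<union> B)\<close>; the dimension of \<open>V / U\<close> is the least size of a spanning set.
\<close>

definition fin_codim :: "'a::complex_vector set \<Rightarrow> 'a set \<Rightarrow> bool"
  where "fin_codim V U \<longleftrightarrow> (\<exists>B\<subseteq>V. finite B \<and> V \<subseteq> cspan (U \<union> B))"

definition quot_dim :: "'a::complex_vector set \<Rightarrow> 'a set \<Rightarrow> nat"
  where "quot_dim V U = (LEAST d. \<exists>B\<subseteq>V. finite B \<and> card B = d \<and> V \<subseteq> cspan (U \<union> B))"

definition ker :: "'a::complex_vector cnspace \<Rightarrow> ('a \<Rightarrow> 'a) \<Rightarrow> 'a set"
  where "ker Y T = {x\<in>pts Y. T x = 0}"

definition fredholm :: "'a::complex_vector cnspace \<Rightarrow> ('a \<Rightarrow> 'a) \<Rightarrow> bool"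
  where "fredholm Y T \<longleftrightarrow> T \<in> ops Y \<and> fin_dim (ker Y T) \<and> fin_codim (pts Y) (T ` pts Y)"

definition fredholm_index :: "'a::complex_vector cnspace \<Rightarrow> ('a \<Rightarrow> 'a) \<Rightarrow> int"
  where "fredholm_index Y T = int (cdim (ker Y T)) - int (quot_dim (pts Y) (T ` pts Y))"


section \<open>The sequence spaces\<close>

type_synonym ('n, 'x) sq = "int ^ 'n \<Rightarrow> 'x"

definition lp_norm :: "ennreal \<Rightarrow> ('n::finite, 'x::complex_normed_vector) sq \<Rightarrow> real"
  where "lp_norm p x =
    (if p = 0 \<or> p = \<infinity> then (SUP i. norm (x i))
     else (\<Sum>\<^sub>\<infinity>i. norm (x i) powr enn2real p) powr (1 / enn2real p))"

definition lp_pts :: "ennreal \<Rightarrow> ('n::finite, 'x::complex_normed_vector) sq set"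
  where "lp_pts p =
    (if p = 0 then {x. bounded (range x) \<and>
         (\<forall>e>0. \<exists>y. finite {i. y i \<noteq> 0} \<and> lp_norm \<infinity> (x - y) < e)}
     else if p = \<infinity> then {x. bounded (range x)}
     else {x. (\<lambda>i. norm (x i) powr enn2real p) summable_on UNIV})"

definition lp :: "ennreal \<Rightarrow> ('n::finite, 'x::complex_normed_vector) sq cnspace"
  where "lp p = \<lparr>pts = lp_pts p, nrm = lp_norm p\<rparr>"

definition P_op ::
    "ennreal \<Rightarrow> nat \<Rightarrow> ('n::finite, 'x::complex_normed_vector) sq \<Rightarrow> ('n, 'x) sq"
  where "P_op p n x =
    (if x \<in> pts (lp p) then (\<lambda>i. if \<forall>k. i $ k \<in> {- int n..int n} then x i else 0) else 0)"

definition Q_op ::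
    "ennreal \<Rightarrow> nat \<Rightarrow> ('n::finite, 'x::complex_normed_vector) sq \<Rightarrow> ('n, 'x) sq"
  where "Q_op p n = id_op (lp p) - P_op p n"

definition mu :: "ennreal \<Rightarrow> (('n::finite, 'x::complex_normed_vector) sq \<Rightarrow> ('n, 'x) sq) \<Rightarrow> real"
  where "mu p A =
    min (mu_tilde (lp p) (Q_op p) A)
        (mu_tilde (dual (lp p)) (\<lambda>m. adj (lp p) (Q_op p m)) (adj (lp p) A))"

end

theory Submission
imports Defs "HOL-Library.Diagonal_Subsequence"
begin

text \<open>
  If \<open>A\<close> and its adjoint are bounded below modulo compact operators, then the image of a far out
  tail space has a complement spanned by finitely many finitely supported vectors \<open>W\<close>, which gives
  an inverse \<open>B\<close> of \<open>A\<close> modulo \<open>K(X, P)\<close>. All quantities then equal \<open>1 / inf \<parallel>B + K\<parallel>\<close>: a lower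
  bound \<open>c\<close> of \<open>A + K\<close> persists on finitely supported vectors far out, as subtracting two of them
  cancels \<open>K\<close>, and cutting off \<open>B\<close> yields an inverse modulo \<open>K(X, P)\<close> of norm about \<open>1 / c\<close>.
  Conversely, such an inverse can be corrected to the inverse of some \<open>A + K\<close> of almost the same
  norm, unless the index \<open>card F - card W\<close> (\<open>F\<close> a basis of the image of \<open>P\<^sub>n\<close>) is an obstruction;
  for \<open>A \<oplus> A\<^sup>*\<close> it cancels.
\<close>

text \<open>Two features of sequence spaces shape the argument. For p = 1 and p = \<infinity> a
  compact operator need not be small on tails, so a lower bound of A + K cannot be moved to tails by
  truncating K. It is moved by comparing two almost disjoint unit vectors z and w far out: the sum
  of two disjoint vectors of equal norm has \<open>ka\<close> times that norm, the factor
  \<open>ka\<close> occurs in the norm of z - w as well as in that of A z - A w, and so it cancels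
  and the bound keeps its constant. For p = \<infinity> the truncations of a functional do not
  determine it, so the dual is not treated as another sequence space: only the inequalities with
  \<open>ka\<close> are dualized, and bounds on the dual return to X by testing with finitely
  supported functionals. All quantities are compared with one number \<open>ess_bound A\<close>, the
  supremum of the reciprocal norms of inverses modulo K(X, P), or 0 if there are none. The index
  requires no general Fredholm theory: on a tail space A is injective with complemented image, and
  all counting takes place between the finite sets F and W.\<close>

notation scaleC (infixr "*C" 75)
notation LIMSEQ ("((_)/ ----> (_))" [60, 60] 60)

alias csubspace = complex_vector.subspace
alias cindependent = complex_vector.independent
alias crepresentation = complex_vector.representation
lemmas cspan_minimal = complex_vector.span_minimal
	and cscale_right_distrib = complex_vector.scale_right_distrib
	and cspan_finite = complex_vector.span_finite
	and cspan_add = complex_vector.span_add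
	and cspan_sum = complex_vector.span_sum
	and cspan_scale = complex_vector.span_scale
	and cspan_base = complex_vector.span_base
	and csubspace_scale = complex_vector.subspace_scale
	and cscale_right_diff_distrib = complex_vector.scale_right_diff_distrib
	and csubspace_diff = complex_vector.subspace_diff
	and cscale_left_distrib = complex_vector.scale_left_distrib
	and csubspace_add = complex_vector.subspace_add
	and cindependent_span_bound = complex_vector.independent_span_bound
	and cspan_superset = complex_vector.span_superset

section \<open>Normed subspaces and their operators\<close>

text \<open>The axioms are relative to \<open>pts Y\<close> because the spaces in question, such as
  a dual inside a function type, are proper subspaces of their types and carry norms that mean
  nothing outside.\<close>

locale cnorm_space =
	fixes Y :: "'a::complex_vector cnspace"
	assumes zero_in [simp]: "0 : pts Y"
		and add_in [simp]: "!!x y. x : pts Y ==> y : pts Y ==> x + y : pts Y"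
		and scale_in [simp]: "!!a x. x : pts Y ==> a *C x : pts Y"
		and nrm_nonneg [simp]: "!!x. x : pts Y ==> 0 <= nrm Y x"
		and nrm_eq_0: "!!x. x : pts Y ==> nrm Y x = 0 ==> x = 0"
		and nrm_add: "!!x y. x : pts Y ==> y : pts Y ==> nrm Y (x + y) <= nrm Y x + nrm Y y"
		and nrm_scale: "!!a x. x : pts Y ==> nrm Y (a *C x) = cmod a * nrm Y x"
begin

abbreviation "pY == pts Y"
abbreviation "nY == nrm Y"
abbreviation "FY == bounded_ops Y scalars"
abbreviation "DY == dual Y"
abbreviation "pD == pts (dual Y)"
abbreviation "nD == nrm (dual Y)"

lemma uminus_in [simp]: "x : pY ==> - x : pY"
	using scale_in[of x "-1"] by simp

lemma diff_in [simp]: "x : pY ==> y : pY ==> x - y : pY"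
	using add_in[of x "- y"] by simp

lemma sum_in: "(!!i. i : I ==> f i : pY) ==> sum f I : pY"
	by (induction I rule: infinite_finite_induct) auto

lemma subspace_pts: "csubspace (pY)"
	by (simp add: complex_vector.subspace_def)

lemma cspan_subset_pts: "B \<subseteq> pY ==> cspan B \<subseteq> pY"
	by (rule cspan_minimal[OF _ subspace_pts])

lemma nrm_zero [simp]: "nY 0 = 0"
	using nrm_scale[of 0 0] by simp

lemma nrm_zero_iff: "x : pY ==> nY x = 0 \<longleftrightarrow> x = 0"
	using nrm_eq_0 by auto

lemma nrm_pos_iff: "x : pY ==> 0 < nY x \<longleftrightarrow> x ~= 0"
	using nrm_zero_iff[of x] nrm_nonneg[of x] by (auto simp: less_le)

lemma nrm_uminus: "x : pY ==> nY (- x) = nY x"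
	using nrm_scale[of x "-1"] by simp

lemma nrm_diff: "x : pY ==> y : pY ==> nY (x - y) <= nY x + nY y"
	using nrm_add[of x "- y"] nrm_uminus[of y] by simp

lemma nrm_commute: "x : pY ==> y : pY ==> nY (x - y) = nY (y - x)"
	using nrm_uminus[of "x - y"] by simp

lemma nrm_triangle: "x : pY ==> y : pY ==> z : pY ==>
		nY (x - z) <= nY (x - y) + nY (y - z)"
	using nrm_add[of "x - y" "y - z"] by simp

lemma nrm_triangle2: "x : pY ==> y : pY ==> nY x <= nY (x - y) + nY y"
	using nrm_add[of "x - y" "y"] by simp

lemma nrm_sum: "(!!i. i : I ==> f i : pY) ==> nY (sum f I) <= (SUM i:I. nY (f i))"
proof (induction I rule: infinite_finite_induct)
	case (insert i I)
	then have "nY (f i + sum f I) <= nY (f i) + nY (sum f I)"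
		by (intro nrm_add) (auto intro: sum_in)
	with insert show ?case by fastforce
qed auto

lemma nrm_normalize:
	assumes "x : pY" "x ~= 0"
	shows "nY (complex_of_real (1 / nY x) *C x) = 1"
	using assms nrm_pos_iff[of x] by (simp add: nrm_scale norm_divide)

lemma limit_unique:
	assumes "!!n. x n : pY" "y : pY" "z : pY"
		and "(%n. nY (x n - y)) ----> 0" "(%n. nY (x n - z)) ----> 0"
	shows "y = z"
proof -
	have "(%n. nY (x n - y) + nY (x n - z)) ----> 0 + 0"
		by (intro tendsto_add assms)
	moreover have "nY (y - z) <= nY (x n - y) + nY (x n - z)" for n
		using nrm_triangle[of y "x n" z] assms nrm_commute[of y "x n"] by simp
	ultimately have "nY (y - z) <= 0"
		by (intro LIMSEQ_le_const[where X = "%n. nY (x n - y) + nY (x n - z)"]) auto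
	then show ?thesis
		using assms nrm_eq_0[of "y - z"] nrm_nonneg[of "y - z"] by (simp del: nrm_nonneg)
qed

end

section \<open>Bounded operators and the operator norm\<close>

lemma cnorm_space_scalars: "cnorm_space scalars"
	by unfold_locales
		(auto simp: scalars_def scaleC_complex_def norm_mult norm_triangle_ineq)

lemma pts_scalars [simp]: "pts scalars = UNIV"
	and nrm_scalars [simp]: "nrm scalars = cmod"
	by (simp_all add: scalars_def)

text \<open>Operators are functions on the whole ambient type, so a map given only on
  \<open>pts Y\<close> has to be cut off to become a member of \<open>bounded_ops\<close>.\<close>

definition zext :: "'a cnspace => ('a => 'b) => 'a => 'b::zero"
	where "zext Y f x = (if x : pts Y then f x else 0)"

lemma zext_in [simp]: "x : pts Y ==> zext Y f x = f x"
	and zext_out: "x ~: pts Y ==> zext Y f x = 0"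
	by (simp_all add: zext_def)

lemma id_op_in [simp]: "x : pts Y ==> id_op Y x = x"
	by (simp add: id_op_def)

lemma bop_in: "T : bounded_ops Y Z ==> x : pts Y ==> T x : pts Z"
	and bop_out: "T : bounded_ops Y Z ==> x ~: pts Y ==> T x = 0"
	and bop_add: "T : bounded_ops Y Z ==> x : pts Y ==> y : pts Y ==> T (x + y) = T x + T y"
	and bop_scale: "T : bounded_ops Y Z ==> x : pts Y ==> T (a *C x) = a *C T x"
	by (auto simp: bounded_ops_def)

lemma bop_zero: "T : bounded_ops Y Z ==> T 0 = 0"
	using bop_scale[of T Y Z 0 0] bop_out[of T Y Z 0] by (cases "0 : pts Y") auto

lemma bop_uminus: "T : bounded_ops Y Z ==> x : pts Y ==> T (- x) = - T x"
	using bop_scale[of T Y Z x "-1"] by simp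

lemma bop_diff:
	assumes "cnorm_space Y" "T : bounded_ops Y Z" "x : pts Y" "y : pts Y"
	shows "T (x - y) = T x - T y"
	using bop_add[OF assms(2), of x "- y"] bop_uminus[OF assms(2), of y] assms
		cnorm_space.uminus_in[OF assms(1)] by simp

lemma bop_sum:
	assumes "cnorm_space Y" "T : bounded_ops Y Z" "!!i. i : I ==> f i : pts Y"
	shows "T (sum f I) = (SUM i:I. T (f i))"
	using assms(3)
proof (induction I rule: infinite_finite_induct)
	case (insert i I)
	then show ?case
		using bop_add[OF assms(2), of "f i" "sum f I"] cnorm_space.sum_in[OF assms(1), of I f] by simp
qed (use bop_zero[OF assms(2)] in auto)

lemma bopI:
	assumes "!!x. x : pts Y ==> T x : pts Z" "!!x. x ~: pts Y ==> T x = 0"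
		and "!!x y. x : pts Y ==> y : pts Y ==> T (x + y) = T x + T y"
		and "!!a x. x : pts Y ==> T (a *C x) = a *C T x"
		and "!!x. x : pts Y ==> nrm Z (T x) <= c * nrm Y x"
	shows "T : bounded_ops Y Z"
	unfolding bounded_ops_def using assms by (intro CollectI conjI exI[of _ c]) blast+

lemma bop_zextI:
	assumes "cnorm_space Y" "!!x. x : pts Y ==> T x : pts Z"
		and "!!x y. x : pts Y ==> y : pts Y ==> T (x + y) = T x + T y"
		and "!!a x. x : pts Y ==> T (a *C x) = a *C T x"
		and "!!x. x : pts Y ==> nrm Z (T x) <= c * nrm Y x"
	shows "zext Y T : bounded_ops Y Z"
	using assms
	by (intro bopI[where c = c])
		(auto simp: zext_out cnorm_space.add_in[OF assms(1)] cnorm_space.scale_in[OF assms(1)])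

lemma bop_eqI:
	assumes "S : bounded_ops Y Z" "T : bounded_ops Y Z" "!!x. x : pts Y ==> S x = T x"
	shows "S = T"
proof
	fix x show "S x = T x" using assms by (cases "x : pts Y") (auto simp: bop_out)
qed

lemma bop_bound:
	assumes "cnorm_space Y" "T : bounded_ops Y Z"
	obtains c where "c > 0" "!!x. x : pts Y ==> nrm Z (T x) <= c * nrm Y x"
proof -
	from assms(2) obtain c where c: "ALL x:pts Y. nrm Z (T x) <= c * nrm Y x"
		by (auto simp: bounded_ops_def)
	\<comment> \<open>The larger constant is strictly positive, which allows later division by
	  it.\<close>
	have "nrm Z (T x) <= (\<bar>c\<bar> + 1) * nrm Y x" if "x : pts Y" for x
	proof -
		have "c * nrm Y x <= (\<bar>c\<bar> + 1) * nrm Y x"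
			using that cnorm_space.nrm_nonneg[OF assms(1)] by (intro mult_right_mono) auto
		with c that show ?thesis by fastforce
	qed
	then show ?thesis by (intro that[of "\<bar>c\<bar> + 1"]) auto
qed

text \<open>A supremum of reals carries information only for a set bounded above; every estimate by
  \<open>op_norm\<close> rests on this.\<close>

lemma op_norm_bdd:
	assumes "cnorm_space Y" "T : bounded_ops Y Z"
	shows "bdd_above ((%x. nrm Z (T x)) ` {x:pts Y. nrm Y x <= 1})"
proof -
	obtain c where c: "c > 0" "!!x. x : pts Y ==> nrm Z (T x) <= c * nrm Y x"
		using bop_bound[OF assms] by blast
	have "nrm Z (T x) <= c" if "x : pts Y" "nrm Y x <= 1" for x
		using c(2)[OF that(1)] mult_left_mono[OF that(2), of c] c(1) by linarith
	then show ?thesis by (intro bdd_aboveI2) auto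
qed

lemma op_norm_bound:
	assumes Y: "cnorm_space Y" and Z: "cnorm_space Z" and T: "T : bounded_ops Y Z" and x: "x : pts Y"
	shows "nrm Z (T x) <= op_norm Y Z T * nrm Y x"
proof (cases "x = 0")
	case True
	then show ?thesis
		using bop_zero[OF T] by (simp add: cnorm_space.nrm_zero[OF Y] cnorm_space.nrm_zero[OF Z])
next
	case False
	have pos: "nrm Y x > 0" using False cnorm_space.nrm_pos_iff[OF Y x] by simp
	define u where "u = complex_of_real (1 / nrm Y x) *C x"
	have u: "u : pts Y" "nrm Y u = 1"
		unfolding u_def using cnorm_space.nrm_normalize[OF Y x False] cnorm_space.scale_in[OF Y x] by auto
	have "nrm Z (T u) <= op_norm Y Z T"
		unfolding op_norm_def using u by (intro cSUP_upper op_norm_bdd[OF Y T]) auto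
	moreover have "nrm Z (T u) = nrm Z (T x) / nrm Y x"
		unfolding u_def bop_scale[OF T x] cnorm_space.nrm_scale[OF Z bop_in[OF T x]]
		using pos by (simp add: norm_divide)
	ultimately show ?thesis using pos by (simp add: field_simps)
qed

lemma op_norm_le:
	assumes Y: "cnorm_space Y" and "0 <= c" "!!x. x : pts Y ==> nrm Z (T x) <= c * nrm Y x"
	shows "op_norm Y Z T <= c"
	unfolding op_norm_def
proof (rule cSUP_least)
	show "{x : pts Y. nrm Y x <= 1} ~= {}"
		using cnorm_space.zero_in[OF Y] cnorm_space.nrm_zero[OF Y] by fastforce
	fix x assume "x : {x : pts Y. nrm Y x <= 1}"
	then show "nrm Z (T x) <= c"
		using assms(3)[of x] mult_left_mono[of "nrm Y x" 1 c] assms(2) by auto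
qed

lemma op_norm_nonneg:
	assumes Y: "cnorm_space Y" and Z: "cnorm_space Z" and T: "T : bounded_ops Y Z"
	shows "0 <= op_norm Y Z T"
proof -
	have "nrm Z (T 0) <= op_norm Y Z T"
		unfolding op_norm_def
		by (intro cSUP_upper op_norm_bdd[OF Y T])
			(auto simp: cnorm_space.zero_in[OF Y] cnorm_space.nrm_zero[OF Y])
	then show ?thesis using bop_zero[OF T] cnorm_space.nrm_zero[OF Z] by simp
qed

lemma bop_plus:
	assumes "cnorm_space Y" "cnorm_space Z" "S : bounded_ops Y Z" "T : bounded_ops Y Z"
	shows "S + T : bounded_ops Y Z"
proof (rule bopI)
	fix x assume x: "x : pts Y"
	show "(S + T) x : pts Z" using assms x by (simp add: cnorm_space.add_in bop_in)
	have "nrm Z (S x + T x) <= nrm Z (S x) + nrm Z (T x)"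
		using assms x by (intro cnorm_space.nrm_add) (auto simp: bop_in)
	also have "... <= op_norm Y Z S * nrm Y x + op_norm Y Z T * nrm Y x"
		using assms x by (intro add_mono op_norm_bound) auto
	finally show "nrm Z ((S + T) x) <= (op_norm Y Z S + op_norm Y Z T) * nrm Y x"
		by (simp add: algebra_simps)
qed (use assms in \<open>auto simp: bop_out bop_add bop_scale cscale_right_distrib algebra_simps\<close>)

lemma bop_cscale:
	assumes "cnorm_space Y" "cnorm_space Z" "T : bounded_ops Y Z"
	shows "a *C T : bounded_ops Y Z"
proof (rule bopI)
	fix x assume x: "x : pts Y"
	show "(a *C T) x : pts Z" using assms x by (simp add: cnorm_space.scale_in bop_in scaleC_fun_def)
	show "nrm Z ((a *C T) x) <= (cmod a * op_norm Y Z T) * nrm Y x"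
		using op_norm_bound[OF assms x] cnorm_space.nrm_scale[OF assms(2) bop_in[OF assms(3) x], of a]
		by (simp add: scaleC_fun_def mult.assoc mult_left_mono)
qed (use assms in \<open>auto simp: bop_out bop_add bop_scale scaleC_fun_def
			 cscale_right_distrib complex_vector.scale_left_commute mult.commute\<close>)

lemma bop_neg:
	assumes "cnorm_space Y" "cnorm_space Z" "T : bounded_ops Y Z"
	shows "- T : bounded_ops Y Z"
proof -
	have "- T = (-1) *C T" by (auto simp: scaleC_fun_def)
	then show ?thesis using bop_cscale[OF assms, of "-1"] by simp
qed

lemma bop_minus:
	assumes "cnorm_space Y" "cnorm_space Z" "S : bounded_ops Y Z" "T : bounded_ops Y Z"
	shows "S - T : bounded_ops Y Z"
	using bop_plus[OF assms(1-3) bop_neg[OF assms(1,2,4)]] by simp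

lemma bop_zero_op:
	assumes "cnorm_space Y" "cnorm_space Z"
	shows "0 : bounded_ops Y Z"
	by (rule bopI[where c = 0])
		(auto simp: cnorm_space.zero_in[OF assms(2)] cnorm_space.nrm_zero[OF assms(2)])

lemma bop_comp:
	assumes Y: "cnorm_space Y" and Z: "cnorm_space Z" and W: "cnorm_space W"
		and S: "S : bounded_ops Z W" and T: "T : bounded_ops Y Z"
	shows "S o T : bounded_ops Y W"
proof (rule bopI)
	fix x assume x: "x : pts Y"
	show "(S o T) x : pts W" using S T x by (simp add: bop_in)
	have "nrm W (S (T x)) <= op_norm Z W S * nrm Z (T x)"
		using op_norm_bound[OF Z W S bop_in[OF T x]] .
	also have "... <= op_norm Z W S * (op_norm Y Z T * nrm Y x)"
		using op_norm_bound[OF Y Z T x] op_norm_nonneg[OF Z W S] by (rule mult_left_mono)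
	finally show "nrm W ((S o T) x) <= (op_norm Z W S * op_norm Y Z T) * nrm Y x"
		by (simp add: mult.assoc)
qed (use S T in \<open>auto simp: bop_out bop_zero[OF S] bop_add bop_scale bop_in\<close>)

lemma bop_id: "cnorm_space Y ==> id_op Y : ops Y"
	by (rule bopI[where c = 1])
		(auto simp: id_op_def cnorm_space.add_in cnorm_space.scale_in)

context cnorm_space
begin

lemmas norm_space = cnorm_space_axioms
lemmas op_diff = bop_diff[OF norm_space]
lemmas op_sum = bop_sum[OF norm_space]
lemmas opn_bound = op_norm_bound[OF norm_space norm_space]
lemmas opn_le = op_norm_le[OF norm_space]
lemmas opn_nonneg = op_norm_nonneg[OF norm_space norm_space]
lemmas ops_plus = bop_plus[OF norm_space norm_space]
lemmas ops_minus = bop_minus[OF norm_space norm_space]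
lemmas ops_neg = bop_neg[OF norm_space norm_space]
lemmas ops_cscale = bop_cscale[OF norm_space norm_space]
lemmas ops_comp = bop_comp[OF norm_space norm_space norm_space]
lemmas ops_zero = bop_zero_op[OF norm_space norm_space]
lemmas ops_id = bop_id[OF norm_space]
lemmas ops_zextI = bop_zextI[OF norm_space]

lemma op_limit:
	assumes T: "T : bounded_ops Y Z" and Z: "cnorm_space Z"
		and x: "!!n. x n : pY" "y : pY" "(%n. nY (x n - y)) ----> 0"
	shows "(%n. nrm Z (T (x n) - T y)) ----> 0"
proof (rule tendsto_sandwich[where f = "%_. 0"])
	show "(%n. op_norm Y Z T * nY (x n - y)) ----> 0"
		using tendsto_mult_right_zero[OF x(3)] by simp
	show "\<forall>\<^sub>F n in sequentially. nrm Z (T (x n) - T y) <= op_norm Y Z T * nY (x n - y)"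
		using op_norm_bound[OF norm_space Z T] x by (auto simp: op_diff[OF T, symmetric])
	show "\<forall>\<^sub>F n in sequentially. 0 <= nrm Z (T (x n) - T y)"
		by (intro always_eventually allI cnorm_space.nrm_nonneg[OF Z] cnorm_space.diff_in[OF Z]
				bop_in[OF T] x)
qed simp

end

section \<open>Completeness and compact operators\<close>

locale banach_cn = cnorm_space Y for Y :: "'a::complex_vector cnspace" +
	assumes complete: "!!x :: nat => 'a. (!!n. x n : pts Y) ==>
			(!!e. e > 0 ==> EX N. ALL i>=N. ALL j>=N. nrm Y (x i - x j) < e) ==>
			EX y:pts Y. (%n. nrm Y (x n - y)) ----> 0"

definition cauchy_in :: "'a::complex_vector cnspace => (nat => 'a) => bool"
	where "cauchy_in Y x \<longleftrightarrow> (ALL e>0. EX N. ALL i>=N. ALL j>=N. nrm Y (x i - x j) < e)"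

lemma cauchy_inD: "cauchy_in Y x ==> e > 0 ==> EX N. ALL i>=N. ALL j>=N. nrm Y (x i - x j) < e"
	by (simp add: cauchy_in_def)

lemma (in banach_cn) complete_cauchy:
	"(!!n. x n : pY) ==> cauchy_in Y x ==> EX y:pY. (%n. nY (x n - y)) ----> 0"
	by (rule complete) (auto simp: cauchy_in_def)

lemma (in cnorm_space) cauchy_in_subseq:
	assumes "cauchy_in Y x" "strict_mono r"
	shows "cauchy_in Y (%n. x (r n))"
	unfolding cauchy_in_def
proof (intro allI impI)
	fix e :: real assume "e > 0"
	then obtain N where "ALL i>=N. ALL j>=N. nY (x i - x j) < e"
		using assms(1) by (auto simp: cauchy_in_def)
	then show "EX N. ALL i>=N. ALL j>=N. nY (x (r i) - x (r j)) < e"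
		using seq_suble[OF assms(2)] le_trans by blast
qed

lemma (in cnorm_space) limit_cauchy:
	assumes "!!n. x n : pY" "y : pY" "(%n. nY (x n - y)) ----> 0"
	shows "cauchy_in Y x"
	unfolding cauchy_in_def
proof (intro allI impI)
	fix e :: real assume "e > 0"
	then have "\<forall>\<^sub>F n in sequentially. nY (x n - y) < e / 2"
		using order_tendstoD(2)[OF assms(3), of "e / 2"] by simp
	then obtain N where N: "!!n. n >= N ==> nY (x n - y) < e / 2"
		by (auto simp: eventually_sequentially)
	have "nY (x i - x j) < e" if "i >= N" "j >= N" for i j
		using nrm_triangle[of "x i" y "x j"] nrm_commute[of y "x j"] N[OF that(1)] N[OF that(2)] assms
		by simp
	then show "EX N. ALL i>=N. ALL j>=N. nY (x i - x j) < e" by blast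
qed

text \<open>By completeness a Cauchy subsequence of images is as good as a convergent one, and
  Cauchy conditions can be combined and dominated without naming limits.\<close>

lemma (in banach_cn) compact_ops_iff:
	"K : compact_ops Y \<longleftrightarrow> K : ops Y & (ALL x :: nat => 'a. (ALL n. x n : pY & nY (x n) <= 1) -->
		 (EX r. strict_mono r & cauchy_in Y (%n. K (x (r n)))))" (is "?L \<longleftrightarrow> ?R")
proof
	assume L: ?L
	then have K: "K : ops Y" by (simp add: compact_ops_def)
	show ?R
	proof (intro conjI allI impI)
		fix x :: "nat => 'a" assume x: "ALL n. x n : pY & nY (x n) <= 1"
		then obtain y r where "y : pY" "strict_mono r" "(%n. nY (K (x (r n)) - y)) ----> 0"
			using L unfolding compact_ops_def by blast
		then show "EX r. strict_mono r & cauchy_in Y (%n. K (x (r n)))"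
			using x bop_in[OF K] by (intro exI[of _ r]) (auto intro: limit_cauchy)
	qed (fact K)
next
	assume R: ?R
	then have K: "K : ops Y" by blast
	show ?L
		unfolding compact_ops_def
	proof (intro CollectI conjI allI impI)
		fix x :: "nat => 'a" assume x: "ALL n. x n : pY & nY (x n) <= 1"
		with R obtain r where r: "strict_mono r" "cauchy_in Y (%n. K (x (r n)))" by blast
		show "EX y:pY. EX r. strict_mono r & (%n. nY (K (x (r n)) - y)) ----> 0"
			using complete_cauchy[OF _ r(2)] r(1) x bop_in[OF K] by blast
	qed (fact K)
qed

section \<open>Closed subspaces and finite-dimensional subspaces\<close>

definition closed_subspace :: "'a::complex_vector cnspace => 'a set => bool"
	where "closed_subspace Y S \<longleftrightarrow> S \<subseteq> pts Y & csubspace S &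
		(ALL x y. (ALL n. x n : S) --> y : pts Y --> (%n::nat. nrm Y (x n - y)) ----> 0 --> y : S)"

lemma closed_subspaceD:
	assumes "closed_subspace Y S"
	shows "S \<subseteq> pts Y" "csubspace S"
		and "(!!n. x n : S) ==> y : pts Y ==> (%n::nat. nrm Y (x n - y)) ----> 0 ==> y : S"
	using assms unfolding closed_subspace_def by blast+

lemma cspan_subspace: "csubspace S ==> cspan S = S"
	by (simp add: complex_vector.span_eq_iff[THEN iffD2])

lemma span_subspace_Un_finite:
	assumes "csubspace M" "finite D" "x : cspan (M \<union> D)"
	obtains m c where "m : M" "x = m + (SUM b:D. c b *C b)"
proof -
	from assms(3) obtain m w where mw: "m : cspan M" "w : cspan D" "x = m + w"
		by (auto simp: complex_vector.span_Un)
	moreover have "m : M" using mw(1) assms(1) by (simp add: complex_vector.span_eq_iff[THEN iffD2])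
	ultimately show ?thesis
		using that cspan_finite[OF assms(2)] by auto
qed

lemma sum_in_span_Un:
	assumes "m : M" "finite D" "E \<subseteq> D"
	shows "m + (SUM b:E. c b *C b) : cspan (M \<union> D)"
	by (intro cspan_add cspan_sum cspan_scale
			cspan_base) (use assms in auto)

context cnorm_space
begin

lemma closed_subspace_zero: "closed_subspace Y {0}"
	unfolding closed_subspace_def
proof (intro conjI allI impI)
	fix x :: "nat => 'a" and y
	assume *: "ALL n. x n : {0}" "y : pY" "(%n. nY (x n - y)) ----> 0"
	then have "(%n. nY y) ----> 0" by (simp add: nrm_uminus)
	then show "y : {0}" using nrm_eq_0[OF *(2)] LIMSEQ_const_iff by auto
qed auto

text \<open>A distance of zero would put \<open>y\<close> into the closed set \<open>S\<close>.
  Homogeneity turns the distance into a bound for the coefficient of \<open>y\<close>, the form in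
  which it is used for coordinates.\<close>

lemma closed_subspace_dist:
	assumes S: "closed_subspace Y S" and y: "y : pY" "y ~: S"
	obtains d where "d > 0" "!!s c. s : S ==> cmod c * d <= nY (s + c *C y)"
proof -
	note SD = closed_subspaceD[OF S]
	have "EX d>0. ALL s:S. d <= nY (s - y)"
	proof (rule ccontr)
		assume "~ ?thesis"
		then have "EX s:S. nY (s - y) < 1 / real (Suc n)" for n
			by (metis not_le zero_less_divide_1_iff of_nat_0_less_iff zero_less_Suc)
		then obtain s where s: "!!n. s n : S" "!!n. nY (s n - y) < 1 / real (Suc n)" by metis
		have sin: "s n : pY" for n using s(1) SD(1) by blast
		have "(%n. nY (s n - y)) ----> 0"
		proof (rule tendsto_sandwich[where f = "%_. 0" and h = "%n. 1 / real (Suc n)"])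
			show "(%n. 1 / real (Suc n)) ----> 0"
				using LIMSEQ_Suc[OF lim_1_over_n] by simp
			show "\<forall>\<^sub>F n in sequentially. 0 <= nY (s n - y)" using sin y by simp
			show "\<forall>\<^sub>F n in sequentially. nY (s n - y) <= 1 / real (Suc n)"
				using s(2) by (intro always_eventually allI less_imp_le)
		qed simp
		then have "y : S" using SD(3)[OF s(1) y(1)] by simp
		with y show False by blast
	qed
	then obtain d where d: "d > 0" "!!s. s : S ==> d <= nY (s - y)" by blast
	have "cmod c * d <= nY (s + c *C y)" if s: "s : S" for s c
	proof (cases "c = 0")
		case True
		then show ?thesis using s SD(1) by auto
	next
		case False
		define s' where "s' = - (inverse c *C s)"
		have s': "s' : S" unfolding s'_def
			using s SD(2) by (simp add: complex_vector.subspace_neg csubspace_scale)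
		have "s + c *C y = - c *C (s' - y)"
			unfolding s'_def using False by (simp add: cscale_right_diff_distrib)
		moreover have "s' - y : pY" using s' SD(1) y by auto
		ultimately have "nY (s + c *C y) = cmod c * nY (s' - y)"
			using nrm_scale[of "s' - y" "- c"] by simp
		then show ?thesis using d(2)[OF s'] by (simp add: mult_left_mono)
	qed
	with d(1) show ?thesis using that by blast
qed

lemma closed_subspace_insert:
	assumes S: "closed_subspace Y S" and b: "b : pY"
	shows "closed_subspace Y (cspan (insert b S))"
proof (cases "b : S")
	case True
	then have "cspan (insert b S) = S"
		using cspan_subspace[OF closed_subspaceD(2)[OF S]] by (simp add: insert_absorb)
	then show ?thesis using S by simp
next
	case False
	note SD = closed_subspaceD[OF S]
	obtain d where d: "d > 0" "!!s c. s : S ==> cmod c * d <= nY (s + c *C b)"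
		using closed_subspace_dist[OF S b False] by blast
	have span: "x : cspan (insert b S) \<longleftrightarrow> (EX c. x - c *C b : S)" for x
		by (simp add: complex_vector.span_insert cspan_subspace[OF SD(2)])
	show ?thesis
		unfolding closed_subspace_def
	proof (intro conjI allI impI)
		show "cspan (insert b S) \<subseteq> pY" using b SD(1) by (intro cspan_subset_pts) auto
		fix x :: "nat => 'a" and y
		assume x: "ALL n. x n : cspan (insert b S)" and y: "y : pY"
			and lim: "(%n. nY (x n - y)) ----> 0"
		from x obtain c where c: "!!n. x n - c n *C b : S" unfolding span by metis
		have xin: "x n : pY" for n
			using x cspan_subset_pts[of "insert b S"] b SD(1) by blast
		\<comment> \<open>The separation from \<open>S\<close> controls the coefficients of
		  \<open>b\<close>, so they converge along with the vectors, and hence the components in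
		  \<open>S\<close> converge too.\<close>
		have cd: "cmod (c i - c j) * d <= nY (x i - x j)" for i j
		proof -
			have "(x i - c i *C b) - (x j - c j *C b) : S"
				by (intro csubspace_diff[OF SD(2)] c)
			from d(2)[OF this, of "c i - c j"] show ?thesis
				by (simp add: complex_vector.scale_left_diff_distrib algebra_simps)
		qed
		have "Cauchy c"
		proof (rule metric_CauchyI)
			fix e :: real assume "e > 0"
			with d(1) have "e * d > 0" by simp
			then obtain N where N: "!!i j. i >= N ==> j >= N ==> nY (x i - x j) < e * d"
				using cauchy_inD[OF limit_cauchy[OF xin y lim]] by blast
			have "dist (c i) (c j) < e" if "i >= N" "j >= N" for i j
			proof -
				have "cmod (c i - c j) * d < e * d" using cd N[OF that] by (rule le_less_trans)
				then show ?thesis using d(1) by (simp add: dist_norm)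
			qed
			then show "EX M. ALL m>=M. ALL n>=M. dist (c m) (c n) < e" by blast
		qed
		then obtain l where l: "c ----> l" by (auto simp: Cauchy_convergent_iff convergent_def)
		have "(%n. nY ((x n - c n *C b) - (y - l *C b))) ----> 0"
		proof (rule tendsto_sandwich[where f = "%_. 0"])
			show "(%n. nY (x n - y) + cmod (c n - l) * nY b) ----> 0"
				using lim tendsto_mult_left_zero[OF tendsto_norm_zero[OF LIM_zero[OF l]], of "nY b"]
				by (auto intro: tendsto_add_zero)
			have eq: "(x n - c n *C b) - (y - l *C b) = (x n - y) - (c n - l) *C b" for n
				by (simp add: complex_vector.scale_left_diff_distrib algebra_simps)
			show "\<forall>\<^sub>F n in sequentially. nY ((x n - c n *C b) - (y - l *C b))
					<= nY (x n - y) + cmod (c n - l) * nY b"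
			proof (intro always_eventually allI)
				fix n
				show "nY ((x n - c n *C b) - (y - l *C b)) <= nY (x n - y) + cmod (c n - l) * nY b"
					unfolding eq using nrm_diff[of "x n - y" "(c n - l) *C b"] xin y b by (simp add: nrm_scale)
			qed
			show "\<forall>\<^sub>F n in sequentially. 0 <= nY ((x n - c n *C b) - (y - l *C b))"
				using xin y b by simp
		qed simp
		then have "y - l *C b : S"
			by (rule SD(3)[where x = "%n. x n - c n *C b", OF c, rotated]) (use y b in simp)
		then show "y : cspan (insert b S)" unfolding span by blast
	qed auto
qed

lemma closed_subspace_span_Un:
	assumes "closed_subspace Y S" "finite B" "B \<subseteq> pY"
	shows "closed_subspace Y (cspan (S \<union> B))"
	using assms(2,3)
proof (induction B)
	case empty
	show ?case using assms(1) by (simp add: cspan_subspace closed_subspaceD(2))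
next
	case (insert b B)
	have "cspan (S \<union> insert b B) = cspan (insert b (cspan (S \<union> B)))"
		using complex_vector.span_Un[of "{b}" "cspan (S \<union> B)"] complex_vector.span_Un[of "{b}" "S \<union> B"]
		by (simp add: complex_vector.span_span)
	then show ?case using closed_subspace_insert[of "cspan (S \<union> B)" b] insert by simp
qed

lemma closed_subspace_span:
	assumes "finite B" "B \<subseteq> pY"
	shows "closed_subspace Y (cspan B)"
	using closed_subspace_span_Un[OF closed_subspace_zero assms] by simp

text \<open>Bolzano-Weierstrass for a finite span, by induction on the generators: the coefficient
  of a new generator is bounded because of its distance to the closed span of the others, hence has
  a convergent subsequence, and what remains is bounded in the smaller span.\<close>

lemma finite_span_convergent_subseq:
	assumes "finite B" "B \<subseteq> pY" "!!n. x n : cspan B" "!!n. nY (x n) <= M"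
	obtains r y where "strict_mono (r :: nat => nat)" "y : cspan B"
		"(%n. nY (x (r n) - y)) ----> 0"
proof -
	have "EX (r :: nat => nat) y. strict_mono r & y : cspan B & (%n. nY (x (r n) - y)) ----> 0"
		using assms
	proof (induction B arbitrary: x M)
		case empty
		then show ?case by (intro exI[of _ id] exI[of _ 0]) (simp add: strict_mono_def)
	next
		case (insert b B)
		show ?case
		proof (cases "b : cspan B")
			case True
			then show ?thesis
				using insert.IH[of x M] insert.prems by (simp add: complex_vector.span_redundant)
		next
			case False
			have b: "b : pY" and B: "B \<subseteq> pY" using insert.prems by auto
			obtain d where d: "d > 0" "!!s c. s : cspan B ==> cmod c * d <= nY (s + c *C b)"
				using closed_subspace_dist[OF closed_subspace_span[OF \<open>finite B\<close> B] b False] by blast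
			have "EX c. x n - c *C b : cspan B" for n
				using insert.prems(2)[of n] by (simp add: complex_vector.span_insert)
			then obtain c where c: "!!n. x n - c n *C b : cspan B" by metis
			have xin: "x n : pY" for n using insert.prems(1,2) cspan_subset_pts by blast
			have cb: "cmod (c n) <= M / d" for n
			proof -
				have "cmod (c n) * d <= M" using d(2)[OF c[of n], of "c n"] insert.prems(3)[of n] by simp
				then show ?thesis using d(1) by (simp add: field_simps)
			qed
			then have "bounded (range c)" by (auto simp: bounded_iff)
			then obtain l r where r: "strict_mono r" "(c o r) ----> l"
				using bounded_imp_convergent_subsequence by blast
			have sb: "nY (x (r n) - c (r n) *C b) <= M + M / d * nY b" for n
				using nrm_diff[of "x (r n)" "c (r n) *C b"] xin b insert.prems(3)[of "r n"]
					mult_right_mono[OF cb[of "r n"] nrm_nonneg[OF b]] by (simp add: nrm_scale)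
			obtain r' y where r': "strict_mono (r' :: nat => nat)" "y : cspan B"
				"(%n. nY (x (r (r' n)) - c (r (r' n)) *C b - y)) ----> 0"
				using insert.IH[of "%n. x (r n) - c (r n) *C b", OF B c sb] by blast
			have yin: "y : pY" using r'(2) cspan_subset_pts[OF B] by blast
			have l': "(%n. c (r (r' n))) ----> l"
				using LIMSEQ_subseq_LIMSEQ[OF r(2) r'(1)] by (simp add: o_def)
			have "(%n. nY (x (r (r' n)) - (y + l *C b))) ----> 0"
			proof (rule tendsto_sandwich[where f = "%_. 0"])
				show "(%n. nY (x (r (r' n)) - c (r (r' n)) *C b - y) + cmod (c (r (r' n)) - l) * nY b) ----> 0"
					using r'(3) tendsto_mult_left_zero[OF tendsto_norm_zero[OF LIM_zero[OF l']], of "nY b"]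
					by (auto intro: tendsto_add_zero)
				have "nY (x (r (r' n)) - (y + l *C b))
					<= nY (x (r (r' n)) - c (r (r' n)) *C b - y) + cmod (c (r (r' n)) - l) * nY b" for n
				proof -
					have eq: "x (r (r' n)) - (y + l *C b) =
							(x (r (r' n)) - c (r (r' n)) *C b - y) + (c (r (r' n)) - l) *C b"
						by (simp add: complex_vector.scale_left_diff_distrib algebra_simps)
					show ?thesis
						unfolding eq
						using nrm_add[of "x (r (r' n)) - c (r (r' n)) *C b - y" "(c (r (r' n)) - l) *C b"]
							xin yin b by (simp add: nrm_scale)
				qed
				then show "\<forall>\<^sub>F n in sequentially. nY (x (r (r' n)) - (y + l *C b))
					<= nY (x (r (r' n)) - c (r (r' n)) *C b - y) + cmod (c (r (r' n)) - l) * nY b"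
					by simp
				show "\<forall>\<^sub>F n in sequentially. 0 <= nY (x (r (r' n)) - (y + l *C b))"
					using xin yin b by simp
			qed simp
			moreover have "y : cspan (insert b B)"
				using r'(2) complex_vector.span_mono[of B "insert b B"] by blast
			then have "y + l *C b : cspan (insert b B)"
				by (rule cspan_add) (simp add: cspan_scale cspan_base)
			ultimately show ?thesis
				using strict_mono_o[OF r(1) r'(1)] by (intro exI[of _ "r o r'"]) (auto simp: o_def)
		qed
	qed
	then show ?thesis using that by blast
qed

text \<open>Each \<open>b\<close> has a positive distance to the closed span of \<open>M\<close> and
  the remaining vectors; its reciprocal bounds the coefficient of \<open>b\<close>. This makes
  coordinates modulo a closed subspace continuous.\<close>

lemma coefficient_bound:
	assumes M: "closed_subspace Y M" and D: "finite D" "D \<subseteq> pY"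
		and indep: "!!c b. (SUM b:D. c b *C b) : M ==> b : D ==> c b = 0"
	obtains C where "C > 0"
		"!!m c b. m : M ==> b : D ==> cmod (c b) <= C * nY (m + (SUM b:D. c b *C b))"
proof -
	note MD = closed_subspaceD[OF M]
	have "EX d>0. ALL m c. m : M --> cmod (c b) * d <= nY (m + (SUM b:D. c b *C b))" if b: "b : D" for b
	proof -
		have cl: "closed_subspace Y (cspan (M \<union> (D - {b})))"
			using D by (intro closed_subspace_span_Un[OF M]) auto
		have "b ~: cspan (M \<union> (D - {b}))"
		proof
			assume "b : cspan (M \<union> (D - {b}))"
			then obtain m c where mc: "m : M" "b = m + (SUM b:D - {b}. c b *C b)"
				using span_subspace_Un_finite[OF MD(2)] D(1) by (metis finite_Diff)
			\<comment> \<open>A representation of \<open>b\<close> by the others is a relation modulo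
			  \<open>M\<close> with coefficient 1 at \<open>b\<close>.\<close>
			define c' where "c' = (%x. if x = b then 1 else - c x)"
			have "(SUM x:D. c' x *C x) = c' b *C b + (SUM x:D - {b}. c' x *C x)"
				using D(1) b by (simp add: sum.remove)
			also have "(SUM x:D - {b}. c' x *C x) = - (SUM x:D - {b}. c x *C x)"
				unfolding sum_negf[symmetric] by (intro sum.cong) (auto simp: c'_def)
			also have "... = m - b" using mc(2) by (simp add: algebra_simps)
			finally have "(SUM x:D. c' x *C x) = m" by (simp add: c'_def)
			then have "c' b = 0" using indep[of c' b] mc(1) b by simp
			then show False by (simp add: c'_def)
		qed
		then obtain d where d: "d > 0"
				"!!s c. s : cspan (M \<union> (D - {b})) ==> cmod c * d <= nY (s + c *C b)"
			using closed_subspace_dist[OF cl] b D by blast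
		have "cmod (c b) * d <= nY (m + (SUM b:D. c b *C b))" if "m : M" for m c
		proof -
			have "m + (SUM b:D - {b}. c b *C b) : cspan (M \<union> (D - {b}))"
				by (rule sum_in_span_Un) (use that D in auto)
			from d(2)[OF this, of "c b"] show ?thesis
				using D(1) b by (simp add: sum.remove[of D b] add.assoc add.left_commute add.commute)
		qed
		with d(1) show ?thesis by blast
	qed
	then obtain d where d: "!!b. b : D ==> d b > 0"
		"!!b m c. b : D ==> m : M ==> cmod (c b) * d b <= nY (m + (SUM b:D. c b *C b))" by metis
	\<comment> \<open>The sum dominates every reciprocal at once; the added 1 keeps the constant
	  positive for empty \<open>D\<close>.\<close>
	define C where "C = (SUM b:D. 1 / d b) + 1"
	have C0: "C > 0" unfolding C_def using d(1) by (intro add_nonneg_pos sum_nonneg) (auto simp: less_imp_le)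
	have "cmod (c b) <= C * nY (m + (SUM b:D. c b *C b))" if "m : M" "b : D" for m c b
	proof -
		have "1 / d b <= (SUM b:D. 1 / d b)"
			using d(1) that D(1) by (intro member_le_sum) (auto simp: less_imp_le)
		then have "1 / d b <= C" by (simp add: C_def)
		moreover have "m + (SUM b:D. c b *C b) : pY"
			using that MD(1) D(2) by (intro add_in sum_in scale_in) auto
		ultimately have "1 / d b * nY (m + (SUM b:D. c b *C b)) <= C * nY (m + (SUM b:D. c b *C b))"
			by (intro mult_right_mono) auto
		moreover have "cmod (c b) <= 1 / d b * nY (m + (SUM b:D. c b *C b))"
			using d(1)[OF that(2)] d(2)[OF that(2,1), of c] by (simp add: field_simps)
		ultimately show ?thesis by linarith
	qed
	with C0 that show ?thesis by blast
qed

lemma representation_bound: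
	assumes "finite B" "B \<subseteq> pY" "cindependent B"
	obtains C where "C > 0"
		"!!x b. x : cspan B ==> b : B ==> cmod (crepresentation B x b) <= C * nY x"
proof -
	have ind: "c b = 0" if "(SUM b:B. c b *C b) : {0}" "b : B" for c b
		using complex_vector.independentD[OF assms(3,1) order_refl] that by auto
	show ?thesis
	proof (rule coefficient_bound[OF closed_subspace_zero assms(1,2)], goal_cases)
		case (1 c b)
		then show ?case by (rule ind)
	next
		case C: (2 C)
		show ?case
		proof (rule that[OF C(1)])
			fix x b assume "x : cspan B" "b : B"
			then show "cmod (crepresentation B x b) <= C * nY x"
				using C(2)[of 0 b "crepresentation B x"]
					complex_vector.sum_representation_eq[OF assms(3) _ assms(1) order_refl, of x] by simp
		qed
	qed
qed

end

section \<open>The Hahn-Banach theorem\<close>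

text \<open>
  A minimal sublinear functional is additive, since \<open>inf\<^sub>t (q (x + t y) - t q y)\<close> is a
  sublinear functional below \<open>q\<close>.
\<close>

context cnorm_space
begin

text \<open>Forcing the value 0 outside \<open>pts Y\<close> lets functionals be compared by the
  pointwise order of functions, so that minimality can be expressed by equality of
  functions.\<close>

definition sublinear_on :: "('a => real) => bool"
	where "sublinear_on q \<longleftrightarrow> (ALL x. x ~: pY --> q x = 0) &
		 (ALL x:pY. ALL y:pY. q (x + y) <= q x + q y) &
		 (ALL t>=0. ALL x:pY. q (complex_of_real t *C x) = t * q x)"

lemma sublinear_onD:
	assumes "sublinear_on q"
	shows "x ~: pY ==> q x = 0" "x : pY ==> y : pY ==> q (x + y) <= q x + q y"
		"t >= 0 ==> x : pY ==> q (complex_of_real t *C x) = t * q x" "q 0 = 0"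
		"x : pY ==> - q (- x) <= q x"
proof -
	show z: "q 0 = 0" using assms zero_in unfolding sublinear_on_def
		by (metis complex_vector.scale_zero_right mult_zero_left order_refl)
	show add: "q (x + y) <= q x + q y" if "x : pY" "y : pY" for x y
		using assms that by (simp add: sublinear_on_def)
	show "x : pY ==> - q (- x) <= q x" using add[of x "- x"] z by simp
qed (use assms in \<open>auto simp: sublinear_on_def\<close>)

lemma sublinear_onI:
	assumes "!!x. x ~: pY ==> q x = 0" "q 0 = 0"
		and "!!x y. x : pY ==> y : pY ==> q (x + y) <= q x + q y"
		and le: "!!t x. t > 0 ==> x : pY ==> q (complex_of_real t *C x) <= t * q x"
	shows "sublinear_on q"
	unfolding sublinear_on_def
proof (intro conjI allI ballI impI assms)
	fix t :: real and x assume t: "t >= 0" and x: "x : pY"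
	show "q (complex_of_real t *C x) = t * q x"
	proof (cases "t = 0")
		case False
		with t have t: "t > 0" by simp
		have "q (complex_of_real (1 / t) *C complex_of_real t *C x) <= 1 / t * q (complex_of_real t *C x)"
			by (rule le) (use t x in auto)
		then have "t * q x <= q (complex_of_real t *C x)"
			using t by (simp add: field_simps)
		with le[OF t x] show ?thesis by simp
	qed (use assms in simp)
qed auto

definition shrink :: "('a => real) => 'a => 'a => real"
	where "shrink q y = zext Y (%x. INF t\<in>{0..}. q (x + complex_of_real t *C y) - t * q y)"

lemma shrink:
	assumes q: "sublinear_on q" and y: "y : pY"
	shows "sublinear_on (shrink q y)" and "shrink q y x <= q x"
		and "x : pY ==> shrink q y x <= q (x + y) - q y"
proof -
	note qD = sublinear_onD[OF q]
	have bdd: "bdd_below ((%t. q (x + complex_of_real t *C y) - t * q y) ` {0..})"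
		if x: "x : pY" for x
	proof (intro bdd_belowI2)
		fix t :: real assume "t : {0..}"
		then have "t * q y = q (complex_of_real t *C y)" using y qD(3) by simp
		also have "... <= q (x + complex_of_real t *C y) + q (- x)"
			using qD(2)[of "x + complex_of_real t *C y" "- x"] x y by simp
		finally show "- q (- x) <= q (x + complex_of_real t *C y) - t * q y" by simp
	qed
	have le: "shrink q y x <= q (x + complex_of_real t *C y) - t * q y" if "x : pY" "t >= 0" for x t
		unfolding shrink_def using that by (auto intro!: cINF_lower bdd)
	have ge: "c <= shrink q y x"
		if "x : pY" "!!t. t >= 0 ==> c <= q (x + complex_of_real t *C y) - t * q y" for x c
		unfolding shrink_def using that by (auto intro!: cINF_greatest)
	show "shrink q y x <= q x"
		using le[of x 0] qD(1)[of x] by (cases "x : pY") (auto simp: shrink_def zext_def)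
	show "x : pY ==> shrink q y x <= q (x + y) - q y"
		using le[of x 1] by simp
	show "sublinear_on (shrink q y)"
	proof (rule sublinear_onI)
		show "shrink q y x = 0" if "x ~: pY" for x using that by (simp add: shrink_def zext_def)
		show "shrink q y 0 = 0"
			using le[of 0 0] ge[of 0 0] qD(3)[OF _ y] qD(4) by (intro antisym) auto
	next
		fix x x' assume x: "x : pY" "x' : pY"
		have *: "shrink q y (x + x') <= (q (x + complex_of_real s *C y) - s * q y) +
				(q (x' + complex_of_real t *C y) - t * q y)" if "s >= 0" "t >= 0" for s t
		proof -
			have "shrink q y (x + x') <= q (x + x' + complex_of_real (s + t) *C y) - (s + t) * q y"
				using x that by (intro le) auto
			also have "x + x' + complex_of_real (s + t) *C y =
					(x + complex_of_real s *C y) + (x' + complex_of_real t *C y)"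
				by (simp add: cscale_left_distrib algebra_simps)
			also have "q \<dots> <= q (x + complex_of_real s *C y) + q (x' + complex_of_real t *C y)"
				using x y by (intro qD(2)) auto
			finally show ?thesis by (simp add: algebra_simps)
		qed
		have "shrink q y (x + x') - shrink q y x' <= shrink q y x"
		proof (rule ge[OF x(1)])
			fix s :: real assume s: "s >= 0"
			have "shrink q y (x + x') - (q (x + complex_of_real s *C y) - s * q y) <= shrink q y x'"
				by (rule ge[OF x(2)]) (use *[OF s] in \<open>simp add: algebra_simps\<close>)
			then show "shrink q y (x + x') - shrink q y x' <= q (x + complex_of_real s *C y) - s * q y"
				by simp
		qed
		then show "shrink q y (x + x') <= shrink q y x + shrink q y x'" by simp
	next
		fix t :: real and x assume t: "t > 0" and x: "x : pY"
		have "shrink q y (complex_of_real t *C x) / t <= shrink q y x"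
		proof (rule ge[OF x])
			fix s :: real assume s: "s >= 0"
			have "shrink q y (complex_of_real t *C x)
					<= q (complex_of_real t *C x + complex_of_real (t * s) *C y) - (t * s) * q y"
				using x s t by (intro le) auto
			also have "complex_of_real t *C x + complex_of_real (t * s) *C y =
					complex_of_real t *C (x + complex_of_real s *C y)"
				by (simp add: cscale_right_distrib)
			also have "q \<dots> = t * q (x + complex_of_real s *C y)"
				using t x y by (intro qD(3)) auto
			finally show "shrink q y (complex_of_real t *C x) / t
					<= q (x + complex_of_real s *C y) - s * q y"
				using t by (simp add: field_simps)
		qed
		then show "shrink q y (complex_of_real t *C x) <= t * shrink q y x"
			using t by (simp add: field_simps)
	qed
qed

lemma minimal_sublinear:
	assumes q: "sublinear_on q"
	obtains p where "sublinear_on p" "p <= q" "!!p'. sublinear_on p' ==> p' <= p ==> p' = p"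
proof -
	define A where "A = {p. sublinear_on p & p <= q}"
	\<comment> \<open>The order is reversed, so that Zorn's lemma yields a minimal functional.\<close>
	define P where "P = (%p p' :: 'a => real. p' <= p)"
	have "EX m:A. ALL a:A. P m a --> a = m"
	proof (rule predicate_Zorn)
		show "partial_order_on A (relation_of P A)"
			by (rule partial_order_on_relation_ofI) (auto simp: P_def)
	next
		fix C assume "C : Chains (relation_of P A)"
		then have CA: "C \<subseteq> A" and chain: "!!p p'. p : C ==> p' : C ==> p <= p' \<or> p' <= p"
			by (auto simp: Chains_def relation_of_def P_def)
		show "EX u:A. ALL a:C. P a u"
		proof (cases "C = {}")
			case True
			then show ?thesis using q by (auto simp: A_def)
		next
			case False
			have sl: "sublinear_on p" "p <= q" if "p : C" for p using CA that by (auto simp: A_def)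
			define u where "u = zext Y (%x. INF p\<in>C. p x)"
			\<comment> \<open>All members of the chain stay above \<open>- q (- x)\<close>, so their
			  pointwise infimum is finite.\<close>
			have bdd: "bdd_below ((%p. p x) ` C)" if x: "x : pY" for x
			proof (rule bdd_belowI2)
				fix p assume p: "p : C"
				have "- q (- x) <= - p (- x)" using sl(2)[OF p] by (simp add: le_fun_def)
				also have "... <= p x" using sublinear_onD(5)[OF sl(1)[OF p] x] .
				finally show "- q (- x) <= p x" .
			qed
			have le: "u x <= p x" if "p : C" for p x
			proof (cases "x : pY")
				case True
				then show ?thesis unfolding u_def using that by (auto intro!: cINF_lower bdd)
			next
				case False
				then show ?thesis using sublinear_onD(1)[OF sl(1)[OF that] False] by (simp add: u_def zext_def)
			qed
			have ge: "c <= u x" if "x : pY" "!!p. p : C ==> c <= p x" for x c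
				unfolding u_def using that False by (auto intro!: cINF_greatest)
			have "sublinear_on u"
			proof (rule sublinear_onI)
				show "u x = 0" if "x ~: pY" for x using that by (simp add: u_def zext_def)
				obtain p where p: "p : C" using False by blast
				show "u 0 = 0"
				proof (rule antisym)
					show "u 0 <= 0" using le[OF p, of 0] sublinear_onD(4)[OF sl(1)[OF p]] by simp
					show "0 <= u 0"
					proof (rule ge)
						show "0 <= p 0" if "p : C" for p using sublinear_onD(4)[OF sl(1)[OF that]] by simp
					qed simp
				qed
			next
				fix x y assume xy: "x : pY" "y : pY"
				\<comment> \<open>Different members of the chain may be nearly optimal at \<open>x\<close> and
				  at \<open>y\<close>; the smaller of the two serves for both.\<close>
				have *: "u (x + y) <= p x + p' y" if pC: "p : C" "p' : C" for p p'
				proof -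
					obtain p0 where p0: "p0 : C" "p0 <= p" "p0 <= p'"
						using chain[OF pC] pC by blast
					have "u (x + y) <= p0 x + p0 y"
						using le[OF p0(1), of "x + y"] sublinear_onD(2)[OF sl(1)[OF p0(1)] xy] by simp
					also have "... <= p x + p' y" using p0 by (intro add_mono) (auto simp: le_fun_def)
					finally show ?thesis .
				qed
				have "u (x + y) - u y <= u x"
				proof (rule ge[OF xy(1)])
					fix p assume p: "p : C"
					have "u (x + y) - p x <= u y"
						by (rule ge[OF xy(2)]) (use *[OF p] in \<open>simp add: algebra_simps\<close>)
					then show "u (x + y) - u y <= p x" by simp
				qed
				then show "u (x + y) <= u x + u y" by simp
			next
				fix t :: real and x assume t: "t > 0" and x: "x : pY"
				have "u (complex_of_real t *C x) / t <= u x"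
				proof (rule ge[OF x])
					fix p assume p: "p : C"
					have "u (complex_of_real t *C x) <= t * p x"
						using le[OF p, of "complex_of_real t *C x"] sublinear_onD(3)[OF sl(1)[OF p] _ x, of t] t by simp
					then show "u (complex_of_real t *C x) / t <= p x" using t by (simp add: field_simps)
				qed
				then show "u (complex_of_real t *C x) <= t * u x" using t by (simp add: field_simps)
			qed
			moreover have "u <= q" using le sl(2) False by (meson equals0I le_fun_def order_trans)
			ultimately show ?thesis using le by (intro bexI[of _ u]) (auto simp: A_def P_def le_fun_def)
		qed
	qed
	then obtain p where "p : A" "!!a. a : A ==> a <= p ==> a = p" by (auto simp: P_def)
	then show ?thesis by (intro that[of p]) (auto simp: A_def intro: order_trans)
qed

lemma real_hahn_banach:
	assumes q: "sublinear_on q" and y0: "y0 : pY"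
	obtains f where "!!x y. x : pY ==> y : pY ==> f (x + y) = f x + f y"
		and "!!t x. x : pY ==> f (complex_of_real t *C x) = t * f x"
		and "!!x. f x <= q x" "!!x. x ~: pY ==> f x = 0" "f y0 = q y0"
proof -
	\<comment> \<open>Minimality is sought below \<open>shrink q y0\<close> and not merely below
	  \<open>q\<close>: at \<open>- y0\<close> the former is at most \<open>- q y0\<close>, which
	  forces \<open>f y0 = q y0\<close>.\<close>
	obtain f where f: "sublinear_on f" "f <= shrink q y0"
		"!!p'. sublinear_on p' ==> p' <= f ==> p' = f"
		using minimal_sublinear[OF shrink(1)[OF q y0]] by blast
	note fD = sublinear_onD[OF f(1)]
	have add: "f (x + y) = f x + f y" if "x : pY" "y : pY" for x y
	proof -
		have "shrink f y = f"
			by (rule f(3)) (use shrink[OF f(1) that(2)] in \<open>auto simp: le_fun_def\<close>)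
		then have "f x <= f (x + y) - f y" using shrink(3)[OF f(1) that(2,1)] by simp
		with fD(2)[OF that] show ?thesis by simp
	qed
	have neg: "f (- x) = - f x" if "x : pY" for x
		using add[of x "- x"] that fD(4) by simp
	have fq: "f x <= q x" for x
		using f(2) shrink(2)[OF q y0, of x] by (auto simp: le_fun_def intro: order_trans)
	show ?thesis
	proof (rule that[of f])
		fix t :: real and x assume x: "x : pY"
		show "f (complex_of_real t *C x) = t * f x"
		proof (cases "t >= 0")
			case False
			then have "f (complex_of_real (- t) *C x) = (- t) * f x" by (intro fD(3) x) auto
			moreover have "f (complex_of_real (- t) *C x) = - f (complex_of_real t *C x)"
				using neg[of "complex_of_real t *C x"] x by simp
			ultimately show ?thesis by simp
		qed (use fD(3) x in auto)
	next
		have "f (- y0) <= - q y0"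
			using f(2) shrink(3)[OF q y0, of "- y0"] y0 sublinear_onD(4)[OF q]
			by (auto simp: le_fun_def intro: order_trans)
		then show "f y0 = q y0" using neg[OF y0] fq[of y0] by simp
	qed (use add fq fD(1) in auto)
qed

text \<open>The distance to \<open>M\<close> is sublinear, bounded by the norm, at most 0 on
  \<open>M\<close> and at least \<open>d\<close> at \<open>y0\<close>. A real functional below it
  that touches it at \<open>y0\<close> is the real part of the wanted one.\<close>

theorem hahn_banach:
	assumes M: "csubspace M" "M \<subseteq> pY" and y0: "y0 : pY"
		and d: "!!m. m : M ==> d <= nY (y0 - m)"
	obtains F where "F : FY" "!!x. x : pY ==> cmod (F x) <= nY x"
		"!!m. m : M ==> F m = 0" "d <= cmod (F y0)"
proof -
	define q where "q = zext Y (%x. INF m\<in>M. nY (x - m))"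
	have M0: "0 : M" using M(1) by (simp add: complex_vector.subspace_0)
	have bdd: "bdd_below ((%m. nY (x - m)) ` M)" if "x : pY" for x
		using that M(2) by (intro bdd_belowI2[where m = 0]) auto
	have le: "q x <= nY (x - m)" if "x : pY" "m : M" for x m
		unfolding q_def using that by (auto intro!: cINF_lower bdd)
	have ge: "c <= q x" if "x : pY" "!!m. m : M ==> c <= nY (x - m)" for x c
		unfolding q_def using that M0 by (auto intro!: cINF_greatest)
	have qM: "q m <= 0" if "m : M" for m using le[of m m] that M(2) by auto
	have qabs: "q (a *C x) <= cmod a * q x" if x: "x : pY" and a: "a ~= 0" for a x
	proof -
		have "q (a *C x) / cmod a <= q x"
		proof (rule ge[OF x])
			fix m assume m: "m : M"
			have "q (a *C x) <= nY (a *C x - a *C m)"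
				using x m M(1) by (intro le) (auto simp: csubspace_scale)
			also have "... = cmod a * nY (x - m)"
				using nrm_scale[of "x - m" a] x m M(2) by (auto simp: cscale_right_diff_distrib)
			finally show "q (a *C x) / cmod a <= nY (x - m)" using a by (simp add: field_simps)
		qed
		then show ?thesis using a by (simp add: field_simps)
	qed
	have "sublinear_on q"
	proof (rule sublinear_onI)
		show "q x = 0" if "x ~: pY" for x using that by (simp add: q_def zext_def)
		have "0 <= q 0"
		proof (rule ge)
			show "0 <= nY (0 - m)" if "m : M" for m
				using that M(2) by (intro nrm_nonneg diff_in) auto
		qed simp
		then show "q 0 = 0" using qM[OF M0] by simp
	next
		fix x y assume xy: "x : pY" "y : pY"
		have *: "q (x + y) <= nY (x - m) + nY (y - m')" if "m : M" "m' : M" for m m'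
		proof -
			have "q (x + y) <= nY (x + y - (m + m'))"
				using xy that M(1) by (intro le) (auto simp: csubspace_add)
			also have "... <= nY (x - m) + nY (y - m')"
			proof -
				have "x + y - (m + m') = (x - m) + (y - m')" by (simp add: algebra_simps)
				moreover have "x - m : pY" "y - m' : pY" using xy that M(2) by auto
				ultimately show ?thesis using nrm_add[of "x - m" "y - m'"] by (simp only:)
			qed
			finally show ?thesis .
		qed
		have "q (x + y) - q y <= q x"
		proof (rule ge[OF xy(1)])
			fix m assume m: "m : M"
			have "q (x + y) - nY (x - m) <= q y"
				by (rule ge[OF xy(2)]) (use *[OF m] in \<open>simp add: algebra_simps\<close>)
			then show "q (x + y) - q y <= nY (x - m)" by simp
		qed
		then show "q (x + y) <= q x + q y" by simp
	next
		fix t :: real and x assume "t > 0" "x : pY"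
		then show "q (complex_of_real t *C x) <= t * q x" using qabs[of x "complex_of_real t"] by simp
	qed
	then obtain f where f_add: "!!x y. x : pY ==> y : pY ==> f (x + y) = f x + f y"
		and f_scale: "!!t x. x : pY ==> f (complex_of_real t *C x) = t * f x"
		and fq: "!!x. f x <= q x" and f_out: "!!x. x ~: pY ==> f x = 0" and fy0: "f y0 = q y0"
		using real_hahn_banach[OF _ y0] by metis
	have f_neg: "f (- x) = - f x" if "x : pY" for x
		using f_scale[OF that, of "-1"] by simp
	\<comment> \<open>A complex linear functional is recovered from its real part as
	  \<open>F x = f x - \<i> f (\<i> x)\<close>.\<close>
	define F where "F = zext Y (%x. Complex (f x) (- f (\<i> *C x)))"
	have F_add: "F (x + y) = F x + F y" if "x : pY" "y : pY" for x y
		using that by (simp add: F_def f_add cscale_right_distrib complex_eq_iff)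
	have F_scale: "F (a *C x) = a *C F x" if x: "x : pY" for a x
	proof -
		have dec: "a *C x = complex_of_real (Re a) *C x + complex_of_real (Im a) *C \<i> *C x"
		proof -
			have "a *C x = (complex_of_real (Re a) + complex_of_real (Im a) * \<i>) *C x"
				by (rule arg_cong[where f = "%a. a *C x"]) (simp add: complex_eq_iff)
			then show ?thesis by (simp only: cscale_left_distrib) simp
		qed
		have dec': "\<i> *C a *C x = complex_of_real (Re a) *C \<i> *C x + complex_of_real (Im a) *C (- x)"
		proof -
			have "\<i> *C a *C x = (complex_of_real (Re a) * \<i> + complex_of_real (Im a) * (-1)) *C x"
				unfolding complex_vector.scale_scale
				by (rule arg_cong[where f = "%a. a *C x"]) (simp add: complex_eq_iff)
			then show ?thesis by (simp only: cscale_left_distrib) simp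
		qed
		have "f (a *C x) = Re a * f x + Im a * f (\<i> *C x)"
			unfolding dec using x by (simp only: f_add f_scale scale_in)
		moreover have "f (\<i> *C a *C x) = Re a * f (\<i> *C x) - Im a * f x"
			unfolding dec' using x by (simp only: f_add f_scale scale_in uminus_in f_neg)
		ultimately show ?thesis
			using x by (simp add: F_def scaleC_complex_def complex_eq_iff algebra_simps)
	qed
	have F_bound: "cmod (F x) <= q x" if x: "x : pY" for x
	proof (cases "F x = 0")
		case True
		then show ?thesis using ge[OF x, of 0] x nrm_nonneg[OF diff_in[OF x]] M(2) by (auto simp del: nrm_nonneg)
	next
		case False
		\<comment> \<open>Rotating \<open>x\<close> makes the value of \<open>F\<close> real and
		  nonnegative, so that its modulus is a value of the real functional \<open>f\<close>.\<close>
		define w where "w = cnj (sgn (F x))"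
		have w: "cmod w = 1" "w ~= 0" using False by (auto simp: w_def norm_sgn sgn_zero_iff)
		have "F x * cnj (F x) = complex_of_real (cmod (F x)) * complex_of_real (cmod (F x))"
			using complex_norm_square[of "F x"] by (simp add: power2_eq_square)
		then have "w * F x = complex_of_real (cmod (F x))"
		proof -
			have "w * F x = (F x * cnj (F x)) / complex_of_real (cmod (F x))"
				by (simp add: w_def sgn_eq)
			then show ?thesis
				unfolding \<open>F x * cnj (F x) = complex_of_real (cmod (F x)) * complex_of_real (cmod (F x))\<close>
				using False by simp
		qed
		then have "cmod (F x) = Re (F (w *C x))"
			using F_scale[OF x, of w] by (simp add: scaleC_complex_def)
		also have "... = f (w *C x)" using x by (simp add: F_def)
		also have "... <= q (w *C x)" by (rule fq)
		also have "... <= q x" using qabs[OF x w(2)] w(1) by simp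
		finally show ?thesis .
	qed
	have qn: "q x <= nY x" if "x : pY" for x using le[OF that M0] by simp
	show ?thesis
	proof (rule that[of F])
		show "F : FY"
		proof (rule bopI[where c = 1])
			show "F x = 0" if "x ~: pY" for x using that by (simp add: F_def zext_def)
			show "nrm scalars (F x) <= 1 * nY x" if "x : pY" for x
				using F_bound[OF that] qn[OF that] by simp
		qed (use F_add F_scale in simp_all)
		show "cmod (F x) <= nY x" if "x : pY" for x using F_bound[OF that] qn[OF that] by simp
		show "F m = 0" if "m : M" for m
		proof -
			have "cmod (F m) <= q m" using that M(2) by (intro F_bound) auto
			with qM[OF that] have "cmod (F m) <= 0" by linarith
			then show ?thesis by simp
		qed
		have "d <= f y0" unfolding fy0 by (rule ge[OF y0 d])
		also have "... = Re (F y0)" using y0 by (simp add: F_def)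
		also have "... <= cmod (F y0)" by (rule complex_Re_le_cmod)
		finally show "d <= cmod (F y0)" .
	qed
qed

end

section \<open>The Fredholm alternative and the open mapping theorem\<close>

lemma (in cnorm_space) nrm_limit_le:
	assumes "!!n. x n : pY" "y : pY" "w : pY" "(%n. nY (x n - y)) ----> 0"
		and le: "!!n. n >= N ==> nY (x n - w) <= c"
	shows "nY (y - w) <= c"
proof -
	have "(%n. nY (x n - y) + c) ----> 0 + c"
		by (intro tendsto_add assms tendsto_const)
	moreover have "nY (y - w) <= nY (x n - y) + c" if "n >= N" for n
		using nrm_triangle[of y "x n" w] nrm_commute[of y "x n"] assms(1-3) le[OF that] by force
	ultimately show ?thesis
		by (intro LIMSEQ_le_const[where X = "%n. nY (x n - y) + c"]) auto
qed

lemma (in cnorm_space) riesz_lemma: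
	assumes S: "closed_subspace Y S" and T: "csubspace T" "S \<subseteq> T" "T \<subseteq> pY"
		and y: "y : T" "y ~: S"
	obtains z where "z : T" "nY z = 1" "!!s. s : S ==> 1 / 2 <= nY (z - s)"
proof -
	note SD = closed_subspaceD[OF S]
	have yin: "y : pY" using y T by blast
	obtain d where d: "d > 0" "!!s c. s : S ==> cmod c * d <= nY (s + c *C y)"
		using closed_subspace_dist[OF S yin y(2)] by blast
	have ds: "d <= nY (y - s)" if "s : S" for s
		using d(2)[OF complex_vector.subspace_neg[OF SD(2) that], of 1] by simp
	define D where "D = (INF s\<in>S. nY (y - s))"
	have S0: "0 : S" using SD(2) by (simp add: complex_vector.subspace_0)
	have "d <= D" unfolding D_def using S0 ds by (intro cINF_greatest) auto
	then have D0: "D > 0" using d(1) by simp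
	have Dle: "D <= nY (y - s)" if "s : S" for s
		unfolding D_def using that ds by (intro cINF_lower bdd_belowI2[where m = d]) auto
	\<comment> \<open>Accepting a point that is nearest only up to a factor 2 is the source of the 1 /
	  2.\<close>
	have "EX u:S. nY (y - u) < 2 * D"
	proof (rule ccontr)
		assume "~ ?thesis"
		then have "2 * D <= D" unfolding D_def using S0 by (intro cINF_greatest) (auto simp: not_less)
		with D0 show False by simp
	qed
	then obtain u where u: "u : S" "nY (y - u) < 2 * D" by blast
	have uin: "u : pY" using u SD(1) by blast
	define \<rho> where "\<rho> = nY (y - u)"
	have \<rho>: "\<rho> > 0" using D0 Dle[OF u(1)] by (simp add: \<rho>_def)
	define z where "z = complex_of_real (1 / \<rho>) *C (y - u)"
	show ?thesis
	proof (rule that[of z])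
		show "z : T" unfolding z_def using y u T
			by (intro csubspace_scale csubspace_diff) auto
		show "nY z = 1" unfolding z_def using \<rho> yin uin by (simp add: nrm_scale norm_divide \<rho>_def)
		fix s assume s: "s : S"
		have sin: "s : pY" using s SD(1) by blast
		have us: "u + complex_of_real \<rho> *C s : S" using u s SD(2)
			by (intro csubspace_add csubspace_scale) auto
		have "z - s = complex_of_real (1 / \<rho>) *C (y - (u + complex_of_real \<rho> *C s))"
			unfolding z_def using \<rho> by (simp add: cscale_right_diff_distrib
					cscale_right_distrib algebra_simps)
		then have "nY (z - s) = nY (y - (u + complex_of_real \<rho> *C s)) / \<rho>"
			using \<rho> yin uin sin by (simp add: nrm_scale norm_divide)
		moreover have "D <= nY (y - (u + complex_of_real \<rho> *C s))" by (rule Dle[OF us])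
		ultimately have "\<rho> * (1 / 2) < \<rho> * nY (z - s)"
			using u(2) \<rho> unfolding \<rho>_def[symmetric] by simp
		then show "1 / 2 <= nY (z - s)"
			using \<rho> by (simp only: mult_less_cancel_left_pos)
	qed
qed

text \<open>A lower bound turns a Cauchy sequence of images into a Cauchy sequence of preimages,
  whose limit stays in the closed \<open>M\<close>. The typical \<open>M\<close> is a tail
  space.\<close>

lemma (in banach_cn) closed_range_on:
	assumes Z: "cnorm_space Z" and T: "T : bounded_ops Y Z" and M: "closed_subspace Y M"
		and c: "c > 0" "!!x. x : M ==> c * nY x <= nrm Z (T x)"
	shows "closed_subspace Z (T ` M)"
proof -
	interpret Z: cnorm_space Z by fact
	note MD = closed_subspaceD[OF M]
	have Min: "x : M ==> x : pY" for x using MD(1) by blast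
	show ?thesis
		unfolding closed_subspace_def
	proof (intro conjI allI impI)
		show "T ` M \<subseteq> pts Z" using Min bop_in[OF T] by auto
		show "csubspace (T ` M)"
		proof (rule complex_vector.subspaceI)
			show "0 : T ` M" 
				by (rule image_eqI[where x = 0]) (simp_all add: bop_zero[OF T] complex_vector.subspace_0[OF MD(2)])
			fix x y a assume xy: "x : T ` M" "y : T ` M"
			then obtain x' y' where *: "x' : M" "x = T x'" "y' : M" "y = T y'" by blast
			have "x + y = T (x' + y')" using bop_add[OF T] Min * by simp
			then show "x + y : T ` M" using * MD(2) by (auto simp: csubspace_add)
			have "a *C x = T (a *C x')" using bop_scale[OF T] Min * by simp
			then show "a *C x : T ` M" using * MD(2) by (auto simp: csubspace_scale)
		qed
		fix w :: "nat => 'b" and y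
		assume w: "ALL n. w n : T ` M" and y: "y : pts Z" and lim: "(%n. nrm Z (w n - y)) ----> 0"
		from w obtain x where x: "!!n. x n : M" "!!n. w n = T (x n)" unfolding image_iff by metis
		have xin: "x n : pY" for n using x(1) Min by blast
		have "cauchy_in Y x"
			unfolding cauchy_in_def
		proof (intro allI impI)
			fix e :: real assume "e > 0"
			have win: "w n : pts Z" for n using x(2) xin bop_in[OF T] by simp
			have "e * c > 0" using \<open>e > 0\<close> c(1) by simp
			then obtain N where N: "!!i j. i >= N ==> j >= N ==> nrm Z (w i - w j) < e * c"
				using cauchy_inD[OF Z.limit_cauchy[OF win y lim]] by blast
			have "nY (x i - x j) < e" if "i >= N" "j >= N" for i j
			proof -
				have "c * nY (x i - x j) <= nrm Z (T (x i - x j))"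
					using x(1) MD(2) by (intro c(2)) (auto simp: csubspace_diff)
				also have "... < e * c" using N[OF that] xin x(2) by (simp add: op_diff[OF T])
				finally show ?thesis using c(1) by simp
			qed
			then show "EX N. ALL i>=N. ALL j>=N. nY (x i - x j) < e" by blast
		qed
		then obtain u where u: "u : pY" "(%n. nY (x n - u)) ----> 0"
			using complete_cauchy[of x, OF xin] by blast
		have uM: "u : M" by (rule MD(3)[OF x(1) u])
		have "(%n. nrm Z (w n - T u)) ----> 0"
			using op_limit[where x = x, OF T Z xin u] by (simp add: x(2))
		then have "y = T u"
			using Z.limit_unique[where x = w, OF _ y bop_in[OF T u(1)] lim] w xin x(2) bop_in[OF T] by auto
		with uM show "y : T ` M" by blast
	qed
qed

lemma (in cnorm_space) closed_subspace_pts: "closed_subspace Y (pY)"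
	using subspace_pts by (auto simp: closed_subspace_def)

text \<open>If I + K is bounded below but not onto, the ranges of its powers form a strictly
  decreasing sequence of closed subspaces. Riesz vectors chosen in each range relative to the next
  have images under \<open>K\<close> at mutual distance at least 1 / 2, against compactness.\<close>

theorem (in banach_cn) fredholm_alternative:
	assumes K: "K : compact_ops Y" and c: "c > 0" "!!x. x : pY ==> c * nY x <= nY (x + K x)"
		and y: "y : pY"
	obtains x where "x : pY" "x + K x = y"
proof (rule ccontr)
	assume neg: "~ thesis"
	have Kop: "K : ops Y" using K by (simp add: compact_ops_def)
	define S where "S = id_op Y + K"
	have S: "S : ops Y" unfolding S_def by (intro ops_plus ops_id Kop)
	have Sx: "S x = x + K x" if "x : pY" for x using that by (simp add: S_def)
	define V where "V = (%n. (S ^^ n) ` pY)"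
	have V0: "V 0 = pY" and VSuc: "V (Suc n) = S ` V n" for n
		by (auto simp: V_def image_image)
	have Vcl: "closed_subspace Y (V n)" for n
	proof (induction n)
		case (Suc n)
		then show ?case unfolding VSuc
			using closed_subspaceD(1)[OF Suc] c Sx
			by (intro closed_range_on[OF norm_space S Suc c(1)]) auto
	qed (simp add: V0 closed_subspace_pts)
	note VD = closed_subspaceD[OF Vcl]
	have Vdec1: "V (Suc n) \<subseteq> V n" for n
	proof (induction n)
		case 0 then show ?case using bop_in[OF S] by (auto simp: VSuc V0)
	next
		case (Suc n) then show ?case unfolding VSuc[of "Suc n"] by (subst VSuc[of n]) blast
	qed
	have Vdec: "V m \<subseteq> V n" if "n <= m" for n m
		using that by (induction rule: dec_induct) (use Vdec1 in auto)
	have inj: "x = x'" if "x : pY" "x' : pY" "S x = S x'" for x x'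
	proof -
		have "c * nY (x - x') <= nY (S (x - x'))" using c(2)[of "x - x'"] that Sx by simp
		then have "nY (x - x') <= 0" using that c(1) by (simp add: op_diff[OF S] mult_le_0_iff)
		then show ?thesis using nrm_eq_0[of "x - x'"] nrm_nonneg[of "x - x'"] that by (simp del: nrm_nonneg)
	qed
	have notin: "(S ^^ n) y : V n & (S ^^ n) y ~: V (Suc n)" for n
	proof (induction n)
		case 0
		have "y ~: S ` pY" using neg that Sx by auto
		then show ?case using y by (simp add: VSuc V0)
	next
		case (Suc n)
		have "S ((S ^^ n) y) ~: S ` V (Suc n)"
		proof
			assume "S ((S ^^ n) y) : S ` V (Suc n)"
			then obtain v where "v : V (Suc n)" "S ((S ^^ n) y) = S v" by blast
			moreover have "(S ^^ n) y : pY" using Suc VD(1) by blast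
			ultimately have "(S ^^ n) y = v" using inj VD(1) by blast
			with Suc \<open>v : V (Suc n)\<close> show False by simp
		qed
		then show ?case using Suc VSuc by simp
	qed
	have "EX z. z : V n & nY z = 1 & (ALL s:V (Suc n). 1 / 2 <= nY (z - s))" for n
		using riesz_lemma[OF Vcl[of "Suc n"] VD(2)[of n] Vdec1 VD(1)] notin[of n] by metis
	then obtain z where z: "!!n. z n : V n" "!!n. nY (z n) = 1"
		"!!n s. s : V (Suc n) ==> 1 / 2 <= nY (z n - s)" by metis
	have zin: "z n : pY" for n using z(1) VD(1) by blast
	obtain r where r: "strict_mono (r :: nat => nat)" "cauchy_in Y (%n. K (z (r n)))"
		using K zin z(2) unfolding compact_ops_iff by (metis order_refl)
	have sep: "1 / 2 <= nY (K (z n) - K (z m))" if "n < m" for n m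
	proof -
		\<comment> \<open>\<open>K (z n) - K (z m)\<close> equals \<open>- z n\<close> up to this vector,
		  which lies in the next smaller range.\<close>
		define s where "s = S (z n) - S (z m) + z m"
		have "S (z n) : V (Suc n)" using z(1) by (simp add: VSuc)
		moreover have "S (z m) : V (Suc n)"
			using z(1)[of m] VSuc[of m] Vdec[of "Suc n" "Suc m"] that by auto
		moreover have "z m : V (Suc n)" using z(1)[of m] Vdec[of "Suc n" m] that by auto
		ultimately have "s : V (Suc n)" unfolding s_def
			using VD(2)[of "Suc n"] by (intro csubspace_add csubspace_diff)
		moreover have "K (z n) - K (z m) = - (z n - s)"
			using Sx[OF zin] by (simp add: s_def algebra_simps)
		moreover have "nY (- (z n - s)) = nY (z n - s)"
			using zin VD(1) \<open>s : V (Suc n)\<close> by (intro nrm_uminus diff_in) auto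
		ultimately show ?thesis using z(3) by simp
	qed
	obtain N where "!!i j. i >= N ==> j >= N ==> nY (K (z (r i)) - K (z (r j))) < 1 / 2"
		using cauchy_inD[OF r(2) half_gt_zero[OF zero_less_one]] by blast
	from this[of N "Suc N"] sep[of "r N" "r (Suc N)"] strict_monoD[OF r(1), of N "Suc N"]
	show False by simp
qed

lemma (in banach_cn) geometric_limit:
	assumes x: "!!n. x n : pY" and step: "!!n. nY (x (Suc n) - x n) <= a * (1 / 2) ^ n"
	obtains y where "y : pY" "(%n. nY (x n - y)) ----> 0"
		"!!n. nY (y - x n) <= 2 * a * (1 / 2) ^ n"
proof -
	have a: "a >= 0" using step[of 0] nrm_nonneg[OF diff_in[OF x x], of "Suc 0" 0] by (simp del: nrm_nonneg)
	have le: "nY (x m - x n) <= 2 * a * ((1 / 2) ^ n - (1 / 2) ^ m)" if "n <= m" for n m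
		using that
	proof (induction m rule: dec_induct)
		case (step m)
		then show ?case
			using nrm_triangle[of "x (Suc m)" "x m" "x n"] x assms(2)[of m] by (simp add: algebra_simps)
	qed simp
	have le': "nY (x m - x n) <= 2 * a * (1 / 2) ^ n" if "n <= m" for n m
	proof -
		have "2 * a * ((1 / 2) ^ n - (1 / 2) ^ m) <= 2 * a * (1 / 2) ^ n"
			using a by (intro mult_left_mono) auto
		with le[OF that] show ?thesis by linarith
	qed
	have "cauchy_in Y x"
		unfolding cauchy_in_def
	proof (intro allI impI)
		fix e :: real assume e: "e > 0"
		have "(%n. 2 * a * (1 / 2) ^ n) ----> 2 * a * 0"
			by (intro tendsto_mult_left LIMSEQ_realpow_zero) auto
		then have "\<forall>\<^sub>F n in sequentially. 2 * a * (1 / 2) ^ n < e"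
			using e by (intro order_tendstoD(2)[where y = "2 * a * 0"]) auto
		then obtain N where N: "!!n. n >= N ==> 2 * a * (1 / 2) ^ n < e"
			by (auto simp: eventually_sequentially)
		have "nY (x i - x j) < e" if "i >= N" "j >= N" for i j
		proof (cases "i <= j")
			case True
			then show ?thesis using le'[OF True] N[OF that(1)] nrm_commute[OF x x, of i j] by simp
		next
			case False
			then show ?thesis using le'[of j i] N[OF that(2)] by simp
		qed
		then show "EX N. ALL i>=N. ALL j>=N. nY (x i - x j) < e" by blast
	qed
	then obtain y where y: "y : pY" "(%n. nY (x n - y)) ----> 0"
		using complete_cauchy[of x, OF x] by blast
	then show ?thesis using that nrm_limit_le[where x = x, OF x y(1) x y(2) le'] by blast
qed

text \<open>Baire's argument is carried out by hand with nested balls: if no ball had an image that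
  is dense in some ball, shrinking balls could be chosen that avoid the image of the ball of radius
  \<open>n\<close> at stage \<open>n\<close>, and their common point would have no preimage.\<close>

theorem open_mapping:
	assumes Y: "banach_cn Y" and Z: "banach_cn Z" and S: "S : bounded_ops Y Z"
		and surj: "!!z. z : pts Z ==> EX x:pts Y. S x = z"
	obtains C where "C > 0" "!!z. z : pts Z ==> EX x:pts Y. S x = z & nrm Y x <= C * nrm Z z"
proof -
	interpret Y: banach_cn Y by fact
	interpret Z: banach_cn Z by fact
	note [simp] = bop_in[OF S]
	have "EX k r z0. r > 0 & z0 : pts Z & (ALL z:pts Z. nrm Z (z - z0) < r -->
			(ALL dl>0. EX x:pts Y. nrm Y x <= real k & nrm Z (z - S x) < dl))"
	proof (rule ccontr)
		assume nt: "~ ?thesis"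
		have neg: "EX z dl. z : pts Z & nrm Z (z - z0) < r & dl > 0 &
				(ALL x:pts Y. nrm Y x <= real k --> dl <= nrm Z (z - S x))"
			if "r > 0" "z0 : pts Z" for k r z0
		proof -
			have "~ (ALL z:pts Z. nrm Z (z - z0) < r -->
					(ALL dl>0. EX x:pts Y. nrm Y x <= real k & nrm Z (z - S x) < dl))"
				using nt that by blast
			then obtain z dl where z: "z : pts Z" "nrm Z (z - z0) < r" "dl > 0"
				and ns: "~ (EX x:pts Y. nrm Y x <= real k & nrm Z (z - S x) < dl)" by blast
			have "dl <= nrm Z (z - S x)" if "x : pts Y" "nrm Y x <= real k" for x
				using ns that by force
			with z show ?thesis by blast
		qed
		\<comment> \<open>A pair is a ball, given by centre and radius; \<open>Q\<close> demands nesting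
		  and a distance of the new centre from the image of the ball of radius \<open>n\<close> that
		  exceeds the new radius.\<close>
		define P where "P = (%(n::nat) (w :: 'b \<times> real). fst w : pts Z & 0 < snd w & snd w <= (1 / 2) ^ n)"
		define Q where "Q = (%(n::nat) (w :: 'b \<times> real) w'. nrm Z (fst w' - fst w) + snd w' <= snd w &
				(ALL x:pts Y. nrm Y x <= real n --> snd w' < nrm Z (fst w' - S x)))"
		have "EX f. ALL n. P n (f n) & Q n (f n) (f (Suc n))"
		proof (rule dependent_nat_choice)
			show "EX w. P 0 w" by (rule exI[of _ "(0, 1)"]) (simp add: P_def)
		next
			fix w n assume w: "P n w"
			then obtain z dl where z: "z : pts Z" "nrm Z (z - fst w) < snd w / 2" "dl > 0"
				"!!x. x : pts Y ==> nrm Y x <= real n ==> dl <= nrm Z (z - S x)"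
				using neg[of "snd w / 2" "fst w" n] by (auto simp: P_def)
			define r' where "r' = min (snd w / 2) (dl / 2)"
			have r': "0 < r'" "r' <= snd w / 2" "r' < dl" using w z(3) by (auto simp: r'_def P_def)
			have "P (Suc n) (z, r')" using w z(1) r' by (auto simp: P_def)
			moreover have "Q n w (z, r')" using z(2) r' z(4) by (force simp: Q_def)
			ultimately show "EX w'. P (Suc n) w' & Q n w w'" by blast
		qed
		then obtain f where f: "!!n. P n (f n)" "!!n. Q n (f n) (f (Suc n))" by blast
		define zs where "zs = (%n. fst (f n))"
		define rs where "rs = (%n. snd (f n))"
		have zs: "zs n : pts Z" and rs: "0 < rs n" "rs n <= (1 / 2) ^ n" for n
			using f(1)[of n] by (auto simp: P_def zs_def rs_def)
		have step: "nrm Z (zs (Suc n) - zs n) + rs (Suc n) <= rs n" for n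
			using f(2)[of n] by (simp add: Q_def zs_def rs_def)
		have far: "rs (Suc n) < nrm Z (zs (Suc n) - S x)" if "x : pts Y" "nrm Y x <= real n" for n x
			using f(2)[of n] that by (simp add: Q_def zs_def rs_def)
		have "nrm Z (zs (Suc n) - zs n) <= 1 * (1 / 2) ^ n" for n
			using step[of n] rs(1)[of "Suc n"] rs(2)[of n] by linarith
		then obtain z where z: "z : pts Z" "(%n. nrm Z (zs n - z)) ----> 0"
			using Z.geometric_limit[where x = zs, OF zs] by blast
		have "nrm Z (zs m - zs n) <= rs n - rs m" if "n <= m" for n m
			using that
		proof (induction m rule: dec_induct)
			case (step m)
			then show ?case
				using Z.nrm_triangle[of "zs (Suc m)" "zs m" "zs n"] zs \<open>nrm Z (zs (Suc m) - zs m) + rs (Suc m) <= rs m\<close>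
				by simp
		qed simp
		then have "nrm Z (zs m - zs n) <= rs n" if "n <= m" for n m
			using that rs(1)[of m] by force
		then have zle: "nrm Z (z - zs n) <= rs n" for n
			by (rule Z.nrm_limit_le[where x = zs, OF zs z(1) zs z(2)])
		obtain x where x: "x : pts Y" "S x = z" using surj[OF z(1)] by blast
		obtain n :: nat where n: "nrm Y x <= real n" using real_arch_simple by blast
		have "rs (Suc n) < nrm Z (z - zs (Suc n))"
			using far[OF x(1) n] x(2) Z.nrm_commute[OF z(1) zs] by simp
		with zle[of "Suc n"] show False by simp
	qed
	then obtain k r z0 where r: "r > 0" and z0: "z0 : pts Z"
		and dense: "!!z dl. z : pts Z ==> nrm Z (z - z0) < r ==> dl > 0 ==>
			EX x:pts Y. nrm Y x <= real k & nrm Z (z - S x) < dl" by blast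
	\<comment> \<open>Subtracting approximations of \<open>z + z0\<close> and of \<open>z0\<close>
	  moves the ball to the origin at the price of doubling the radius in the domain.\<close>
	have dense0: "EX x:pts Y. nrm Y x <= 2 * real k & nrm Z (z - S x) < dl"
		if "z : pts Z" "nrm Z z < r" "dl > 0" for z dl
	proof -
		have *: "z + z0 : pts Z" "nrm Z (z + z0 - z0) < r" "nrm Z (z0 - z0) < r" "dl / 2 > 0"
			using that z0 r by auto
		obtain x1 where x1: "x1 : pts Y" "nrm Y x1 <= real k" "nrm Z (z + z0 - S x1) < dl / 2"
			using dense[OF *(1,2,4)] by blast
		obtain x2 where x2: "x2 : pts Y" "nrm Y x2 <= real k" "nrm Z (z0 - S x2) < dl / 2"
			using dense[OF z0 *(3,4)] by blast
		have "nrm Z (z - S (x1 - x2)) <= nrm Z (z + z0 - S x1) + nrm Z (z0 - S x2)"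
			using Z.nrm_diff[of "z + z0 - S x1" "z0 - S x2"] x1 x2 z0 that
			by (simp add: Y.op_diff[OF S] algebra_simps)
		moreover have "nrm Y (x1 - x2) <= 2 * real k" using Y.nrm_diff[OF x1(1) x2(1)] x1 x2 by simp
		ultimately show ?thesis using x1 x2 by (intro bexI[of _ "x1 - x2"]) auto
	qed
	\<comment> \<open>A vector is rescaled to norm \<open>r / 2\<close> and approximated from the ball
	  of radius \<open>2 * real k\<close>; undoing the scaling gives this factor.\<close>
	define C where "C = 4 * real k / r"
	have C0: "C >= 0" using r by (simp add: C_def)
	have half: "EX x:pts Y. nrm Y x <= C * nrm Z z & nrm Z (z - S x) <= nrm Z z / 2" if z: "z : pts Z" for z
	proof (cases "z = 0")
		case True
		then show ?thesis using bop_zero[OF S] by (intro bexI[of _ 0]) auto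
	next
		case False
		then have pos: "nrm Z z > 0" using z by (simp add: Z.nrm_pos_iff)
		define t where "t = r / (2 * nrm Z z)"
		have t: "t > 0" using r pos by (simp add: t_def)
		have "nrm Z (complex_of_real t *C z) = t * nrm Z z" using t z by (simp add: Z.nrm_scale)
		also have "... = r / 2" using pos by (simp add: t_def)
		finally have "nrm Z (complex_of_real t *C z) < r" using r by simp
		moreover have "complex_of_real t *C z : pts Z" "t * nrm Z z / 2 > 0" using z t pos by auto
		ultimately obtain x where x: "x : pts Y" "nrm Y x <= 2 * real k"
			"nrm Z (complex_of_real t *C z - S x) < t * nrm Z z / 2"
			using dense0 by blast
		define x' where "x' = complex_of_real (1 / t) *C x"
		have x'in: "x' : pts Y" using x by (simp add: x'_def)
		have "nrm Y x' = nrm Y x / t" using x t by (simp add: x'_def Y.nrm_scale norm_divide)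
		also have "... <= 2 * real k / t" using x(2) t by (simp add: divide_right_mono)
		also have "... = C * nrm Z z" using r pos by (simp add: C_def t_def)
		finally have "nrm Y x' <= C * nrm Z z" .
		moreover have "z - S x' = complex_of_real (1 / t) *C (complex_of_real t *C z - S x)"
			using x(1) t bop_scale[OF S x(1)] by (simp add: x'_def cscale_right_diff_distrib)
		then have "nrm Z (z - S x') = nrm Z (complex_of_real t *C z - S x) / t"
			using x(1) z t by (simp add: Z.nrm_scale norm_divide)
		then have "t * nrm Z (z - S x') < t * (nrm Z z / 2)" using x(3) t by simp
		then have "nrm Z (z - S x') <= nrm Z z / 2" using t by (simp only: mult_less_cancel_left_pos)
		ultimately show ?thesis using x'in by blast
	qed
	then obtain g where g: "!!z. z : pts Z ==> g z : pts Y" "!!z. z : pts Z ==> nrm Y (g z) <= C * nrm Z z"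
		"!!z. z : pts Z ==> nrm Z (z - S (g z)) <= nrm Z z / 2" by metis
	show ?thesis
	proof (rule that[of "2 * C + 1"])
		show "2 * C + 1 > 0" using C0 by simp
		fix z assume z: "z : pts Z"
		\<comment> \<open>Successive approximation: the remainders halve at each step, so the chosen
		  approximate preimages sum to an exact one.\<close>
		define zs where "zs = (%n. ((%z. z - S (g z)) ^^ n) z)"
		have zs: "zs n : pts Z" for n
			by (induction n) (use z g(1) in \<open>auto simp: zs_def\<close>)
		have zsSuc: "zs (Suc n) = zs n - S (g (zs n))" for n by (simp add: zs_def)
		have zn: "nrm Z (zs n) <= nrm Z z * (1 / 2) ^ n" for n
		proof (induction n)
			case (Suc n)
			then show ?case using g(3)[OF zs[of n]] by (simp add: zsSuc)
		qed (simp add: zs_def)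
		define X where "X = (%n. \<Sum>i<n. g (zs i))"
		have X: "X n : pts Y" for n unfolding X_def using g(1) zs by (intro Y.sum_in) auto
		have SX: "S (X n) = z - zs n" for n
		proof (induction n)
			case 0
			then show ?case using bop_zero[OF S] by (simp add: X_def zs_def)
		next
			case (Suc n)
			have "S (X (Suc n)) = S (X n) + S (g (zs n))"
				using bop_add[OF S X g(1)[OF zs]] by (simp add: X_def)
			then show ?case using Suc by (simp add: zsSuc)
		qed
		have "nrm Y (X (Suc n) - X n) <= (C * nrm Z z) * (1 / 2) ^ n" for n
		proof -
			have "nrm Y (X (Suc n) - X n) <= C * nrm Z (zs n)" using g(2)[OF zs] by (simp add: X_def)
			also have "... <= C * (nrm Z z * (1 / 2) ^ n)" using zn C0 by (rule mult_left_mono)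
			finally show ?thesis by (simp add: mult.assoc)
		qed
		then obtain x where x: "x : pts Y" "(%n. nrm Y (X n - x)) ----> 0"
			"!!n. nrm Y (x - X n) <= 2 * (C * nrm Z z) * (1 / 2) ^ n"
			using Y.geometric_limit[where x = X, OF X] by blast
		have "(%n. nrm Z (S (X n) - z)) ----> 0"
		proof (rule tendsto_sandwich[where f = "%_. 0"])
			show "(%n. nrm Z z * (1 / 2) ^ n) ----> 0"
				using tendsto_mult_left[OF LIMSEQ_realpow_zero[of "1 / 2 :: real"], of "nrm Z z"] by simp
		qed (use zn zs in \<open>auto simp: SX Z.nrm_uminus\<close>)
		then have "S x = z"
			using Z.limit_unique[OF _ _ _ Y.op_limit[where x = X, OF S Z.norm_space X x(1,2)]] X x(1) z by simp
		moreover have "nrm Y x <= (2 * C + 1) * nrm Z z"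
			using x(3)[of 0] z by (simp add: X_def algebra_simps) (smt (verit) Z.nrm_nonneg)
		ultimately show "EX x:pts Y. S x = z & nrm Y x <= (2 * C + 1) * nrm Z z" using x(1) by blast
	qed
qed

lemma (in cnorm_space) nrm_mult_le_0:
	assumes "c > 0" "c * nY x <= 0" "x : pY"
	shows "x = 0"
proof (rule ccontr)
	assume "x ~= 0"
	with assms have "0 < c * nY x" by (simp add: nrm_pos_iff)
	with assms(2) show False by simp
qed

section \<open>Compact gauges\<close>

text \<open>
  A compact gauge plays the role of \<open>\<lambda>x. \<parallel>K x\<parallel>\<close> for a compact operator \<open>K\<close> into an unspecified
  space; \<open>ess_below Y T\<close> says that \<open>T\<close> is bounded below modulo such a gauge.
\<close>

definition compact_gauge :: "'a::complex_vector cnspace => ('a => real) => bool"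
	where "compact_gauge Y k \<longleftrightarrow> (ALL (x :: nat => 'a) M. (ALL n. x n : pts Y & nrm Y (x n) <= M) -->
		(EX r :: nat => nat. strict_mono r & (ALL e>0. EX N. ALL i>=N. ALL j>=N. k (x (r i) - x (r j)) < e)))"

definition ess_below :: "'a::complex_vector cnspace => ('a => 'a) => bool"
	where "ess_below Y T \<longleftrightarrow> (EX c>0. EX k. compact_gauge Y k &
		(ALL x:pts Y. c * nrm Y x <= nrm Y (T x) + k x))"

lemma compact_gaugeD:
	fixes x :: "nat => 'a::complex_vector"
	assumes "compact_gauge Y k" "!!n. x n : pts Y" "!!n. nrm Y (x n) <= M"
	obtains r :: "nat => nat" where "strict_mono r" "!!e. e > 0 ==> EX N. ALL i>=N. ALL j>=N. k (x (r i) - x (r j)) < e"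
	using assms(1)[unfolded compact_gauge_def, rule_format, of x M] assms(2,3) by blast

context cnorm_space
begin

lemma compact_gauge_mono:
	assumes k: "compact_gauge Y k" and a: "a > 0" and le: "!!x. x : pY ==> k' x <= a * k x"
	shows "compact_gauge Y k'"
	unfolding compact_gauge_def
proof (intro allI impI)
	fix x :: "nat => 'a" and M assume x: "ALL n. x n : pY & nY (x n) <= M"
	obtain r where r: "strict_mono (r :: nat => nat)" "!!e. e > 0 ==> EX N. ALL i>=N. ALL j>=N. k (x (r i) - x (r j)) < e"
		using compact_gaugeD[OF k, of x M] x by blast
	have "EX N. ALL i>=N. ALL j>=N. k' (x (r i) - x (r j)) < e" if "e > 0" for e
	proof -
		obtain N where N: "!!i j. i >= N ==> j >= N ==> k (x (r i) - x (r j)) < e / a"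
			using r(2)[of "e / a"] \<open>e > 0\<close> a by (meson divide_pos_pos)
		have "k' (x (r i) - x (r j)) < e" if "i >= N" "j >= N" for i j
		proof -
			have "k' (x (r i) - x (r j)) <= a * k (x (r i) - x (r j))" using x by (intro le) auto
			also have "... < a * (e / a)" using N[OF that] a by (intro mult_strict_left_mono) auto
			finally show ?thesis using a by simp
		qed
		then show ?thesis by blast
	qed
	with r(1) show "EX r :: nat => nat. strict_mono r & (ALL e>0. EX N. ALL i>=N. ALL j>=N. k' (x (r i) - x (r j)) < e)"
		by blast
qed

lemma compact_gauge_add:
	assumes k: "compact_gauge Y k" "compact_gauge Y k'"
	shows "compact_gauge Y (%x. k x + k' x)"
	unfolding compact_gauge_def
proof (intro allI impI)
	fix x :: "nat => 'a" and M assume x: "ALL n. x n : pY & nY (x n) <= M"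
	obtain r where r: "strict_mono (r :: nat => nat)" "!!e. e > 0 ==> EX N. ALL i>=N. ALL j>=N. k (x (r i) - x (r j)) < e"
		using compact_gaugeD[OF k(1), of x M] x by blast
	obtain r' where r': "strict_mono (r' :: nat => nat)"
		"!!e. e > 0 ==> EX N. ALL i>=N. ALL j>=N. k' (x (r (r' i)) - x (r (r' j))) < e"
		using compact_gaugeD[OF k(2), of "%n. x (r n)" M] x by blast
	have "EX N. ALL i>=N. ALL j>=N. k (x (r (r' i)) - x (r (r' j))) + k' (x (r (r' i)) - x (r (r' j))) < e"
		if "e > 0" for e
	proof -
		obtain N where N: "!!i j. i >= N ==> j >= N ==> k (x (r i) - x (r j)) < e / 2"
			using r(2)[OF half_gt_zero[OF \<open>e > 0\<close>]] by blast
		obtain N' where N': "!!i j. i >= N' ==> j >= N' ==> k' (x (r (r' i)) - x (r (r' j))) < e / 2"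
			using r'(2)[OF half_gt_zero[OF \<open>e > 0\<close>]] by blast
		have "k (x (r (r' i)) - x (r (r' j))) + k' (x (r (r' i)) - x (r (r' j))) < e"
			if "i >= max N N'" "j >= max N N'" for i j
			using N[of "r' i" "r' j"] N'[of i j] that seq_suble[OF r'(1), of i] seq_suble[OF r'(1), of j] by simp
		then show ?thesis by blast
	qed
	with strict_mono_o[OF r(1) r'(1)]
	show "EX r :: nat => nat. strict_mono r & (ALL e>0. EX N. ALL i>=N. ALL j>=N. k (x (r i) - x (r j)) + k' (x (r i) - x (r j)) < e)"
		by (intro exI[of _ "r o r'"]) (auto simp: o_def)
qed

lemma compact_gauge_comp:
	assumes Z: "cnorm_space Z" and k: "compact_gauge Z k" and T: "T : bounded_ops Y Z"
	shows "compact_gauge Y (%x. k (T x))"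
	unfolding compact_gauge_def
proof (intro allI impI)
	fix x :: "nat => 'a" and M assume x: "ALL n. x n : pY & nY (x n) <= M"
	have "nrm Z (T (x n)) <= op_norm Y Z T * M" for n
		using op_norm_bound[OF norm_space Z T, of "x n"] x op_norm_nonneg[OF norm_space Z T]
		by (meson mult_left_mono order_trans)
	then obtain r where r: "strict_mono (r :: nat => nat)"
		"!!e. e > 0 ==> EX N. ALL i>=N. ALL j>=N. k (T (x (r i)) - T (x (r j))) < e"
		using compact_gaugeD[OF k, of "%n. T (x n)"] bop_in[OF T] x by blast
	have "T (x (r i) - x (r j)) = T (x (r i)) - T (x (r j))" for i j
		using x by (intro op_diff[OF T]) auto
	with r show "EX r :: nat => nat. strict_mono r & (ALL e>0. EX N. ALL i>=N. ALL j>=N. k (T (x (r i) - x (r j))) < e)"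
		by (intro exI[of _ r]) simp
qed

lemma compact_gauge_finite_rank:
	assumes Z: "cnorm_space Z" and T: "T : bounded_ops Y Z"
		and B: "finite B" "B \<subseteq> pts Z" "!!x. x : pY ==> T x : cspan B"
	shows "compact_gauge Y (%x. nrm Z (T x))"
	unfolding compact_gauge_def
proof (intro allI impI)
	interpret Z: cnorm_space Z by fact
	fix x :: "nat => 'a" and M assume x: "ALL n. x n : pY & nY (x n) <= M"
	have le: "nrm Z (T (x n)) <= op_norm Y Z T * M" for n
		using op_norm_bound[OF norm_space Z T, of "x n"] x op_norm_nonneg[OF norm_space Z T]
		by (meson mult_left_mono order_trans)
	obtain r y where r: "strict_mono (r :: nat => nat)" "y : cspan B" "(%n. nrm Z (T (x (r n)) - y)) ----> 0"
		using Z.finite_span_convergent_subseq[OF B(1,2), of "%n. T (x n)"] B(3) x le by blast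
	have "cauchy_in Z (%n. T (x (r n)))"
		by (rule Z.limit_cauchy[OF _ _ r(3)]) (use x bop_in[OF T] r(2) Z.cspan_subset_pts[OF B(2)] in auto)
	moreover have "T (x (r i) - x (r j)) = T (x (r i)) - T (x (r j))" for i j
		using x by (intro op_diff[OF T]) auto
	ultimately show "EX r :: nat => nat. strict_mono r & (ALL e>0. EX N. ALL i>=N. ALL j>=N. nrm Z (T (x (r i) - x (r j))) < e)"
		using r(1) by (intro exI[of _ r]) (simp add: cauchy_in_def)
qed

end

context banach_cn
begin

lemma compact_ops_gauge:
	"K : compact_ops Y \<longleftrightarrow> K : ops Y & compact_gauge Y (%x. nY (K x))" (is "?L \<longleftrightarrow> ?R")
proof
	assume L: ?L
	then have K: "K : ops Y" by (simp add: compact_ops_def)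
	have "compact_gauge Y (%x. nY (K x))"
		unfolding compact_gauge_def
	proof (intro allI impI)
		fix x :: "nat => 'a" and M assume x: "ALL n. x n : pY & nY (x n) <= M"
		\<comment> \<open>Gauges are tested on arbitrary bounded sequences, compact operators on the unit
		  ball only; rescaling by \<open>t\<close> mediates.\<close>
		define t where "t = \<bar>M\<bar> + 1"
		have t: "t > 0" by (simp add: t_def)
		have "nY (x n) <= t" for n using x[rule_format, of n] unfolding t_def by linarith
		then have "nY (complex_of_real (1 / t) *C x n) <= 1" for n
			using x t by (simp add: nrm_scale norm_divide)
		moreover have "complex_of_real (1 / t) *C x n : pY" for n using x by simp
		ultimately obtain r where r: "strict_mono (r :: nat => nat)"
			"cauchy_in Y (%n. K (complex_of_real (1 / t) *C x (r n)))"
			using L unfolding compact_ops_iff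
			by (elim conjE allE[of _ "%n. complex_of_real (1 / t) *C x n"]) blast
		have eq: "nY (K (x (r i) - x (r j))) =
				t * nY (K (complex_of_real (1 / t) *C x (r i)) - K (complex_of_real (1 / t) *C x (r j)))" for i j
		proof -
			have "K (complex_of_real (1 / t) *C x (r i)) - K (complex_of_real (1 / t) *C x (r j))
					= complex_of_real (1 / t) *C K (x (r i) - x (r j))"
				using x by (simp add: bop_scale[OF K] op_diff[OF K] cscale_right_diff_distrib)
			then show ?thesis using x t bop_in[OF K] by (simp add: nrm_scale norm_divide)
		qed
		have "EX N. ALL i>=N. ALL j>=N. nY (K (x (r i) - x (r j))) < e" if "e > 0" for e
		proof -
			have "e / t > 0" using that t by simp
			from cauchy_inD[OF r(2) this] show ?thesis
				unfolding eq using t by (simp add: pos_less_divide_eq mult.commute)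
		qed
		then show "EX r :: nat => nat. strict_mono r & (ALL e>0. EX N. ALL i>=N. ALL j>=N. nY (K (x (r i) - x (r j))) < e)"
			using r(1) by blast
	qed
	with K show ?R by blast
next
	assume R: ?R
	then have K: "K : ops Y" by blast
	show ?L
		unfolding compact_ops_iff
	proof (intro conjI allI impI)
		fix x :: "nat => 'a" assume x: "ALL n. x n : pY & nY (x n) <= 1"
		obtain r where r: "strict_mono (r :: nat => nat)" "!!e. e > 0 ==> EX N. ALL i>=N. ALL j>=N. nY (K (x (r i) - x (r j))) < e"
			using compact_gaugeD[of Y "%x. nY (K x)" x 1] R x by blast
		have "K (x (r i) - x (r j)) = K (x (r i)) - K (x (r j))" for i j
			using x by (intro op_diff[OF K]) auto
		then show "EX r :: nat => nat. strict_mono r & cauchy_in Y (%n. K (x (r n)))"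
			using r by (intro exI[of _ r]) (simp add: cauchy_in_def)
	qed (fact K)
qed

lemma compact_opsD: "K : compact_ops Y ==> K : ops Y"
	by (simp add: compact_ops_def)

lemma compact_ops_dominated:
	assumes "K : ops Y" "compact_gauge Y k" "!!x. x : pY ==> nY (K x) <= k x"
	shows "K : compact_ops Y"
	using compact_gauge_mono[OF assms(2), of 1] assms by (auto simp: compact_ops_gauge)

lemma compact_ops_plus:
	assumes "K : compact_ops Y" "L : compact_ops Y"
	shows "K + L : compact_ops Y"
proof (rule compact_ops_dominated)
	show "K + L : ops Y" using assms by (intro ops_plus compact_opsD)
	show "compact_gauge Y (%x. nY (K x) + nY (L x))"
		using assms by (intro compact_gauge_add) (auto simp: compact_ops_gauge)
	show "nY ((K + L) x) <= nY (K x) + nY (L x)" if "x : pY" for x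
		using bop_in[OF compact_opsD[OF assms(1)] that] bop_in[OF compact_opsD[OF assms(2)] that]
		by (simp add: nrm_add)
qed

lemma compact_ops_comp_right:
	assumes "K : compact_ops Y" "T : ops Y"
	shows "K o T : compact_ops Y"
proof (rule compact_ops_dominated)
	show "K o T : ops Y" by (rule ops_comp[OF compact_opsD[OF assms(1)] assms(2)])
	show "compact_gauge Y (%x. nY (K (T x)))"
		using compact_gauge_comp[OF norm_space, of "%x. nY (K x)" T] assms
		by (simp add: compact_ops_gauge)
qed auto

lemma compact_ops_comp_left:
	assumes "K : compact_ops Y" "T : ops Y"
	shows "T o K : compact_ops Y"
proof -
	have K: "K : ops Y" using assms(1) by (rule compact_opsD)
	obtain c where c: "c > 0" "!!x. x : pY ==> nY (T x) <= c * nY x"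
		using bop_bound[OF norm_space assms(2)] by blast
	show ?thesis
		using compact_gauge_mono[of "%x. nY (K x)" c "%x. nY (T (K x))"] c bop_in[OF K] assms
			ops_comp[OF assms(2) K]
		by (auto simp: compact_ops_gauge)
qed

lemma compact_ops_zero: "0 : compact_ops Y"
	using compact_ops_dominated[OF ops_zero, of "%x. 0"] by (auto simp: compact_gauge_def strict_mono_def)

lemma compact_ops_cscale:
	assumes "K : compact_ops Y" shows "a *C K : compact_ops Y"
proof -
	have K: "K : ops Y" using assms by (rule compact_opsD)
	have "a *C K = (a *C id_op Y) o K"
		by (rule bop_eqI[OF ops_cscale[OF K] ops_comp[OF ops_cscale[OF ops_id] K]])
			(simp add: scaleC_fun_def bop_in[OF K])
	then show ?thesis using compact_ops_comp_left[OF assms ops_cscale[OF ops_id]] by simp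
qed

text \<open>A subsequence on which the gauge is Cauchy lets the lower estimate transfer the Cauchy
  property from the images to the vectors. Compactness arguments for operators bounded below up to a
  gauge go through this.\<close>

lemma ess_below_cauchy_subseq:
	assumes T: "ess_below Y T" "T : ops Y" and x: "!!n. x n : pY" "!!n. nY (x n) <= M"
		and Tx: "cauchy_in Y (%n. T (x n))"
	obtains r where "strict_mono (r :: nat => nat)" "cauchy_in Y (%n. x (r n))"
proof -
	obtain c k where c: "c > 0" and k: "compact_gauge Y k"
		and le: "!!x. x : pY ==> c * nY x <= nY (T x) + k x"
		using T(1) unfolding ess_below_def by blast
	obtain r where r: "strict_mono (r :: nat => nat)" "!!e. e > 0 ==> EX N. ALL i>=N. ALL j>=N. k (x (r i) - x (r j)) < e"
		using compact_gaugeD[OF k, of x M] x by blast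
	have "cauchy_in Y (%n. x (r n))"
		unfolding cauchy_in_def
	proof (intro allI impI)
		fix e :: real assume "e > 0"
		then have pos: "c * e / 2 > 0" using c by simp
		obtain N where N: "!!i j. i >= N ==> j >= N ==> k (x (r i) - x (r j)) < c * e / 2"
			using r(2)[OF pos] by blast
		obtain N' where N': "!!i j. i >= N' ==> j >= N' ==> nY (T (x (r i)) - T (x (r j))) < c * e / 2"
			using cauchy_inD[OF cauchy_in_subseq[OF Tx r(1)] pos] by blast
		have "nY (x (r i) - x (r j)) < e" if "i >= max N N'" "j >= max N N'" for i j
		proof -
			have "c * nY (x (r i) - x (r j)) < c * e"
				using le[of "x (r i) - x (r j)"] N[of i j] N'[of i j] that x by (simp add: op_diff[OF T(2)])
			then show ?thesis using c by simp
		qed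
		then show "EX N. ALL i>=N. ALL j>=N. nY (x (r i) - x (r j)) < e" by blast
	qed
	with r(1) show ?thesis using that by blast
qed

text \<open>Otherwise normalized vectors of \<open>M\<close> with images tending to 0 would have a
  convergent subsequence, whose limit is a unit vector of \<open>M\<close> in the kernel.\<close>

lemma ess_below_bounded_below:
	assumes T: "ess_below Y T" "T : ops Y" and M: "closed_subspace Y M"
		and inj: "!!x. x : M ==> T x = 0 ==> x = 0"
	obtains c where "c > 0" "!!x. x : M ==> c * nY x <= nY (T x)"
proof -
	note MD = closed_subspaceD[OF M]
	have Min: "x : pY" if "x : M" for x using that MD(1) by blast
	have "EX c>0. ALL x:M. c * nY x <= nY (T x)"
	proof (rule ccontr)
		assume neg: "~ ?thesis"
		have "EX x:M. nY x = 1 & nY (T x) < 1 / real (Suc n)" for n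
		proof -
			have "~ (ALL x:M. 1 / real (Suc n) * nY x <= nY (T x))"
				using neg by (metis of_nat_0_less_iff zero_less_Suc zero_less_divide_1_iff)
			then obtain x where x: "x : M" "nY (T x) < 1 / real (Suc n) * nY x" by force
			have "x ~= 0" using x(2) bop_zero[OF T(2)] by auto
			then have pos: "nY x > 0" using Min[OF x(1)] nrm_pos_iff by blast
			let ?u = "complex_of_real (1 / nY x) *C x"
			have "nY (T ?u) = nY (T x) / nY x"
				using Min[OF x(1)] bop_in[OF T(2)] by (simp add: bop_scale[OF T(2)] nrm_scale norm_divide)
			also have "... < 1 / real (Suc n)" using x(2) pos by (simp add: pos_divide_less_eq)
			finally have "nY (T ?u) < 1 / real (Suc n)" .
			then show ?thesis
				using nrm_normalize[OF Min[OF x(1)] \<open>x ~= 0\<close>] csubspace_scale[OF MD(2) x(1)] by blast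
		qed
		then obtain x where x: "!!n. x n : M" "!!n. nY (x n) = 1" "!!n. nY (T (x n)) < 1 / real (Suc n)"
			by metis
		have xin: "x n : pY" for n using Min x(1) by blast
		have Tlim: "(%n. nY (T (x n) - 0)) ----> 0"
		proof (rule tendsto_sandwich[where f = "%_. 0" and h = "%n. 1 / real (Suc n)"])
			show "(%n. 1 / real (Suc n)) ----> 0" using LIMSEQ_Suc[OF lim_1_over_n] by simp
			show "\<forall>\<^sub>F n in sequentially. nY (T (x n) - 0) <= 1 / real (Suc n)"
				using x(3) by (auto intro!: always_eventually less_imp_le simp del: of_nat_Suc)
		qed (use xin bop_in[OF T(2)] in auto)
		have "cauchy_in Y (%n. T (x n))"
			by (rule limit_cauchy[OF _ _ Tlim]) (use xin bop_in[OF T(2)] in auto)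
		then obtain r where r: "strict_mono (r :: nat => nat)" "cauchy_in Y (%n. x (r n))"
			using ess_below_cauchy_subseq[where x = x and M = 1, OF T xin] x(2) by auto
		then obtain y where y: "y : pY" "(%n. nY (x (r n) - y)) ----> 0"
			using complete_cauchy[of "%n. x (r n)", OF xin] by blast
		have yM: "y : M" by (rule MD(3)[of "%n. x (r n)", OF x(1) y])
		have "(%n. nY (T (x (r n)) - 0)) ----> 0"
			using LIMSEQ_subseq_LIMSEQ[OF Tlim r(1)] by (simp add: o_def)
		moreover have "(%n. nY (T (x (r n)) - T y)) ----> 0"
			by (rule op_limit[where x = "%n. x (r n)", OF T(2) norm_space xin y])
		ultimately have "T y = 0"
			using limit_unique[of "%n. T (x (r n))" "T y" 0] xin y(1) bop_in[OF T(2)] by simp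
		then have "y = 0" using inj yM by blast
		then have "(%n. nY (x (r n))) ----> 0" using y(2) by simp
		then show False using x(2) LIMSEQ_const_iff[of "1 :: real" 0] by simp
	qed
	then show ?thesis using that by blast
qed

lemma ess_below_id_compact:
	assumes K: "K : compact_ops Y"
	shows "ess_below Y (id_op Y + K)"
	unfolding ess_below_def
proof (intro exI[of _ "1 :: real"] conjI exI[of _ "%x. nY (K x)"] ballI)
	fix x assume x: "x : pY"
	then show "1 * nY x <= nY ((id_op Y + K) x) + nY (K x)"
		using nrm_diff[of "x + K x" "K x"] bop_in[OF compact_opsD[OF K]] by simp
qed (use K in \<open>auto simp: compact_ops_gauge\<close>)

lemma inverse_op:
	assumes T: "T : ops Y" and c: "c > 0" "!!x. x : pY ==> c * nY x <= nY (T x)"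
		and surj: "!!y. y : pY ==> EX x:pY. T x = y"
	obtains S where "S : ops Y" "!!x. x : pY ==> T (S x) = x" "!!x. x : pY ==> S (T x) = x"
proof -
	have inj: "x = x'" if "x : pY" "x' : pY" "T x = T x'" for x x'
	proof -
		have "c * nY (x - x') <= 0" using c(2)[of "x - x'"] that by (simp add: op_diff[OF T])
		then show ?thesis using nrm_mult_le_0[OF c(1), of "x - x'"] that by simp
	qed
	from surj obtain g where g: "!!y. y : pY ==> g y : pY" "!!y. y : pY ==> T (g y) = y" by metis
	have "zext Y g : ops Y"
	proof (rule ops_zextI[where c = "1 / c"])
		fix x y a assume x: "x : pY"
		show "g (a *C x) = a *C g x"
			by (rule inj) (use x g in \<open>auto simp: bop_scale[OF T]\<close>)
		show "nY (g x) <= 1 / c * nY x"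
			using c(1) c(2)[OF g(1)[OF x]] g(2)[OF x] by (simp add: field_simps)
		assume y: "y : pY"
		show "g (x + y) = g x + g y"
			by (rule inj) (use x y g in \<open>auto simp: bop_add[OF T]\<close>)
	qed (use g in auto)
	moreover have "zext Y g (T x) = x" if "x : pY" for x
		by (rule inj) (use that g bop_in[OF T] in auto)
	ultimately show ?thesis using that[of "zext Y g"] g by simp
qed

text \<open>An index argument without an index. Composition with \<open>B\<close> turns A + K into
  the identity plus a compact operator, bounded below and hence onto. A solution \<open>y\<close>
  for the right side \<open>K x\<close> makes \<open>B y - x\<close> a zero of A + K, so
  \<open>B y = x\<close> and \<open>y = A x = 0\<close>.\<close>

lemma right_inverse_injective:
	assumes A: "A : ops Y" and B: "B : ops Y" and AB: "!!x. x : pY ==> A (B x) = x"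
		and K: "K : compact_ops Y" and c: "c > 0" "!!x. x : pY ==> c * nY x <= nY (A x + K x)"
		and x: "x : pY" "A x = 0"
	shows "x = 0"
proof -
	note [simp] = bop_in[OF A] bop_in[OF B] bop_in[OF compact_opsD[OF K]]
	obtain a where a: "a > 0" "!!x. x : pY ==> nY (A x) <= a * nY x"
		using bop_bound[OF norm_space A] by blast
	have "c / a * nY y <= nY (y + (K o B) y)" if y: "y : pY" for y
	proof -
		have "nY y <= a * nY (B y)" using a(2)[of "B y"] AB[OF y] y by simp
		then have "c / a * nY y <= c / a * (a * nY (B y))" using a(1) c(1) by (intro mult_left_mono) auto
		also have "... = c * nY (B y)" using a(1) by simp
		also have "... <= nY (y + (K o B) y)" using c(2)[of "B y"] AB[OF y] y by simp
		finally show ?thesis .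
	qed
	moreover have "c / a > 0" using a c by simp
	moreover have "K x : pY" using x by simp
	ultimately obtain y where y: "y : pY" "y + (K o B) y = K x"
		using fredholm_alternative[OF compact_ops_comp_right[OF K B]] by metis
	have "A (B y - x) + K (B y - x) = 0"
		using x y AB[OF y(1)]
		by (simp add: op_diff[OF A] op_diff[OF compact_opsD[OF K]] add_diff_eq)
	then have "c * nY (B y - x) <= 0" using c(2)[of "B y - x"] x y by simp
	then have "B y = x" using nrm_mult_le_0[OF c(1), of "B y - x"] x y by simp
	then have "y = 0" using AB[OF y(1)] x(2) by simp
	then show ?thesis using \<open>B y = x\<close> bop_zero[OF B] by simp
qed

end

section \<open>Spaces with projections\<close>

text \<open>The diagonal sequence is a subsequence of the selection made for \<open>n\<close> only
  from index \<open>Suc n\<close> on, hence the shift and the stability of \<open>P n\<close> under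
  subsequences.\<close>

lemma diagonal_subsequence:
	fixes P :: "nat => (nat => nat) => bool"
	assumes ex: "!!n (s :: nat => nat). strict_mono s ==> EX r. strict_mono r & P n (s o r)"
		and stable: "!!n (r :: nat => nat) s. strict_mono r ==> P n s ==> P n (s o r)"
	obtains d where "strict_mono d" "!!n. P n (d o (+) (Suc n))"
proof -
	interpret subseqs P
		by unfold_locales (rule ex)
	show ?thesis
		using that[of diagseq] subseq_diagseq diagseq_holds[OF stable] by blast
qed

text \<open>The common frame for X, its dual and their sum, so that the calculus of K(Y, R) and L(Y,
  R) is developed once. The finite dimension of the entries enters through
  \<open>R_fin\<close>.\<close>

locale proj_space = banach_cn Y for Y :: "'a::complex_vector cnspace" +
	fixes R :: "nat => 'a => 'a"
	assumes R_ops: "R n : ops Y"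
		and R_R: "x : pts Y ==> R m (R n x) = R (min m n) x"
		and R_le: "x : pts Y ==> nrm Y (R n x) <= nrm Y x"
		and S_le: "x : pts Y ==> nrm Y (x - R n x) <= nrm Y x"
		and R_fin: "EX B. finite B & B \<subseteq> pts Y & R n ` pts Y \<subseteq> cspan B"
begin

abbreviation "KY == proj_compact_ops Y R"
abbreviation "LY == proj_ops Y R"

lemma R_in [simp]: "x : pY ==> R n x : pY"
	by (rule bop_in[OF R_ops])

lemma R_diff: "x : pY ==> y : pY ==> R n (x - y) = R n x - R n y"
	by (rule op_diff[OF R_ops])

lemmas R_add = bop_add[OF R_ops]
lemmas R_scale = bop_scale[OF R_ops]
lemmas R_zero [simp] = bop_zero[OF R_ops]

lemma R_tail: "x : pY ==> m <= n ==> R m (x - R n x) = 0"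
	by (simp add: R_diff R_R)

lemma tail_tail: "x : pY ==> m <= n ==> (x - R m x) - R n (x - R m x) = x - R n x"
	by (simp add: R_diff R_R min_absorb2)

lemma tail_mono: "x : pY ==> m <= n ==> nY (x - R n x) <= nY (x - R m x)"
	using S_le[of "x - R m x" n] tail_tail[of x m n] by simp

lemma tail_tail': "x : pY ==> m <= n ==> (x - R n x) - R m (x - R n x) = x - R n x"
	by (simp add: R_tail)

lemma tail_op: "id_op Y - R n : ops Y"
	by (intro ops_minus ops_id R_ops)

lemma pc_opsD: "K : KY ==> K : ops Y"
	by (simp add: proj_compact_ops_def)

lemma po_opsD: "A : LY ==> A : ops Y"
	by (simp add: proj_ops_def)

lemma pcD:
	assumes K: "K : KY" and e: "e > 0"
	obtains N where "!!n x. n >= N ==> x : pY ==> nY (K x - R n (K x)) <= e * nY x"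
		"!!n x. n >= N ==> x : pY ==> nY (K (x - R n x)) <= e * nY x"
proof -
	have Kop: "K : ops Y" using K by (rule pc_opsD)
	let ?a = "%n. op_norm Y Y ((id_op Y - R n) o K)" and ?b = "%n. op_norm Y Y (K o (id_op Y - R n))"
	have o: "(id_op Y - R n) o K : ops Y" "K o (id_op Y - R n) : ops Y" for n
		using ops_comp[OF tail_op Kop] ops_comp[OF Kop tail_op] by auto
	have "(%n. ?a n + ?b n) ----> 0" using K by (simp add: proj_compact_ops_def)
	from order_tendstoD(2)[OF this e] obtain N where N: "!!n. n >= N ==> ?a n + ?b n < e"
		by (auto simp: eventually_sequentially)
	show ?thesis
	proof (rule that)
		fix n x assume n: "n >= N" and x: "x : pY"
		have "?a n <= e" "?b n <= e"
			using N[OF n] opn_nonneg[OF o(1), of n] opn_nonneg[OF o(2), of n] by linarith+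
		then have "?a n * nY x <= e * nY x" "?b n * nY x <= e * nY x"
			using nrm_nonneg[OF x] by (auto intro: mult_right_mono)
		moreover have "nY (K x - R n (K x)) <= ?a n * nY x"
			using opn_bound[OF o(1) x, of n] bop_in[OF Kop x] by simp
		moreover have "nY (K (x - R n x)) <= ?b n * nY x"
			using opn_bound[OF o(2) x, of n] x by simp
		ultimately show "nY (K x - R n (K x)) <= e * nY x" "nY (K (x - R n x)) <= e * nY x"
			by linarith+
	qed
qed

text \<open>One index per \<open>e\<close> suffices: both norms can only decrease when the index
  grows, since tails of tails are tails and cutting is contractive.\<close>

lemma pcI:
	assumes K: "K : ops Y"
		and small: "!!e. e > 0 ==> EX n. ALL x:pY. nY (K x - R n (K x)) <= e * nY x &
			nY (K (x - R n x)) <= e * nY x"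
	shows "K : KY"
proof -
	let ?a = "%n. op_norm Y Y ((id_op Y - R n) o K)" and ?b = "%n. op_norm Y Y (K o (id_op Y - R n))"
	have o: "(id_op Y - R n) o K : ops Y" "K o (id_op Y - R n) : ops Y" for n
		using ops_comp[OF tail_op K] ops_comp[OF K tail_op] by auto
	have "(%n. ?a n + ?b n) ----> 0"
	proof (rule LIMSEQ_I)
		fix e :: real assume e: "e > 0"
		then obtain n where n: "!!x. x : pY ==> nY (K x - R n (K x)) <= e / 3 * nY x"
			"!!x. x : pY ==> nY (K (x - R n x)) <= e / 3 * nY x"
			using small[of "e / 3"] by auto
		have "norm (?a m + ?b m - 0) < e" if m: "m >= n" for m
		proof -
			have "?a m <= e / 3"
			proof (rule opn_le)
				fix x assume x: "x : pY"
				have "nY (((id_op Y - R m) o K) x) <= nY (K x - R n (K x))"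
					using tail_mono[OF bop_in[OF K x] m] bop_in[OF K x] by simp
				with n(1)[OF x] show "nY (((id_op Y - R m) o K) x) <= e / 3 * nY x" by linarith
			qed (use e in simp)
			moreover have "?b m <= e / 3"
			proof (rule opn_le)
				fix x assume x: "x : pY"
				have "nY (K (x - R m x)) <= e / 3 * nY (x - R m x)"
					using n(2)[of "x - R m x"] tail_tail'[OF x m] x by simp
				also have "... <= e / 3 * nY x" using S_le[OF x, of m] e by (intro mult_left_mono) auto
				finally show "nY ((K o (id_op Y - R m)) x) <= e / 3 * nY x" using x by simp
			qed (use e in simp)
			ultimately show ?thesis using e opn_nonneg[OF o(1), of m] opn_nonneg[OF o(2), of m] by simp
		qed
		then show "EX no. ALL n>=no. norm (?a n + ?b n - 0) < e" by blast
	qed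
	with K show ?thesis by (simp add: proj_compact_ops_def)
qed

lemma R_pc: "R j : KY"
proof (rule pcI[OF R_ops])
	fix e :: real assume "e > 0"
	then show "EX n. ALL x:pY. nY (R j x - R n (R j x)) <= e * nY x & nY (R j (x - R n x)) <= e * nY x"
		by (intro exI[of _ j]) (simp add: R_R R_diff)
qed

lemma poD:
	assumes A: "A : LY" and e: "e > 0"
	obtains N where "!!n x. n >= N ==> x : pY ==> nY (A (R j x) - R n (A (R j x))) <= e * nY x"
		"!!n x. n >= N ==> x : pY ==> nY (R j (A (x - R n x))) <= e * nY x"
proof -
	have "A o R j : KY" "R j o A : KY"
		using A R_pc by (auto simp: proj_ops_def)
	then obtain N N' where
		"!!n x. n >= N ==> x : pY ==> nY ((A o R j) x - R n ((A o R j) x)) <= e * nY x"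
		"!!n x. n >= N' ==> x : pY ==> nY ((R j o A) (x - R n x)) <= e * nY x"
		using pcD[OF _ e] by meson
	then show ?thesis by (intro that[of "max N N'"]) auto
qed

lemma poI:
	assumes A: "A : ops Y"
		and small: "!!j e. e > 0 ==> EX n. ALL x:pY. nY (A (R j x) - R n (A (R j x))) <= e * nY x"
			"!!j e. e > 0 ==> EX n. ALL x:pY. nY (R j (A (x - R n x))) <= e * nY x"
	shows "A : LY"
	unfolding proj_ops_def
proof (intro CollectI conjI ballI A)
	fix K assume K: "K : KY"
	note Kop = pc_opsD[OF K]
	note [simp] = bop_in[OF A] bop_in[OF Kop]
	obtain a where a: "a > 0" "!!x. x : pY ==> nY (A x) <= a * nY x"
		using bop_bound[OF norm_space A] by blast
	obtain k where k: "k > 0" "!!x. x : pY ==> nY (K x) <= k * nY x"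
		using bop_bound[OF norm_space Kop] by blast
	show "A o K : KY"
	proof (rule pcI[OF ops_comp[OF A Kop]])
		fix e :: real assume e: "e > 0"
		have e1: "e / (2 * a) > 0" "e / (2 * k) > 0" using e a k by auto
		obtain j where j: "!!n x. n >= j ==> x : pY ==> nY (K x - R n (K x)) <= e / (2 * a) * nY x"
			"!!n x. n >= j ==> x : pY ==> nY (K (x - R n x)) <= e / (2 * a) * nY x"
			using pcD[OF K e1(1)] by blast
		obtain n0 where n0: "!!x. x : pY ==> nY (A (R j x) - R n0 (A (R j x))) <= e / (2 * k) * nY x"
			using small(1)[OF e1(2)] by blast
		define n where "n = max j n0"
		have "nY (A (K x) - R n (A (K x))) <= e * nY x & nY (A (K (x - R n x))) <= e * nY x"
			if x: "x : pY" for x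
		proof
			have "nY (A (R j (K x)) - R n (A (R j (K x)))) <= nY (A (R j (K x)) - R n0 (A (R j (K x))))"
				using x by (intro tail_mono) (auto simp: n_def)
			also have "... <= e / (2 * k) * nY (K x)" using n0[of "K x"] x by simp
			also have "... <= e / (2 * k) * (k * nY x)" using k(2)[OF x] e1 by (intro mult_left_mono) auto
			finally have 1: "nY (A (R j (K x)) - R n (A (R j (K x)))) <= e / 2 * nY x"
				using k(1) by simp
			let ?w = "A (K x - R j (K x))"
			have "nY (?w - R n ?w) <= nY ?w" using x by (intro S_le) auto
			also have "... <= a * nY (K x - R j (K x))" using a(2) x by simp
			also have "... <= a * (e / (2 * a) * nY x)" using j(1)[of j x] x a(1) by (intro mult_left_mono) auto
			finally have 2: "nY (?w - R n ?w) <= e / 2 * nY x" using a(1) by simp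
			have "A (K x) = A (R j (K x)) + ?w" using x by (simp add: op_diff[OF A])
			then have "A (K x) - R n (A (K x)) = (A (R j (K x)) - R n (A (R j (K x)))) + (?w - R n ?w)"
				using x by (simp add: R_add)
			then have "nY (A (K x) - R n (A (K x)))
					<= nY (A (R j (K x)) - R n (A (R j (K x)))) + nY (?w - R n ?w)"
				using x by (simp only:) (intro nrm_add; simp)
			with 1 2 show "nY (A (K x) - R n (A (K x))) <= e * nY x" by (simp add: field_simps)
			have "nY (A (K (x - R n x))) <= a * nY (K (x - R n x))" using a(2) x by simp
			also have "... <= a * (e / (2 * a) * nY x)" using j(2)[of n x] x a(1)
				by (intro mult_left_mono) (auto simp: n_def)
			also have "... <= e * nY x" using a(1) e x by simp
			finally show "nY (A (K (x - R n x))) <= e * nY x" .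
		qed
		then show "EX n. ALL x:pY. nY ((A o K) x - R n ((A o K) x)) <= e * nY x &
				nY ((A o K) (x - R n x)) <= e * nY x"
			by (intro exI[of _ n]) simp
	qed
	show "K o A : KY"
	proof (rule pcI[OF ops_comp[OF Kop A]])
		fix e :: real assume e: "e > 0"
		have e1: "e / (2 * a) > 0" "e / (2 * k) > 0" using e a k by auto
		obtain j where j: "!!n x. n >= j ==> x : pY ==> nY (K x - R n (K x)) <= e / (2 * a) * nY x"
			"!!n x. n >= j ==> x : pY ==> nY (K (x - R n x)) <= e / (2 * a) * nY x"
			using pcD[OF K e1(1)] by blast
		obtain n0 where n0: "!!x. x : pY ==> nY (R j (A (x - R n0 x))) <= e / (2 * k) * nY x"
			using small(2)[OF e1(2)] by blast
		define n where "n = max j n0"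
		have "nY (K (A x) - R n (K (A x))) <= e * nY x & nY (K (A (x - R n x))) <= e * nY x"
			if x: "x : pY" for x
		proof
			have "nY (K (A x) - R n (K (A x))) <= e / (2 * a) * nY (A x)"
				using j(1)[of n "A x"] x by (simp add: n_def)
			also have "... <= e / (2 * a) * (a * nY x)" using a(2)[OF x] e1 by (intro mult_left_mono) auto
			also have "... <= e * nY x" using a(1) e x by simp
			finally show "nY (K (A x) - R n (K (A x))) <= e * nY x" .
			let ?y = "x - R n x"
			have y: "?y : pY" "nY ?y <= nY x" using x S_le by auto
			have "?y - R n0 ?y = ?y" using x by (simp add: R_tail n_def)
			then have "nY (R j (A ?y)) <= e / (2 * k) * nY ?y" using n0[OF y(1)] by simp
			also have "... <= e / (2 * k) * nY x" using y(2) e1 by (intro mult_left_mono) auto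
			finally have "k * nY (R j (A ?y)) <= e / 2 * nY x" using k(1) by (simp add: field_simps)
			then have 1: "nY (K (R j (A ?y))) <= e / 2 * nY x" using k(2)[of "R j (A ?y)"] y by simp
			have "nY (K (A ?y - R j (A ?y))) <= e / (2 * a) * nY (A ?y)" using j(2)[of j "A ?y"] y by simp
			also have "... <= e / (2 * a) * (a * nY x)"
			proof (rule mult_left_mono)
				have "a * nY ?y <= a * nY x" using y(2) a(1) by (intro mult_left_mono) auto
				then show "nY (A ?y) <= a * nY x" using a(2)[OF y(1)] by linarith
			qed (use e1 in simp)
			finally have 2: "nY (K (A ?y - R j (A ?y))) <= e / 2 * nY x" using a(1) by simp
			have "K (A ?y) = K (R j (A ?y)) + K (A ?y - R j (A ?y))" using y(1) by (simp add: op_diff[OF Kop])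
			then have "nY (K (A ?y)) <= nY (K (R j (A ?y))) + nY (K (A ?y - R j (A ?y)))"
				using y(1) by (simp only:) (intro nrm_add; simp)
			with 1 2 show "nY (K (A (x - R n x))) <= e * nY x" by (simp add: field_simps)
		qed
		then show "EX n. ALL x:pY. nY ((K o A) x - R n ((K o A) x)) <= e * nY x &
				nY ((K o A) (x - R n x)) <= e * nY x"
			by (intro exI[of _ n]) simp
	qed
qed

lemma po_pc: "A : LY ==> K : KY ==> A o K : KY"
	and pc_po: "A : LY ==> K : KY ==> K o A : KY"
	by (auto simp: proj_ops_def)

lemma pc_plus:
	assumes K: "K : KY" "L : KY"
	shows "K + L : KY"
proof (rule pcI)
	note o = pc_opsD[OF K(1)] pc_opsD[OF K(2)]
	note [simp] = bop_in[OF o(1)] bop_in[OF o(2)]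
	show "K + L : ops Y" using o by (rule ops_plus)
	fix e :: real assume "e > 0"
	then have e: "e / 2 > 0" by simp
	obtain N where N: "!!n x. n >= N ==> x : pY ==> nY (K x - R n (K x)) <= e / 2 * nY x"
			"!!n x. n >= N ==> x : pY ==> nY (K (x - R n x)) <= e / 2 * nY x"
		using pcD[OF K(1) e] by blast
	obtain N' where N': "!!n x. n >= N' ==> x : pY ==> nY (L x - R n (L x)) <= e / 2 * nY x"
			"!!n x. n >= N' ==> x : pY ==> nY (L (x - R n x)) <= e / 2 * nY x"
		using pcD[OF K(2) e] by blast
	define n where "n = max N N'"
	have "nY ((K + L) x - R n ((K + L) x)) <= e * nY x & nY ((K + L) (x - R n x)) <= e * nY x"
		if x: "x : pY" for x
	proof
		have "(K + L) x - R n ((K + L) x) = (K x - R n (K x)) + (L x - R n (L x))"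
			using x by (simp add: R_add)
		then have "nY ((K + L) x - R n ((K + L) x)) <= nY (K x - R n (K x)) + nY (L x - R n (L x))"
			using x by (simp only:) (intro nrm_add; simp)
		then show "nY ((K + L) x - R n ((K + L) x)) <= e * nY x"
			using N(1)[of n x] N'(1)[of n x] x by (simp add: n_def field_simps)
		have "nY ((K + L) (x - R n x)) <= nY (K (x - R n x)) + nY (L (x - R n x))"
			using x by (simp add: nrm_add)
		then show "nY ((K + L) (x - R n x)) <= e * nY x"
			using N(2)[of n x] N'(2)[of n x] x by (simp add: n_def field_simps)
	qed
	then show "EX n. ALL x:pY. nY ((K + L) x - R n ((K + L) x)) <= e * nY x &
			nY ((K + L) (x - R n x)) <= e * nY x" by blast
qed

lemma po_id: "id_op Y : LY"
proof (rule poI[OF ops_id])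
	fix j and e :: real assume "e > 0"
	then show "EX n. ALL x:pY. nY (id_op Y (R j x) - R n (id_op Y (R j x))) <= e * nY x"
		"EX n. ALL x:pY. nY (R j (id_op Y (x - R n x))) <= e * nY x"
		by (intro exI[of _ j]; simp add: R_R R_diff)+
qed

lemma pc_subset_po: "K : KY ==> K : LY"
proof (rule poI)
	assume K: "K : KY"
	show o: "K : ops Y" using K by (rule pc_opsD)
	note [simp] = bop_in[OF o]
	fix j and e :: real assume e: "e > 0"
	obtain N where N: "!!n x. n >= N ==> x : pY ==> nY (K x - R n (K x)) <= e * nY x"
			"!!n x. n >= N ==> x : pY ==> nY (K (x - R n x)) <= e * nY x"
		using pcD[OF K e] by blast
	have "nY (K (R j x) - R N (K (R j x))) <= e * nY x" if x: "x : pY" for x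
	proof -
		have "e * nY (R j x) <= e * nY x" using R_le[OF x, of j] e by (intro mult_left_mono) auto
		then show ?thesis using N(1)[of N "R j x"] x by simp
	qed
	then show "EX n. ALL x:pY. nY (K (R j x) - R n (K (R j x))) <= e * nY x" by blast
	have "nY (R j (K (x - R N x))) <= e * nY x" if x: "x : pY" for x
		using N(2)[of N x] R_le[of "K (x - R N x)" j] x by simp
	then show "EX n. ALL x:pY. nY (R j (K (x - R n x))) <= e * nY x" by blast
qed

lemma po_comp:
	assumes "A : LY" "B : LY"
	shows "A o B : LY"
	unfolding proj_ops_def
proof (intro CollectI conjI ballI)
	show "A o B : ops Y" using assms by (intro ops_comp po_opsD)
	fix K assume K: "K : KY"
	show "A o B o K : KY"
		using po_pc[OF assms(1) po_pc[OF assms(2) K]] by (simp add: comp_assoc)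
	show "K o (A o B) : KY"
		using pc_po[OF assms(2) pc_po[OF assms(1) K]] by (simp add: comp_assoc)
qed

lemma po_plus:
	assumes "A : LY" "B : LY"
	shows "A + B : LY"
	unfolding proj_ops_def
proof (intro CollectI conjI ballI)
	show "A + B : ops Y" using assms by (intro ops_plus po_opsD)
	fix K assume K: "K : KY"
	have "(A + B) o K = (A o K) + (B o K)" by auto
	then show "(A + B) o K : KY"
		using pc_plus po_pc assms K by simp
	have "K o (A + B) = (K o A) + (K o B)"
		by (rule bop_eqI[OF ops_comp[OF pc_opsD[OF K] ops_plus] ops_plus[OF ops_comp ops_comp]])
			(use assms K in \<open>auto simp: po_opsD pc_opsD bop_add[OF pc_opsD[OF K]] bop_in[OF po_opsD]\<close>)
	then show "K o (A + B) : KY"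
		using pc_plus pc_po assms K by simp
qed

lemma po_cscale:
	assumes "A : LY" shows "a *C A : LY"
proof -
	have "a *C id_op Y : LY"
	proof (rule poI[OF ops_cscale[OF ops_id]])
		fix j and e :: real assume "e > 0"
		then show "EX n. ALL x:pY. nY ((a *C id_op Y) (R j x) - R n ((a *C id_op Y) (R j x))) <= e * nY x"
			"EX n. ALL x:pY. nY (R j ((a *C id_op Y) (x - R n x))) <= e * nY x"
			by (intro exI[of _ j]; simp add: R_R R_diff R_scale scaleC_fun_def)+
	qed
	moreover have "a *C A = (a *C id_op Y) o A"
		by (rule bop_eqI[OF ops_cscale[OF po_opsD[OF assms]] ops_comp[OF ops_cscale[OF ops_id] po_opsD[OF assms]]])
			(simp add: scaleC_fun_def bop_in[OF po_opsD[OF assms]])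
	ultimately show ?thesis using po_comp assms by simp
qed

lemma pc_cscale:
	assumes "K : KY" shows "a *C K : KY"
proof -
	have o: "K : ops Y" using assms by (rule pc_opsD)
	have "a *C K = (a *C id_op Y) o K"
		by (rule bop_eqI[OF ops_cscale[OF o] ops_comp[OF ops_cscale[OF ops_id] o]])
			(simp add: scaleC_fun_def bop_in[OF o])
	then show ?thesis using po_pc[OF po_cscale[OF po_id] assms] by simp
qed

lemma pc_neg: "K : KY ==> - K : KY"
	using pc_cscale[of K "-1"] by (simp add: scaleC_fun_def fun_Compl_def)

lemma pc_minus: "K : KY ==> L : KY ==> K - L : KY"
	using pc_plus[of K "- L"] pc_neg[of L] by simp

lemma pc_zero: "0 : KY"
	using pc_minus[OF R_pc[of 0] R_pc[of 0]] by simp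

lemma po_neg: "A : LY ==> - A : LY"
	using po_cscale[of A "-1"] by (simp add: scaleC_fun_def fun_Compl_def)

lemma po_minus: "A : LY ==> B : LY ==> A - B : LY"
	using po_plus[of A "- B"] po_neg[of B] by simp

lemma gauge_R: "compact_gauge Y (%x. nY (R n x))"
proof -
	obtain B where "finite B" "B \<subseteq> pY" "R n ` pY \<subseteq> cspan B" using R_fin by blast
	then show ?thesis by (intro compact_gauge_finite_rank[OF norm_space R_ops, of B]) auto
qed

lemma gauge_R_comp: "T : ops Y ==> compact_gauge Y (%x. nY (R n (T x)))"
	by (rule compact_gauge_comp[OF norm_space gauge_R])

text \<open>\<open>R n o K\<close> has finite rank and tends to \<open>K\<close> in norm. A diagonal
  sequence makes all the finite rank parts Cauchy at once, and the remainder is uniformly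
  small.\<close>

lemma pc_compact:
	assumes K: "K : KY"
	shows "K : compact_ops Y"
proof -
	have o: "K : ops Y" using K by (rule pc_opsD)
	note [simp] = bop_in[OF o]
	have "compact_gauge Y (%x. nY (K x))"
		unfolding compact_gauge_def
	proof (intro allI impI)
		fix x :: "nat => 'a" and M assume x: "ALL n. x n : pY & nY (x n) <= M"
		define P where "P = (%n (s :: nat => nat). ALL e>0. EX N. ALL i>=N. ALL j>=N.
				nY (R n (K (x (s i) - x (s j)))) < (e::real))"
		have "EX r. strict_mono r & P n (s o r)" if "strict_mono s" for n and s :: "nat => nat"
		proof -
			obtain r :: "nat => nat" where "strict_mono r"
				"!!e. e > 0 ==> EX N. ALL i>=N. ALL j>=N. nY (R n (K (x (s (r i)) - x (s (r j))))) < e"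
				using compact_gaugeD[OF gauge_R_comp[OF o, of n], of "%i. x (s i)" M] x by blast
			then show ?thesis unfolding P_def by (intro exI[of _ r]) simp
		qed
		moreover have "P n (s o r)" if r: "strict_mono r" and P: "P n s" for n and r s :: "nat => nat"
			unfolding P_def
		proof (intro allI impI)
			fix e :: real assume "e > 0"
			with P obtain N where N: "ALL i>=N. ALL j>=N. nY (R n (K (x (s i) - x (s j)))) < e"
				unfolding P_def by blast
			have "nY (R n (K (x (s (r i)) - x (s (r j))))) < e" if "i >= N" "j >= N" for i j
				using N that seq_suble[OF r, of i] seq_suble[OF r, of j] by simp
			then show "EX N. ALL i>=N. ALL j>=N. nY (R n (K (x ((s o r) i) - x ((s o r) j)))) < e"
				by (intro exI[of _ N]) simp
		qed
		ultimately obtain d where d: "strict_mono d" "!!n. P n (d o (+) (Suc n))"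
			using diagonal_subsequence[of P] by blast
		have "EX N. ALL i>=N. ALL j>=N. nY (K (x (d i) - x (d j))) < e" if e: "e > 0" for e
		proof -
			define t where "t = 2 * (\<bar>M\<bar> + 1)"
			have t: "t > 0" by (simp add: t_def)
			have et: "e / (2 * t) > 0" using e t by simp
			obtain n where n: "!!m y. m >= n ==> y : pY ==> nY (K y - R m (K y)) <= e / (2 * t) * nY y"
				"!!m y. m >= n ==> y : pY ==> nY (K (y - R m y)) <= e / (2 * t) * nY y"
				using pcD[OF K et] by blast
			obtain N where N: "!!i j. i >= N ==> j >= N ==> nY (R n (K (x (d (Suc n + i)) - x (d (Suc n + j))))) < e / 2"
				using d(2)[of n, unfolded P_def, rule_format, OF half_gt_zero[OF e]] unfolding o_def by blast
			have "nY (K (x (d i) - x (d j))) < e" if ij: "i >= Suc n + N" "j >= Suc n + N" for i j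
			proof -
				let ?y = "x (d i) - x (d j)"
				have y: "?y : pY" using x by simp
				have "nY ?y <= nY (x (d i)) + nY (x (d j))" using x by (intro nrm_diff) auto
				also have "... <= t" using conjunct2[OF x[rule_format, of "d i"]] conjunct2[OF x[rule_format, of "d j"]]
					abs_ge_self[of M] unfolding t_def by (simp add: algebra_simps)
				finally have "e / (2 * t) * nY ?y <= e / (2 * t) * t" using e t by (intro mult_left_mono) auto
				moreover have "e / (2 * t) * t = e / 2" using t by simp
				ultimately have 1: "nY (K ?y - R n (K ?y)) <= e / 2"
					using n(1)[OF order_refl y] by linarith
				have 2: "nY (R n (K ?y)) < e / 2"
					using N[of "i - Suc n" "j - Suc n"] ij by simp
				show ?thesis using nrm_triangle2[of "K ?y" "R n (K ?y)"] 1 2 y by simp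
			qed
			then show ?thesis by blast
		qed
		then show "EX r :: nat => nat. strict_mono r &
				(ALL e>0. EX N. ALL i>=N. ALL j>=N. nY (K (x (r i) - x (r j))) < e)" using d(1) by blast
	qed
	with o show ?thesis by (simp add: compact_ops_gauge)
qed

subsection \<open>Invertible perturbations\<close>

text \<open>
  If \<open>(I + K + s R\<^sub>n) v\<^sub>s = 0\<close> with \<open>v\<^sub>s \<noteq> 0\<close> for several \<open>s\<close>, then the vectors \<open>R\<^sub>n v\<^sub>s\<close> are
  independent by the argument for eigenvectors, so only finitely many \<open>s\<close> are exceptional.
\<close>

lemma injective_perturbation:
	assumes K: "K : ops Y" and n: "!!x. x : pY ==> nY (K x - R n (K x)) <= 1 / 2 * nY x"
		and dl: "dl > 0"
	obtains s :: real where "0 < s" "s < dl"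
		"!!v. v : pY ==> v + K v + complex_of_real s *C R n v = 0 ==> v = 0"
proof (rule ccontr)
	note witness = that
	assume nt: "~ thesis"
	have "EX v:pY. v + K v + complex_of_real s *C R n v = 0 & v ~= 0" if s: "0 < s" "s < dl" for s
		using nt witness[OF s] by blast
	then obtain v where v: "!!s. 0 < s ==> s < dl ==> v s : pY"
		"!!s. 0 < s ==> s < dl ==> v s + K (v s) + complex_of_real s *C R n (v s) = 0"
		"!!s. 0 < s ==> s < dl ==> v s ~= 0" by metis
	note [simp] = bop_in[OF K]
	\<comment> \<open>Off the image of \<open>R n\<close> the operator is within 1 / 2 of the identity,
	  so a nonzero solution cannot be annihilated by \<open>R n\<close>.\<close>
	have inj: "w = 0" if w: "w : pY" "(w - R n w) + (K w - R n (K w)) = 0" "R n w = 0" for w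
	proof -
		have "w = - (K w - R n (K w))" using w(2,3) by (simp add: add_eq_0_iff2)
		then have "nY w = nY (K w - R n (K w))" using w(1) nrm_uminus[of "K w - R n (K w)"] by simp
		with n[OF w(1)] have "1 / 2 * nY w <= 0" by simp
		then show ?thesis using nrm_mult_le_0[of "1 / 2" w] w(1) by simp
	qed
	have zero: "c s = 0" if "finite S" "S \<subseteq> {0<..<dl}" "(SUM s:S. c s *C R n (v s)) = 0" "s : S" for S c s
		using that
	proof (induction S arbitrary: c s)
		case (insert s0 S)
		have vin: "v s : pY" if "s : insert s0 S" for s using insert.prems(1) that v(1) by auto
		define w where "w = (SUM s:insert s0 S. c s *C v s)"
		have win: "w : pY" unfolding w_def by (intro sum_in scale_in vin)
		have Rw: "R n w = 0"
			using insert.prems(2) vin unfolding w_def by (subst op_sum[OF R_ops]) (auto simp: R_scale)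
		have Kw: "K w = (SUM s:insert s0 S. c s *C K (v s))"
			unfolding w_def using vin by (subst op_sum[OF K]) (auto simp: bop_scale[OF K])
		have e: "v s + K (v s) = - (complex_of_real s *C R n (v s))" if "s : insert s0 S" for s
		proof -
			have "0 < s" "s < dl" using insert.prems(1) that by auto
			from v(2)[OF this] show ?thesis by (simp add: eq_neg_iff_add_eq_0)
		qed
		have wK: "w + K w = - (SUM s:insert s0 S. (c s * complex_of_real s) *C R n (v s))"
		proof -
			have "w + K w = (SUM s:insert s0 S. c s *C (v s + K (v s)))"
				unfolding Kw by (simp only: w_def sum.distrib cscale_right_distrib)
			also have "... = (SUM s:insert s0 S. - ((c s * complex_of_real s) *C R n (v s)))"
				by (rule sum.cong) (simp_all add: e del: insert_iff)
			finally show ?thesis by (simp only: sum_negf)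
		qed
		have "R n (w + K w) = w + K w"
			unfolding wK using vin
			by (simp only: bop_uminus[OF R_ops] sum_in scale_in R_in vin, subst op_sum[OF R_ops])
				(auto simp: R_scale R_R)
		moreover have "(w - R n w) + (K w - R n (K w)) = (w + K w) - R n (w + K w)"
			using win by (simp add: R_add)
		ultimately have "(w - R n w) + (K w - R n (K w)) = 0" by simp
		then have "w = 0" using inj win Rw by blast
		then have "(SUM s:insert s0 S. (c s * complex_of_real s) *C R n (v s)) = 0"
			using wK bop_zero[OF K] by simp
		\<comment> \<open>As for eigenvectors, subtracting \<open>s0\<close> times the relation from the
		  relation weighted by \<open>s\<close> removes the term of \<open>s0\<close>.\<close>
		then have "(SUM s:insert s0 S. (c s * complex_of_real s) *C R n (v s))
				- complex_of_real s0 *C (SUM s:insert s0 S. c s *C R n (v s)) = 0"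
			using insert.prems(2) by simp
		then have "(SUM s:insert s0 S. (c s * complex_of_real (s - s0)) *C R n (v s)) = 0"
			by (simp only: complex_vector.scale_sum_right sum_subtractf[symmetric]
					complex_vector.scale_scale complex_vector.scale_left_diff_distrib[symmetric])
				(simp add: algebra_simps)
		then have "(SUM s:S. (c s * complex_of_real (s - s0)) *C R n (v s)) = 0"
			using insert.hyps by simp
		then have cS: "c s = 0" if "s : S" for s
			using insert.IH[of "%s. c s * complex_of_real (s - s0)" s] insert.prems(1) insert.hyps that by auto
		then have "c s0 *C R n (v s0) = 0" using insert.prems(2) insert.hyps by simp
		moreover have "R n (v s0) ~= 0"
		proof
			assume r0: "R n (v s0) = 0"
			have "v s0 + K (v s0) = 0" using e[of s0] r0 by simp
			moreover have "(v s0 - R n (v s0)) + (K (v s0) - R n (K (v s0)))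
					= (v s0 + K (v s0)) - R n (v s0 + K (v s0))"
				using vin[of s0] by (simp add: R_add)
			ultimately have "(v s0 - R n (v s0)) + (K (v s0) - R n (K (v s0))) = 0" by simp
			then have "v s0 = 0" using inj vin r0 by blast
			then show False using v(3)[of s0] insert.prems(1) by simp
		qed
		ultimately show ?case using cS insert.prems(3) by auto
	qed simp
	obtain B where B: "finite B" "B \<subseteq> pY" "R n ` pY \<subseteq> cspan B" using R_fin by blast
	\<comment> \<open>One exceptional value more than there are generators of the image of
	  \<open>R n\<close> contradicts the bound on independent vectors.\<close>
	have "infinite {0<..<dl}" using dl by simp
	then obtain S where S: "finite S" "card S = Suc (card B)" "S \<subseteq> {0<..<dl}"
		by (meson infinite_arbitrarily_large)
	have vin: "v s : pY" if "s : S" for s using that S(3) v(1) by auto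
	have inj_on: "inj_on (%s. R n (v s)) S"
	proof (rule inj_onI, rule ccontr)
		fix s t assume st: "s : S" "t : S" "R n (v s) = R n (v t)" "s ~= t"
		have "(SUM u:{s, t}. (if u = s then 1 else - 1) *C R n (v u)) = 0"
			using st by (simp add: complex_vector.scale_minus_left)
		moreover have "{s, t} \<subseteq> {0<..<dl}" using st(1,2) S(3) by blast
		ultimately show False using zero[of "{s, t}" "%u. if u = s then 1 else - 1" s] by simp
	qed
	have "cindependent ((%s. R n (v s)) ` S)"
	proof (rule complex_vector.independent_if_scalars_zero)
		fix f x assume f: "(SUM x:(%s. R n (v s)) ` S. f x *C x) = 0" and x: "x : (%s. R n (v s)) ` S"
		then obtain s where s: "s : S" "x = R n (v s)" by blast
		have "(SUM s:S. f (R n (v s)) *C R n (v s)) = 0" using f by (simp add: sum.reindex[OF inj_on])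
		then show "f x = 0" using zero[OF S(1,3), of "%s. f (R n (v s))" s] s by simp
	qed (use S in simp)
	moreover have "(%s. R n (v s)) ` S \<subseteq> cspan B" using B(3) vin by blast
	ultimately have "card ((%s. R n (v s)) ` S) <= card B"
		using cindependent_span_bound[OF B(1)] by blast
	then show False using S(2) card_image[OF inj_on] by simp
qed

text \<open>A small multiple of \<open>R n\<close> removes the kernel, and the Fredholm alternative
  gives surjectivity. The inverse satisfies S - I = - (K + F) S and S - I = - S (K + F), one formula
  for each half of membership in K(Y, R).\<close>

lemma invertible_perturbation:
	assumes K: "K : KY" and dl: "dl > 0"
	obtains F S where "F : KY" "!!x. x : pY ==> nY (F x) <= dl * nY x"
		"S - id_op Y : KY" "S : ops Y"
		"!!x. x : pY ==> S x + K (S x) + F (S x) = x" "!!x. x : pY ==> S (x + K x + F x) = x"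
proof -
	have Kop: "K : ops Y" using K by (rule pc_opsD)
	obtain n where n: "!!m x. m >= n ==> x : pY ==> nY (K x - R m (K x)) <= 1 / 2 * nY x"
		using pcD[OF K, of "1 / 2"] by (metis half_gt_zero_iff zero_less_one)
	obtain s :: real where s: "0 < s" "s < dl"
		"!!v. v : pY ==> v + K v + complex_of_real s *C R n v = 0 ==> v = 0"
		using injective_perturbation[OF Kop n[OF order_refl] dl] by blast
	define F where "F = complex_of_real s *C R n"
	have Fx: "F x = complex_of_real s *C R n x" for x by (simp add: F_def scaleC_fun_def)
	have F: "F : KY" unfolding F_def by (intro pc_cscale R_pc)
	have KF: "K + F : KY" using K F by (rule pc_plus)
	note c = pc_compact[OF KF]
	let ?T = "id_op Y + (K + F)"
	have T: "?T : ops Y" by (intro ops_plus ops_id pc_opsD[OF KF])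
	have Tx: "?T x = x + K x + F x" if "x : pY" for x using that by (simp add: algebra_simps)
	obtain c' where c': "c' > 0" "!!x. x : pY ==> c' * nY x <= nY (?T x)"
		using ess_below_bounded_below[OF ess_below_id_compact[OF c] T closed_subspace_pts] s(3)
		by (metis Fx Tx)
	have "EX x:pY. ?T x = y" if "y : pY" for y
		using fredholm_alternative[OF c c'(1) _ that] c'(2) by (metis id_op_in plus_fun_apply)
	then obtain S where S: "S : ops Y" "!!x. x : pY ==> ?T (S x) = x" "!!x. x : pY ==> S (?T x) = x"
		using inverse_op[OF T c'] by blast
	note [simp] = bop_in[OF S(1)] bop_in[OF pc_opsD[OF KF]]
	have SI: "S - id_op Y : ops Y" by (intro ops_minus S(1) ops_id)
	have S1: "(S - id_op Y) x = - (K + F) (S x)" if "x : pY" for x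
		using S(2)[OF that] that by (simp add: algebra_simps)
	have S2: "(S - id_op Y) x = - S ((K + F) x)" if "x : pY" for x
		using S(3)[OF that] that bop_add[OF S(1) that, of "(K + F) x"] bop_in[OF pc_opsD[OF KF] that]
		by (simp add: eq_neg_iff_add_eq_0 algebra_simps)
	obtain a where a: "a > 0" "!!x. x : pY ==> nY (S x) <= a * nY x"
		using bop_bound[OF norm_space S(1)] by blast
	have "S - id_op Y : KY"
	proof (rule pcI[OF SI])
		fix e :: real assume e: "e > 0"
		then have ea: "e / a > 0" using a by simp
		obtain N where N: "!!m x. m >= N ==> x : pY ==> nY ((K + F) x - R m ((K + F) x)) <= e / a * nY x"
			"!!m x. m >= N ==> x : pY ==> nY ((K + F) (x - R m x)) <= e / a * nY x"
			using pcD[OF KF ea] by blast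
		have "nY ((S - id_op Y) x - R N ((S - id_op Y) x)) <= e * nY x &
				nY ((S - id_op Y) (x - R N x)) <= e * nY x" if x: "x : pY" for x
		proof
			let ?u = "(K + F) (S x)"
			have u: "?u : pY" using x bop_in[OF pc_opsD[OF KF], of "S x"] by (simp del: plus_fun_apply)
			have "(S - id_op Y) x - R N ((S - id_op Y) x) = - (?u - R N ?u)"
				unfolding S1[OF x] using u by (simp add: bop_uminus[OF R_ops] del: plus_fun_apply)
			then have "nY ((S - id_op Y) x - R N ((S - id_op Y) x)) = nY (?u - R N ?u)"
				using u nrm_uminus[of "?u - R N ?u"] by (simp del: plus_fun_apply)
			also have "... <= e / a * nY (S x)" using N(1)[OF order_refl, of "S x"] x by simp
			also have "... <= e / a * (a * nY x)" using a(2)[OF x] ea by (intro mult_left_mono) auto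
			finally show "nY ((S - id_op Y) x - R N ((S - id_op Y) x)) <= e * nY x" using a(1) by simp
			let ?w = "(K + F) (x - R N x)"
			have w: "?w : pY" using x bop_in[OF pc_opsD[OF KF], of "x - R N x"] by (simp del: plus_fun_apply)
			have "nY ((S - id_op Y) (x - R N x)) = nY (S ?w)"
				unfolding S2[OF diff_in[OF x R_in[OF x]]] using w by (intro nrm_uminus bop_in[OF S(1)])
			also have "... <= a * nY ?w" by (rule a(2)[OF w])
			also have "... <= a * (e / a * nY x)" using N(2)[OF order_refl x] a(1) by (intro mult_left_mono) auto
			finally show "nY ((S - id_op Y) (x - R N x)) <= e * nY x" using a(1) by simp
		qed
		then show "EX n. ALL x:pY. nY ((S - id_op Y) x - R n ((S - id_op Y) x)) <= e * nY x &
				nY ((S - id_op Y) (x - R n x)) <= e * nY x" by blast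
	qed
	show ?thesis
	proof (rule that[OF F _ \<open>S - id_op Y : KY\<close> S(1)])
		fix x assume x: "x : pY"
		have "nY (F x) = s * nY (R n x)" using x s(1) by (simp add: Fx nrm_scale)
		also have "... <= dl * nY x" using s x R_le[OF x] by (intro mult_mono) auto
		finally show "nY (F x) <= dl * nY x" .
		show "S x + K (S x) + F (S x) = x" using S(2)[OF x] Tx[of "S x"] x by simp
		show "S (x + K x + F x) = x" using S(3)[OF x] unfolding Tx[OF x] .
	qed
qed

text \<open>With L = C (A + F) - I one has C = (I + L) G. Perturbing I + L by a small F' into an
  operator with inverse S makes D = C + F' G invertible: its inverse is (A + F) S, which is A plus
  an element of K(Y, R), while D exceeds C in norm by at most \<open>eps\<close>.\<close>

lemma inverse_with_norm:
	assumes A: "A : LY" and F: "F : KY"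
		and G: "G : ops Y" "!!x. x : pY ==> A (G x) + F (G x) = x" "!!x. x : pY ==> G (A x + F x) = x"
		and C: "C : LY" "(C o A) - id_op Y : KY"
		and gam: "!!x. x : pY ==> nY (C x) <= gam * nY x" and eps: "eps > 0"
	obtains K D where "K : KY" "D : ops Y"
		"!!x. x : pY ==> A (D x) + K (D x) = x" "!!x. x : pY ==> D (A x + K x) = x"
		"!!x. x : pY ==> nY (D x) <= (gam + eps) * nY x"
proof -
	have Aop: "A : ops Y" and Fop: "F : ops Y" and Cop: "C : ops Y"
		using A F C by (auto intro: po_opsD pc_opsD)
	define L where "L = ((C o A) - id_op Y) + (C o F)"
	have L: "L : KY" unfolding L_def using C F by (intro pc_plus po_pc)
	note [simp] = bop_in[OF Aop] bop_in[OF Fop] bop_in[OF Cop] bop_in[OF G(1)] bop_in[OF pc_opsD[OF L]]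
	obtain g where g: "g > 0" "!!x. x : pY ==> nY (G x) <= g * nY x"
		using bop_bound[OF norm_space G(1)] by blast
	\<comment> \<open>\<open>F'\<close> will be composed with \<open>G\<close>, so its size is measured
	  against the bound \<open>g\<close> of \<open>G\<close>.\<close>
	have eg: "eps / g > 0" using eps g by simp
	obtain F' S where F': "F' : KY" "!!x. x : pY ==> nY (F' x) <= eps / g * nY x"
		and S: "S - id_op Y : KY" "S : ops Y"
		"!!x. x : pY ==> S x + L (S x) + F' (S x) = x" "!!x. x : pY ==> S (x + L x + F' x) = x"
		using invertible_perturbation[OF L eg] by blast
	note [simp] = bop_in[OF S(2)] bop_in[OF pc_opsD[OF F'(1)]]
	have CG: "C x = G x + L (G x)" if x: "x : pY" for x
	proof -
		have "C x = C (A (G x) + F (G x))" using G(2)[OF x] by simp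
		also have "... = C (A (G x)) + C (F (G x))" using x by (intro bop_add[OF Cop]) auto
		finally show ?thesis using x by (simp add: L_def)
	qed
	define D where "D = C + (F' o G)"
	have Dx: "D x = G x + L (G x) + F' (G x)" if "x : pY" for x
		using CG[OF that] by (simp add: D_def)
	define K where "K = F + (A o (S - id_op Y)) + (F o (S - id_op Y))"
	have AFS: "A x + K x = A (S x) + F (S x)" if x: "x : pY" for x
		using x by (simp add: K_def op_diff[OF Aop] op_diff[OF Fop])
	show ?thesis
	proof (rule that)
		show "K : KY"
			unfolding K_def by (intro pc_plus F po_pc[OF A S(1)] po_pc[OF pc_subset_po[OF F] S(1)])
		show D: "D : ops Y"
			unfolding D_def by (intro ops_plus Cop ops_comp pc_opsD[OF F'(1)] G(1))
		fix x assume x: "x : pY"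
		have "A (D x) + K (D x) = A (S (D x)) + F (S (D x))" using AFS[OF bop_in[OF D x]] .
		also have "S (D x) = G x" using S(4)[of "G x"] Dx[OF x] x by simp
		finally show "A (D x) + K (D x) = x" using G(2)[OF x] by simp
		have GS: "G (A x + K x) = S x" unfolding AFS[OF x] using G(3)[of "S x"] x by simp
		have "A x + K x : pY" unfolding AFS[OF x] using x by simp
		then show "D (A x + K x) = x" using Dx GS S(3)[OF x] by simp
		have "nY (D x) <= nY (C x) + nY (F' (G x))" using x by (simp add: D_def nrm_add)
		also have "nY (F' (G x)) <= eps / g * (g * nY x)"
			using F'(2)[of "G x"] mult_left_mono[OF g(2)[OF x], of "eps / g"] eg x by simp
		finally show "nY (D x) <= (gam + eps) * nY x" using gam[OF x] g(1) by (simp add: algebra_simps)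
	qed
qed

end

section \<open>Dual spaces\<close>

lemma pts_dual [simp]: "pts (dual Y) = bounded_ops Y scalars"
	and nrm_dual: "nrm (dual Y) = op_norm Y scalars"
	by (simp_all add: dual_def)

context cnorm_space
begin

lemma dual_bound: "f : FY ==> x : pY ==> cmod (f x) <= nD f * nY x"
	using op_norm_bound[OF norm_space cnorm_space_scalars] by (simp add: nrm_dual)

lemma dual_le:
	"0 <= c ==> (!!x. x : pY ==> cmod (f x) <= c * nY x) ==> nD f <= c"
	using op_norm_le[OF norm_space, where Z = scalars] by (simp add: nrm_dual)

lemma dual_le_unit:
	assumes "!!x. x : pY ==> nY x <= 1 ==> cmod (f x) <= c"
	shows "nD f <= c"
proof -
	have "{x : pY. nY x <= 1} ~= {}" using zero_in nrm_zero by fastforce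
	then show ?thesis unfolding nrm_dual op_norm_def
		by (intro cSUP_least) (use assms in auto)
qed

lemma functionals_plus: "f : FY ==> g : FY ==> f + g : FY"
	by (rule bop_plus[OF norm_space cnorm_space_scalars])

lemma functionals_cscale: "f : FY ==> a *C f : FY"
	by (rule bop_cscale[OF norm_space cnorm_space_scalars])

lemma functionals_zero: "0 : FY"
	by (rule bop_zero_op[OF norm_space cnorm_space_scalars])

lemma functionals_comp: "f : FY ==> T : ops Y ==> f o T : FY"
	by (rule bop_comp[OF norm_space norm_space cnorm_space_scalars])

lemma dual_cnorm_space: "cnorm_space DY"
proof
	have nn: "0 <= nD f" if "f : FY" for f
		using op_norm_nonneg[OF norm_space cnorm_space_scalars that] by (simp add: nrm_dual)
	fix f g :: "'a => complex" and a
	show "0 : pD" by (simp add: functionals_zero)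
	assume f: "f : pD"
	then have f': "f : FY" by simp
	show "a *C f : pD" using f by (simp add: functionals_cscale)
	show "0 <= nD f" using f by (simp add: nn)
	show "f = 0" if "nD f = 0"
		by (rule bop_eqI[OF f' functionals_zero]) (use dual_bound[OF f'] that in auto)
	have le: "nD (a *C f) <= cmod a * nD f" if "f : FY" for a f
		by (rule dual_le) (use nn[OF that] dual_bound[OF that] in
				\<open>auto simp: scaleC_fun_def scaleC_complex_def norm_mult mult.assoc intro!: mult_left_mono\<close>)
	show "nD (a *C f) = cmod a * nD f"
	proof (cases "a = 0")
		case True
		then show ?thesis using le[OF f', of 0] nn[OF functionals_zero] by simp
	next
		case False
		have "nD (inverse a *C a *C f) <= cmod (inverse a) * nD (a *C f)"
			by (rule le[OF functionals_cscale[OF f']])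
		then have "cmod a * nD f <= nD (a *C f)"
			using False by (simp add: norm_divide norm_inverse field_simps)
		with le[OF f'] show ?thesis by (intro antisym)
	qed
	assume g: "g : pD"
	then have g': "g : FY" by simp
	show "f + g : pD" using f g by (simp add: functionals_plus)
	show "nD (f + g) <= nD f + nD g"
	proof (rule dual_le)
		fix x assume x: "x : pY"
		have "cmod (f x + g x) <= cmod (f x) + cmod (g x)" by (rule norm_triangle_ineq)
		with dual_bound[OF f' x] dual_bound[OF g' x]
		show "cmod ((f + g) x) <= (nD f + nD g) * nY x"
			by (simp add: algebra_simps)
	qed (use nn f g in auto)
qed

lemma dual_banach: "banach_cn DY"
proof -
	interpret D: cnorm_space "dual Y" by (rule dual_cnorm_space)
	show ?thesis
	proof
		fix f :: "nat => 'a => complex"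
		assume f: "!!n. f n : pD"
			and cau: "!!e. e > 0 ==> EX N. ALL i>=N. ALL j>=N. nD (f i - f j) < e"
		have f': "f n : FY" for n using f by simp
		have bnd: "cmod (f i x - f j x) <= nD (f i - f j) * nY x" if "x : pY" for i j x
			using dual_bound[of "f i - f j" x] D.diff_in[OF f f] that by simp
		have "Cauchy (%n. f n x)" if x: "x : pY" for x
		proof (rule metric_CauchyI)
			fix e :: real assume e: "e > 0"
			have "e / (nY x + 1) > 0" using e nrm_nonneg[OF x] by (simp add: add_nonneg_pos)
			from cau[OF this] obtain N where N: "!!i j. i >= N ==> j >= N ==> nD (f i - f j) < e / (nY x + 1)"
				by blast
			have "dist (f i x) (f j x) < e" if "i >= N" "j >= N" for i j
			proof -
				have "nD (f i - f j) * nY x <= nD (f i - f j) * (nY x + 1)"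
					using D.nrm_nonneg[OF D.diff_in[OF f f]] by (intro mult_left_mono) auto
				also have "... < e"
					using N[OF that] nrm_nonneg[OF x] by (simp add: pos_less_divide_eq add_nonneg_pos)
				finally show ?thesis using bnd[OF x, of i j] by (simp add: dist_norm)
			qed
			then show "EX M. ALL m>=M. ALL n>=M. dist (f m x) (f n x) < e" by blast
		qed
		then have "EX l. (%n. f n x) ----> l" if "x : pY" for x
			using that by (auto simp: Cauchy_convergent_iff convergent_def)
		then obtain l where l: "!!x. x : pY ==> (%n. f n x) ----> l x" by metis
		obtain N0 where N0: "!!i j. i >= N0 ==> j >= N0 ==> nD (f i - f j) < 1"
			using cau[OF zero_less_one] by blast
		define F where "F = zext Y l"
		have diff: "cmod (f n x - F x) <= e * nY x"
			if x: "x : pY" and N: "!!i j. i >= N ==> j >= N ==> nD (f i - f j) < e" and n: "n >= N" for n x e N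
		proof (rule LIMSEQ_le_const2)
			show "(%m. cmod (f n x - f m x)) ----> cmod (f n x - F x)"
				using x l[OF x] by (auto simp: F_def intro!: tendsto_intros)
			show "EX M. ALL m>=M. cmod (f n x - f m x) <= e * nY x"
			proof (intro exI[of _ N] allI impI)
				fix m assume "m >= N"
				then have "nD (f n - f m) * nY x <= e * nY x"
					using less_imp_le[OF N[OF n \<open>m >= N\<close>]] nrm_nonneg[OF x] by (intro mult_right_mono)
				with bnd[OF x, of n m] show "cmod (f n x - f m x) <= e * nY x" by linarith
			qed
		qed
		have F: "F : FY"
			unfolding F_def
		proof (rule bop_zextI[OF norm_space])
			fix x y a assume x: "x : pY"
			show "l x : pts scalars" by simp
			have "(%n. f n (a *C x)) ----> a *C l x"
				using l[OF x] by (auto simp: bop_scale[OF f' x] scaleC_complex_def intro!: tendsto_intros)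
			then show "l (a *C x) = a *C l x" using l[of "a *C x"] x LIMSEQ_unique by auto
			have "cmod (l x) <= cmod (f N0 x) + cmod (f N0 x - l x)"
				using norm_triangle_ineq4[of "f N0 x" "f N0 x - l x"] by simp
			also have "... <= nD (f N0) * nY x + 1 * nY x"
				using dual_bound[OF f' x] diff[OF x N0 order_refl] x by (intro add_mono) (auto simp: F_def)
			finally show "nrm scalars (l x) <= (nD (f N0) + 1) * nY x" by (simp add: algebra_simps)
			assume y: "y : pY"
			have "(%n. f n (x + y)) ----> l x + l y"
				using l[OF x] l[OF y] by (auto simp: bop_add[OF f' x y] intro!: tendsto_intros)
			then show "l (x + y) = l x + l y" using l[of "x + y"] x y LIMSEQ_unique by auto
		qed
		have "(%n. nD (f n - F)) ----> 0"
		proof (rule LIMSEQ_I)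
			fix e :: real assume e: "e > 0"
			then obtain N where N: "!!i j. i >= N ==> j >= N ==> nD (f i - f j) < e / 2"
				using cau[OF half_gt_zero[OF e]] by blast
			have "norm (nD (f n - F) - 0) < e" if "n >= N" for n
			proof -
				have "nD (f n - F) <= e / 2"
					by (rule dual_le) (use e diff[OF _ N that] in auto)
				moreover have "0 <= nD (f n - F)"
					using F f by (intro D.nrm_nonneg D.diff_in) auto
				ultimately show ?thesis using e by simp
			qed
			then show "EX no. ALL n>=no. norm (nD (f n - F) - 0) < e" by blast
		qed
		with F show "EX y:pD. (%n. nD (f n - y)) ----> 0" by auto
	qed
qed

lemma adj_apply: "f : FY ==> adj Y T f = f o T"
	by (simp add: adj_def)

lemma adj_bound:
	assumes f: "f : FY" and T: "!!x. x : pY ==> T x : pY"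
		and c: "c >= 0" "!!x. x : pY ==> nY (T x) <= c * nY x"
	shows "nD (f o T) <= c * nD f"
proof (rule dual_le)
	have nn: "0 <= nD f" using f cnorm_space.nrm_nonneg[OF dual_cnorm_space] by simp
	then show "0 <= c * nD f" using c by simp
	fix x assume x: "x : pY"
	have "cmod (f (T x)) <= nD f * nY (T x)" using dual_bound[OF f T[OF x]] .
	also have "... <= nD f * (c * nY x)" using c(2)[OF x] nn by (rule mult_left_mono)
	finally show "cmod ((f o T) x) <= c * nD f * nY x" by (simp add: mult_ac)
qed

lemma adj_ops:
	assumes T: "T : ops Y"
	shows "adj Y T : ops DY"
proof -
	obtain c where c: "c > 0" "!!x. x : pY ==> nY (T x) <= c * nY x"
		using bop_bound[OF norm_space T] by blast
	show ?thesis
	proof (rule bopI[where c = c])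
		fix f g :: "'a => complex" and a assume f: "f : pD"
		then show "adj Y T f : pD" using functionals_comp[OF _ T] by (simp add: adj_def)
		show "nD (adj Y T f) <= c * nD f"
			using f c adj_bound[of f T c] bop_in[OF T] by (simp add: adj_def)
		show "adj Y T (a *C f) = a *C adj Y T f"
			using f functionals_cscale[of f a] by (simp add: adj_def scaleC_fun_def fun_eq_iff)
		assume "g : pD"
		then show "adj Y T (f + g) = adj Y T f + adj Y T g"
			using f functionals_plus[of f g] by (simp add: adj_def fun_eq_iff)
	qed (simp add: adj_def)
qed

lemma norming_functional:
	assumes "x : pY"
	obtains f where "f : FY" "nD f <= 1" "nY x <= cmod (f x)"
proof -
	obtain F where "F : FY" "!!x. x : pY ==> cmod (F x) <= nY x"
		"nY x <= cmod (F x)"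
		using hahn_banach[of "{0}" x "nY x"] assms by auto
	then show ?thesis using that[of F] dual_le[of 1 F] by simp
qed

end

context proj_space
begin

text \<open>A basis chosen inside the image of \<open>R n\<close> is fixed by \<open>R n\<close>;
  its coordinate functionals are continuous by \<open>representation_bound\<close> and factor
  through \<open>R n\<close>.\<close>

lemma R_coordinates:
	obtains B e where "finite B" "B \<subseteq> pY" "cindependent B" "!!b. b : B ==> R n b = b"
		"!!b. e b : FY" "!!x. x : pY ==> R n x = (SUM b:B. e b x *C b)"
		"!!b c. b : B ==> c : B ==> e b c = (if b = c then 1 else 0)"
		"!!b x. x : pY ==> e b (R n x) = e b x"
proof -
	obtain B0 where B0: "finite B0" "R n ` pY \<subseteq> cspan B0" using R_fin by blast
	obtain B where B: "B \<subseteq> R n ` pY" "cindependent B" "R n ` pY \<subseteq> cspan B"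
		using complex_vector.maximal_independent_subset by blast
	have fin: "finite B" using cindependent_span_bound[OF B0(1) B(2)] B(1) B0(2) by blast
	have Bin: "B \<subseteq> pY" using B(1) by auto
	have RB: "R n b = b" if "b : B" for b using B(1) that by (auto simp: R_R)
	obtain C where C: "C > 0"
		"!!x b. x : cspan B ==> b : B ==> cmod (crepresentation B x b) <= C * nY x"
		using representation_bound[OF fin Bin B(2)] by blast
	define e where "e = (%b. if b : B then zext Y (%x. crepresentation B (R n x) b) else 0)"
	have Rin: "R n x : cspan B" if "x : pY" for x using that B(3) by blast
	have e: "e b : FY" for b
	proof (cases "b : B")
		case True
		have "zext Y (%x. crepresentation B (R n x) b) : FY"
		proof (rule bop_zextI[OF norm_space])
			fix x y a assume x: "x : pY"
			show "crepresentation B (R n x) b : pts scalars" by simp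
			show "crepresentation B (R n (a *C x)) b = a *C crepresentation B (R n x) b"
				using x by (simp add: R_scale complex_vector.representation_scale[OF B(2) Rin[OF x]] scaleC_complex_def)
			have "C * nY (R n x) <= C * nY x" using C(1) R_le[OF x] by (intro mult_left_mono) auto
			then show "nrm scalars (crepresentation B (R n x) b) <= C * nY x"
				using C(2)[OF Rin[OF x] True] by simp
			assume y: "y : pY"
			show "crepresentation B (R n (x + y)) b =
					crepresentation B (R n x) b + crepresentation B (R n y) b"
				using x y by (simp add: R_add complex_vector.representation_add[OF B(2) Rin[OF y] Rin[OF x]])
		qed
		then show ?thesis using True by (simp add: e_def)
	qed (simp add: e_def functionals_zero)
	show ?thesis
	proof (rule that[OF fin Bin B(2) RB e])
		fix x assume x: "x : pY"
		show "R n x = (SUM b:B. e b x *C b)"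
			using complex_vector.sum_representation_eq[OF B(2) Rin[OF x] fin order_refl] x
			by (simp add: e_def)
	next
		fix b c assume "b : B" "c : B"
		then show "e b c = (if b = c then 1 else 0)"
			using Bin RB complex_vector.representation_basis[OF B(2), of c]
			by (auto simp: e_def subset_iff)
	next
		fix b x assume "x : pY"
		then show "e b (R n x) = e b x" by (simp add: e_def R_R)
	qed auto
qed

lemma adj_comp_R:
	assumes f: "f : FY"
	shows "adj Y (R m) (adj Y (R n) f) = adj Y (R (min m n)) f"
proof -
	have "f o R n o R m = f o R (min m n)"
	proof
		fix x show "(f o R n o R m) x = (f o R (min m n)) x"
			by (cases "x : pY") (auto simp: R_R min.commute bop_out[OF R_ops])
	qed
	then show ?thesis using f functionals_comp[OF f R_ops] by (simp add: adj_def)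
qed

lemma dual_proj_space: "proj_space DY (%n. adj Y (R n))"
proof -
	interpret D: banach_cn "dual Y" by (rule dual_banach)
	show ?thesis
	proof
		show "adj Y (R n) : ops DY" for n by (rule adj_ops[OF R_ops])
		fix f m n assume f: "f : pD"
		then have f': "f : FY" by simp
		show "adj Y (R m) (adj Y (R n) f) = adj Y (R (min m n)) f" by (rule adj_comp_R[OF f'])
		show "nD (adj Y (R n) f) <= nD f"
			using adj_bound[OF f', of "R n" 1] R_le by (simp add: adj_apply[OF f'])
		have "f - (f o R n) = f o (id_op Y - R n)"
		proof
			fix x show "(f - (f o R n)) x = (f o (id_op Y - R n)) x"
				by (cases "x : pY") (auto simp: op_diff[OF f'] bop_out[OF R_ops] bop_out[OF f'] id_op_def bop_zero[OF f'])
		qed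
		then show "nD (f - adj Y (R n) f) <= nD f"
			using adj_bound[OF f', of "id_op Y - R n" 1] S_le by (simp add: adj_apply[OF f'])
	next
		fix n
		obtain B e where B: "finite B" "B \<subseteq> pY" "!!b. e b : FY"
			"!!x. x : pY ==> R n x = (SUM b:B. e b x *C b)"
			using R_coordinates[of n] by metis
		have "adj Y (R n) f : cspan (e ` B)" if f: "f : pD" for f
		proof -
			have f': "f : FY" using f by simp
			\<comment> \<open>The coordinate functionals of the image of \<open>R n\<close> span the image of
			  its adjoint.\<close>
			have "f o R n = (SUM b:B. f b *C e b)"
			proof
				fix x
				have sum_app: "(SUM b:B. f b *C e b) x = (SUM b:B. f b * e b x)"
					using B(1) by (induction B rule: finite_induct) (auto simp: scaleC_fun_def scaleC_complex_def)
				show "(f o R n) x = (SUM b:B. f b *C e b) x"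
				proof (cases "x : pY")
					case True
					have "f (R n x) = (SUM b:B. f (e b x *C b))"
						unfolding B(4)[OF True] using B(2) by (intro op_sum[OF f']) auto
					also have "... = (SUM b:B. f b * e b x)"
						using B(2) by (intro sum.cong) (auto simp: bop_scale[OF f'] scaleC_complex_def mult.commute)
					finally show ?thesis by (simp add: sum_app)
				next
					case False
					then show ?thesis unfolding sum_app
						using bop_out[OF R_ops False] bop_out[OF B(3) False] bop_zero[OF f'] by simp
				qed
			qed
			also have "... : cspan (e ` B)"
				by (intro cspan_sum cspan_scale cspan_base imageI)
			finally show ?thesis by (simp add: adj_apply[OF f'])
		qed
		then show "EX B. finite B & B \<subseteq> pD & adj Y (R n) ` pD \<subseteq> cspan B"
			using B by (intro exI[of _ "e ` B"]) auto
	qed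
qed

lemma adj_diff_apply:
	assumes f: "f : FY" and S: "S : ops Y" and T: "T : ops Y"
	shows "f o (S - T) = (f o S) - (f o T)"
proof
	fix x show "(f o (S - T)) x = ((f o S) - (f o T)) x"
		by (cases "x : pY")
			(auto simp: op_diff[OF f] bop_in[OF S] bop_in[OF T] bop_out[OF S] bop_out[OF T] bop_zero[OF f])
qed

lemma adj_tail:
	assumes f: "f : FY"
	shows "f - adj Y (R n) f = f o (id_op Y - R n)"
proof -
	have "f o id_op Y = f"
		by (rule ext) (auto simp: id_op_def bop_zero[OF f] bop_out[OF f])
	then show ?thesis using adj_diff_apply[OF f ops_id R_ops] by (simp add: adj_apply[OF f])
qed

text \<open>Adjoints reverse products, so the estimates for \<open>A o R j\<close> and
  \<open>R j o A\<close> exchange their roles.\<close>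

lemma adj_po:
	assumes A: "A : LY"
	shows "adj Y A : proj_ops DY (%n. adj Y (R n))"
proof -
	interpret D: proj_space "dual Y" "%n. adj Y (R n)" by (rule dual_proj_space)
	have Aop: "A : ops Y" using A by (rule po_opsD)
	note [simp] = bop_in[OF Aop]
	show ?thesis
	proof (rule D.poI[OF adj_ops[OF Aop]])
		fix j and e :: real assume e: "e > 0"
		obtain N where N: "!!n x. n >= N ==> x : pY ==> nY (A (R j x) - R n (A (R j x))) <= e * nY x"
			"!!n x. n >= N ==> x : pY ==> nY (R j (A (x - R n x))) <= e * nY x"
			using poD[OF A e] by blast
		have "nD (adj Y A (adj Y (R j) f) - adj Y (R N) (adj Y A (adj Y (R j) f))) <= e * nD f"
			if f: "f : pD" for f
		proof -
			have f': "f : FY" using f by simp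
			have g: "f o R j : FY" "f o R j o A : FY"
				using f' by (auto intro!: functionals_comp R_ops Aop)
			have "adj Y A (adj Y (R j) f) - adj Y (R N) (adj Y A (adj Y (R j) f))
					= f o (R j o A o (id_op Y - R N))"
				using adj_tail[OF g(2), of N] by (simp add: adj_apply[OF f'] adj_apply[OF g(1)] comp_assoc)
			moreover have "nD (f o (R j o A o (id_op Y - R N))) <= e * nD f"
				by (rule adj_bound[OF f']) (use e N(2)[OF order_refl] in auto)
			ultimately show ?thesis by simp
		qed
		then show "EX n. ALL f:pD. nD (adj Y A (adj Y (R j) f) -
				adj Y (R n) (adj Y A (adj Y (R j) f))) <= e * nD f" by blast
		have "nD (adj Y (R j) (adj Y A (f - adj Y (R N) f))) <= e * nD f"
			if f: "f : pD" for f
		proof -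
			have f': "f : FY" using f by simp
			have g: "f o (id_op Y - R N) : FY" "f o (id_op Y - R N) o A : FY"
				using f' by (auto intro!: functionals_comp tail_op Aop)
			have "adj Y (R j) (adj Y A (f - adj Y (R N) f)) = f o ((id_op Y - R N) o A o R j)"
				by (simp only: adj_tail[OF f'] adj_apply[OF g(1)] adj_apply[OF g(2)]) (simp add: comp_assoc)
			moreover have "nD (f o ((id_op Y - R N) o A o R j)) <= e * nD f"
				by (rule adj_bound[OF f']) (use e N(1)[OF order_refl] in auto)
			ultimately show ?thesis by simp
		qed
		then show "EX n. ALL f:pD. nD (adj Y (R j) (adj Y A (f - adj Y (R n) f))) <= e * nD f"
			by blast
	qed
qed

lemma adj_pc:
	assumes K: "K : KY"
	shows "adj Y K : proj_compact_ops DY (%n. adj Y (R n))"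
proof -
	interpret D: proj_space "dual Y" "%n. adj Y (R n)" by (rule dual_proj_space)
	have Kop: "K : ops Y" using K by (rule pc_opsD)
	note [simp] = bop_in[OF Kop]
	show ?thesis
	proof (rule D.pcI[OF adj_ops[OF Kop]])
		fix e :: real assume e: "e > 0"
		obtain N where N: "!!n x. n >= N ==> x : pY ==> nY (K x - R n (K x)) <= e * nY x"
			"!!n x. n >= N ==> x : pY ==> nY (K (x - R n x)) <= e * nY x"
			using pcD[OF K e] by blast
		have "nD (adj Y K f - adj Y (R N) (adj Y K f)) <= e * nD f &
			nD (adj Y K (f - adj Y (R N) f)) <= e * nD f" if f: "f : pD" for f
		proof -
			have f': "f : FY" using f by simp
			have g: "f o K : FY" "f o (id_op Y - R N) : FY"
				using f' by (auto intro!: functionals_comp tail_op Kop)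
			have "nD (f o (K o (id_op Y - R N))) <= e * nD f"
				by (rule adj_bound[OF f']) (use e N(2)[OF order_refl] in auto)
			moreover have "nD (f o ((id_op Y - R N) o K)) <= e * nD f"
				by (rule adj_bound[OF f']) (use e N(1)[OF order_refl] in auto)
			ultimately show ?thesis
				using adj_tail[OF g(1), of N] adj_tail[OF f', of N]
				by (simp add: adj_apply[OF f'] adj_apply[OF g(2)] comp_assoc)
		qed
		then show "EX n. ALL f:pD. nD (adj Y K f - adj Y (R n) (adj Y K f)) <= e * nD f &
			nD (adj Y K (f - adj Y (R n) f)) <= e * nD f" by blast
	qed
qed

end

section \<open>Direct sums\<close>

lemma pts_sum_space [simp]: "pts (sum_space Y Z) = pts Y \<times> pts Z"
	and nrm_sum_space [simp]: "nrm (sum_space Y Z) (x, f) = max (nrm Y x) (nrm Z f)"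
	by (simp_all add: sum_space_def)

lemma sum_op_apply [simp]: "x : pts Y ==> f : pts Z ==> sum_op Y Z S T (x, f) = (S x, T f)"
	and sum_op_out: "x ~: pts Y \<or> f ~: pts Z ==> sum_op Y Z S T (x, f) = 0"
	by (auto simp: sum_op_def)

lemma sum_cnorm_space:
	assumes "cnorm_space Y" "cnorm_space Z"
	shows "cnorm_space (sum_space Y Z)"
proof -
	interpret Y: cnorm_space Y by fact
	interpret Z: cnorm_space Z by fact
	show ?thesis
	proof
		fix x y :: "'a \<times> 'b" and a
		show "0 : pts (sum_space Y Z)" by (simp add: zero_prod_def)
		assume x: "x : pts (sum_space Y Z)"
		then show "a *C x : pts (sum_space Y Z)" by (auto simp: scaleC_prod_def)
		show "0 <= nrm (sum_space Y Z) x" using x by (auto simp: le_max_iff_disj)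
		show "nrm (sum_space Y Z) (a *C x) = cmod a * nrm (sum_space Y Z) x"
			using x by (auto simp: scaleC_prod_def Y.nrm_scale Z.nrm_scale max_mult_distrib_left)
		show "x = 0" if "nrm (sum_space Y Z) x = 0"
		proof -
			obtain u f where uf: "x = (u, f)" "u : pts Y" "f : pts Z" using x by auto
			then have "nrm Y u = 0" "nrm Z f = 0"
				using that Y.nrm_nonneg[of u] Z.nrm_nonneg[of f] by (auto simp del: Y.nrm_nonneg Z.nrm_nonneg simp: max_def split: if_splits)
			then show ?thesis using uf Y.nrm_eq_0 Z.nrm_eq_0 by (simp add: zero_prod_def)
		qed
		assume y: "y : pts (sum_space Y Z)"
		show "x + y : pts (sum_space Y Z)" using x y by auto
		obtain u f v g where uf: "x = (u, f)" "u : pts Y" "f : pts Z" "y = (v, g)" "v : pts Y" "g : pts Z"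
			using x y by auto
		then show "nrm (sum_space Y Z) (x + y) <= nrm (sum_space Y Z) x + nrm (sum_space Y Z) y"
			using Y.nrm_add[of u v] Z.nrm_add[of f g] by auto
	qed
qed

lemma sum_banach:
	assumes "banach_cn Y" "banach_cn Z"
	shows "banach_cn (sum_space Y Z)"
proof -
	interpret Y: banach_cn Y by fact
	interpret Z: banach_cn Z by fact
	interpret S: cnorm_space "sum_space Y Z" by (rule sum_cnorm_space[OF Y.norm_space Z.norm_space])
	show ?thesis
	proof
		fix x :: "nat => 'a \<times> 'b"
		assume x: "!!n. x n : pts (sum_space Y Z)"
			and cau: "!!e. e > 0 ==> EX N. ALL i>=N. ALL j>=N. nrm (sum_space Y Z) (x i - x j) < e"
		have xin: "fst (x n) : pts Y" "snd (x n) : pts Z" for n using x[of n] by (auto simp: mem_Times_iff)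
		have nd: "nrm (sum_space Y Z) (x i - y) = max (nrm Y (fst (x i) - fst y)) (nrm Z (snd (x i) - snd y))" for i y
			by (cases "x i"; cases y) simp
		have "cauchy_in Y (%n. fst (x n))" "cauchy_in Z (%n. snd (x n))"
			using cau unfolding cauchy_in_def nd by (meson max_less_iff_conj)+
		then obtain u f where u: "u : pts Y" "(%n. nrm Y (fst (x n) - u)) ----> 0"
			and f: "f : pts Z" "(%n. nrm Z (snd (x n) - f)) ----> 0"
			using Y.complete_cauchy[of "%n. fst (x n)"] Z.complete_cauchy[of "%n. snd (x n)"] xin by blast
		have "(%n. nrm (sum_space Y Z) (x n - (u, f))) ----> max 0 0"
			unfolding nd using tendsto_max[OF u(2) f(2)] by simp
		then show "EX y:pts (sum_space Y Z). (%n. nrm (sum_space Y Z) (x n - y)) ----> 0"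
			using u f by (intro bexI[of _ "(u, f)"]) auto
	qed
qed

lemma sum_op_ops:
	assumes "cnorm_space Y" "cnorm_space Z" and S: "S : ops Y" and T: "T : ops Z"
	shows "sum_op Y Z S T : ops (sum_space Y Z)"
proof -
	interpret Y: cnorm_space Y by fact
	interpret Z: cnorm_space Z by fact
	obtain a where a: "a > 0" "!!x. x : pts Y ==> nrm Y (S x) <= a * nrm Y x"
		using bop_bound[OF assms(1) S] by blast
	obtain b where b: "b > 0" "!!x. x : pts Z ==> nrm Z (T x) <= b * nrm Z x"
		using bop_bound[OF assms(2) T] by blast
	show ?thesis
	proof (rule bopI[where c = "max a b"])
		fix x y :: "'a \<times> 'b" and r
		show "sum_op Y Z S T x = 0" if "x ~: pts (sum_space Y Z)"
			using that by (cases x) (auto simp: sum_op_def)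
		assume x: "x : pts (sum_space Y Z)"
		then obtain u f where uf: "x = (u, f)" "u : pts Y" "f : pts Z" by auto
		show "sum_op Y Z S T x : pts (sum_space Y Z)" using uf bop_in[OF S] bop_in[OF T] by simp
		show "sum_op Y Z S T (r *C x) = r *C sum_op Y Z S T x"
			using uf by (simp add: scaleC_prod_def bop_scale[OF S] bop_scale[OF T])
		have "a * nrm Y u <= max a b * max (nrm Y u) (nrm Z f)" "b * nrm Z f <= max a b * max (nrm Y u) (nrm Z f)"
			using a(1) b(1) uf by (auto intro!: mult_mono simp: le_max_iff_disj)
		then show "nrm (sum_space Y Z) (sum_op Y Z S T x) <= max a b * nrm (sum_space Y Z) x"
			using a(2)[OF uf(2)] b(2)[OF uf(3)] uf by simp
		assume y: "y : pts (sum_space Y Z)"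
		then obtain v g where vg: "y = (v, g)" "v : pts Y" "g : pts Z" by auto
		show "sum_op Y Z S T (x + y) = sum_op Y Z S T x + sum_op Y Z S T y"
			using uf vg by (simp add: bop_add[OF S] bop_add[OF T])
	qed
qed

lemma sum_proj_space:
	assumes "proj_space Y R" "proj_space Z P"
	shows "proj_space (sum_space Y Z) (%n. sum_op Y Z (R n) (P n))"
proof -
	interpret Y: proj_space Y R by fact
	interpret Z: proj_space Z P by fact
	interpret S: banach_cn "sum_space Y Z" by (rule sum_banach[OF Y.banach_cn_axioms Z.banach_cn_axioms])
	show ?thesis
	proof
		fix m n x
		show "sum_op Y Z (R n) (P n) : ops (sum_space Y Z)"
			by (rule sum_op_ops[OF Y.norm_space Z.norm_space Y.R_ops Z.R_ops])
		assume x: "x : pts (sum_space Y Z)"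
		then obtain u f where uf: "x = (u, f)" "u : pts Y" "f : pts Z" by auto
		show "sum_op Y Z (R m) (P m) (sum_op Y Z (R n) (P n) x) = sum_op Y Z (R (min m n)) (P (min m n)) x"
			using uf by (simp add: Y.R_R Z.R_R)
		show "nrm (sum_space Y Z) (sum_op Y Z (R n) (P n) x) <= nrm (sum_space Y Z) x"
			using uf Y.R_le[of u n] Z.R_le[of f n] by auto
		show "nrm (sum_space Y Z) (x - sum_op Y Z (R n) (P n) x) <= nrm (sum_space Y Z) x"
			using uf Y.S_le[of u n] Z.S_le[of f n] by auto
	next
		fix n
		obtain B where B: "finite B" "B \<subseteq> pts Y" "R n ` pts Y \<subseteq> cspan B" using Y.R_fin by blast
		obtain C where C: "finite C" "C \<subseteq> pts Z" "P n ` pts Z \<subseteq> cspan C" using Z.R_fin by blast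
		let ?D = "(%b. (b, 0)) ` B \<union> (%c. (0, c)) ` C"
		have 1: "(b, 0) : cspan ?D" if "b : cspan B" for b
			using that
		proof (induction rule: complex_vector.span_induct_alt)
			case base then show ?case using complex_vector.span_zero[of ?D] by (simp add: zero_prod_def)
		next
			case (step c x y)
			have "(x, 0) : cspan ?D" using step(1) by (intro cspan_base) auto
			then have "c *C (x, 0) + (y, 0) : cspan ?D"
				using step(2) by (intro cspan_add cspan_scale)
			then show ?case by (simp add: scaleC_prod_def)
		qed
		have 2: "(0, b) : cspan ?D" if "b : cspan C" for b
			using that
		proof (induction rule: complex_vector.span_induct_alt)
			case base then show ?case using complex_vector.span_zero[of ?D] by (simp add: zero_prod_def)
		next
			case (step c x y)
			have "(0, x) : cspan ?D" using step(1) by (intro cspan_base) auto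
			then have "c *C (0, x) + (0, y) : cspan ?D"
				using step(2) by (intro cspan_add cspan_scale)
			then show ?case by (simp add: scaleC_prod_def)
		qed
		have "sum_op Y Z (R n) (P n) x : cspan ?D" if "x : pts (sum_space Y Z)" for x
		proof -
			obtain u f where uf: "x = (u, f)" "u : pts Y" "f : pts Z" using \<open>x : _\<close> by auto
			have "(R n u, 0) + (0, P n f) : cspan ?D"
				using 1[of "R n u"] 2[of "P n f"] B(3) C(3) uf by (intro cspan_add) auto
			then show ?thesis using uf by simp
		qed
		moreover have "?D \<subseteq> pts (sum_space Y Z)" using B(2) C(2) by auto
		ultimately show "EX B. finite B & B \<subseteq> pts (sum_space Y Z) &
				sum_op Y Z (R n) (P n) ` pts (sum_space Y Z) \<subseteq> cspan B"
			using B(1) C(1) by (intro exI[of _ ?D]) blast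
	qed
qed

lemma sum_op_pc:
	assumes "proj_space Y R" "proj_space Z P"
		and K: "K : proj_compact_ops Y R" and L: "L : proj_compact_ops Z P"
	shows "sum_op Y Z K L : proj_compact_ops (sum_space Y Z) (%n. sum_op Y Z (R n) (P n))"
proof -
	interpret Y: proj_space Y R by fact
	interpret Z: proj_space Z P by fact
	interpret S: proj_space "sum_space Y Z" "%n. sum_op Y Z (R n) (P n)"
		by (rule sum_proj_space[OF assms(1,2)])
	note o = Y.pc_opsD[OF K] Z.pc_opsD[OF L]
	note [simp] = bop_in[OF o(1)] bop_in[OF o(2)]
	show ?thesis
	proof (rule S.pcI[OF sum_op_ops[OF Y.norm_space Z.norm_space o]])
		fix e :: real assume e: "e > 0"
		obtain N where N: "!!n x. n >= N ==> x : pts Y ==> nrm Y (K x - R n (K x)) <= e * nrm Y x"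
			"!!n x. n >= N ==> x : pts Y ==> nrm Y (K (x - R n x)) <= e * nrm Y x"
			using Y.pcD[OF K e] by blast
		obtain N' where N': "!!n x. n >= N' ==> x : pts Z ==> nrm Z (L x - P n (L x)) <= e * nrm Z x"
			"!!n x. n >= N' ==> x : pts Z ==> nrm Z (L (x - P n x)) <= e * nrm Z x"
			using Z.pcD[OF L e] by blast
		define n where "n = max N N'"
		have m: "max s t <= e * max s' t'" if "s <= e * s'" "t <= e * t'" for s t s' t'
			using that e by (simp add: max_mult_distrib_left) linarith
		have "nrm (sum_space Y Z) (sum_op Y Z K L x - sum_op Y Z (R n) (P n) (sum_op Y Z K L x)) <= e * nrm (sum_space Y Z) x &
			nrm (sum_space Y Z) (sum_op Y Z K L (x - sum_op Y Z (R n) (P n) x)) <= e * nrm (sum_space Y Z) x"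
			if x: "x : pts (sum_space Y Z)" for x
		proof -
			obtain u f where uf: "x = (u, f)" "u : pts Y" "f : pts Z" using x by auto
			have "N <= n" "N' <= n" by (auto simp: n_def)
			then show ?thesis
				using uf m[OF N(1)[of n u] N'(1)[of n f]] m[OF N(2)[of n u] N'(2)[of n f]] by simp
		qed
		then show "EX n. ALL x:pts (sum_space Y Z).
				nrm (sum_space Y Z) (sum_op Y Z K L x - sum_op Y Z (R n) (P n) (sum_op Y Z K L x)) <= e * nrm (sum_space Y Z) x &
				nrm (sum_space Y Z) (sum_op Y Z K L (x - sum_op Y Z (R n) (P n) x)) <= e * nrm (sum_space Y Z) x" by blast
	qed
qed

lemma sum_op_po:
	assumes "proj_space Y R" "proj_space Z P"
		and A: "A : proj_ops Y R" and B: "B : proj_ops Z P"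
	shows "sum_op Y Z A B : proj_ops (sum_space Y Z) (%n. sum_op Y Z (R n) (P n))"
proof -
	interpret Y: proj_space Y R by fact
	interpret Z: proj_space Z P by fact
	interpret S: proj_space "sum_space Y Z" "%n. sum_op Y Z (R n) (P n)"
		by (rule sum_proj_space[OF assms(1,2)])
	note o = Y.po_opsD[OF A] Z.po_opsD[OF B]
	note [simp] = bop_in[OF o(1)] bop_in[OF o(2)]
	have m: "max s t <= e * max s' t'" if "e > 0" "s <= e * s'" "t <= e * t'" for s t s' t' e :: real
		using that by (simp add: max_mult_distrib_left) linarith
	show ?thesis
	proof (rule S.poI[OF sum_op_ops[OF Y.norm_space Z.norm_space o]])
		fix j and e :: real assume e: "e > 0"
		obtain N where N: "!!n x. n >= N ==> x : pts Y ==> nrm Y (A (R j x) - R n (A (R j x))) <= e * nrm Y x"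
			"!!n x. n >= N ==> x : pts Y ==> nrm Y (R j (A (x - R n x))) <= e * nrm Y x"
			using Y.poD[OF A e] by blast
		obtain N' where N': "!!n x. n >= N' ==> x : pts Z ==> nrm Z (B (P j x) - P n (B (P j x))) <= e * nrm Z x"
			"!!n x. n >= N' ==> x : pts Z ==> nrm Z (P j (B (x - P n x))) <= e * nrm Z x"
			using Z.poD[OF B e] by blast
		define n where "n = max N N'"
		have n: "N <= n" "N' <= n" by (auto simp: n_def)
		let ?R = "%n. sum_op Y Z (R n) (P n)" and ?A = "sum_op Y Z A B"
		have "nrm (sum_space Y Z) (?A (?R j x) - ?R n (?A (?R j x))) <= e * nrm (sum_space Y Z) x &
			nrm (sum_space Y Z) (?R j (?A (x - ?R n x))) <= e * nrm (sum_space Y Z) x"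
			if x: "x : pts (sum_space Y Z)" for x
		proof -
			obtain u f where uf: "x = (u, f)" "u : pts Y" "f : pts Z" using x by auto
			then show ?thesis
				using n m[OF e N(1)[of n u] N'(1)[of n f]] m[OF e N(2)[of n u] N'(2)[of n f]] by simp
		qed
		then show "EX n. ALL x:pts (sum_space Y Z). nrm (sum_space Y Z) (?A (?R j x) - ?R n (?A (?R j x))) <= e * nrm (sum_space Y Z) x"
			"EX n. ALL x:pts (sum_space Y Z). nrm (sum_space Y Z) (?R j (?A (x - ?R n x))) <= e * nrm (sum_space Y Z) x"
			by blast+
	qed
qed

section \<open>Disjointly supported vectors\<close>

text \<open>
  The constant \<open>ka\<close> is the norm of a sum of two disjointly supported unit vectors: \<open>2\<^bsup>1/p\<^esup>\<close> for
  \<open>l\<^sup>p\<close>, and \<open>2 / ka\<close> for the dual space.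
\<close>

locale proj_kappa = proj_space Y R for Y :: "'a::complex_vector cnspace" and R +
	fixes ka :: real
	assumes ka: "1 <= ka" "ka <= 2"
		and ka_le: "u : pts Y ==> v : pts Y ==> R n u = u ==> R n v = 0 ==>
			nrm Y (u + v) <= ka * max (nrm Y u) (nrm Y v)"
		and ka_ge: "u : pts Y ==> v : pts Y ==> R n u = u ==> R n v = 0 ==>
			ka * (nrm Y u + nrm Y v) <= 2 * nrm Y (u + v)"
begin

text \<open>The upper estimate for disjoint vectors dualizes to the lower one for functionals and
  conversely, which replaces \<open>ka\<close> by \<open>2 / ka\<close>.\<close>

lemma dual_kappa: "proj_kappa DY (%n. adj Y (R n)) (2 / ka)"
proof -
	interpret D: proj_space "dual Y" "%n. adj Y (R n)" by (rule dual_proj_space)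
	have ka0: "ka > 0" using ka by simp
	show ?thesis
	proof
		show "1 <= 2 / ka" "2 / ka <= 2" using ka by (auto simp: field_simps)
		fix f g n assume fg: "f : pD" "g : pD" "adj Y (R n) f = f" "adj Y (R n) g = 0"
		then have f: "f : FY" and g: "g : FY" by auto
		have fR: "f (R n x) = f x" and gR: "g (R n x) = 0" for x
			using fg f g by (auto simp: adj_apply fun_eq_iff)
		have fS: "f (x - R n x) = 0" and gS: "g (x - R n x) = g x" if "x : pY" for x
			using that by (simp_all add: op_diff[OF f] op_diff[OF g] fR gR)
		let ?M = "max (nD f) (nD g)"
		have M0: "0 <= ?M" using D.nrm_nonneg[OF fg(1)] by (simp add: le_max_iff_disj)
		show "nD (f + g) <= 2 / ka * ?M"
		proof (rule dual_le)
			show "0 <= 2 / ka * ?M" using ka0 M0 by simp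
			fix x assume x: "x : pY"
			have "cmod ((f + g) x) <= cmod (f (R n x)) + cmod (g (x - R n x))"
				using norm_triangle_ineq[of "f x" "g x"] gS[OF x] by (simp add: fR)
			also have "... <= ?M * nY (R n x) + ?M * nY (x - R n x)"
			proof (rule add_mono)
				have "nD f * nY (R n x) <= ?M * nY (R n x)" using x by (intro mult_right_mono) auto
				then show "cmod (f (R n x)) <= ?M * nY (R n x)" using dual_bound[OF f, of "R n x"] x by simp
				have "nD g * nY (x - R n x) <= ?M * nY (x - R n x)" using x by (intro mult_right_mono) auto
				then show "cmod (g (x - R n x)) <= ?M * nY (x - R n x)" using dual_bound[OF g, of "x - R n x"] x by simp
			qed
			also have "... = ?M * (nY (R n x) + nY (x - R n x))" by (simp add: distrib_left)
			also have "... <= ?M * (2 / ka * nY x)"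
			proof (rule mult_left_mono[OF _ M0])
				have "ka * (nY (R n x) + nY (x - R n x)) <= 2 * nY (R n x + (x - R n x))"
					using x by (intro ka_ge[of _ _ n]) (auto simp: R_R R_tail)
				then show "nY (R n x) + nY (x - R n x) <= 2 / ka * nY x" using ka0 by (simp add: field_simps)
			qed
			finally show "cmod ((f + g) x) <= 2 / ka * ?M * nY x" by (simp add: mult_ac)
		qed
		let ?N = "nD (f + g)"
		have fg': "f + g : FY" using f g by (rule functionals_plus)
		\<comment> \<open>Unimodular factors align the phases of \<open>f u\<close> and
		  \<open>g v\<close>, so that both moduli are seen together on one vector \<open>a + b\<close>
		  built from disjoint pieces.\<close>
		have key: "cmod (f u) + cmod (g v) <= ka * ?N"
			if u: "u : pY" "nY u <= 1" and v: "v : pY" "nY v <= 1" for u v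
		proof -
			have ph: "EX w. cmod w = 1 & w * z = complex_of_real (cmod z)" for z
			proof (cases "z = 0")
				case False
				then show ?thesis
					by (intro exI[of _ "complex_of_real (cmod z) / z"]) (simp add: norm_divide)
			qed (auto intro: exI[of _ 1])
			obtain s where s: "cmod s = 1" "s * f u = complex_of_real (cmod (f u))" using ph by blast
			obtain t where t: "cmod t = 1" "t * g v = complex_of_real (cmod (g v))" using ph by blast
			define a where "a = s *C R n u"
			define b where "b = t *C (v - R n v)"
			have ab: "a : pY" "b : pY" "R n a = a" "R n b = 0" "nY a <= 1" "nY b <= 1"
				using u v s(1) t(1) R_le[OF u(1), of n] S_le[OF v(1), of n]
				by (auto simp: a_def b_def R_scale R_R R_tail nrm_scale)
			have fa: "f (a + b) = s * f u"
				using u v unfolding a_def b_def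
				by (subst bop_add[OF f]) (auto simp: bop_scale[OF f] fR fS scaleC_complex_def)
			have gb: "g (a + b) = t * g v"
				using u v unfolding a_def b_def
				by (subst bop_add[OF g]) (auto simp: bop_scale[OF g] gR gS scaleC_complex_def)
			have "complex_of_real (cmod (f u) + cmod (g v)) = (f + g) (a + b)" by (simp add: fa gb s t)
			then have "cmod (f u) + cmod (g v) = cmod ((f + g) (a + b))"
				by (metis abs_of_nonneg add_nonneg_nonneg norm_ge_zero norm_of_real)
			also have "... <= ?N * nY (a + b)" using dual_bound[OF fg'] ab by simp
			also have "... <= ?N * ka"
			proof (rule mult_left_mono)
				have "ka * max (nY a) (nY b) <= ka * 1" using ab ka0 by (intro mult_left_mono) auto
				moreover have "nY (a + b) <= ka * max (nY a) (nY b)" using ab by (intro ka_le)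
				ultimately show "nY (a + b) <= ka" by simp
				show "0 <= ?N" using fg' by (intro D.nrm_nonneg) simp
			qed
			finally show ?thesis by (simp only: mult.commute)
		qed
		\<comment> \<open>The suprema are taken one variable at a time, over \<open>u\<close> here and
		  over \<open>v\<close> next.\<close>
		have f1: "nD f <= ka * ?N - cmod (g v)" if "v : pY" "nY v <= 1" for v
			by (rule dual_le_unit) (use key[OF _ _ that] in \<open>simp add: algebra_simps\<close>)
		have "nD g <= ka * ?N - nD f"
			by (rule dual_le_unit) (use f1 in \<open>simp add: algebra_simps\<close>)
		then show "2 / ka * (nD f + nD g) <= 2 * ?N"
			using ka0 by (simp add: field_simps)
	qed
qed

text \<open>
  A unit vector \<open>z\<close> far out is paired with another one, \<open>w\<close>, still further out, such that the
  gauge of \<open>z - w\<close> is small; the supports of \<open>T z\<close> and \<open>T w\<close> are almost disjoint.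
\<close>

lemma gauge_lower_bound:
	assumes T: "T : LY" and k: "compact_gauge Y k"
		and le: "!!z. z : pY ==> c * nY z <= nY (T z) + k z" and dl: "dl > 0"
	obtains m where "!!z b. z : pY ==> R m z = 0 ==> R b z = z ==> (c - dl) * nY z <= nY (T z)"
proof (rule ccontr)
	note witness = that
	assume nt: "~ thesis"
	have Top: "T : ops Y" using T by (rule po_opsD)
	note [simp] = bop_in[OF Top]
	have ex: "EX z b. z : pY & nY z = 1 & R m z = 0 & R b z = z & nY (T z) < c - dl" for m
	proof -
		obtain z b where z: "z : pY" "R m z = 0" "R b z = z" "nY (T z) < (c - dl) * nY z"
			using nt witness[of m] by (meson not_le)
		have "z ~= 0" using z(4) bop_zero[OF Top] by auto
		then have pos: "nY z > 0" using z(1) by (simp add: nrm_pos_iff)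
		let ?u = "complex_of_real (1 / nY z) *C z"
		have "nY (T ?u) = nY (T z) / nY z"
			using z(1) pos by (simp add: bop_scale[OF Top] nrm_scale norm_divide)
		also have "... < c - dl" using z(4) pos by (simp add: pos_divide_less_eq)
		finally show ?thesis
			using z nrm_normalize[OF z(1) \<open>z ~= 0\<close>]
			by (intro exI[of _ ?u] exI[of _ b]) (simp add: R_scale)
	qed
	then obtain x b where x: "!!m. x m : pY" "!!m. nY (x m) = 1" "!!m. R m (x m) = 0"
		"!!m. R (b m) (x m) = x m" "!!m. nY (T (x m)) < c - dl" by metis
	have c\<delta>: "c - dl > 0" using x(5)[of 0] nrm_nonneg[of "T (x 0)"] x(1) by (simp del: nrm_nonneg)
	have x1: "nY (x n) <= 1" for n using x(2) by simp
	obtain r where r: "strict_mono (r :: nat => nat)"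
		"!!e. e > 0 ==> EX N. ALL i>=N. ALL j>=N. k (x (r i) - x (r j)) < e"
		using compact_gaugeD[OF k, of x 1] x(1) x1 by blast
	\<comment> \<open>Three errors of this size occur, two from the overlap of the images and one from
	  the gauge; together they stay below \<open>dl\<close>.\<close>
	define \<eta> where "\<eta> = dl / 4"
	have \<eta>: "\<eta> > 0" using dl by (simp add: \<eta>_def)
	obtain N where N: "!!i j. i >= N ==> j >= N ==> k (x (r i) - x (r j)) < \<eta>" using r(2)[OF \<eta>] by blast
	define z where "z = x (r N)"
	define b0 where "b0 = b (r N)"
	have z: "z : pY" "nY z = 1" "R b0 z = z" "nY (T z) < c - dl"
		using x by (auto simp: z_def b0_def)
	obtain n1 where n1: "!!n x. n >= n1 ==> x : pY ==> nY (T (R b0 x) - R n (T (R b0 x))) <= \<eta> * nY x"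
		"!!n x. n >= n1 ==> x : pY ==> nY (R b0 (T (x - R n x))) <= \<eta> * nY x"
		using poD[OF T \<eta>] by blast
	have tz: "nY (T z - R n1 (T z)) <= \<eta>" using n1(1)[OF order_refl z(1)] z by simp
	obtain n2 where n2: "!!n x. n >= n2 ==> x : pY ==> nY (T (R n1 x) - R n (T (R n1 x))) <= \<eta> * nY x"
		"!!n x. n >= n2 ==> x : pY ==> nY (R n1 (T (x - R n x))) <= \<eta> * nY x"
		using poD[OF T \<eta>] by blast
	\<comment> \<open>\<open>w\<close> starts beyond the support of \<open>z\<close>, and so far out
	  that \<open>T w\<close> is negligible where \<open>T z\<close> is concentrated.\<close>
	define j where "j = max N (max b0 n2)"
	have rj: "r j >= j" by (rule seq_suble[OF r(1)])
	define w where "w = x (r j)"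
	have w: "w : pY" "nY w = 1" "nY (T w) < c - dl" using x by (auto simp: w_def)
	have Rw: "R i w = 0" if "i <= r j" for i
	proof -
		have "R i w = R i (R (r j) w)" using R_R[OF w(1), of i "r j"] that by (simp add: min_absorb1)
		then show ?thesis using x(3)[of "r j"] by (simp add: w_def)
	qed
	have Rw': "R b0 w = 0" "R n2 w = 0" using rj by (auto intro!: Rw simp: j_def)
	have tw: "nY (R n1 (T w)) <= \<eta>" using n2(2)[OF order_refl w(1)] w Rw' by simp
	have kz: "k (z - w) < \<eta>" unfolding z_def w_def by (rule N) (auto simp: j_def)
	have "ka * (nY z + nY (- w)) <= 2 * nY (z + - w)"
		using z w Rw' by (intro ka_ge[of _ _ b0]) (auto simp: bop_uminus[OF R_ops])
	then have low: "ka <= nY (z - w)" using z w by (simp add: nrm_uminus)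
	\<comment> \<open>\<open>T z\<close> is replaced by its part under \<open>R n1\<close> and
	  \<open>T w\<close> by its tail, which makes the two disjoint.\<close>
	let ?a = "R n1 (T z)" and ?d = "T w - R n1 (T w)"
	have "nY (?a + - ?d) <= ka * max (nY ?a) (nY (- ?d))"
		using z w by (intro ka_le[of _ _ n1]) (auto simp: R_R R_diff R_tail bop_uminus[OF R_ops])
	also have "nY ?a <= c - dl" using R_le[of "T z" n1] z by simp
	moreover have "nY (- ?d) <= c - dl"
		using S_le[of "T w" n1] w nrm_uminus[of ?d] by (simp del: minus_diff_eq)
	ultimately have ad: "nY (?a + - ?d) <= ka * (c - dl)"
		using ka by (meson max.boundedI mult_left_mono order_trans zero_le_one)
	have "T (z - w) = (?a + - ?d) + ((T z - R n1 (T z)) - R n1 (T w))"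
		using z w by (simp add: op_diff[OF Top])
	then have "nY (T (z - w)) <= nY (?a + - ?d) + nY ((T z - R n1 (T z)) - R n1 (T w))"
		using z w by (simp only:) (intro nrm_add; simp)
	also have "nY ((T z - R n1 (T z)) - R n1 (T w)) <= nY (T z - R n1 (T z)) + nY (R n1 (T w))"
		using z w by (intro nrm_diff) auto
	finally have "nY (T (z - w)) <= ka * (c - dl) + 2 * \<eta>" using ad tz tw by simp
	moreover have "c * ka <= c * nY (z - w)" using low c\<delta> dl by (intro mult_left_mono) auto
	\<comment> \<open>Both sides carry \<open>ka\<close>, so only \<open>ka * dl\<close> is left to be
	  compared with the errors, and \<open>ka\<close> is at least 1.\<close>
	ultimately have "c * ka <= ka * (c - dl) + 3 * \<eta>" using le[of "z - w"] kz z w by simp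
	then have "ka * dl <= 3 / 4 * dl" by (simp add: \<eta>_def algebra_simps)
	moreover have "1 * dl <= ka * dl" using ka dl by (intro mult_right_mono) auto
	ultimately show False using dl by simp
qed

end

section \<open>Norm bounds for regularizers\<close>

context proj_space
begin

text \<open>On the tail of \<open>B y\<close> the operator \<open>A\<close> reproduces
  \<open>y\<close> up to small errors, so the lower bound of \<open>A\<close> limits that tail. As
  this bound is available for finitely supported vectors only, the tail is cut off once more, with
  an arbitrarily small error.\<close>

lemma regularizer_tail_bound:
	assumes A: "A : LY" and B: "B : LY" and AB: "(A o B) - id_op Y : KY"
		and c: "c > 0" "!!z b. z : pY ==> R m z = 0 ==> R b z = z ==> c * nY z <= nY (A z)"
		and \<eta>: "\<eta> > 0"
	obtains n where "!!y b. y : pY ==> R n y = 0 ==> R b y = y ==>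
		c * nY (B y - R m (B y)) <= (1 + \<eta>) * nY y"
proof -
	have Aop: "A : ops Y" and Bop: "B : ops Y" using A B by (auto intro: po_opsD)
	note [simp] = bop_in[OF Aop] bop_in[OF Bop]
	obtain a where a: "a > 0" "!!x. x : pY ==> nY (A x) <= a * nY x"
		using bop_bound[OF norm_space Aop] by blast
	have \<eta>2: "\<eta> / 2 > 0" "\<eta> / (2 * a) > 0" using \<eta> a by auto
	let ?K = "(A o B) - id_op Y"
	obtain N where N: "!!n x. n >= N ==> x : pY ==> nY (?K x - R n (?K x)) <= \<eta> / 2 * nY x"
		"!!n x. n >= N ==> x : pY ==> nY (?K (x - R n x)) <= \<eta> / 2 * nY x"
		using pcD[OF AB \<eta>2(1)] by blast
	obtain N' where N': "!!n x. n >= N' ==> x : pY ==> nY (B (R m x) - R n (B (R m x))) <= \<eta> / (2 * a) * nY x"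
		"!!n x. n >= N' ==> x : pY ==> nY (R m (B (x - R n x))) <= \<eta> / (2 * a) * nY x"
		using poD[OF B \<eta>2(2)] by blast
	define n where "n = max N N'"
	show ?thesis
	proof (rule that[of n])
		fix y b assume y: "y : pY" "R n y = 0" "R b y = y"
		let ?x = "B y"
		have 1: "nY (A ?x - y) <= \<eta> / 2 * nY y" using N(2)[of n y] y by (simp add: n_def)
		have "nY (R m ?x) <= \<eta> / (2 * a) * nY y" using N'(2)[of n y] y by (simp add: n_def)
		then have "a * nY (R m ?x) <= a * (\<eta> / (2 * a) * nY y)" using a by (intro mult_left_mono) auto
		then have 2: "nY (A (R m ?x)) <= \<eta> / 2 * nY y" using a(2)[of "R m ?x"] a(1) y by simp
		let ?q = "?x - R m ?x"
		have "A ?q = y + ((A ?x - y) - A (R m ?x))" using y by (simp add: op_diff[OF Aop])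
		then have "nY (A ?q) <= nY y + nY ((A ?x - y) - A (R m ?x))"
			using y by (simp only:) (intro nrm_add; simp)
		also have "nY ((A ?x - y) - A (R m ?x)) <= nY (A ?x - y) + nY (A (R m ?x))"
			using y by (intro nrm_diff) auto
		finally have Aq: "nY (A ?q) <= (1 + \<eta>) * nY y" using 1 2 by (simp add: algebra_simps)
		show "c * nY ?q <= (1 + \<eta>) * nY y"
		proof (rule field_le_epsilon)
			fix e :: real assume e: "e > 0"
			\<comment> \<open>The denominator makes the total error of the final cut at most
			  \<open>e\<close>; the added 1 covers \<open>y = 0\<close>.\<close>
			define e' where "e' = e / ((a + c) * (nY y + 1))"
			have pos: "(a + c) * (nY y + 1) > 0" using a c nrm_nonneg[OF y(1)] by (intro mult_pos_pos) auto
			then have e': "e' > 0" using e by (simp add: e'_def)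
			have e'e: "(a + c) * (e' * nY y) <= e"
			proof -
				have "(a + c) * (e' * nY y) <= (a + c) * (e' * (nY y + 1))"
					using a c e' by (intro mult_left_mono) auto
				also have "... = e' * ((a + c) * (nY y + 1))" by (simp add: mult_ac)
				also have "... = e"
					unfolding e'_def by (simp only: times_divide_eq_left
							nonzero_mult_div_cancel_right[OF less_imp_neq[OF pos, symmetric]])
				finally show ?thesis .
			qed
			obtain M where M: "!!n x. n >= M ==> x : pY ==> nY (B (R b x) - R n (B (R b x))) <= e' * nY x"
				"!!n x. n >= M ==> x : pY ==> nY (R b (B (x - R n x))) <= e' * nY x"
				using poD[OF B e'] by blast
			define t where "t = max M m"
			have tail: "?q - R t ?q = ?x - R t ?x" using y by (intro tail_tail) (auto simp: t_def)
			have qt: "nY (?q - R t ?q) <= e' * nY y"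
				unfolding tail using M(1)[of t y] y by (simp add: t_def)
			have "c * nY (R t ?q) <= nY (A (R t ?q))"
				using y by (intro c(2)[where b = t]) (auto simp: R_R R_diff t_def min_absorb1)
			also have "A (R t ?q) = A ?q - A (?q - R t ?q)" using y by (simp add: op_diff[OF Aop])
			also have "nY \<dots> <= nY (A ?q) + nY (A (?q - R t ?q))" using y by (intro nrm_diff) auto
			also have "nY (A (?q - R t ?q)) <= a * nY (?q - R t ?q)" using y by (intro a(2)) auto
			finally have "c * nY (R t ?q) <= (1 + \<eta>) * nY y + a * nY (?q - R t ?q)" using Aq by simp
			moreover have "c * nY ?q <= c * (nY (?q - R t ?q) + nY (R t ?q))"
				using c(1) y nrm_triangle2[of ?q "R t ?q"] by (intro mult_left_mono) auto
			moreover have "(a + c) * nY (?q - R t ?q) <= (a + c) * (e' * nY y)"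
				using qt a c by (intro mult_left_mono) auto
			ultimately show "c * nY ?q <= (1 + \<eta>) * nY y + e" using e'e by (simp add: algebra_simps)
		qed
	qed
qed

end

text \<open>\<open>sup\<close> holds in all the sequence spaces but fails in the dual for p =
  \<infinity>, where some nonzero functionals vanish on all finitely supported sequences. This is
  why the norm bound for regularizers gets a separate dual version.\<close>

locale proj_sup = proj_kappa Y R ka for Y :: "'a::complex_vector cnspace" and R ka +
	assumes sup: "x : pts Y ==> (!!j. nrm Y (R j x) <= c) ==> nrm Y x <= c"
		and tail_nontrivial: "EX x:pts Y. R n x = 0 & x ~= 0"
begin

text \<open>\<open>C\<close> is \<open>B\<close> cut off on both sides, a change within K(Y, R). On
  finitely supported vectors its bound is the tail estimate; in general each
  \<open>R j (C x)\<close> depends only slightly on far out entries of \<open>x\<close>, and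
  \<open>sup\<close> recovers the norm from these truncations.\<close>

lemma regularizer_norm:
	assumes A: "A : LY" and B: "B : LY" and AB: "(A o B) - id_op Y : KY"
		and c: "c > 0" "!!z b. z : pY ==> R m z = 0 ==> R b z = z ==> c * nY z <= nY (A z)"
		and eps: "eps > 0"
	obtains C where "C : LY" "C - B : KY"
		"!!x. x : pY ==> nY (C x) <= (1 / c + eps) * nY x"
proof -
	have Bop: "B : ops Y" using B by (rule po_opsD)
	note [simp] = bop_in[OF Bop]
	have ce: "c * eps > 0" using c eps by simp
	have "EX n. ALL y b. y : pY --> R n y = 0 --> R b y = y -->
		c * nY (B y - R m (B y)) <= (1 + c * eps) * nY y"
	proof (rule regularizer_tail_bound[where m = m and c = c, OF A B AB c(1) _ ce])
		show "c * nY z <= nY (A z)" if "z : pY" "R m z = 0" "R b z = z" for z b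
			using c(2) that .
	qed blast
	then obtain n where n: "!!y b. y : pY ==> R n y = 0 ==> R b y = y ==>
		c * nY (B y - R m (B y)) <= (1 + c * eps) * nY y"
		by blast
	define C where "C = (id_op Y - R m) o (B o (id_op Y - R n))"
	have Cx: "C x = B (x - R n x) - R m (B (x - R n x))" if "x : pY" for x
		using that by (simp add: C_def)
	have po_tail: "id_op Y - R j : LY" for j
		by (rule po_minus[OF po_id pc_subset_po[OF R_pc]])
	have C: "C : LY" unfolding C_def by (intro po_comp po_tail B)
	have Cop: "C : ops Y" using C by (rule po_opsD)
	have CB: "C - B = - (B o R n) - (R m o (B o (id_op Y - R n)))"
		by (rule bop_eqI[OF ops_minus[OF Cop Bop] ops_minus[OF ops_neg[OF ops_comp[OF Bop R_ops]]
					ops_comp[OF R_ops ops_comp[OF Bop tail_op]]]])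
			(simp add: Cx op_diff[OF Bop])
	have CBpc: "C - B : KY"
		unfolding CB by (intro pc_minus pc_neg po_pc[OF B R_pc] pc_po[OF _ R_pc] po_comp B po_tail)
	have fin: "nY (C (R b x)) <= (1 / c + eps) * nY x" if x: "x : pY" for b x
	proof -
		let ?y = "R b x - R n (R b x)"
		have y: "?y : pY" "R n ?y = 0" "R b ?y = ?y"
			using x by (auto simp: R_R R_diff min.commute)
		have "c * nY (C (R b x)) <= (1 + c * eps) * nY ?y" using n[OF y] x by (simp add: Cx)
		also have "... <= (1 + c * eps) * nY x"
			using S_le[of "R b x" n] R_le[OF x, of b] x ce by (intro mult_left_mono) auto
		finally show ?thesis using c(1) by (simp add: field_simps)
	qed
	have "nY (C x) <= (1 / c + eps) * nY x" if x: "x : pY" for x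
	proof (rule sup[OF bop_in[OF Cop x]], rule field_le_epsilon)
		fix j and e :: real assume e: "e > 0"
		define e' where "e' = e / (nY x + 1)"
		have pos: "nY x + 1 > 0" using nrm_nonneg[OF x] by simp
		have e': "e' > 0" using e pos by (simp add: e'_def)
		have "e' * nY x <= e' * (nY x + 1)" using e' by (intro mult_left_mono) auto
		also have "... = e" using pos by (simp add: e'_def)
		finally have e'e: "e' * nY x <= e" .
		obtain b where b: "!!n x. n >= b ==> x : pY ==> nY (C (R j x) - R n (C (R j x))) <= e' * nY x"
			"!!n x. n >= b ==> x : pY ==> nY (R j (C (x - R n x))) <= e' * nY x"
			using poD[OF C e'] by blast
		have "R j (C x) = R j (C (R b x)) + R j (C (x - R b x))"
			using x bop_in[OF Cop] by (simp add: op_diff[OF Cop] R_diff)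
		then have "nY (R j (C x)) <= nY (R j (C (R b x))) + nY (R j (C (x - R b x)))"
			using x bop_in[OF Cop] by (simp only:) (intro nrm_add; simp)
		also have "... <= (1 / c + eps) * nY x + e"
			using b(2)[OF order_refl x] e'e fin[OF x, of b] R_le[OF bop_in[OF Cop R_in[OF x]], of j b] by linarith
		finally show "nY (R j (C x)) <= (1 / c + eps) * nY x + e" .
	qed
	with C CBpc that show ?thesis by blast
qed

text \<open>The lower bound is known for the adjoint, so the two cuts are exchanged. A norming
  functional for a truncation of \<open>C x\<close> is itself cut to finite support, and the tail
  estimate for the adjoint of \<open>B\<close> at this functional bounds the value.\<close>

lemma regularizer_norm_dual:
	assumes A: "A : LY" and B: "B : LY" and BA: "(B o A) - id_op Y : KY"
		and c: "c > 0" "!!f b. f : pD ==> adj Y (R m) f = 0 ==> adj Y (R b) f = f ==>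
			c * nD f <= nD (adj Y A f)"
		and eps: "eps > 0"
	obtains C where "C : LY" "C - B : KY"
		"!!x. x : pY ==> nY (C x) <= (1 / c + eps) * nY x"
proof -
	interpret D: proj_space "dual Y" "%n. adj Y (R n)" by (rule dual_proj_space)
	have Aop: "A : ops Y" and Bop: "B : ops Y" using A B by (auto intro: po_opsD)
	note [simp] = bop_in[OF Bop] bop_in[OF Aop]
	have ce: "c * eps > 0" using c eps by simp
	have "(adj Y A o adj Y B) - id_op DY = adj Y ((B o A) - id_op Y)"
	proof (rule bop_eqI)
		show "(adj Y A o adj Y B) - id_op DY : ops DY"
			by (intro D.ops_minus D.ops_comp D.ops_id adj_ops Aop Bop)
		show "adj Y ((B o A) - id_op Y) : ops DY"
			by (intro adj_ops ops_minus ops_comp ops_id Aop Bop)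
		fix f assume f: "f : pD"
		then have f': "f : FY" by simp
		have "f o id_op Y = f" by (rule ext) (auto simp: id_op_def bop_zero[OF f'] bop_out[OF f'])
		then show "((adj Y A o adj Y B) - id_op DY) f = adj Y ((B o A) - id_op Y) f"
			using f adj_diff_apply[OF f' ops_comp[OF Bop Aop] ops_id]
			by (simp add: adj_apply functionals_comp[OF f' Bop] comp_assoc)
	qed
	then have AB': "(adj Y A o adj Y B) - id_op DY : proj_compact_ops DY (%n. adj Y (R n))"
		using adj_pc[OF BA] by simp
	have "EX n. ALL f b. f : pD --> adj Y (R n) f = 0 --> adj Y (R b) f = f -->
		c * nD (adj Y B f - adj Y (R m) (adj Y B f)) <= (1 + c * eps) * nD f"
	proof (rule D.regularizer_tail_bound[where m = m and c = c, OF adj_po[OF A] adj_po[OF B] AB' c(1) _ ce])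
		show "c * nD f <= nD (adj Y A f)"
			if "f : pD" "adj Y (R m) f = 0" "adj Y (R b) f = f" for f b
			using c(2) that .
	qed blast
	then obtain n where n: "!!f b. f : pD ==> adj Y (R n) f = 0 ==> adj Y (R b) f = f ==>
		c * nD (adj Y B f - adj Y (R m) (adj Y B f)) <= (1 + c * eps) * nD f"
		by blast
	define C where "C = (id_op Y - R n) o (B o (id_op Y - R m))"
	have Cx: "C x = B (x - R m x) - R n (B (x - R m x))" if "x : pY" for x
		using that by (simp add: C_def)
	have po_tail: "id_op Y - R j : LY" for j
		by (rule po_minus[OF po_id pc_subset_po[OF R_pc]])
	have C: "C : LY" unfolding C_def by (intro po_comp po_tail B)
	have Cop: "C : ops Y" using C by (rule po_opsD)
	have CB: "C - B = - (B o R m) - (R n o (B o (id_op Y - R m)))"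
		by (rule bop_eqI[OF ops_minus[OF Cop Bop] ops_minus[OF ops_neg[OF ops_comp[OF Bop R_ops]]
					ops_comp[OF R_ops ops_comp[OF Bop tail_op]]]])
			(simp add: Cx op_diff[OF Bop])
	have CBpc: "C - B : KY"
		unfolding CB by (intro pc_minus pc_neg po_pc[OF B R_pc] pc_po[OF _ R_pc] po_comp B po_tail)
	have "nY (C x) <= (1 / c + eps) * nY x" if x: "x : pY" for x
	proof (rule sup[OF bop_in[OF Cop x]])
		fix j
		have Cin: "C x : pY" using bop_in[OF Cop x] .
		obtain f where f: "f : FY" "nD f <= 1" "nY (R j (C x)) <= cmod (f (R j (C x)))"
			using norming_functional[of "R j (C x)"] Cin by auto
		\<comment> \<open>This functional is fixed by the adjoint of \<open>R j\<close> and annihilated by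
		  that of \<open>R n\<close>, as the dual tail estimate demands.\<close>
		define g where "g = f o (R j o (id_op Y - R n))"
		have jn: "R j o (id_op Y - R n) : ops Y" by (intro ops_comp R_ops tail_op)
		have g: "g : FY" unfolding g_def by (rule functionals_comp[OF f(1) jn])
		have gx: "g y = f (R j (y - R n y))" if "y : pY" for y using that by (simp add: g_def)
		have "nD g <= 1 * nD f"
			unfolding g_def
		proof (rule adj_bound[OF f(1)])
			fix y assume y: "y : pY"
			show "nY ((R j o (id_op Y - R n)) y) <= 1 * nY y"
				using R_le[of "y - R n y" j] S_le[OF y, of n] y by simp
		qed auto
		then have g1: "nD g <= 1" using f(2) by simp
		have "adj Y (R n) g = 0"
			unfolding adj_apply[OF g]
			by (rule bop_eqI[OF functionals_comp[OF g R_ops] functionals_zero]) (simp add: gx R_R bop_zero[OF f(1)])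
		moreover have "adj Y (R j) g = g"
			unfolding adj_apply[OF g]
			by (rule bop_eqI[OF functionals_comp[OF g R_ops] g]) (simp add: gx R_R R_diff min.commute)
		ultimately have "c * nD (adj Y B g - adj Y (R m) (adj Y B g)) <= (1 + c * eps) * nD g"
			using n[of g j] g by simp
		also have "... <= (1 + c * eps) * 1" using g1 ce by (intro mult_left_mono) auto
		finally have h: "nD (adj Y B g - adj Y (R m) (adj Y B g)) <= 1 / c + eps"
			using c(1) by (simp add: field_simps)
		have gB: "g o B : FY" by (rule functionals_comp[OF g Bop])
		have hx: "adj Y B g - adj Y (R m) (adj Y B g) = g o B o (id_op Y - R m)"
			using adj_tail[OF gB, of m] by (simp add: adj_apply[OF g] adj_apply[OF gB])
		have "f (R j (C x)) = (g o B o (id_op Y - R m)) x"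
			using x by (simp add: gx Cx)
		then have "cmod (f (R j (C x))) <= nD (g o B o (id_op Y - R m)) * nY x"
			using dual_bound[OF functionals_comp[OF gB tail_op] x] by simp
		also have "... <= (1 / c + eps) * nY x" using h x unfolding hx by (intro mult_right_mono) auto
		finally show "nY (R j (C x)) <= (1 / c + eps) * nY x" using f(3) by simp
	qed
	with C CBpc that show ?thesis by blast
qed

end

section \<open>Construction of regularizers\<close>

text \<open>
  The alternatives cover the sequence spaces: for \<open>p < \<infinity>\<close> (including \<open>p = 0\<close>) tails vanish, for
  \<open>p \<noteq> 0\<close> bounded sequences have subsequences converging entrywise, and for \<open>p \<in> {0, \<infinity>}\<close>
  the norm of a disjoint sum is the maximum of the norms.
\<close>

definition tails_vanish :: "'a::complex_vector cnspace => (nat => 'a => 'a) => bool"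
	where "tails_vanish Y R \<longleftrightarrow> (ALL x:pts Y. (%n. nrm Y (x - R n x)) ----> 0)"

definition locally_compact :: "'a::complex_vector cnspace => (nat => 'a => 'a) => bool"
	where "locally_compact Y R \<longleftrightarrow> (ALL (x :: nat => 'a) M. (ALL n. x n : pts Y & nrm Y (x n) <= M) -->
		(EX (r :: nat => nat) y. strict_mono r & y : pts Y & (ALL j. (%n. nrm Y (R j (x (r n)) - R j y)) ----> 0)))"

definition max_norm :: "'a::complex_vector cnspace => (nat => 'a => 'a) => bool"
	where "max_norm Y R \<longleftrightarrow> (ALL n. ALL u:pts Y. ALL v:pts Y. R n u = u --> R n v = 0 -->
		nrm Y (u + v) <= max (nrm Y u) (nrm Y v))"

text \<open>For p = 0 an entrywise limit may fail to vanish at infinity and so leave the space, and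
  for p = \<infinity> tails need not vanish. In each exceptional case the maximum norm compensates
  for the missing property.\<close>

locale lp_like = proj_sup Y R ka for Y :: "'a::complex_vector cnspace" and R ka +
	assumes compact_or: "locally_compact Y R \<or> tails_vanish Y R & max_norm Y R"
		and vanish_or: "tails_vanish Y R \<or> locally_compact Y R & max_norm Y R"
begin

definition tail_space :: "nat => 'a set"
	where "tail_space n = {x : pY. R n x = 0}"

lemma tlD: "x : tail_space n ==> x : pY" "x : tail_space n ==> R n x = 0"
	by (auto simp: tail_space_def)

lemma tl_mono: "x : tail_space n ==> m <= n ==> x : tail_space m"
	using R_R[of x m n] by (auto simp: tail_space_def min_absorb1)

lemma tail_in_tl: "x : pY ==> m <= n ==> x - R n x : tail_space m"
	by (auto simp: tail_space_def R_tail)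

lemma tl_subspace: "csubspace (tail_space n)"
	by (rule complex_vector.subspaceI) (auto simp: tail_space_def R_add R_scale)

lemma tl_closed: "closed_subspace Y (tail_space n)"
	unfolding closed_subspace_def
proof (intro conjI allI impI)
	fix x :: "nat => 'a" and y
	assume x: "ALL i. x i : tail_space n" and y: "y : pY" and lim: "(%i. nY (x i - y)) ----> 0"
	have "(%i. nY (R n (x i) - R n y)) ----> 0"
		by (rule op_limit[where x = x, OF R_ops norm_space _ y lim]) (use x tlD in blast)
	then have "(%i::nat. nY (- R n y)) ----> 0" using x tlD(2) by simp
	then have "nY (- R n y) = 0" by (simp only: LIMSEQ_const_iff)
	then have "R n y = 0" using nrm_eq_0[of "- R n y"] y by simp
	with y show "y : tail_space n" by (simp add: tail_space_def)
qed (use tl_subspace in \<open>auto simp: tail_space_def\<close>)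

lemma vanishD:
	assumes "(%n. nY (x - R n x)) ----> 0" "e > 0"
	obtains N where "!!n. n >= N ==> nY (x - R n x) < e"
	using order_tendstoD(2)[OF assms] by (auto simp: eventually_sequentially)

text \<open>Otherwise unit vectors ever farther out would have images tending to 0. In a Cauchy
  subsequence the truncations of an early member are small, because later members vanish there, and
  by \<open>sup\<close> the early member itself is small.\<close>

lemma tail_bounded_below:
	assumes A: "ess_below Y A" "A : ops Y"
	obtains n c where "c > 0" "!!x. x : tail_space n ==> c * nY x <= nY (A x)"
proof -
	have "EX n c. c > 0 & (ALL x:tail_space n. c * nY x <= nY (A x))"
	proof (rule ccontr)
		assume neg: "~ ?thesis"
		have "EX x:tail_space n. nY x = 1 & nY (A x) < 1 / real (Suc n)" for n
		proof -
			have "~ (ALL x:tail_space n. 1 / real (Suc n) * nY x <= nY (A x))"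
				using neg by (metis of_nat_0_less_iff zero_less_Suc zero_less_divide_1_iff)
			then obtain x where x: "x : tail_space n" "nY (A x) < 1 / real (Suc n) * nY x" by force
			have "x ~= 0" using x(2) bop_zero[OF A(2)] by auto
			then have pos: "nY x > 0" using tlD[OF x(1)] nrm_pos_iff by blast
			let ?u = "complex_of_real (1 / nY x) *C x"
			have "nY (A ?u) = nY (A x) / nY x"
				using tlD[OF x(1)] bop_in[OF A(2)] by (simp add: bop_scale[OF A(2)] nrm_scale norm_divide)
			also have "... < 1 / real (Suc n)" using x(2) pos by (simp add: pos_divide_less_eq)
			finally have "nY (A ?u) < 1 / real (Suc n)" .
			then show ?thesis
				using nrm_normalize[OF tlD(1)[OF x(1)] \<open>x ~= 0\<close>] csubspace_scale[OF tl_subspace x(1)]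
				by blast
		qed
		then obtain x where x: "!!n. x n : tail_space n" "!!n. nY (x n) = 1" "!!n. nY (A (x n)) < 1 / real (Suc n)"
			by metis
		have xin: "x n : pY" for n using tlD x(1) by blast
		have lim: "(%n. nY (A (x n) - 0)) ----> 0"
		proof (rule tendsto_sandwich[where f = "%_. 0" and h = "%n. 1 / real (Suc n)"])
			show "(%n. 1 / real (Suc n)) ----> 0" using LIMSEQ_Suc[OF lim_1_over_n] by simp
			show "\<forall>\<^sub>F n in sequentially. nY (A (x n) - 0) <= 1 / real (Suc n)"
				using x(3) by (auto intro!: always_eventually less_imp_le simp del: of_nat_Suc)
		qed (use xin bop_in[OF A(2)] in auto)
		have "cauchy_in Y (%n. A (x n))"
			by (rule limit_cauchy[OF _ _ lim]) (use xin bop_in[OF A(2)] in auto)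
		then obtain r where r: "strict_mono (r :: nat => nat)" "cauchy_in Y (%n. x (r n))"
			using ess_below_cauchy_subseq[where x = x and M = 1, OF A xin] x(2) by auto
		obtain N where N: "!!i j. i >= N ==> j >= N ==> nY (x (r i) - x (r j)) < 1 / 2"
			using cauchy_inD[OF r(2) half_gt_zero[OF zero_less_one]] by blast
		have "nY (x (r N)) <= 1 / 2"
		proof (rule sup[OF xin])
			fix j
			define i where "i = max N j"
			have "x (r i) : tail_space j" using tl_mono[OF x(1)] seq_suble[OF r(1), of i] by (simp add: i_def)
			then have "R j (x (r N)) = R j (x (r N) - x (r i))" using tlD xin by (simp add: R_diff)
			then show "nY (R j (x (r N))) <= 1 / 2"
				using R_le[of "x (r N) - x (r i)" j] xin N[of N i] by (simp add: i_def)
		qed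
		with x(2) show False by simp
	qed
	then show ?thesis using that by blast
qed

text \<open>Elements of L(X, P) are continuous for bounded entrywise convergence: far out entries
  hardly influence \<open>R j (A x)\<close>, and the part under a fixed \<open>R m\<close> converges
  in norm.\<close>

lemma po_entrywise_limit:
	assumes A: "A : LY" and x: "!!n. x n : pY" "!!n. nY (x n) <= M" "y : pY"
		and lim: "!!j. (%n. nY (R j (x n) - R j y)) ----> 0"
	shows "(%n. nY (R j (A (x n)) - R j (A y))) ----> 0"
proof (rule LIMSEQ_I)
	have Aop: "A : ops Y" using A by (rule po_opsD)
	note [simp] = bop_in[OF Aop]
	obtain a where a: "a > 0" "!!x. x : pY ==> nY (A x) <= a * nY x"
		using bop_bound[OF norm_space Aop] by blast
	fix e :: real assume e: "e > 0"
	define L where "L = M + nY y + 1"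
	have M0: "0 <= M" using x(2)[of 0] nrm_nonneg[OF x(1), of 0] by linarith
	have L: "L > 0" using M0 nrm_nonneg[OF x(3)] by (simp add: L_def)
	have e': "e / (2 * L) > 0" using e L by simp
	obtain m where m: "!!n x. n >= m ==> x : pY ==> nY (A (R j x) - R n (A (R j x))) <= e / (2 * L) * nY x"
		"!!n x. n >= m ==> x : pY ==> nY (R j (A (x - R n x))) <= e / (2 * L) * nY x"
		using poD[OF A e'] by blast
	have "e / (2 * a) > 0" using e a by simp
	then obtain N where N: "!!n. n >= N ==> nY (R m (x n) - R m y) < e / (2 * a)"
		using order_tendstoD(2)[OF lim[of m]] by (auto simp: eventually_sequentially)
	have "norm (nY (R j (A (x n)) - R j (A y)) - 0) < e" if n: "n >= N" for n
	proof -
		let ?d = "x n - y"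
		have d: "?d : pY" using x by simp
		have "nY ?d < L" using nrm_diff[OF x(1)[of n] x(3)] x(2)[of n] by (simp add: L_def)
		then have "e / (2 * L) * nY ?d <= e / (2 * L) * L" using e' by (intro mult_left_mono) auto
		also have "... = e / 2" using L by simp
		finally have "e / (2 * L) * nY ?d <= e / 2" .
		then have 1: "nY (R j (A (?d - R m ?d))) <= e / 2" using m(2)[OF order_refl d] by linarith
		have "nY (R j (A (R m ?d))) <= nY (A (R m ?d))" using d by (intro R_le) auto
		also have "... <= a * nY (R m ?d)" using d by (intro a(2)) auto
		also have "... < a * (e / (2 * a))"
			using N[OF n] x a(1) by (intro mult_strict_left_mono) (auto simp: R_diff)
		also have "... = e / 2" using a(1) by simp
		finally have 2: "nY (R j (A (R m ?d))) < e / 2" .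
		have "R j (A (x n)) - R j (A y) = R j (A (?d - R m ?d)) + R j (A (R m ?d))"
			using x by (simp add: op_diff[OF Aop] R_diff)
		then have "nY (R j (A (x n)) - R j (A y)) <= nY (R j (A (?d - R m ?d))) + nY (R j (A (R m ?d)))"
			using d by (simp only:) (intro nrm_add; simp)
		with 1 2 show ?thesis using x by simp
	qed
	then show "EX no. ALL n>=no. norm (nY (R j (A (x n)) - R j (A y)) - 0) < e" by blast
qed

lemma zero_if_R_zero: "x : pY ==> (!!j. R j x = 0) ==> x = 0"
	using sup[of x 0] nrm_mult_le_0[of 1 x] by simp

text \<open>Sums of many disjoint blocks with almost equal images contradict boundedness.\<close>

lemma compact_tails_small:
	assumes vm: "tails_vanish Y R" "max_norm Y R" and G: "G : compact_ops Y" and e: "e > 0"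
	obtains r where "!!y. y : tail_space r ==> nY (G y) <= e * nY y"
proof -
	have Gop: "G : ops Y" using G by (rule compact_opsD)
	note [simp] = bop_in[OF Gop]
	obtain g where g: "g > 0" "!!x. x : pY ==> nY (G x) <= g * nY x"
		using bop_bound[OF norm_space Gop] by blast
	have "EX r. ALL y:tail_space r. nY (G y) <= e * nY y"
	proof (rule ccontr)
		assume neg: "~ ?thesis"
		have "EX y:tail_space r. nY y = 1 & e <= nY (G y)" for r
		proof -
			obtain y where y: "y : tail_space r" "e * nY y < nY (G y)" using neg by (meson not_le)
			have "y ~= 0" using y(2) bop_zero[OF Gop] by auto
			then have pos: "nY y > 0" using tlD[OF y(1)] nrm_pos_iff by blast
			let ?u = "complex_of_real (1 / nY y) *C y"
			have "nY (G ?u) = nY (G y) / nY y"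
				using tlD[OF y(1)] by (simp add: bop_scale[OF Gop] nrm_scale norm_divide)
			moreover have "e <= nY (G y) / nY y" using y(2) pos by (simp add: pos_le_divide_eq)
			ultimately show ?thesis
				using nrm_normalize[OF tlD(1)[OF y(1)] \<open>y ~= 0\<close>] csubspace_scale[OF tl_subspace y(1)]
				by metis
		qed
		then obtain y where y: "!!r. y r : tail_space r" "!!r. nY (y r) = 1" "!!r. e <= nY (G (y r))" by metis
		have yin: "y r : pY" for r using tlD y(1) by blast
		have "ALL n. y n : pY & nY (y n) <= 1" using yin y(2) by simp
		then obtain s where s: "strict_mono (s :: nat => nat)" "cauchy_in Y (%n. G (y (s n)))"
			using G unfolding compact_ops_iff by blast
		have e4: "e / 4 > 0" using e by simp
		obtain N where N: "!!i j. i >= N ==> j >= N ==> nY (G (y (s i)) - G (y (s j))) < e / 4"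
			using cauchy_inD[OF s(2) e4] by blast
		define w where "w = G (y (s N))"
		have w: "w : pY" "e <= nY w" using yin y(3) by (auto simp: w_def)
		\<comment> \<open>Disjoint finitely supported blocks are added whose images are all close to the
		  same vector \<open>w\<close>. Each block may cost \<open>e / 2\<close>: a quarter of
		  \<open>e\<close> for the distance of its image from \<open>w\<close> and a quarter for cutting
		  it off.\<close>
		have blocks: "EX u t. u : pY & R t u = u & nY u <= 1 &
				nY (G u - of_nat k *C w) <= of_nat k * (e / 2)" for k
		proof (induction k)
			case 0
			show ?case by (intro exI[of _ 0]) (simp add: bop_zero[OF Gop])
		next
			case (Suc k)
			then obtain u t where u: "u : pY" "R t u = u" "nY u <= 1"
				"nY (G u - of_nat k *C w) <= of_nat k * (e / 2)" by blast
			define i where "i = max N t"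
			let ?y = "y (s i)"
			have "?y : tail_space t" using tl_mono[OF y(1)] seq_suble[OF s(1), of i] by (simp add: i_def)
			then have Ry: "R t ?y = 0" by (rule tlD)
			have "(%n. nY (?y - R n ?y)) ----> 0" using vm(1) yin by (auto simp: tails_vanish_def)
			then obtain q0 where q0: "!!n. n >= q0 ==> nY (?y - R n ?y) < e / (4 * g)"
				using vanishD[of ?y "e / (4 * g)"] e g(1) by auto
			define q where "q = max q0 t"
			let ?z = "R q ?y"
			have z: "?z : pY" "R t ?z = 0" "nY ?z <= 1"
				using yin Ry y(2) R_le[OF yin, of q] by (auto simp: R_R q_def min_absorb1)
			have "g * nY (?y - ?z) <= g * (e / (4 * g))"
				using q0[of q] g(1) by (intro mult_left_mono) (auto simp: q_def)
			also have "... = e / 4" using g(1) by simp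
			finally have gz: "nY (G (?z - ?y)) <= e / 4"
				using g(2)[of "?z - ?y"] yin nrm_commute[of ?z ?y] by simp
			have "nY (u + ?z) <= max (nY u) (nY ?z)"
				using vm(2) u z unfolding max_norm_def by blast
			then have n1: "nY (u + ?z) <= 1" using u(3) z(3) by simp
			have Rq: "R q u = u" using u R_R[OF u(1), of q t] by (simp add: q_def min_absorb2)
			have "G (u + ?z) - of_nat (Suc k) *C w = (G u - of_nat k *C w) + (G (?z - ?y) + (G ?y - w))"
				using u(1) yin by (simp add: bop_add[OF Gop] op_diff[OF Gop] cscale_left_distrib)
			then have "nY (G (u + ?z) - of_nat (Suc k) *C w)
					<= nY (G u - of_nat k *C w) + nY (G (?z - ?y) + (G ?y - w))"
				using u(1) yin w(1) by (simp only:) (intro nrm_add; simp)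
			also have "nY (G (?z - ?y) + (G ?y - w)) <= nY (G (?z - ?y)) + nY (G ?y - w)"
				using u(1) yin w(1) by (intro nrm_add) auto
			also have "nY (G ?y - w) < e / 4" unfolding w_def by (rule N) (auto simp: i_def)
			finally have "nY (G (u + ?z) - of_nat (Suc k) *C w) <= of_nat (Suc k) * (e / 2)"
				using u(4) gz by (simp add: algebra_simps)
			moreover have "R q (u + ?z) = u + ?z" using u(1) yin Rq by (simp add: R_add R_R)
			ultimately show ?case using n1 u(1) z(1) by (intro exI[of _ "u + ?z"] exI[of _ q]) simp
		qed
		\<comment> \<open>The sum of the blocks keeps norm at most 1 while its image has norm at least
		  \<open>k * (e / 2)\<close>, so any \<open>k\<close> beyond \<open>2 * g / e\<close> contradicts
		  the bound \<open>g\<close>.\<close>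
		obtain k :: nat where k: "2 * g / e < real k" using reals_Archimedean2 by blast
		obtain u where u: "u : pY" "nY u <= 1" "nY (G u - of_nat k *C w) <= of_nat k * (e / 2)"
			using blocks[of k] by blast
		have "real k * e <= nY (of_nat k *C w)" using w by (simp add: nrm_scale mult_left_mono)
		also have "... <= nY (of_nat k *C w - G u) + nY (G u)" using u w by (intro nrm_triangle2) auto
		also have "... <= real k * (e / 2) + g"
		proof (rule add_mono)
			show "nY (of_nat k *C w - G u) <= real k * (e / 2)"
				using u w nrm_commute[of "G u" "of_nat k *C w"] by simp
			have "g * nY u <= g * 1" using u(2) g(1) by (intro mult_left_mono) auto
			then show "nY (G u) <= g" using g(2)[OF u(1)] by simp
		qed
		finally have "real k * e <= 2 * g" by simp
		then have "real k <= 2 * g / e" using e by (simp add: pos_le_divide_eq)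
		with k show False by simp
	qed
	then show ?thesis using that by blast
qed

text \<open>
  Case \<open>p = \<infinity>\<close>: if \<open>A x\<close> has vanishing tails, then sums of many far out tails of \<open>x\<close> have images
  of bounded norm.
\<close>

lemma tails_vanish_preimage:
	assumes vm: "max_norm Y R" and A: "A : LY"
		and c: "c > 0" "!!x. x : tail_space n ==> c * nY x <= nY (A x)"
		and x: "x : tail_space n" "(%r. nY (A x - R r (A x))) ----> 0"
	shows "(%r. nY (x - R r x)) ----> 0"
proof (rule ccontr)
	have Aop: "A : ops Y" using A by (rule po_opsD)
	note [simp] = bop_in[OF Aop] tlD(1)[OF x(1)]
	obtain a where a: "a > 0" "!!x. x : pY ==> nY (A x) <= a * nY x"
		using bop_bound[OF norm_space Aop] by blast
	assume neg: "~ (%r. nY (x - R r x)) ----> 0"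
	have "EX e>0. ALL r. e <= nY (x - R r x)"
	proof (rule ccontr)
		assume ne: "~ ?thesis"
		have "(%r. nY (x - R r x)) ----> 0"
		proof (rule LIMSEQ_I)
			fix e :: real assume "e > 0"
			then obtain r where r: "nY (x - R r x) < e" using ne by (meson not_le)
			have "norm (nY (x - R i x) - 0) < e" if "i >= r" for i
				using tail_mono[of x r i] that r by simp
			then show "EX no. ALL n>=no. norm (nY (x - R n x) - 0) < e" by blast
		qed
		with neg show False by blast
	qed
	then obtain e where e: "e > 0" "!!r. e <= nY (x - R r x)" by blast
	\<comment> \<open>Each induction step costs \<open>2 * dl\<close>, a quarter of the gain
	  \<open>c * e\<close> that one more tail contributes.\<close>
	define dl where "dl = c * e / 8"
	have dl: "dl > 0" using c e by (simp add: dl_def)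
	define C where "C = a * nY x"
	\<comment> \<open>\<open>u\<close> is a sum of \<open>k\<close> tails of \<open>x\<close>: far out
	  it looks like \<open>k\<close> times \<open>x\<close>, while its image stays bounded up to small
	  costs.\<close>
	have tails: "EX u J. u : tail_space n & (ALL j>=J. u - R j u = of_nat k *C (x - R j x)) &
			nY (A u) <= C + 2 * real k * dl & (%r. nY (A u - R r (A u))) ----> 0" for k
	proof (induction k)
		case 0
		show ?case using a
			by (intro exI[of _ 0]) (simp add: bop_zero[OF Aop] C_def tail_space_def)
	next
		case (Suc k)
		then obtain u J where u: "u : tail_space n" "!!j. j >= J ==> u - R j u = of_nat k *C (x - R j x)"
			"nY (A u) <= C + 2 * real k * dl" "(%r. nY (A u - R r (A u))) ----> 0" by blast
		note [simp] = tlD(1)[OF u(1)]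
		obtain b where b: "!!i. i >= b ==> nY (A u - R i (A u)) < dl" using vanishD[OF u(4) dl] by blast
		define d where "d = dl / (nY x + 1)"
		have n1: "nY x + 1 > 0" using nrm_nonneg[of x] by (simp add: add_nonneg_pos)
		have d: "d > 0" using dl n1 by (simp add: d_def)
		obtain j0 where j0: "!!n y. n >= j0 ==> y : pY ==> nY (A (R b y) - R n (A (R b y))) <= d * nY y"
			"!!n y. n >= j0 ==> y : pY ==> nY (R b (A (y - R n y))) <= d * nY y"
			using poD[OF A d] by blast
		\<comment> \<open>The new tail starts so late that its image hardly meets the part of
		  \<open>A u\<close> under \<open>R b\<close>.\<close>
		define j where "j = max j0 (max n J)"
		let ?t = "x - R j x"
		have t: "?t : tail_space n" by (rule tail_in_tl) (auto simp: j_def)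
		note [simp] = tlD(1)[OF t]
		have "d * nY x <= d * (nY x + 1)" using d by (intro mult_left_mono) auto
		also have "... = dl" using n1 by (simp add: d_def)
		finally have Rb: "nY (R b (A ?t)) <= dl" using j0(2)[of j x] by (simp add: j_def)
		have "a * nY ?t <= a * nY x" using S_le[of x j] a(1) by (intro mult_left_mono) auto
		then have At: "nY (A ?t) <= C" unfolding C_def using a(2)[OF tlD(1)[OF t]] by linarith
		let ?p = "R b (A u)" and ?q = "A ?t - R b (A ?t)"
		\<comment> \<open>Disjointness of the two main parts gives a maximum instead of a sum, which
		  prevents \<open>C\<close> from accumulating with \<open>k\<close>.\<close>
		have "nY (?p + ?q) <= max (nY ?p) (nY ?q)"
		proof -
			have "R b ?p = ?p" "R b ?q = 0" by (auto simp: R_R R_tail)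
			then show ?thesis using vm unfolding max_norm_def by simp
		qed
		also have "... <= C + 2 * real k * dl"
		proof (rule max.boundedI)
			show "nY ?p <= C + 2 * real k * dl" using R_le[of "A u" b] u(3) by simp
			have "nY ?q <= C" using S_le[of "A ?t" b] At by simp
			then show "nY ?q <= C + 2 * real k * dl" using dl by (simp add: add_increasing2)
		qed
		finally have pq: "nY (?p + ?q) <= C + 2 * real k * dl" .
		have "A (u + ?t) = (?p + ?q) + ((A u - ?p) + R b (A ?t))" by (simp add: bop_add[OF Aop])
		then have "nY (A (u + ?t)) <= nY (?p + ?q) + nY ((A u - ?p) + R b (A ?t))"
			by (simp only:) (intro nrm_add; simp)
		also have "nY ((A u - ?p) + R b (A ?t)) <= nY (A u - ?p) + nY (R b (A ?t))" by (intro nrm_add) auto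
		finally have 1: "nY (A (u + ?t)) <= C + 2 * real (Suc k) * dl"
			using pq Rb b[OF order_refl] by (simp add: algebra_simps)
		have 2: "(u + ?t) - R i (u + ?t) = of_nat (Suc k) *C (x - R i x)" if "i >= max J j" for i
		proof -
			have "(u + ?t) - R i (u + ?t) = (u - R i u) + (?t - R i ?t)" by (simp add: R_add)
			also have "?t - R i ?t = x - R i x" by (rule tail_tail) (use that in auto)
			finally show ?thesis using u(2)[of i] that by (simp add: cscale_left_distrib)
		qed
		have 3: "(%r. nY (A (u + ?t) - R r (A (u + ?t)))) ----> 0"
		proof (rule tendsto_sandwich[where f = "%_. 0"])
			have "(%r. nY (A (R j x) - R r (A (R j x)))) ----> 0"
			proof (rule LIMSEQ_I)
				fix e :: real assume e: "e > 0"
				then have e': "e / (2 * (nY x + 1)) > 0" using n1 by simp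
				obtain N where N: "!!n y. n >= N ==> y : pY ==> nY (A (R j y) - R n (A (R j y))) <= e / (2 * (nY x + 1)) * nY y"
					"!!n y. n >= N ==> y : pY ==> nY (R j (A (y - R n y))) <= e / (2 * (nY x + 1)) * nY y"
					using poD[OF A e'] by blast
				have "e / (2 * (nY x + 1)) * nY x <= e / (2 * (nY x + 1)) * (nY x + 1)"
					using e' by (intro mult_left_mono) auto
				also have "... = e / 2" using n1 by (simp add: field_simps)
				finally have half: "e / (2 * (nY x + 1)) * nY x <= e / 2" .
				have "norm (nY (A (R j x) - R i (A (R j x))) - 0) < e" if "i >= N" for i
				proof -
					have "nY (A (R j x) - R i (A (R j x))) < e"
						using N(1)[OF that tlD(1)[OF x(1)]] half e by linarith
					then show ?thesis by simp
				qed
				then show "EX no. ALL n>=no. norm (nY (A (R j x) - R n (A (R j x))) - 0) < e" by blast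
			qed
			with u(4) x(2) show "(%r. nY (A u - R r (A u)) + (nY (A x - R r (A x)) +
					nY (A (R j x) - R r (A (R j x))))) ----> 0"
				by (auto intro!: tendsto_add_zero)
			have "nY (A (u + ?t) - R r (A (u + ?t))) <= nY (A u - R r (A u)) + (nY (A x - R r (A x)) +
					nY (A (R j x) - R r (A (R j x))))" for r
			proof -
				have "A (u + ?t) - R r (A (u + ?t)) =
						(A u - R r (A u)) + ((A x - R r (A x)) - (A (R j x) - R r (A (R j x))))"
					by (simp add: bop_add[OF Aop] op_diff[OF Aop] R_add R_diff)
				then have "nY (A (u + ?t) - R r (A (u + ?t)))
						<= nY (A u - R r (A u)) + nY ((A x - R r (A x)) - (A (R j x) - R r (A (R j x))))"
					by (simp only:) (intro nrm_add; simp)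
				also have "nY ((A x - R r (A x)) - (A (R j x) - R r (A (R j x))))
						<= nY (A x - R r (A x)) + nY (A (R j x) - R r (A (R j x)))" by (intro nrm_diff) auto
				finally show ?thesis by simp
			qed
			then show "\<forall>\<^sub>F r in sequentially. nY (A (u + ?t) - R r (A (u + ?t))) <= nY (A u - R r (A u)) +
					(nY (A x - R r (A x)) + nY (A (R j x) - R r (A (R j x))))" by simp
		qed auto
		have 0: "u + ?t : tail_space n" using u(1) t tl_subspace by (simp add: csubspace_add)
		from 0 1 2 3 show ?case by (intro exI[of _ "u + ?t"] exI[of _ "max J j"]) blast
	qed
	obtain k :: nat where k: "4 * C / (3 * (c * e)) < real k" using reals_Archimedean2 by blast
	have ce: "c * e > 0" using c e by simp
	obtain u J where u: "u : tail_space n" "!!j. j >= J ==> u - R j u = of_nat k *C (x - R j x)"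
		"nY (A u) <= C + 2 * real k * dl" using tails[of k] by blast
	have "real k * e <= nY (of_nat k *C (x - R J x))" using e(2)[of J] by (simp add: nrm_scale mult_left_mono)
	also have "... = nY (u - R J u)" using u(2)[OF order_refl] by simp
	also have "... <= nY u" by (rule S_le[OF tlD(1)[OF u(1)]])
	finally have "c * (real k * e) <= c * nY u" using c(1) by (intro mult_left_mono) auto
	also have "... <= C + 2 * real k * dl" using c(2)[OF u(1)] u(3) by simp
	finally have "real k * (3 * (c * e)) <= 4 * C" by (simp add: dl_def algebra_simps)
	then have "real k <= 4 * C / (3 * (c * e))" using ce by (simp add: pos_le_divide_eq)
	with k show False by simp
qed

end

lemma independent_complement:
	assumes "finite E"
	obtains D where "D \<subseteq> E" "E \<subseteq> cspan (M \<union> D)"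
		"!!h b. (SUM b:D. h b *C b) : M ==> b : D ==> h b = 0"
proof -
	define good where "good = (%D. D \<subseteq> E & E \<subseteq> cspan (M \<union> D))"
	have "good E" unfolding good_def using cspan_superset[of "M \<union> E"] by blast
	then obtain D where D: "good D" "!!D'. good D' ==> card D <= card D'"
		using ex_has_least_nat[of good E card] by blast
	have DE: "D \<subseteq> E" and ED: "E \<subseteq> cspan (M \<union> D)" using D(1) by (auto simp: good_def)
	have Dfin: "finite D" using DE assms finite_subset by auto
	have "h b = 0" if h: "(SUM b:D. h b *C b) : M" and b: "b : D" for h b
	proof (rule ccontr)
		assume hb: "h b ~= 0"
		have sp: "csubspace (cspan (M \<union> (D - {b})))" by simp
		have "(SUM b:D. h b *C b) - (SUM b:D - {b}. h b *C b) : cspan (M \<union> (D - {b}))"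
			by (intro complex_vector.span_diff cspan_sum cspan_scale
					cspan_base) (use h in auto)
		then have "h b *C b : cspan (M \<union> (D - {b}))" using Dfin b by (simp add: sum.remove[of D b])
		then have "inverse (h b) *C h b *C b : cspan (M \<union> (D - {b}))" by (rule cspan_scale)
		then have "b : cspan (M \<union> (D - {b}))" using hb by simp
		then have "M \<union> D \<subseteq> cspan (M \<union> (D - {b}))"
			using cspan_superset[of "M \<union> (D - {b})"] by blast
		then have "cspan (M \<union> D) \<subseteq> cspan (M \<union> (D - {b}))" by (rule cspan_minimal[OF _ sp])
		then have "good (D - {b})" using DE ED by (auto simp: good_def)
		then have "card D <= card (D - {b})" by (rule D(2))
		with Dfin b show False by (metis card_Diff1_less not_le)
	qed
	with DE ED that show ?thesis by blast
qed

section \<open>Splitting off the image of a tail space\<close>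

context lp_like
begin

text \<open>
  \<open>B\<close> inverts \<open>A\<close> on the tail space of index \<open>n\<close>, and \<open>W\<close> is a basis of a complement of the image
  of that tail space, with coordinate functionals \<open>om\<close>.
\<close>

definition regularizer :: "('a => 'a) => nat => ('a => 'a) => 'a set => ('a => 'a => complex) => bool"
	where "regularizer A n B W om \<longleftrightarrow> A : LY & B : LY &
		(ALL x:pY. R n (B x) = 0) & (ALL x:tail_space n. B (A x) = x) &
		finite W & W \<subseteq> pY & (ALL w:W. B w = 0) & (ALL w:W. EX l. R l w = w) &
		(ALL w. om w : FY) & (ALL w:W. ALL v:W. om w v = (if w = v then 1 else 0)) &
		(ALL w:W. ALL x:tail_space n. om w (A x) = 0) &
		(ALL y:pY. y = A (B y) + (SUM w:W. om w y *C w)) & (id_op Y - (A o B)) : KY"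

text \<open>The image of the tail space is closed, and by \<open>stab\<close> finitely many vectors
  in the image of \<open>R l\<close> complete it to a space containing every truncation
  \<open>R j y\<close>, and in the limit every \<open>y\<close>. The unique decomposition
  \<open>y = A x + S h\<close> defines \<open>B\<close> by \<open>x\<close> and \<open>om\<close> by
  the coefficients \<open>h\<close>.\<close>

lemma regularizer_exists:
	assumes A: "A : LY"
		and c: "c > 0" "!!x. x : tail_space n ==> c * nY x <= nY (A x)"
		and stab: "!!j y. y : pY ==> EX x:tail_space n. EX z:pY. R j y = A x + R l z"
	shows "EX B W om. regularizer A n B W om"
proof -
	have Aop: "A : ops Y" using A by (rule po_opsD)
	note [simp] = bop_in[OF Aop]
	obtain a where a: "a > 0" "!!x. x : pY ==> nY (A x) <= a * nY x"
		using bop_bound[OF norm_space Aop] by blast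
	define M where "M = A ` tail_space n"
	have M: "closed_subspace Y M" unfolding M_def by (rule closed_range_on[OF norm_space Aop tl_closed c])
	note MD = closed_subspaceD[OF M]
	have AM: "A x : M" if "x : tail_space n" for x using that by (simp add: M_def)
	obtain E e where E: "finite E" "E \<subseteq> pY" "!!b. b : E ==> R l b = b"
		"!!x. x : pY ==> R l x = (SUM b:E. e b x *C b)"
		by (rule R_coordinates[of l]) blast
	obtain D where DE: "D \<subseteq> E" and ED: "E \<subseteq> cspan (M \<union> D)"
		and indep: "!!h b. (SUM b:D. h b *C b) : M ==> b : D ==> h b = 0"
		using independent_complement[OF E(1), of M] by blast
	have Dfin: "finite D" and Din: "D \<subseteq> pY" using DE E(1,2) finite_subset by auto
	have Rl: "R l b = b" if "b : D" for b using that DE E(3) by blast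
	obtain C where C: "C > 0" "!!m h b. m : M ==> b : D ==> cmod (h b) <= C * nY (m + (SUM b:D. h b *C b))"
		using coefficient_bound[OF M Dfin Din] indep by blast
	define S where "S = (%h. SUM b:D. h b *C b)"
	have Sin [simp]: "S h : pY" for h unfolding S_def using Din by (intro sum_in) auto
	have Sspan: "S h : cspan D" for h unfolding S_def
		by (intro cspan_sum cspan_scale cspan_base)
	have RlS: "R j (S h) = S h" if "j >= l" for j h
	proof -
		have "R j b = b" if b: "b : D" for b
			using R_R[of b j l] Rl[OF b] b Din \<open>j >= l\<close> by (auto simp: min_absorb2)
		then show ?thesis unfolding S_def using Din by (subst op_sum[OF R_ops]) (auto simp: R_scale intro!: sum.cong)
	qed
	define \<beta> where "\<beta> = (SUM b:D. nY b)"
	have \<beta>: "\<beta> >= 0" unfolding \<beta>_def using Din by (intro sum_nonneg) auto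
	have Sbound: "nY (S h) <= C * \<beta> * nY (m + S h)" if m: "m : M" for m h
	proof -
		have "nY (S h) <= (SUM b:D. nY (h b *C b))"
			unfolding S_def using Din by (intro nrm_sum) auto
		also have "... <= (SUM b:D. C * nY (m + S h) * nY b)"
		proof (rule sum_mono)
			fix b assume b: "b : D"
			then have bY: "b : pY" using Din by blast
			have "cmod (h b) * nY b <= C * nY (m + S h) * nY b"
				using C(2)[OF m b, of h] bY by (intro mult_right_mono) (auto simp: S_def)
			then show "nY (h b *C b) <= C * nY (m + S h) * nY b" using bY by (simp add: nrm_scale)
		qed
		also have "... = C * \<beta> * nY (m + S h)" by (simp add: \<beta>_def sum_distrib_left sum_distrib_right mult_ac)
		finally show ?thesis .
	qed
	define gam where "gam = (1 + C * \<beta>) / c"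
	have gam: "gam >= 0" using C(1) \<beta> c(1) by (simp add: gam_def)
	have xbound: "nY x <= gam * nY (A x + S h)" if x: "x : tail_space n" for x h
	proof -
		have xin: "x : pY" using x by (rule tlD)
		have "c * nY x <= nY (A x)" by (rule c(2)[OF x])
		also have "... <= nY (A x + S h) + nY (S h)"
			using nrm_diff[of "A x + S h" "S h"] xin by simp
		also have "nY (S h) <= C * \<beta> * nY (A x + S h)" by (rule Sbound[OF AM[OF x]])
		finally have "c * nY x <= (1 + C * \<beta>) * nY (A x + S h)" by (simp add: algebra_simps)
		then show ?thesis using c(1) by (simp add: gam_def field_simps)
	qed
	have uniq: "x = x'" "!!b. b : D ==> h b = h' b"
		if x: "x : tail_space n" "x' : tail_space n" and eq: "A x + S h = A x' + S h'" for x x' h h'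
	proof -
		have xin: "x : pY" "x' : pY" using x by (auto dest: tlD)
		have d: "x' - x : tail_space n" using x tl_subspace by (simp add: csubspace_diff)
		have "S h - S h' = A (x' - x)" using eq xin by (simp add: op_diff[OF Aop] algebra_simps)
		moreover have "S h - S h' = (SUM b:D. (h b - h' b) *C b)"
			by (simp add: S_def sum_subtractf complex_vector.scale_left_diff_distrib)
		ultimately have "(SUM b:D. (h b - h' b) *C b) : M" using AM[OF d] by simp
		then show hh: "h b = h' b" if "b : D" for b using indep[of "%b. h b - h' b" b] that by simp
		have "S h = S h'" unfolding S_def by (rule sum.cong) (simp_all add: hh)
		with \<open>S h - S h' = A (x' - x)\<close> have "A (x' - x) = 0" by simp
		then have "c * nY (x' - x) <= 0" using c(2)[OF d] by simp
		then show "x = x'" using nrm_mult_le_0[OF c(1)] xin by force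
	qed
	have dec_span: "EX x:tail_space n. EX h. y = A x + S h" if yD: "y : cspan (M \<union> D)" for y
	proof -
		obtain m h where "m : M" "y = m + (SUM b:D. h b *C b)"
			using span_subspace_Un_finite[OF MD(2) Dfin yD] by blast
		then show ?thesis by (auto simp: M_def S_def)
	qed
	have Rj: "R j y : cspan (M \<union> D)" if y: "y : pY" for j y
	proof -
		obtain x z where xz: "x : tail_space n" "z : pY" "R j y = A x + R l z" using stab[OF y] by blast
		have "R l z : cspan (M \<union> D)"
			unfolding E(4)[OF xz(2)] using ED by (intro cspan_sum cspan_scale) auto
		moreover have "A x : cspan (M \<union> D)" using AM[OF xz(1)] by (intro cspan_base) simp
		ultimately show ?thesis unfolding xz(3) by (rule cspan_add[rotated])
	qed
	have clMD: "closed_subspace Y (cspan (M \<union> D))" by (rule closed_subspace_span_Un[OF M Dfin Din])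
	\<comment> \<open>Along a subsequence of bounded decompositions, one part converges entrywise and
	  the finite-dimensional part in norm, and the limits decompose the entrywise limit. This serves
	  both for the existence of decompositions and for their smallness on tails.\<close>
	have limit: "EX (r :: nat => nat) x h. strict_mono r & x : tail_space n & u = A x + S h &
			(%i. nY (S (hs (r i)) - S h)) ----> 0 & (ALL j. (%i. nY (R j (xs (r i)) - R j x)) ----> 0)"
		if lc: "locally_compact Y R" and xs: "!!i. xs i : tail_space n" and u: "u : pY"
			and bnd: "!!i. nY (A (xs i) + S (hs i)) <= b"
			and lim: "!!j. (%i. nY (R j (A (xs i) + S (hs i)) - R j u)) ----> 0" for xs hs u b
	proof -
		have xin: "xs i : pY" for i using xs by (rule tlD)
		have xb: "nY (xs i) <= gam * b" for i
			using xbound[OF xs[of i], of "hs i"] mult_left_mono[OF bnd[of i] gam] by linarith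
		have C\<beta>: "C * \<beta> >= 0" using C(1) \<beta> by simp
		have Sb: "nY (S (hs i)) <= C * \<beta> * b" for i
			using Sbound[OF AM[OF xs[of i]], of "hs i"] mult_left_mono[OF bnd[of i] C\<beta>] by linarith
		obtain r1 x where r1: "strict_mono (r1 :: nat => nat)" "x : pY"
			"!!j. (%i. nY (R j (xs (r1 i)) - R j x)) ----> 0"
			using lc xin xb unfolding locally_compact_def by blast
		obtain r2 s where r2: "strict_mono (r2 :: nat => nat)" "s : cspan D"
			"(%i. nY (S (hs (r1 (r2 i))) - s)) ----> 0"
			using finite_span_convergent_subseq[OF Dfin Din, of "%i. S (hs (r1 i))"] Sspan Sb by blast
		have sin: "s : pY" using r2(2) cspan_subset_pts[OF Din] by blast
		obtain h where h: "s = S h" using r2(2) Dfin by (auto simp: cspan_finite S_def)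
		define r where "r = r1 o r2"
		have r: "strict_mono r" unfolding r_def by (rule strict_mono_o[OF r1(1) r2(1)])
		have xl: "(%i. nY (R j (xs (r i)) - R j x)) ----> 0" for j
			using LIMSEQ_subseq_LIMSEQ[OF r1(3) r2(1)] by (simp add: r_def o_def)
		have Sl: "(%i. nY (S (hs (r i)) - S h)) ----> 0" using r2(3) by (simp add: r_def h)
		have "(%i::nat. nY (- R n x)) ----> 0" using xl[of n] tlD(2)[OF xs] by simp
		then have "nY (- R n x) = 0" by (simp only: LIMSEQ_const_iff)
		then have "R n x = 0" using nrm_eq_0[of "- R n x"] r1(2) by simp
		then have xt: "x : tail_space n" using r1(2) by (simp add: tail_space_def)
		have "u - (A x + S h) = 0"
		proof (rule zero_if_R_zero)
			fix j
			have 1: "(%i. nY (R j (A (xs (r i))) - R j (A x))) ----> 0"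
				by (rule po_entrywise_limit[where x = "%i. xs (r i)", OF A xin xb r1(2) xl])
			have 2: "(%i. nY (R j (S (hs (r i))) - R j (S h))) ----> 0"
				by (rule op_limit[where x = "%i. S (hs (r i))", OF R_ops norm_space Sin Sin Sl])
			have 3: "(%i. nY (R j (A (xs (r i)) + S (hs (r i))) - R j u)) ----> 0"
				using LIMSEQ_subseq_LIMSEQ[OF lim[of j] r] by (simp add: o_def)
			have 4: "(%i. nY (R j (A (xs (r i)) + S (hs (r i))) - R j (A x + S h))) ----> 0"
			proof (rule tendsto_sandwich[where f = "%_. 0"])
				show "(%i. nY (R j (A (xs (r i))) - R j (A x)) + nY (R j (S (hs (r i))) - R j (S h))) ----> 0"
					using 1 2 by (rule tendsto_add_zero)
				have "nY (R j (A (xs (r i)) + S (hs (r i))) - R j (A x + S h))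
						<= nY (R j (A (xs (r i))) - R j (A x)) + nY (R j (S (hs (r i))) - R j (S h))" for i
					using nrm_add[of "R j (A (xs (r i))) - R j (A x)" "R j (S (hs (r i))) - R j (S h)"] xin r1(2)
					by (simp add: R_add algebra_simps)
				then show "\<forall>\<^sub>F i in sequentially. nY (R j (A (xs (r i)) + S (hs (r i))) - R j (A x + S h))
						<= nY (R j (A (xs (r i))) - R j (A x)) + nY (R j (S (hs (r i))) - R j (S h))" by simp
			qed (use xin r1(2) in auto)
			have "R j (A x + S h) = R j u"
				by (rule limit_unique[OF _ _ _ 4 3]) (use xin r1(2) u in auto)
			then show "R j (u - (A x + S h)) = 0" using u r1(2) by (simp add: R_diff)
		qed (use u r1(2) in auto)
		then have "u = A x + S h" by simp
		with r xt Sl xl show ?thesis by blast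
	qed
	\<comment> \<open>With vanishing tails \<open>y\<close> is a norm limit of its truncations in a
	  closed sum; otherwise an entrywise limit of decompositions of the truncations is taken.\<close>
	have dec: "EX x:tail_space n. EX h. y = A x + S h" if y: "y : pY" for y
		using compact_or
	proof
		assume "tails_vanish Y R & max_norm Y R"
		then have lim: "(%j. nY (y - R j y)) ----> 0" using y by (simp add: tails_vanish_def)
		have "(%j. nY (R j y - y)) ----> 0" using lim nrm_commute[OF y R_in[OF y]] by simp
		then have "y : cspan (M \<union> D)" by (rule closed_subspaceD(3)[OF clMD Rj[OF y] y])
		then show ?thesis by (rule dec_span)
	next
		assume lc: "locally_compact Y R"
		have "ALL j. EX x h. x : tail_space n & R j y = A x + S h" using dec_span[OF Rj[OF y]] by blast
		then obtain xs hs where xs: "!!j. xs j : tail_space n" "!!j. R j y = A (xs j) + S (hs j)" by metis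
		have lim: "(%i. nY (R j (A (xs i) + S (hs i)) - R j y)) ----> 0" for j
		proof (rule tendsto_eventually, unfold eventually_sequentially, intro exI allI impI)
			fix i assume "i >= j"
			then show "nY (R j (A (xs i) + S (hs i)) - R j y) = 0"
				using R_R[OF y, of j i] by (simp add: xs(2)[symmetric] min_absorb1)
		qed
		show ?thesis using limit[OF lc xs(1) y _ lim, of "nY y"] R_le[OF y] xs(2) by metis
	qed
	then have "ALL y:pY. EX x h. x : tail_space n & y = A x + S h" by blast
	then obtain g h where gh: "!!y. y : pY ==> g y : tail_space n" "!!y. y : pY ==> y = A (g y) + S (h y)" by metis
	have gin [simp]: "y : pY ==> g y : pY" for y using gh(1) by (rule tlD)
	have Sadd: "S (%b. k b + k' b) = S k + S k'" for k k'
		by (simp add: S_def sum.distrib cscale_left_distrib)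
	have Sscale: "S (%b. t * k b) = t *C S k" for t k
		by (simp add: S_def complex_vector.scale_sum_right)
	have tadd: "x + y : tail_space n" "t *C x : tail_space n" if "x : tail_space n" "y : tail_space n" for x y t
		using that tl_subspace by (auto simp: csubspace_add csubspace_scale)
	have ghadd: "g (x + y) = g x + g y" "!!b. b : D ==> h (x + y) b = h x b + h y b"
		if xy: "x : pY" "y : pY" for x y
	proof -
		have eq: "A (g (x + y)) + S (h (x + y)) = A (g x + g y) + S (%b. h x b + h y b)"
			using gh(2)[of "x + y"] gh(2)[OF xy(1)] gh(2)[OF xy(2)] xy
			by (simp add: Sadd bop_add[OF Aop] algebra_simps)
		note u = uniq[OF gh(1) tadd(1)[OF gh(1) gh(1)] eq]
		show "g (x + y) = g x + g y" using u(1) xy by simp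
		show "h (x + y) b = h x b + h y b" if "b : D" for b using u(2) xy that by simp
	qed
	have ghscale: "g (t *C x) = t *C g x" "!!b. b : D ==> h (t *C x) b = t * h x b" if x: "x : pY" for x t
	proof -
		have eq: "A (g (t *C x)) + S (h (t *C x)) = A (t *C g x) + S (%b. t * h x b)"
			using gh(2)[of "t *C x"] gh(2)[OF x] x
			by (simp add: Sscale bop_scale[OF Aop] cscale_right_distrib[symmetric])
		note u = uniq[OF gh(1) tadd(2)[OF gh(1) gh(1)] eq]
		show "g (t *C x) = t *C g x" using u(1) x by simp
		show "h (t *C x) b = t * h x b" if "b : D" for b using u(2) x that by simp
	qed
	have hbound: "cmod (h y b) <= C * nY y" if y: "y : pY" and b: "b : D" for y b
		using C(2)[OF AM[OF gh(1)[OF y]] b, of "h y"] gh(2)[OF y] by (simp add: S_def)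
	define B where "B = zext Y g"
	have B: "B : ops Y"
		unfolding B_def
	proof (rule ops_zextI[where c = gam])
		show "nY (g x) <= gam * nY x" if x: "x : pY" for x
			using xbound[OF gh(1)[OF x], of "h x"] gh(2)[OF x] by simp
	qed (use ghadd ghscale in auto)
	note [simp] = bop_in[OF B]
	have Bx: "B x = g x" if "x : pY" for x using that by (simp add: B_def)
	define om where "om = (%b. if b : D then zext Y (%y. h y b) else 0)"
	have om: "om b : FY" for b
	proof (cases "b : D")
		case True
		have "zext Y (%y. h y b) : FY"
			by (rule bop_zextI[where c = C, OF norm_space])
				(use ghadd ghscale hbound True in \<open>auto simp: scaleC_complex_def\<close>)
		then show ?thesis using True by (simp add: om_def)
	qed (simp add: om_def functionals_zero)
	have omS: "(SUM w:D. om w y *C w) = S (h y)" if "y : pY" for y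
		unfolding S_def using that by (intro sum.cong) (auto simp: om_def)
	have BA: "B (A x) = x" "!!w. w : D ==> om w (A x) = 0" if x: "x : tail_space n" for x
	proof -
		have xin: "x : pY" using x by (rule tlD)
		have eq: "A (g (A x)) + S (h (A x)) = A x + S (%_. 0)" using gh(2)[of "A x"] xin by (simp add: S_def)
		note u = uniq[OF gh(1) x eq]
		show "B (A x) = x" using u(1) xin by (simp add: Bx)
		show "om w (A x) = 0" if "w : D" for w using u(2) xin that by (simp add: om_def)
	qed
	have t0: "0 : tail_space n" by (simp add: tail_space_def)
	have BW: "B w = 0" "!!v. v : D ==> om v w = (if v = w then 1 else 0)" if w: "w : D" for w
	proof -
		have win: "w : pY" using w Din by blast
		have "S (%b. if b = w then 1 else 0) = w"
			using Dfin w by (simp add: S_def if_distrib[where f = "%t. t *C _"] cong: if_cong)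
		then have eq: "A (g w) + S (h w) = A 0 + S (%b. if b = w then 1 else 0)"
			using gh(2)[OF win] bop_zero[OF Aop] by simp
		note u = uniq[OF gh(1) t0 eq]
		show "B w = 0" using u(1) win by (simp add: Bx)
		show "om v w = (if v = w then 1 else 0)" if "v : D" for v using u(2) win that by (simp add: om_def)
	qed
	let ?E = "id_op Y - (A o B)"
	have Eop: "?E : ops Y" by (intro ops_minus ops_id ops_comp Aop B)
	have Ex: "?E y = S (h y)" if y: "y : pY" for y
		using gh(2)[OF y] y by (simp add: Bx algebra_simps)
	\<comment> \<open>I - A B and \<open>R j o B\<close> must be small on far out vectors. Both are
	  compact, which suffices where \<open>compact_tails_small\<close> applies; otherwise unit vectors
	  moving out tend entrywise to 0, and \<open>limit\<close> makes their decompositions tend to that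
	  of 0.\<close>
	have small: "EX r. ALL y:tail_space r. nY (G y) <= e * nY y"
		if G: "G = ?E \<or> G = R j o B" and e: "e > 0" for G j and e :: real
		using compact_or
	proof
		assume v: "tails_vanish Y R & max_norm Y R"
		have "compact_gauge Y (%y. nY (?E y))"
			by (rule compact_gauge_finite_rank[OF norm_space Eop Dfin Din]) (simp only: Ex Sspan)
		then have "?E : compact_ops Y" using Eop by (simp only: compact_ops_gauge)
		moreover have "R j o B : compact_ops Y" by (rule compact_ops_comp_right[OF pc_compact[OF R_pc] B])
		ultimately have Gc: "G : compact_ops Y" using G by auto
		show ?thesis by (rule compact_tails_small[OF conjunct1[OF v] conjunct2[OF v] Gc e]) blast
	next
		assume lc: "locally_compact Y R"
		show ?thesis
		proof (rule ccontr)
			assume neg: "~ ?thesis"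
			have Gop: "G : ops Y" using G Eop ops_comp[OF R_ops B] by blast
			have "EX y:tail_space r. nY y = 1 & e <= nY (G y)" for r
			proof -
				obtain y where y: "y : tail_space r" "e * nY y < nY (G y)" using neg by (meson not_le)
				have "y ~= 0" using y(2) bop_zero[OF Gop] by auto
				then have pos: "nY y > 0" using tlD[OF y(1)] nrm_pos_iff by blast
				let ?u = "complex_of_real (1 / nY y) *C y"
				have "nY (G ?u) = nY (G y) / nY y"
					using tlD[OF y(1)] bop_in[OF Gop] by (simp add: bop_scale[OF Gop] nrm_scale norm_divide)
				moreover have "e <= nY (G y) / nY y" using y(2) pos by (simp add: pos_le_divide_eq)
				ultimately show ?thesis
					using nrm_normalize[OF tlD(1)[OF y(1)] \<open>y ~= 0\<close>] csubspace_scale[OF tl_subspace y(1)]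
					by metis
			qed
			then obtain y where y: "!!r. y r : tail_space r" "!!r. nY (y r) = 1" "!!r. e <= nY (G (y r))" by metis
			have yin: "y r : pY" for r using tlD y(1) by blast
			have yd: "A (g (y r)) + S (h (y r)) = y r" for r using gh(2)[OF yin] by simp
			have lim: "(%i. nY (R k (A (g (y i)) + S (h (y i))) - R k 0)) ----> 0" for k
			proof (rule tendsto_eventually, unfold eventually_sequentially, intro exI allI impI)
				fix i assume "i >= k"
				then show "nY (R k (A (g (y i)) + S (h (y i))) - R k 0) = 0"
					using tlD(2)[OF tl_mono[OF y(1)[of i]], of k] by (simp add: yd)
			qed
			have bnd: "nY (A (g (y i)) + S (h (y i))) <= 1" for i using y(2) by (simp add: yd)
			obtain r x k where r: "strict_mono (r :: nat => nat)" "x : tail_space n" "0 = A x + S k"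
				"(%i. nY (S (h (y (r i))) - S k)) ----> 0"
				"ALL j. (%i. nY (R j (g (y (r i))) - R j x)) ----> 0"
				using limit[of "%i. g (y i)" 0 "%i. h (y i)" 1, OF lc gh(1)[OF yin] zero_in bnd lim] by blast
			have "A x + S k = A 0 + S (%_. 0)" using r(3) bop_zero[OF Aop] by (simp add: S_def)
			note u = uniq[OF r(2) t0 this]
			have "S k = 0" unfolding S_def using u(2) by simp
			have "(%i. nY (G (y (r i)))) ----> 0"
			proof (cases "G = ?E")
				case True
				then show ?thesis using r(4) \<open>S k = 0\<close> Ex[OF yin] by simp
			next
				case False
				then have "G = R j o B" using G by blast
				then show ?thesis using spec[OF r(5), of j] u(1) yin by (simp add: Bx)
			qed
			then have "e <= 0" using y(3) by (intro LIMSEQ_le_const) auto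
			with e show False by simp
		qed
	qed
	have Epc: "?E : KY"
	proof (rule pcI[OF Eop])
		fix e :: real assume e: "e > 0"
		then obtain r where r: "!!y. y : tail_space r ==> nY (?E y) <= e * nY y"
			using small[of ?E 0] by blast
		define q where "q = max l r"
		have "nY (?E x - R q (?E x)) <= e * nY x & nY (?E (x - R q x)) <= e * nY x"
			if x: "x : pY" for x
		proof
			show "nY (?E x - R q (?E x)) <= e * nY x"
				unfolding Ex[OF x] using e x by (simp add: RlS q_def)
			have "nY (?E (x - R q x)) <= e * nY (x - R q x)"
				by (rule r) (rule tail_in_tl[OF x], simp add: q_def)
			also have "... <= e * nY x" using S_le[OF x] e by (intro mult_left_mono) auto
			finally show "nY (?E (x - R q x)) <= e * nY x" .
		qed
		then show "EX n. ALL x:pY. nY (?E x - R n (?E x)) <= e * nY x & nY (?E (x - R n x)) <= e * nY x"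
			by blast
	qed
	\<comment> \<open>Without vanishing tails in the whole space, \<open>A (g b)\<close> is still
	  finitely supported, and \<open>tails_vanish_preimage\<close> carries the vanishing of tails back
	  to \<open>g b\<close>.\<close>
	have Bvanish: "(%r. nY (B b - R r (B b))) ----> 0" if b: "b : pY" "R j b = b" for b j
		using vanish_or
	proof
		assume "tails_vanish Y R"
		then show ?thesis using b by (simp add: tails_vanish_def)
	next
		assume v: "locally_compact Y R & max_norm Y R"
		have Ag: "A (g b) = b - S (h b)" using gh(2)[OF b(1)] by (simp add: algebra_simps)
		have "(%r. nY (A (g b) - R r (A (g b)))) ----> 0"
		proof (rule tendsto_eventually, unfold eventually_sequentially, intro exI allI impI)
			fix r assume r: "r >= max j l"
			have "R r b = b" using R_R[OF b(1), of r j] b(2) r by (simp add: min_absorb2)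
			then show "nY (A (g b) - R r (A (g b))) = 0"
				unfolding Ag using r b(1) by (simp add: R_diff RlS)
		qed
		then have "(%r. nY (g b - R r (g b))) ----> 0"
			using tails_vanish_preimage[OF _ A c gh(1)[OF b(1)]] v by blast
		then show ?thesis using b by (simp add: Bx)
	qed
	have Bpo: "B : LY"
	proof (rule poI[OF B])
		fix j and e :: real assume e: "e > 0"
		obtain r where r: "!!y. y : tail_space r ==> nY ((R j o B) y) <= e * nY y"
			using small[of "R j o B" j e] e by blast
		have "nY (R j (B (x - R r x))) <= e * nY x" if x: "x : pY" for x
		proof -
			have "nY (R j (B (x - R r x))) <= e * nY (x - R r x)"
				using r[OF tail_in_tl[OF x order_refl]] by simp
			also have "... <= e * nY x" using S_le[OF x] e by (intro mult_left_mono) auto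
			finally show ?thesis .
		qed
		then show "EX n. ALL x:pY. nY (R j (B (x - R n x))) <= e * nY x" by blast
		\<comment> \<open>On the image of \<open>R j\<close> it is enough to control \<open>B\<close> at
		  finitely many basis vectors.\<close>
		obtain F f where F: "finite F" "F \<subseteq> pY" "!!b. b : F ==> R j b = b"
			"!!b. f b : FY" "!!x. x : pY ==> R j x = (SUM b:F. f b x *C b)"
			by (rule R_coordinates[of j]) blast
		have F': "b : pY" if "b : F" for b using F(2) that by blast
		have "(%r. SUM b:F. nD (f b) * nY (B b - R r (B b))) ----> (SUM b:F. nD (f b) * 0)"
			using Bvanish F' F(3) by (intro tendsto_sum tendsto_mult_left) auto
		then have "\<forall>\<^sub>F r in sequentially. (SUM b:F. nD (f b) * nY (B b - R r (B b))) < e"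
			using e by (intro order_tendstoD(2)) auto
		then obtain q where q: "(SUM b:F. nD (f b) * nY (B b - R q (B b))) < e"
			by (auto simp: eventually_sequentially)
		have "nY (B (R j x) - R q (B (R j x))) <= e * nY x" if x: "x : pY" for x
		proof -
			have "B (R j x) = (SUM b:F. f b x *C B b)"
				unfolding F(5)[OF x] using F' by (subst op_sum[OF B]) (auto simp: bop_scale[OF B])
			then have "B (R j x) - R q (B (R j x)) = (SUM b:F. f b x *C (B b - R q (B b)))"
				using F' by (simp add: op_sum[OF R_ops] R_scale cscale_right_diff_distrib sum_subtractf)
			then have "nY (B (R j x) - R q (B (R j x))) <= (SUM b:F. nY (f b x *C (B b - R q (B b))))"
				using nrm_sum[of F "%b. f b x *C (B b - R q (B b))"] F' by simp
			also have "... <= (SUM b:F. nD (f b) * nY (B b - R q (B b)) * nY x)"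
			proof (rule sum_mono)
				fix b assume b: "b : F"
				have "cmod (f b x) * nY (B b - R q (B b)) <= (nD (f b) * nY x) * nY (B b - R q (B b))"
					using dual_bound[OF F(4) x] F'[OF b] by (intro mult_right_mono) auto
				then show "nY (f b x *C (B b - R q (B b))) <= nD (f b) * nY (B b - R q (B b)) * nY x"
					using F'[OF b] by (simp add: nrm_scale mult_ac)
			qed
			also have "... = (SUM b:F. nD (f b) * nY (B b - R q (B b))) * nY x"
				by (simp add: sum_distrib_right)
			also have "... <= e * nY x" using q x by (intro mult_right_mono) auto
			finally show ?thesis .
		qed
		then show "EX n. ALL x:pY. nY (B (R j x) - R n (B (R j x))) <= e * nY x" by blast
	qed
	have "regularizer A n B D om"
		unfolding regularizer_def
	proof (intro conjI ballI)
		show "R n (B x) = 0" if "x : pY" for x using tlD(2)[OF gh(1)[OF that]] that by (simp add: Bx)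
		show "y = A (B y) + (SUM w:D. om w y *C w)" if "y : pY" for y
			using gh(2)[OF that] that by (simp add: omS Bx)
		show "EX l. R l w = w" if "w : D" for w using Rl[OF that] by blast
		show "om w v = (if w = v then 1 else 0)" if "w : D" "v : D" for w v using BW(2)[OF that(2,1)] .
	qed (use A Bpo BA Dfin Din BW(1) om Epc in auto)
	then show ?thesis by blast
qed

end

section \<open>Criteria for the existence of regularizers\<close>

text \<open>The exchange lemma modulo \<open>U\<close>: a finite basis \<open>U0\<close> of the
  components in \<open>U\<close> makes \<open>U0 \<union> H\<close> independent and contained in the
  span of \<open>U0 \<union> G\<close>, after which ordinary counting applies.\<close>

lemma independent_mod_bound:
	assumes U: "csubspace U" and G: "finite G" and H: "finite H" "H \<subseteq> cspan (U \<union> G)"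
		and indep: "!!c h. (SUM h:H. c h *C h) : U ==> h : H ==> c h = 0"
	shows "card H <= card G"
proof -
	have "EX m c. m : U & h = m + (SUM g:G. c g *C g)" if "h : H" for h
		using span_subspace_Un_finite[OF U G] H(2) that by blast
	then obtain m c where mc: "!!h. h : H ==> m h : U" "!!h. h : H ==> h = m h + (SUM g:G. c h g *C g)"
		by metis
	obtain U0 where U0: "U0 \<subseteq> m ` H" "cindependent U0" "m ` H \<subseteq> cspan U0"
		using complex_vector.maximal_independent_subset by blast
	have U0fin: "finite U0" using U0(1) H(1) finite_subset by auto
	have U0U: "cspan U0 \<subseteq> U" using U0(1) mc(1) by (intro cspan_minimal U) auto
	have disj: "U0 \<inter> H = {}"
	proof (rule ccontr)
		assume "U0 \<inter> H ~= {}"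
		then obtain u where u: "u : U0" "u : H" by blast
		have "(SUM h:H. (if h = u then 1 else 0) *C h) = u"
			using H(1) u by (simp add: if_distrib[where f = "%t. t *C _"] cong: if_cong)
		moreover have "u : U" using U0U cspan_base[OF u(1)] by blast
		ultimately show False using indep[of "%h. if h = u then 1 else 0" u] u by simp
	qed
	have "cindependent (U0 \<union> H)"
	proof (rule complex_vector.independent_if_scalars_zero)
		fix f x assume f: "(SUM x:U0 \<union> H. f x *C x) = 0" and x: "x : U0 \<union> H"
		have split: "(SUM x:U0. f x *C x) + (SUM x:H. f x *C x) = 0"
			using f unfolding sum.union_disjoint[OF U0fin H(1) disj] .
		have "(SUM x:U0. f x *C x) : U"
			using U0U by (intro subsetD[OF U0U] cspan_sum cspan_scale cspan_base)
		moreover have "(SUM x:H. f x *C x) = - (SUM x:U0. f x *C x)" using split by (simp add: add_eq_0_iff)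
		ultimately have "(SUM x:H. f x *C x) : U" using U by (simp add: complex_vector.subspace_neg)
		then have fH: "f h = 0" if "h : H" for h using indep that by blast
		then have "(SUM x:U0. f x *C x) = 0" using split by simp
		then have "f u = 0" if "u : U0" for u
			using complex_vector.independentD[OF U0(2) U0fin order_refl] that by blast
		with fH x show "f x = 0" by blast
	qed (use U0fin H in simp)
	moreover have "U0 \<union> H \<subseteq> cspan (U0 \<union> G)"
	proof -
		have "U0 \<subseteq> cspan (U0 \<union> G)" using cspan_superset[of "U0 \<union> G"] by blast
		moreover have "h : cspan (U0 \<union> G)" if h: "h : H" for h
		proof -
			have "m h : cspan (U0 \<union> G)" using U0(3) h complex_vector.span_mono[of U0 "U0 \<union> G"] by blast
			moreover have "(SUM g:G. c h g *C g) : cspan (U0 \<union> G)"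
				by (intro cspan_sum cspan_scale cspan_base) simp
			ultimately show ?thesis using mc(2)[OF h] cspan_add by metis
		qed
		ultimately show ?thesis by blast
	qed
	ultimately have "card (U0 \<union> H) <= card (U0 \<union> G)"
		using cindependent_span_bound[of "U0 \<union> G" "U0 \<union> H"] U0fin G by simp
	also have "... <= card U0 + card G" by (rule card_Un_le)
	finally show ?thesis using card_Un_disjoint[OF U0fin H(1) disj] by simp
qed

text \<open>Lets the open mapping theorem be applied to tail spaces and finite spans.\<close>

lemma (in banach_cn) closed_subspace_banach:
	assumes S: "closed_subspace Y S"
	shows "banach_cn \<lparr>pts = S, nrm = nY\<rparr>"
proof -
	note SD = closed_subspaceD[OF S]
	have Sin: "x : pY" if "x : S" for x using SD(1) that by blast
	show ?thesis
	proof
		fix x :: "nat => 'a"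
		assume x: "!!n. x n : pts \<lparr>pts = S, nrm = nY\<rparr>"
			and c: "!!e. e > 0 ==> EX N. ALL i>=N. ALL j>=N. nrm \<lparr>pts = S, nrm = nY\<rparr> (x i - x j) < e"
		have "x n : pY" for n using x Sin by simp
		then obtain y where y: "y : pY" "(%n. nY (x n - y)) ----> 0"
			using complete[of x] c by auto
		then show "EX y:pts \<lparr>pts = S, nrm = nY\<rparr>. (%n. nrm \<lparr>pts = S, nrm = nY\<rparr> (x n - y)) ----> 0"
			using SD(3)[of x y] x by auto
	qed (use SD(2) Sin nrm_eq_0 nrm_add nrm_scale in
			\<open>auto simp: complex_vector.subspace_0 csubspace_add csubspace_scale\<close>)
qed

section \<open>Stabilization of the image modulo finitely supported vectors\<close>

context lp_like
begin

text \<open>One \<open>l\<close> serves all \<open>j\<close>: modulo the image of the tail space,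
  finitely supported vectors reduce to a fixed finite-dimensional space. This is the hypothesis of
  \<open>regularizer_exists\<close> beyond the lower bound.\<close>

definition stabilizes :: "('a => 'a) => nat => bool"
	where "stabilizes A n \<longleftrightarrow> (EX l. ALL j. ALL y:pY. EX x:tail_space n. EX z:pY. R j y = A x + R l z)"

text \<open>If no \<open>l\<close> suffices, the closed sums of the image with that of
  \<open>R l\<close> keep growing strictly. Riesz vectors and separating functionals along them form
  a triangular system, which each of the following criteria contradicts by compactness or by
  counting.\<close>

lemma not_stabilizes_sequence:
	assumes A: "A : ops Y" and c: "c > 0" "!!x. x : tail_space n ==> c * nY x <= nY (A x)"
		and ns: "~ stabilizes A n"
	obtains y f where "!!k::nat. y k : pY" "!!k. nY (y k) <= 1" "!!k. f k : FY"
		"!!k. nD (f k) <= 1" "!!k x. x : tail_space n ==> f k (A x) = 0"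
		"!!j k. j < k ==> f k (y j) = 0" "!!k. 1 / 2 <= cmod (f k (y k))"
proof -
	note [simp] = bop_in[OF A]
	define M where "M = (%l. {A x + R l z | x z. x : tail_space n & z : pY})"
	have Mcl: "closed_subspace Y (M l)" for l
	proof -
		obtain E e where E: "finite E" "E \<subseteq> pY" "!!b. b : E ==> R l b = b"
			"!!x. x : pY ==> R l x = (SUM b:E. e b x *C b)"
			by (rule R_coordinates[of l]) blast
		have cl: "closed_subspace Y (A ` tail_space n)" by (rule closed_range_on[OF norm_space A tl_closed c])
		have "M l = cspan (A ` tail_space n \<union> E)"
		proof
			show "M l \<subseteq> cspan (A ` tail_space n \<union> E)"
			proof
				fix u assume "u : M l"
				then obtain x z where u: "u = A x + R l z" "x : tail_space n" "z : pY" by (auto simp: M_def)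
				show "u : cspan (A ` tail_space n \<union> E)"
					unfolding u(1) E(4)[OF u(3)] by (rule sum_in_span_Un) (use u E in auto)
			qed
			show "cspan (A ` tail_space n \<union> E) \<subseteq> M l"
			proof
				fix u assume "u : cspan (A ` tail_space n \<union> E)"
				then obtain m h where u: "m : A ` tail_space n" "u = m + (SUM b:E. h b *C b)"
					using span_subspace_Un_finite[OF closed_subspaceD(2)[OF cl] E(1)] by blast
				have sin: "(SUM b:E. h b *C b) : pY" using E(2) by (intro sum_in) auto
				have Rs: "R l (SUM b:E. h b *C b) = (SUM b:E. h b *C b)"
					using E(2,3) by (subst op_sum[OF R_ops]) (auto simp: R_scale subset_iff intro!: sum.cong)
				obtain x where "x : tail_space n" "m = A x" using u(1) by blast
				then show "u : M l" unfolding M_def u(2)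
					by (intro CollectI exI[of _ x] exI[of _ "SUM b:E. h b *C b"]) (simp add: Rs sin)
			qed
		qed
		then show ?thesis using closed_subspace_span_Un[OF cl E(1,2)] by simp
	qed
	note MD = closed_subspaceD[OF Mcl]
	have t0: "0 : tail_space n" by (simp add: tail_space_def)
	have Rin: "R l z : M l" if "z : pY" for l z
		using that t0 bop_zero[OF A] unfolding M_def by (intro CollectI exI[of _ 0] exI[of _ z]) simp
	have Ain: "A x : M l" if "x : tail_space n" for l x
		using that unfolding M_def by (intro CollectI exI[of _ x] exI[of _ 0]) simp
	have mono: "M l \<subseteq> M l'" if "l <= l'" for l l'
	proof
		fix u assume "u : M l"
		then obtain x z where u: "u = A x + R l z" "x : tail_space n" "z : pY" by (auto simp: M_def)
		have "R l z = R l' (R l z)" using R_R[OF u(3), of l' l] that by (simp add: min_absorb2)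
		with u R_in[OF u(3), of l] show "u : M l'"
			unfolding M_def by (intro CollectI exI[of _ x] exI[of _ "R l z"]) simp
	qed
	have "EX l' z f. l <= l' & z : M l' & nY z = 1 & f : FY & nD f <= 1 &
			(ALL m:M l. f m = 0) & 1 / 2 <= cmod (f z)" for l
	proof -
		have "EX j. EX y:pY. R j y ~: M l"
			using ns unfolding stabilizes_def M_def by blast
		then obtain j y where y: "y : pY" "R j y ~: M l" by blast
		define l' where "l' = max l j"
		have "R j y = R l' (R j y)" using R_R[OF y(1), of l' j] by (simp add: l'_def min_absorb2)
		then have "R j y : M l'" using Rin[OF R_in[OF y(1)], of l' j] by simp
		then obtain z where z: "z : M l'" "nY z = 1" "!!s. s : M l ==> 1 / 2 <= nY (z - s)"
			using riesz_lemma[OF Mcl[of l] MD(2)[of l'] mono MD(1)[of l'] _ y(2)] by (auto simp: l'_def)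
		obtain f where f: "f : FY" "!!x. x : pY ==> cmod (f x) <= nY x"
			"!!m. m : M l ==> f m = 0" "1 / 2 <= cmod (f z)"
			using hahn_banach[OF MD(2)[of l] MD(1)[of l] _ z(3)] z(1) MD(1)[of l'] by blast
		have "nD f <= 1" by (rule dual_le) (use f(2) in auto)
		then show ?thesis using z f by (intro exI[of _ l'] exI[of _ z] exI[of _ f]) (simp add: l'_def)
	qed
	then obtain L Z F where LZF: "!!l. l <= L l" "!!l. Z l : M (L l)" "!!l. nY (Z l) = 1"
		"!!l. F l : FY" "!!l. nD (F l) <= 1" "!!l m. m : M l ==> F l m = 0"
		"!!l. 1 / 2 <= cmod (F l (Z l))" by metis
	define s where "s = (%k. (L ^^ k) 0)"
	have sS: "s (Suc k) = L (s k)" for k by (simp add: s_def)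
	have smono: "s j <= s k" if "j <= k" for j k
		using that by (rule lift_Suc_mono_le[rotated]) (simp add: sS LZF(1))
	show ?thesis
	proof (rule that[of "%k. Z (s k)" "%k. F (s k)"])
		show "Z (s k) : pY" for k using LZF(2) MD(1) by blast
		show "F (s k) (A x) = 0" if "x : tail_space n" for k x using LZF(6)[OF Ain[OF that]] .
		show "F (s k) (Z (s j)) = 0" if "j < k" for j k
		proof -
			have "Z (s j) : M (s (Suc j))" using LZF(2)[of "s j"] by (simp add: sS)
			then have "Z (s j) : M (s k)" using mono[OF smono[of "Suc j" k]] that by auto
			then show ?thesis by (rule LZF(6))
		qed
	qed (use LZF in auto)
qed

lemma tail_split:
	assumes "A : ops Y" "x : pY"
	shows "A x = A (R n x) + A (x - R n x)" "x - R n x : tail_space n"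
	using assms by (auto simp: op_diff tail_space_def R_tail)

text \<open>The functionals \<open>f k o A\<close> are fixed by the adjoint of \<open>R n\<close>,
  hence range over a finite-dimensional space. An adjoint bounded below up to a gauge would force
  some of the \<open>f k\<close> close together, but the triangular system keeps them 1 / 2
  apart.\<close>

lemma stabilizes_dual:
	assumes A: "A : ops Y" and c: "c > 0" "!!x. x : tail_space n ==> c * nY x <= nY (A x)"
		and ess: "ess_below DY (adj Y A)"
	shows "stabilizes A n"
proof (rule ccontr)
	interpret D: proj_space "dual Y" "%n. adj Y (R n)" by (rule dual_proj_space)
	assume ns: "~ stabilizes A n"
	obtain y f where y: "!!k::nat. y k : pY" "!!k. nY (y k) <= 1"
		and f: "!!k. f k : FY" "!!k. nD (f k) <= 1"
			"!!k x. x : tail_space n ==> f k (A x) = 0"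
		and fy: "!!j k. j < k ==> f k (y j) = 0" "!!k. 1 / 2 <= cmod (f k (y k))"
		by (rule not_stabilizes_sequence[OF A c ns]) (assumption | (rule that; assumption))+
	have fA: "f k o A : FY" for k by (rule functionals_comp[OF f(1) A])
	have fAR: "adj Y (R n) (f k o A) = f k o A" for k
		unfolding adj_apply[OF fA]
	proof (rule bop_eqI[OF functionals_comp[OF fA R_ops] fA])
		fix x assume x: "x : pY"
		have "f k (A x) = f k (A (R n x)) + f k (A (x - R n x))"
			unfolding tail_split(1)[OF A x, of n] using x bop_in[OF A] by (intro bop_add[OF f(1)]) auto
		then show "(f k o A o R n) x = (f k o A) x" using f(3)[OF tail_split(2)[OF A x]] by simp
	qed
	have fin: "f k : pD" for k using f(1) by simp
	have aop: "adj Y A : ops DY" by (rule adj_ops[OF A])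
	have bnd: "nD (f k) <= 1" for k by (rule f(2))
	obtain r where r: "strict_mono (r :: nat => nat)"
		"!!e. e > 0 ==> EX N. ALL i>=N. ALL j>=N. nD (adj Y (R n) (adj Y A (f (r i) - f (r j)))) < e"
		using compact_gaugeD[OF D.gauge_R_comp[OF aop, of n], of f 1] fin bnd by blast
	have "cauchy_in DY (%k. adj Y A (f (r k)))"
		unfolding cauchy_in_def
	proof (intro allI impI)
		fix e :: real assume "e > 0"
		have "adj Y (R n) (adj Y A (f i - f j)) = adj Y A (f i) - adj Y A (f j)" for i j
			using D.op_diff[OF aop fin fin] D.R_diff[OF bop_in[OF aop fin] bop_in[OF aop fin]]
			by (simp add: adj_apply[OF f(1)] fAR)
		then show "EX N. ALL i>=N. ALL j>=N. nD (adj Y A (f (r i)) - adj Y A (f (r j))) < e"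
			using r(2)[OF \<open>e > 0\<close>] by simp
	qed
	then obtain r' where r': "strict_mono (r' :: nat => nat)" "cauchy_in DY (%k. f (r (r' k)))"
		using D.ess_below_cauchy_subseq[OF ess aop, of "%k. f (r k)" 1] fin bnd by blast
	obtain N where N: "!!i j. i >= N ==> j >= N ==> nD (f (r (r' i)) - f (r (r' j))) < 1 / 2"
		using cauchy_inD[OF r'(2) half_gt_zero[OF zero_less_one]] by blast
	define j k where "j = r (r' N)" and "k = r (r' (Suc N))"
	have jk: "j < k" unfolding j_def k_def using strict_monoD[OF r(1)] strict_monoD[OF r'(1)] by simp
	have "cmod ((f j - f k) (y j)) <= nD (f j - f k) * nY (y j)"
		using dual_bound[of "f j - f k" "y j"] D.diff_in[OF fin fin] y by simp
	also have "... <= nD (f j - f k) * 1"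
		using D.nrm_nonneg[OF D.diff_in[OF fin fin]] y(2) by (intro mult_left_mono) auto
	also have "... < 1 / 2" using N[of N "Suc N"] by (simp add: j_def k_def)
	finally show False using fy(1)[OF jk] fy(2)[of j] by simp
qed

text \<open>For a difference d of two \<open>y\<close>, the functional sees A C d only through A (R
  n (C d)). With A C = I + K this makes \<open>f j (y j)\<close> a difference of values at images of
  d under compact operators, hence small for suitable indices.\<close>

lemma stabilizes_right_inverse:
	assumes A: "A : ops Y" and c: "c > 0" "!!x. x : tail_space n ==> c * nY x <= nY (A x)"
		and C: "C : ops Y" and K: "K : compact_ops Y" and AC: "!!y. y : pY ==> A (C y) = y + K y"
	shows "stabilizes A n"
proof (rule ccontr)
	have Kop: "K : ops Y" using K by (rule compact_opsD)
	note [simp] = bop_in[OF A] bop_in[OF C] bop_in[OF Kop]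
	assume ns: "~ stabilizes A n"
	obtain y f where y: "!!k::nat. y k : pY" "!!k. nY (y k) <= 1"
		and f: "!!k. f k : FY" "!!k. nD (f k) <= 1"
			"!!k x. x : tail_space n ==> f k (A x) = 0"
		and fy: "!!j k. j < k ==> f k (y j) = 0" "!!k. 1 / 2 <= cmod (f k (y k))"
		by (rule not_stabilizes_sequence[OF A c ns]) (assumption | (rule that; assumption))+
	obtain a where a: "a > 0" "!!x. x : pY ==> nY (A x) <= a * nY x"
		using bop_bound[OF norm_space A] by blast
	have "compact_gauge Y (%x. nY (K x) + nY (R n (C x)))"
		using K gauge_R_comp[OF C] by (intro compact_gauge_add) (auto simp: compact_ops_gauge)
	then obtain r where r: "strict_mono (r :: nat => nat)"
		"!!e. e > 0 ==> EX N. ALL i>=N. ALL j>=N. nY (K (y (r i) - y (r j))) + nY (R n (C (y (r i) - y (r j)))) < e"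
		using compact_gaugeD[of Y _ y 1] y by blast
	\<comment> \<open>With this bound the two terms together stay below 1 / 4, against the lower bound
	  1 / 2.\<close>
	have pos: "1 / (4 * (a + 1)) > 0" using a by simp
	obtain N where N: "!!i j. i >= N ==> j >= N ==>
			nY (K (y (r i) - y (r j))) + nY (R n (C (y (r i) - y (r j)))) < 1 / (4 * (a + 1))"
		using r(2)[OF pos] by blast
	define i j where "i = r N" and "j = r (Suc N)"
	have ij: "i < j" unfolding i_def j_def using strict_monoD[OF r(1)] by simp
	let ?d = "y j - y i"
	have d: "?d : pY" using y by simp
	have small: "nY (K ?d) + nY (R n (C ?d)) < 1 / (4 * (a + 1))"
		using N[of "Suc N" N] by (simp add: i_def j_def)
	have "f j (A (C ?d)) = f j (A (R n (C ?d))) + f j (A (C ?d - R n (C ?d)))"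
		unfolding tail_split(1)[OF A bop_in[OF C d], of n] using d by (intro bop_add[OF f(1)]) auto
	also have "... = f j (A (R n (C ?d)))" using f(3)[OF tail_split(2)[OF A bop_in[OF C d]]] by simp
	finally have 1: "f j (A (C ?d)) = f j (A (R n (C ?d)))" .
	have "f j (A (C ?d)) = f j ?d + f j (K ?d)"
		unfolding AC[OF d] using d by (intro bop_add[OF f(1)]) auto
	moreover have "f j ?d = f j (y j)" using op_diff[OF f(1) y(1) y(1)] fy(1)[OF ij] by simp
	ultimately have "f j (y j) = f j (A (R n (C ?d))) - f j (K ?d)" using 1 by simp
	then have "cmod (f j (y j)) <= cmod (f j (A (R n (C ?d)))) + cmod (f j (K ?d))"
		using norm_triangle_ineq4 by metis
	also have "... <= a * nY (R n (C ?d)) + nY (K ?d)"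
	proof (rule add_mono)
		have f1: "cmod (f j x) <= nY x" if "x : pY" for x
			using dual_bound[OF f(1) that, of j] mult_right_mono[OF f(2)[of j] nrm_nonneg[OF that]] by simp
		show "cmod (f j (K ?d)) <= nY (K ?d)" using d by (intro f1) auto
		show "cmod (f j (A (R n (C ?d)))) <= a * nY (R n (C ?d))"
			using f1[of "A (R n (C ?d))"] a(2)[of "R n (C ?d)"] d by simp
	qed
	also have "... <= (a + 1) * (nY (K ?d) + nY (R n (C ?d)))"
		using a d by (simp add: algebra_simps)
	also have "... < (a + 1) * (1 / (4 * (a + 1)))" using small a(1) by (intro mult_strict_left_mono) auto
	also have "... = 1 / 4" using a(1) by simp
	finally show False using fy(2)[of j] by simp
qed

text \<open>The triangular system makes the \<open>y k\<close> independent modulo the image of the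
  tail space, so a finite spanning set of the quotient limits their number.\<close>

lemma stabilizes_fin_codim:
	assumes A: "A : ops Y" and c: "c > 0" "!!x. x : tail_space n ==> c * nY x <= nY (A x)"
		and G: "finite G" "pY \<subseteq> cspan (A ` tail_space n \<union> G)"
	shows "stabilizes A n"
proof (rule ccontr)
	assume ns: "~ stabilizes A n"
	obtain y f where y: "!!k::nat. y k : pY" "!!k. nY (y k) <= 1"
		and f: "!!k. f k : FY" "!!k. nD (f k) <= 1"
			"!!k x. x : tail_space n ==> f k (A x) = 0"
		and fy: "!!j k. j < k ==> f k (y j) = 0" "!!k. 1 / 2 <= cmod (f k (y k))"
		by (rule not_stabilizes_sequence[OF A c ns]) (assumption | (rule that; assumption))+
	have fyk: "f k (y k) ~= 0" for k using fy(2)[of k] by auto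
	have inj: "inj y"
	proof (rule injI, rule ccontr)
		fix i j assume "y i = y j" "i ~= j"
		then show False using fy(1)[of i j] fy(1)[of j i] fyk[of i] fyk[of j] by (metis nat_neq_iff)
	qed
	have zero: "ALL i<k. t i = 0" if "(\<Sum>i<k. t i *C y i) : A ` tail_space n" for k and t :: "nat => complex"
		using that
	proof (induction k)
		case (Suc k)
		from Suc.prems obtain x where x: "x : tail_space n" "(\<Sum>i<Suc k. t i *C y i) = A x" by blast
		have "f k (\<Sum>i<Suc k. t i *C y i) = (\<Sum>i<Suc k. t i * f k (y i))"
			using y(1) by (subst op_sum[OF f(1)]) (auto simp: bop_scale[OF f(1)] scaleC_complex_def)
		also have "... = t k * f k (y k)" using fy(1) by simp
		finally have tk: "t k = 0" using f(3)[OF x(1)] x(2) fyk by simp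
		then have "(\<Sum>i<k. t i *C y i) : A ` tail_space n" using Suc.prems by simp
		then have "ALL i<k. t i = 0" by (rule Suc.IH)
		with tk show ?case by (simp add: less_Suc_eq all_conj_distrib imp_disjL)
	qed simp
	define H where "H = y ` {..card G}"
	have injH: "inj_on y {..card G}" using inj by (rule inj_on_subset) simp
	have "card H <= card G"
	proof (rule independent_mod_bound[OF _ G(1)])
		show "csubspace (A ` tail_space n)"
			by (rule closed_subspaceD(2)[OF closed_range_on[OF norm_space A tl_closed c]])
		show "finite H" by (simp add: H_def)
		show "H \<subseteq> cspan (A ` tail_space n \<union> G)" using G(2) y(1) by (auto simp: H_def)
		fix t h assume t: "(SUM h:H. t h *C h) : A ` tail_space n" and h: "h : H"
		have "(SUM h:H. t h *C h) = (\<Sum>i<Suc (card G). t (y i) *C y i)"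
			unfolding H_def sum.reindex[OF injH] by (simp add: lessThan_Suc_atMost)
		then have "(\<Sum>i<Suc (card G). t (y i) *C y i) : A ` tail_space n" using t by simp
		then have "ALL i<Suc (card G). t (y i) = 0" by (rule zero)
		moreover obtain i where "i <= card G" "h = y i" using h unfolding H_def by blast
		ultimately show "t h = 0" by (simp add: less_Suc_eq_le)
	qed
	moreover have "card H = Suc (card G)" unfolding H_def using card_image[OF injH] by simp
	ultimately show False by simp
qed

lemma regularizer_stabilizes:
	assumes A: "A : LY"
		and c: "c > 0" "!!x. x : tail_space n ==> c * nY x <= nY (A x)" and st: "stabilizes A n"
	shows "EX B W om. regularizer A n B W om"
proof -
	obtain l where l: "!!j y. y : pY ==> EX x:tail_space n. EX z:pY. R j y = A x + R l z"
		using st unfolding stabilizes_def by blast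
	show ?thesis by (rule regularizer_exists[OF A c l])
qed

theorem regularizer_ess_below:
	assumes A: "A : LY" and "ess_below Y A" "ess_below DY (adj Y A)"
	obtains n B W om where "regularizer A n B W om"
proof -
	obtain n c where c: "c > 0" "!!x. x : tail_space n ==> c * nY x <= nY (A x)"
		by (rule tail_bounded_below[OF assms(2) po_opsD[OF A]]) (rule that)
	have "stabilizes A n" by (rule stabilizes_dual[OF po_opsD[OF A] c assms(3)])
	have "EX B W om. regularizer A n B W om"
		by (rule regularizer_stabilizes[OF A c \<open>stabilizes A n\<close>])
	with that show ?thesis by blast
qed

text \<open>The left inverse modulo compact operators bounds \<open>A\<close> below up to a gauge,
  hence on a tail space; the right inverse provides stabilization.\<close>

theorem regularizer_compact_inverse:
	assumes A: "A : LY" and C: "C : ops Y"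
		and CA: "(C o A) - id_op Y : compact_ops Y" and AC: "(A o C) - id_op Y : compact_ops Y"
	obtains n B W om where "regularizer A n B W om"
proof -
	have Aop: "A : ops Y" using A by (rule po_opsD)
	note [simp] = bop_in[OF Aop] bop_in[OF C]
	obtain c0 where c0: "c0 > 0" "!!x. x : pY ==> nY (C x) <= c0 * nY x"
		using bop_bound[OF norm_space C] by blast
	let ?K = "(C o A) - id_op Y"
	have ess: "ess_below Y A"
		unfolding ess_below_def
	proof (intro exI[of _ "1 / c0"] conjI exI[of _ "%x. 1 / c0 * nY (?K x)"] ballI)
		show "compact_gauge Y (%x. 1 / c0 * nY (?K x))"
			using compact_gauge_mono[of "%x. nY (?K x)" "1 / c0"] CA c0 by (simp add: compact_ops_gauge)
		fix x assume x: "x : pY"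
		have "nY x <= nY (C (A x)) + nY (C (A x) - x)"
			using nrm_diff[of "C (A x)" "C (A x) - x"] x by simp
		also have "nY (C (A x)) <= c0 * nY (A x)" using c0(2) x by simp
		finally show "1 / c0 * nY x <= nY (A x) + 1 / c0 * nY (?K x)"
			using c0(1) x by (simp add: field_simps)
	qed (use c0 in simp)
	obtain n c where c: "c > 0" "!!x. x : tail_space n ==> c * nY x <= nY (A x)"
		by (rule tail_bounded_below[OF ess Aop]) (rule that)
	have "stabilizes A n" by (rule stabilizes_right_inverse[OF Aop c C AC]) (simp_all add: algebra_simps)
	have "EX B W om. regularizer A n B W om"
		by (rule regularizer_stabilizes[OF A c \<open>stabilizes A n\<close>])
	with that show ?thesis by blast
qed

text \<open>Unit vectors of a finite-dimensional space lying in ever farther tails would have a norm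
  limit with all truncations zero.\<close>

lemma finite_dim_tail:
	assumes N: "finite N" "N \<subseteq> pY"
	obtains n where "!!x. x : cspan N ==> x : tail_space n ==> x = 0"
proof -
	have "EX n. ALL x:cspan N. x : tail_space n --> x = 0"
	proof (rule ccontr)
		assume neg: "~ ?thesis"
		have "EX x:cspan N. x : tail_space n & nY x = 1" for n
		proof -
			obtain x where x: "x : cspan N" "x : tail_space n" "x ~= 0" using neg by blast
			show ?thesis
				using nrm_normalize[OF tlD(1)[OF x(2)] x(3)] cspan_scale[OF x(1)]
					csubspace_scale[OF tl_subspace x(2)] by blast
		qed
		then obtain x where x: "!!n. x n : cspan N" "!!n. x n : tail_space n" "!!n. nY (x n) = 1" by metis
		have x1: "nY (x n) <= 1" for n using x(3) by simp
		obtain r y where r: "strict_mono (r :: nat => nat)" "y : cspan N" "(%n. nY (x (r n) - y)) ----> 0"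
			using finite_span_convergent_subseq[OF N, of x 1] x(1) x1 by blast
		have xin: "x n : pY" for n using tlD x(2) by blast
		have yin: "y : pY" using r(2) cspan_subset_pts[OF N(2)] by blast
		have "R j y = 0" for j
		proof -
			have "(%n. nY (R j (x (r n)) - R j y)) ----> 0"
				by (rule op_limit[where x = "%n. x (r n)", OF R_ops norm_space xin yin r(3)])
			moreover have "\<forall>\<^sub>F n in sequentially. nY (R j (x (r n)) - R j y) = nY (R j y)"
				unfolding eventually_sequentially
			proof (intro exI allI impI)
				fix n assume "n >= j"
				then have "x (r n) : tail_space j" using tl_mono[OF x(2)] seq_suble[OF r(1), of n] by simp
				then show "nY (R j (x (r n)) - R j y) = nY (R j y)" using tlD yin by (simp add: nrm_uminus)
			qed
			ultimately have "(%n::nat. nY (R j y)) ----> 0" by (simp add: tendsto_cong)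
			then have "nY (R j y) = 0" by (simp only: LIMSEQ_const_iff)
			then show ?thesis using nrm_eq_0[of "R j y"] yin by simp
		qed
		then have "y = 0" by (rule zero_if_R_zero[OF yin])
		then show False using r(3) x(3) LIMSEQ_const_iff[of "1 :: real" 0] by simp
	qed
	then show ?thesis using that by blast
qed

text \<open>A lower bound on a tail space has to be produced from algebraic data. A tail space that
  misses the kernel, together with a finite complement \<open>D\<close> of its image, is mapped
  bijectively onto the whole space, and the open mapping theorem bounds the inverse.\<close>

theorem regularizer_fredholm:
	assumes A: "A : LY" and F: "fredholm Y A"
	obtains n B W om where "regularizer A n B W om"
proof -
	have Aop: "A : ops Y" using A by (rule po_opsD)
	note [simp] = bop_in[OF Aop]
	obtain N0 where N0: "finite N0" "ker Y A \<subseteq> cspan N0" using F unfolding fredholm_def fin_dim_def by blast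
	obtain B0 where B0: "B0 \<subseteq> pY" "finite B0" "pY \<subseteq> cspan (A ` pY \<union> B0)"
		using F unfolding fredholm_def fin_codim_def by blast
	obtain N where N: "N \<subseteq> ker Y A" "cindependent N" "ker Y A \<subseteq> cspan N"
		using complex_vector.maximal_independent_subset by blast
	have Nfin: "finite N" using cindependent_span_bound[OF N0(1) N(2)] N(1) N0(2) by blast
	have "N \<subseteq> pY" using N(1) by (auto simp: ker_def)
	from finite_dim_tail[OF Nfin this]
	obtain n where n: "!!x. x : cspan N ==> x : tail_space n ==> x = 0" by blast
	have inj: "x = 0" if "x : tail_space n" "A x = 0" for x
		using n[of x] N(3) that tlD by (auto simp: ker_def)
	obtain E e where E: "finite E" "E \<subseteq> pY" "!!b. b : E ==> R n b = b"
		"!!x. x : pY ==> R n x = (SUM b:E. e b x *C b)"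
		by (rule R_coordinates[of n]) blast
	\<comment> \<open>Passing from the whole space to the tail space costs only the images of finitely
	  many basis vectors, so the codimension stays finite.\<close>
	define G where "G = B0 \<union> A ` E"
	have Gfin: "finite G" and Gin: "G \<subseteq> pY" using B0 E by (auto simp: G_def)
	have "A ` pY \<union> B0 \<subseteq> cspan (A ` tail_space n \<union> G)"
	proof -
		have "A x : cspan (A ` tail_space n \<union> G)" if x: "x : pY" for x
		proof -
			have "A (R n x) = (SUM b:E. e b x *C A b)"
				unfolding E(4)[OF x] using E(2) by (subst op_sum[OF Aop]) (auto simp: bop_scale[OF Aop] subset_iff)
			then have "A (R n x) : cspan (A ` tail_space n \<union> G)"
				by (simp only:) (intro cspan_sum cspan_scale cspan_base, auto simp: G_def)
			moreover have "A (x - R n x) : cspan (A ` tail_space n \<union> G)"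
				using tail_split(2)[OF Aop x] by (intro cspan_base) auto
			ultimately show ?thesis unfolding tail_split(1)[OF Aop x, of n] by (rule cspan_add)
		qed
		moreover have "B0 \<subseteq> cspan (A ` tail_space n \<union> G)"
			using cspan_superset[of "A ` tail_space n \<union> G"] by (auto simp: G_def)
		ultimately show ?thesis by blast
	qed
	then have "cspan (A ` pY \<union> B0) \<subseteq> cspan (A ` tail_space n \<union> G)"
		by (intro cspan_minimal) auto
	then have span: "pY \<subseteq> cspan (A ` tail_space n \<union> G)" using B0(3) by blast
	obtain D where D: "D \<subseteq> G" "G \<subseteq> cspan (A ` tail_space n \<union> D)"
		"!!h b. (SUM b:D. h b *C b) : A ` tail_space n ==> b : D ==> h b = 0"
		using independent_complement[OF Gfin, of "A ` tail_space n"] by blast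
	have Dfin: "finite D" and Din: "D \<subseteq> pY" using D(1) Gfin Gin finite_subset by auto
	have "A ` tail_space n \<union> G \<subseteq> cspan (A ` tail_space n \<union> D)"
		using D(2) cspan_superset[of "A ` tail_space n \<union> D"] by blast
	then have "cspan (A ` tail_space n \<union> G) \<subseteq> cspan (A ` tail_space n \<union> D)"
		by (intro cspan_minimal) auto
	then have spanD: "pY \<subseteq> cspan (A ` tail_space n \<union> D)" using span by blast
	have subA: "csubspace (A ` tail_space n)"
	proof (rule complex_vector.subspaceI)
		show "0 : A ` tail_space n"
			using complex_vector.subspace_0[OF tl_subspace] bop_zero[OF Aop] by (metis image_eqI)
		fix x y t assume "x : A ` tail_space n" "y : A ` tail_space n"
		then obtain u v where uv: "u : tail_space n" "v : tail_space n" "x = A u" "y = A v" by blast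
		have "x + y = A (u + v)" "t *C x = A (t *C u)"
			using uv tlD by (auto simp: bop_add[OF Aop] bop_scale[OF Aop])
		then show "x + y : A ` tail_space n" "t *C x : A ` tail_space n"
			using uv tl_subspace by (auto simp: csubspace_add csubspace_scale)
	qed
	let ?T = "\<lparr>pts = tail_space n, nrm = nY\<rparr>" and ?D = "\<lparr>pts = cspan D, nrm = nY\<rparr>"
	have bT: "banach_cn ?T" by (rule closed_subspace_banach[OF tl_closed])
	have bD: "banach_cn ?D" by (rule closed_subspace_banach[OF closed_subspace_span[OF Dfin Din]])
	have bS: "banach_cn (sum_space ?T ?D)" by (rule sum_banach[OF bT bD])
	have Dpts: "d : pY" if "d : cspan D" for d using that cspan_subset_pts[OF Din] by blast
	obtain a where a: "a > 0" "!!x. x : pY ==> nY (A x) <= a * nY x"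
		using bop_bound[OF norm_space Aop] by blast
	define S where "S = zext (sum_space ?T ?D) (%(x, d). A x + d)"
	have "S : bounded_ops (sum_space ?T ?D) Y"
		unfolding S_def
	proof (rule bop_zextI[where c = "a + 1"])
		show "cnorm_space (sum_space ?T ?D)" using bS by (simp add: banach_cn_def)
		fix p q t assume p: "p : pts (sum_space ?T ?D)"
		then obtain x d where xd: "p = (x, d)" "x : tail_space n" "d : cspan D" by auto
		note [simp] = tlD(1)[OF xd(2)] Dpts[OF xd(3)]
		show "(case p of (x, d) => A x + d) : pY" using xd by simp
		show "(case t *C p of (x, d) => A x + d) = t *C (case p of (x, d) => A x + d)"
			using xd by (simp add: scaleC_prod_def bop_scale[OF Aop] cscale_right_distrib)
		have "nY (A x + d) <= a * nY x + nY d"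
			using nrm_add[of "A x" d] a(2)[of x] by simp
		also have "... <= a * max (nY x) (nY d) + max (nY x) (nY d)"
			using a(1) by (intro add_mono mult_left_mono) auto
		finally show "nY (case p of (x, d) => A x + d) <= (a + 1) * nrm (sum_space ?T ?D) p"
			using xd by (simp add: algebra_simps)
		assume q: "q : pts (sum_space ?T ?D)"
		then obtain x' d' where xd': "q = (x', d')" "x' : tail_space n" "d' : cspan D" by auto
		show "(case p + q of (x, d) => A x + d) = (case p of (x, d) => A x + d) + (case q of (x, d) => A x + d)"
			using xd xd' tlD(1)[OF xd'(2)] by (simp add: bop_add[OF Aop])
	qed
	moreover have "EX p:pts (sum_space ?T ?D). S p = y" if y: "y : pY" for y
	proof -
		obtain m h where mh: "m : A ` tail_space n" "y = m + (SUM b:D. h b *C b)"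
			using span_subspace_Un_finite[OF subA Dfin] spanD y by blast
		then obtain x where x: "x : tail_space n" "m = A x" by blast
		have "(SUM b:D. h b *C b) : cspan D"
			by (intro cspan_sum cspan_scale cspan_base)
		then show ?thesis using x mh by (intro bexI[of _ "(x, SUM b:D. h b *C b)"]) (auto simp: S_def)
	qed
	ultimately obtain C where C: "C > 0"
		"!!y. y : pY ==> EX p:pts (sum_space ?T ?D). S p = y & nrm (sum_space ?T ?D) p <= C * nY y"
		using open_mapping[OF bS banach_cn_axioms] by blast
	have c: "1 / C * nY x <= nY (A x)" if x: "x : tail_space n" for x
	proof -
		obtain x' d where p: "x' : tail_space n" "d : cspan D" "A x' + d = A x" "max (nY x') (nY d) <= C * nY (A x)"
			using C(2)[of "A x"] tlD[OF x] by (auto simp: S_def)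
		obtain h where h: "d = (SUM b:D. h b *C b)" using p(2) Dfin by (auto simp: cspan_finite)
		have xx: "x - x' : tail_space n" using x p(1) tl_subspace by (simp add: csubspace_diff)
		have "A (x - x') = d" using p(3) tlD[OF x] tlD[OF p(1)] by (simp add: op_diff[OF Aop] algebra_simps)
		then have "(SUM b:D. h b *C b) = A (x - x')" using h by simp
		then have hA: "(SUM b:D. h b *C b) : A ` tail_space n" using xx by (rule image_eqI)
		have "h b = 0" if "b : D" for b by (rule D(3)[OF hA that])
		then have "d = 0" by (simp add: h)
		then have "A (x - x') = 0" using \<open>A (x - x') = d\<close> by simp
		then have "x = x'" using inj[OF xx] by simp
		then show ?thesis using p(4) C(1) by (simp add: field_simps)
	qed
	have c0: "1 / C > 0" using C(1) by simp
	have "stabilizes A n" by (rule stabilizes_fin_codim[OF Aop c0 c Gfin span])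
	have "EX B W om. regularizer A n B W om"
		by (rule regularizer_stabilizes[OF A c0 c \<open>stabilizes A n\<close>])
	with that show ?thesis by blast
qed

end

section \<open>Invertible perturbations and the index\<close>

lemma sum_fun_apply: "(sum g I) x = (SUM i:I. g i x)"
	by (induction I rule: infinite_finite_induct) auto

lemma independent_family:
	fixes Z :: "'i => 'b::complex_vector"
	assumes G: "finite G" and zero: "!!c g. (SUM g:G. c g *C Z g) = 0 ==> g : G ==> c g = 0"
	shows "inj_on Z G" "cindependent (Z ` G)"
proof -
	show inj: "inj_on Z G"
	proof (rule inj_onI, rule ccontr)
		fix s t assume st: "s : G" "t : G" "Z s = Z t" "s ~= t"
		have "(SUM u:G. (if u = s then 1 else if u = t then - 1 else 0) *C Z u)
				= (SUM u:{s, t}. (if u = s then 1 else if u = t then - 1 else 0) *C Z u)"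
			using G st by (intro sum.mono_neutral_right) auto
		also have "... = 0" using st by (simp add: complex_vector.scale_minus_left)
		finally show False using zero[of "%u. if u = s then 1 else if u = t then - 1 else 0" s] st by simp
	qed
	show "cindependent (Z ` G)"
	proof (rule complex_vector.independent_if_scalars_zero)
		fix f x assume f: "(SUM x:Z ` G. f x *C x) = 0" and x: "x : Z ` G"
		then obtain s where s: "s : G" "x = Z s" by blast
		have "(SUM s:G. f (Z s) *C Z s) = 0" using f by (simp add: sum.reindex[OF inj])
		then show "f x = 0" using zero[of "%s. f (Z s)" s] s by simp
	qed (use G in simp)
qed

lemma (in cnorm_space) rank_one_ops:
	assumes F: "F : FY" and v: "v : pY"
	shows "(%x. F x *C v) : ops Y"
proof (rule bopI[where c = "nD F * nY v"])
	fix x y a assume x: "x : pY"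
	show "F x *C v : pY" using v by simp
	show "F (a *C x) *C v = a *C F x *C v" using x by (simp add: bop_scale[OF F] scaleC_complex_def)
	have "cmod (F x) * nY v <= (nD F * nY x) * nY v"
		using dual_bound[OF F x] v by (intro mult_right_mono) auto
	then show "nY (F x *C v) <= nD F * nY v * nY x"
		using v by (simp add: nrm_scale mult_ac)
	assume y: "y : pY"
	show "F (x + y) *C v = F x *C v + F y *C v"
		using x y by (simp add: bop_add[OF F] cscale_left_distrib)
qed (simp add: bop_out[OF F])

lemma (in cnorm_space) ops_sum: "(!!i. i : I ==> T i : ops Y) ==> sum T I : ops Y"
	by (induction I rule: infinite_finite_induct) (auto intro: ops_zero ops_plus)

context proj_space
begin

lemma pc_sum: "(!!i. i : I ==> T i : KY) ==> sum T I : KY"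
	by (induction I rule: infinite_finite_induct) (auto intro: pc_zero pc_plus)

text \<open>For a rank one operator smallness on tails is a matter of the functional and smallness
  of the tails a matter of the vector; the hypotheses provide one half each.\<close>

lemma pc_rank_one:
	assumes F: "F : FY" and v: "v : pY"
		and Ft: "!!e. e > 0 ==> EX r. ALL x:pY. cmod (F (x - R r x)) <= e * nY x" and vR: "R l v = v"
	shows "(%x. F x *C v) : KY"
proof (rule pcI[OF rank_one_ops[OF F v]])
	fix e :: real assume e: "e > 0"
	have n1: "nY v + 1 > 0" using nrm_nonneg[OF v] by simp
	then have "e / (nY v + 1) > 0" using e by simp
	from Ft[OF this] obtain r where r: "!!x. x : pY ==> cmod (F (x - R r x)) <= e / (nY v + 1) * nY x"
		by blast
	define q where "q = max l r"
	have "nY (F x *C v - R q (F x *C v)) <= e * nY x & nY (F (x - R q x) *C v) <= e * nY x"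
		if x: "x : pY" for x
	proof
		have "R q v = v" using R_R[OF v, of q l] vR by (simp add: q_def min_absorb2)
		then show "nY (F x *C v - R q (F x *C v)) <= e * nY x" using v e x by (simp add: R_scale)
		have y: "x - R q x : pY" "nY (x - R q x) <= nY x" using x S_le by auto
		have "cmod (F (x - R q x)) <= e / (nY v + 1) * nY (x - R q x)"
			using r[OF y(1)] tail_tail'[OF x, of r q] by (simp add: q_def)
		also have "... <= e / (nY v + 1) * nY x" using y(2) e n1 by (intro mult_left_mono) auto
		finally have "cmod (F (x - R q x)) * nY v <= (e / (nY v + 1) * nY x) * nY v"
			using v by (intro mult_right_mono) auto
		also have "... = (e * nY x) * (nY v / (nY v + 1))" by simp
		also have "... <= (e * nY x) * 1" using e x n1 by (intro mult_left_mono) auto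
		finally show "nY (F (x - R q x) *C v) <= e * nY x" using v by (simp add: nrm_scale)
	qed
	then show "EX n. ALL x:pY. nY (F x *C v - R n (F x *C v)) <= e * nY x &
			nY (F (x - R n x) *C v) <= e * nY x" by blast
qed


text \<open>The outcome of \<open>R_coordinates\<close> as a predicate, so that one basis
  \<open>F\<close> can be shared by several statements whose counts are compared.\<close>

definition coordinates :: "nat => 'a set => ('a => 'a => complex) => bool"
	where "coordinates n F e \<longleftrightarrow> finite F & F \<subseteq> pY & cindependent F &
		(ALL b:F. R n b = b) & (ALL b. e b : FY) &
		(ALL x:pY. R n x = (SUM b:F. e b x *C b)) &
		(ALL b:F. ALL c:F. e b c = (if b = c then 1 else 0)) & (ALL b. ALL x:pY. e b (R n x) = e b x)"

lemma coordinates_exist: "EX F e. coordinates n F e"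
proof (rule R_coordinates[of n])
	fix B e
	assume "finite B" "B \<subseteq> pY" "cindependent B" "!!b. b : B ==> R n b = b"
		"!!b. e b : FY" "!!x. x : pY ==> R n x = (SUM b:B. e b x *C b)"
		"!!b c. b : B ==> c : B ==> e b c = (if b = c then 1 else 0)"
		"!!b x. x : pY ==> e b (R n x) = e b x"
	then show ?thesis
		unfolding coordinates_def by (intro exI[of _ B] exI[of _ e] conjI ballI allI)
qed

end

section \<open>Matching the bases \<open>F\<close> and \<open>W\<close>\<close>

context lp_like
begin

lemma regularizerD:
	assumes "regularizer A n B W om"
	shows "A : LY" "B : LY" "x : pY ==> R n (B x) = 0"
		"x : tail_space n ==> B (A x) = x" "finite W" "W \<subseteq> pY" "w : W ==> B w = 0"
		"w : W ==> EX l. R l w = w" "om w : FY"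
		"w : W ==> v : W ==> om w v = (if w = v then 1 else 0)"
		"w : W ==> x : tail_space n ==> om w (A x) = 0"
		"y : pY ==> A (B y) + (SUM w:W. om w y *C w) = y"
		"(id_op Y - (A o B)) : KY"
	using assms unfolding regularizer_def by auto

lemma coordinatesD:
	assumes "coordinates n F e"
	shows "finite F" "F \<subseteq> pY" "cindependent F" "b : F ==> R n b = b"
		"e b : FY" "x : pY ==> (SUM b:F. e b x *C b) = R n x"
		"b : F ==> c : F ==> e b c = (if b = c then 1 else 0)" "x : pY ==> e b (R n x) = e b x"
	using assms unfolding coordinates_def by auto

text \<open>\<open>B\<close> inverts \<open>A\<close> on the tail space, so B A - I reduces to B A R
  n - R n, a difference of products with \<open>R n\<close>.\<close>

lemma regularizer_inverse:
	assumes reg: "regularizer A n B W om"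
	shows "(A o B) - id_op Y : KY" "(B o A) - id_op Y : KY"
proof -
	note r = regularizerD[OF reg]
	have Aop: "A : ops Y" and Bop: "B : ops Y" using r(1,2) by (auto intro: po_opsD)
	note [simp] = bop_in[OF Aop] bop_in[OF Bop]
	show "(A o B) - id_op Y : KY" using pc_neg[OF r(13)] by simp
	have "(B o A) - id_op Y = (B o (A o R n)) - R n"
	proof (rule bop_eqI)
		show "(B o A) - id_op Y : ops Y" "(B o (A o R n)) - R n : ops Y"
			by (auto intro!: ops_minus ops_comp ops_id R_ops Aop Bop)
		fix x assume x: "x : pY"
		have "B (A x) = B (A (R n x)) + B (A (x - R n x))"
			unfolding tail_split(1)[OF Aop x, of n] using x by (intro bop_add[OF Bop]) auto
		then show "((B o A) - id_op Y) x = ((B o (A o R n)) - R n) x"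
			using r(4)[OF tail_split(2)[OF Aop x]] x by simp
	qed
	then show "(B o A) - id_op Y : KY"
		using pc_minus[OF po_pc[OF r(2) po_pc[OF r(1) R_pc]] R_pc] by simp
qed

text \<open>\<open>A\<close> is changed on the image of \<open>R n\<close> only: basis vectors in
  \<open>B0\<close> are sent by \<open>h\<close> into \<open>W\<close>, the others to 0, and
  \<open>B2\<close> sends them back. Taking \<open>B0\<close> as all of \<open>F\<close> makes
  \<open>B2\<close> a left inverse, taking \<open>h\<close> onto \<open>W\<close> makes it a right
  inverse.\<close>

lemma partial_isomorphism:
	assumes reg: "regularizer A n B W om" and co: "coordinates n F e"
		and h: "B0 \<subseteq> F" "inj_on h B0" "h ` B0 \<subseteq> W"
	obtains A2 B2 where "A2 - A : KY" "A2 : ops Y" "B2 : ops Y"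
		"!!x. x : pY ==> B2 (A2 x) = (x - R n x) + (SUM b:B0. e b x *C b)"
		"!!y. y : pY ==> A2 (B2 y) = A (B y) + (SUM b:B0. om (h b) y *C h b)"
proof -
	note r = regularizerD[OF reg] and c = coordinatesD[OF co]
	have Aop: "A : ops Y" and Bop: "B : ops Y" using r(1,2) by (auto intro: po_opsD)
	note [simp] = bop_in[OF Aop] bop_in[OF Bop]
	have B0: "finite B0" using h(1) c(1) finite_subset by blast
	have bF: "b : F" "b : pY" if "b : B0" for b using h(1) c(2) that by auto
	have hW: "h b : W" "h b : pY" if "b : B0" for b using h(3) r(6) that by auto
	define J where "J = (SUM b:B0. (%x. e b x *C h b))"
	define J' where "J' = (SUM b:B0. (%y. om (h b) y *C b))"
	have Jx: "J x = (SUM b:B0. e b x *C h b)" for x by (simp add: J_def sum_fun_apply)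
	have J'x: "J' x = (SUM b:B0. om (h b) x *C b)" for x by (simp add: J'_def sum_fun_apply)
	have J: "J : KY"
		unfolding J_def
	proof (rule pc_sum)
		fix b assume b: "b : B0"
		obtain l where l: "R l (h b) = h b" using r(8)[OF hW(1)[OF b]] by blast
		have en: "e b (x - R n x) = 0" if "x : pY" for x
			using that by (simp add: op_diff[OF c(5)] c(8))
		show "(%x. e b x *C h b) : KY"
			by (rule pc_rank_one[OF c(5) hW(2)[OF b] _ l]) (auto intro!: exI[of _ n] simp: en)
	qed
	have Jop: "J : ops Y" using J by (rule pc_opsD)
	have J'op: "J' : ops Y" unfolding J'_def by (intro ops_sum rank_one_ops r(9) bF)
	define A2 where "A2 = (A o (id_op Y - R n)) + J"
	define B2 where "B2 = B + J'"
	have A2x: "A2 x = A (x - R n x) + J x" if "x : pY" for x using that by (simp add: A2_def)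
	have B2x: "B2 y = B y + J' y" for y by (simp add: B2_def)
	have A2op: "A2 : ops Y" unfolding A2_def by (intro ops_plus ops_comp Aop tail_op Jop)
	have B2op: "B2 : ops Y" unfolding B2_def by (intro ops_plus Bop J'op)
	have eB: "e b (B y) = 0" if "y : pY" for b y
		using c(8)[of "B y" b] r(3)[OF that] that bop_zero[OF c(5)] by simp
	show ?thesis
	proof (rule that[of A2 B2])
		have "A2 - A = J - (A o R n)"
			by (rule bop_eqI[OF ops_minus[OF A2op Aop] ops_minus[OF Jop ops_comp[OF Aop R_ops]]])
				(simp add: A2x op_diff[OF Aop])
		then show "A2 - A : KY" using pc_minus[OF J po_pc[OF r(1) R_pc]] by simp
		show "A2 : ops Y" "B2 : ops Y" by fact+
		fix x assume x: "x : pY"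
		have t: "x - R n x : tail_space n" by (rule tail_split(2)[OF Aop x])
		have BJ: "B (J x) = 0"
			unfolding Jx using hW r(7) by (subst op_sum[OF Bop]) (auto simp: bop_scale[OF Bop])
		have J'A: "J' (A (x - R n x)) = 0" unfolding J'x using r(11)[OF hW(1) t] by simp
		have J'J: "J' (J x) = (SUM b:B0. e b x *C b)"
		proof -
			have "om (h b) (J x) = e b x" if b: "b : B0" for b
			proof -
				have "om (h b) (J x) = (SUM b':B0. e b' x * om (h b) (h b'))"
					unfolding Jx using hW by (subst op_sum[OF r(9)]) (auto simp: bop_scale[OF r(9)] scaleC_complex_def)
				also have "... = (SUM b':B0. if b' = b then e b x else 0)"
					using b hW inj_onD[OF h(2)] by (intro sum.cong) (auto simp: r(10))
				finally show ?thesis using B0 b by simp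
			qed
			then show ?thesis unfolding J'x by simp
		qed
		have "B2 (A2 x) = B2 (A (x - R n x)) + B2 (J x)"
			unfolding A2x[OF x] using x bop_in[OF Jop x] by (intro bop_add[OF B2op]) auto
		then show "B2 (A2 x) = (x - R n x) + (SUM b:B0. e b x *C b)"
			using r(4)[OF t] BJ J'A J'J by (simp add: B2x)
	next
		fix y assume y: "y : pY"
		have J'y: "J' y : pY" by (rule bop_in[OF J'op y])
		have RJ': "R n (J' y) = J' y"
			unfolding J'x using bF c(4) by (subst op_sum[OF R_ops]) (auto simp: R_scale)
		have JB: "J (B y) = 0" unfolding Jx using eB[OF y] by simp
		have JJ': "J (J' y) = (SUM b:B0. om (h b) y *C h b)"
		proof -
			have "e b (J' y) = om (h b) y" if b: "b : B0" for b
			proof -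
				have "e b (J' y) = (SUM b':B0. om (h b') y * e b b')"
					unfolding J'x using bF by (subst op_sum[OF c(5)]) (auto simp: bop_scale[OF c(5)] scaleC_complex_def)
				also have "... = (SUM b':B0. if b' = b then om (h b) y else 0)"
					using b bF by (intro sum.cong) (auto simp: c(7))
				finally show ?thesis using B0 b by simp
			qed
			then show ?thesis unfolding Jx by simp
		qed
		have "A2 (B2 y) = A2 (B y) + A2 (J' y)"
			unfolding B2x using y J'y by (intro bop_add[OF A2op]) auto
		then show "A2 (B2 y) = A (B y) + (SUM b:B0. om (h b) y *C h b)"
			using y J'y RJ' JB JJ' r(3)[OF y] bop_zero[OF Aop] by (simp add: A2x)
	qed
qed

lemma invertible_perturbation_if_card_eq:
	assumes reg: "regularizer A n B W om" and co: "coordinates n F e" and card: "card F = card W"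
	obtains L G where "L : KY" "G : ops Y"
		"!!x. x : pY ==> A (G x) + L (G x) = x" "!!x. x : pY ==> G (A x + L x) = x"
proof -
	note r = regularizerD[OF reg] and c = coordinatesD[OF co]
	obtain h where h: "bij_betw h F W" using finite_same_card_bij[OF c(1) r(5) card] by blast
	obtain A2 B2 where A2: "A2 - A : KY" "A2 : ops Y" "B2 : ops Y"
		"!!x. x : pY ==> B2 (A2 x) = (x - R n x) + (SUM b:F. e b x *C b)"
		"!!y. y : pY ==> A2 (B2 y) = A (B y) + (SUM b:F. om (h b) y *C h b)"
		using partial_isomorphism[OF reg co, of F h] h by (auto simp: bij_betw_def)
	show ?thesis
	proof (rule that[OF A2(1,3)])
		fix x assume x: "x : pY"
		have "(SUM b:F. om (h b) x *C h b) = (SUM w:W. om w x *C w)"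
			by (rule sum.reindex_bij_betw[OF h, of "%w. om w x *C w"])
		then show "A (B2 x) + (A2 - A) (B2 x) = x" using A2(5)[OF x] r(12)[OF x] by simp
		show "B2 (A x + (A2 - A) x) = x" using A2(4)[OF x] c(6)[OF x] by simp
	qed
qed

text \<open>With more vectors in \<open>F\<close> than in \<open>W\<close>, the matching exhausts
  \<open>W\<close> and leaves a basis vector over. It lies in the kernel of \<open>A2\<close>, which
  has a right inverse, and a lower bound of A + K forbids this by
  \<open>right_inverse_injective\<close>.\<close>

lemma card_le_if_bounded_below:
	assumes reg: "regularizer A n B W om" and co: "coordinates n F e"
		and K: "K : compact_ops Y" and k: "k > 0" "!!x. x : pY ==> k * nY x <= nY (A x + K x)"
	shows "card F <= card W"
proof (rule ccontr)
	note r = regularizerD[OF reg] and c = coordinatesD[OF co]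
	assume "~ card F <= card W"
	then obtain B0 where B0: "B0 \<subseteq> F" "card B0 = card W" "B0 ~= F"
		using obtain_subset_with_card_n[of "card W" F] by (metis nat_le_linear)
	have B0fin: "finite B0" using B0(1) c(1) finite_subset by blast
	obtain h where h: "bij_betw h B0 W" using finite_same_card_bij[OF B0fin r(5) B0(2)] by blast
	obtain A2 B2 where A2: "A2 - A : KY" "A2 : ops Y" "B2 : ops Y"
		"!!x. x : pY ==> B2 (A2 x) = (x - R n x) + (SUM b:B0. e b x *C b)"
		"!!y. y : pY ==> A2 (B2 y) = A (B y) + (SUM b:B0. om (h b) y *C h b)"
		using partial_isomorphism[OF reg co B0(1), of h] h by (auto simp: bij_betw_def)
	have A2B2: "A2 (B2 y) = y" if y: "y : pY" for y
	proof -
		have "(SUM b:B0. om (h b) y *C h b) = (SUM w:W. om w y *C w)"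
			by (rule sum.reindex_bij_betw[OF h, of "%w. om w y *C w"])
		then show ?thesis using A2(5)[OF y] r(12)[OF y] by simp
	qed
	obtain b where b: "b : F" "b ~: B0" using B0 by blast
	have bin: "b : pY" using b c(2) by blast
	have "(SUM b':B0. e b' b *C b') = 0"
	proof (rule sum.neutral, rule ballI)
		fix b' assume "b' : B0"
		then have "b' : F" "b' ~= b" using B0(1) b(2) by auto
		then show "e b' b *C b' = 0" using c(7)[OF _ b(1), of b'] by simp
	qed
	then have "B2 (A2 b) = 0" using A2(4)[OF bin] c(4)[OF b(1)] by simp
	then have "A2 b = 0" using A2B2[OF bop_in[OF A2(2) bin]] bop_zero[OF A2(2)] by simp
	have K2: "K - (A2 - A) : compact_ops Y"
		using compact_ops_plus[OF K compact_ops_cscale[OF pc_compact[OF A2(1)], of "-1"]]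
		by (simp add: complex_vector.scale_minus_left add_diff_eq diff_diff_eq2)
	have "b = 0"
		by (rule right_inverse_injective[OF A2(2,3) A2B2 K2 k(1) _ bin \<open>A2 b = 0\<close>])
			(use k(2) in \<open>simp_all add: algebra_simps\<close>)
	then show False using c(3) b(1) complex_vector.dependent_zero by blast
qed

text \<open>The mirror image on the dual: for an unmatched \<open>w\<close> the functional
  \<open>om w\<close> is annihilated by the adjoint of \<open>A2\<close>, which has the adjoint of
  \<open>B2\<close> as a right inverse.\<close>

lemma card_ge_if_dual_bounded_below:
	assumes reg: "regularizer A n B W om" and co: "coordinates n F e"
		and K: "K : compact_ops DY" and k: "k > 0"
			"!!f. f : pD ==> k * nD f <= nD (adj Y A f + K f)"
	shows "card W <= card F"
proof (rule ccontr)
	interpret D: proj_space "dual Y" "%n. adj Y (R n)" by (rule dual_proj_space)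
	note r = regularizerD[OF reg] and c = coordinatesD[OF co]
	have Aop: "A : ops Y" and Bop: "B : ops Y" using r(1,2) by (auto intro: po_opsD)
	assume "~ card W <= card F"
	then obtain W0 where W0: "W0 \<subseteq> W" "card W0 = card F" "W0 ~= W"
		using obtain_subset_with_card_n[of "card F" W] by (metis nat_le_linear)
	have W0fin: "finite W0" using W0(1) r(5) finite_subset by blast
	obtain h where h: "bij_betw h F W0" using finite_same_card_bij[OF c(1) W0fin] W0(2) by auto
	obtain A2 B2 where A2: "A2 - A : KY" "A2 : ops Y" "B2 : ops Y"
		"!!x. x : pY ==> B2 (A2 x) = (x - R n x) + (SUM b:F. e b x *C b)"
		"!!y. y : pY ==> A2 (B2 y) = A (B y) + (SUM b:F. om (h b) y *C h b)"
		using partial_isomorphism[OF reg co order_refl, of h] h W0(1) by (auto simp: bij_betw_def)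
	have B2A2: "B2 (A2 x) = x" if "x : pY" for x using A2(4)[OF that] c(6)[OF that] by simp
	obtain w where w: "w : W" "w ~: W0" using W0 by blast
	have win: "w : pY" using w r(6) by blast
	have hW: "h b : W" "h b ~= w" "h b : pY" if "b : F" for b
		using h that W0(1) w(2) r(6) by (auto simp: bij_betw_def)
	have omA2: "om w (A2 x) = 0" if x: "x : pY" for x
	proof -
		let ?y = "A2 x"
		have y: "?y : pY" by (rule bop_in[OF A2(2) x])
		have By: "B ?y : tail_space n" using r(3)[OF y] bop_in[OF Bop y] by (simp add: tail_space_def)
		have "om w (A2 (B2 ?y)) = om w (A (B ?y)) + om w (SUM b:F. om (h b) ?y *C h b)"
			unfolding A2(5)[OF y] using y hW bop_in[OF Aop] bop_in[OF Bop]
			by (intro bop_add[OF r(9)]) (auto intro: sum_in)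
		also have "om w (SUM b:F. om (h b) ?y *C h b) = (SUM b:F. om (h b) ?y * om w (h b))"
			using hW by (subst op_sum[OF r(9)]) (auto simp: bop_scale[OF r(9)] scaleC_complex_def)
		also have "... = 0" using hW r(10)[OF w(1)] by (intro sum.neutral) auto
		finally show ?thesis using r(11)[OF w(1) By] B2A2[OF x] by simp
	qed
	have wd: "om w : pD" using r(9) by simp
	have adjAB: "adj Y A2 (adj Y B2 f) = f" if f: "f : pD" for f
	proof -
		have f': "f : FY" using f by simp
		have fB: "f o B2 : FY" by (rule functionals_comp[OF f' A2(3)])
		show ?thesis unfolding adj_apply[OF f'] adj_apply[OF fB]
			by (rule bop_eqI[OF functionals_comp[OF fB A2(2)] f']) (simp add: B2A2)
	qed
	have diff: "adj Y (A2 - A) f = adj Y A2 f - adj Y A f" if f: "f : pD" for f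
		using f adj_diff_apply[OF _ A2(2) Aop, of f] by (simp add: adj_apply)
	have K2: "K - adj Y (A2 - A) : compact_ops DY"
		using D.compact_ops_plus[OF K D.compact_ops_cscale[OF D.pc_compact[OF adj_pc[OF A2(1)]], of "-1"]]
		by (simp add: complex_vector.scale_minus_left add_diff_eq diff_diff_eq2)
	have "om w = 0"
	proof (rule D.right_inverse_injective[OF adj_ops[OF A2(2)] adj_ops[OF A2(3)] adjAB K2 k(1) _ wd])
		show "k * nD f <= nD (adj Y A2 f + (K - adj Y (A2 - A)) f)"
			if "f : pD" for f
		proof -
			have "adj Y A2 f + (K - adj Y (A2 - A)) f = adj Y A f + K f" using diff[OF that] by simp
			then show ?thesis using k(2)[OF that] by metis
		qed
		show "adj Y A2 (om w) = 0"
			unfolding adj_apply[OF r(9)]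
			by (rule bop_eqI[OF functionals_comp[OF r(9) A2(2)] functionals_zero]) (simp add: omA2)
	qed
	then show False using r(10)[OF w(1) w(1)] by simp
qed

text \<open>Let \<open>E\<close> project onto the span of \<open>W\<close> along the image of the
  tail space. Then \<open>Z\<close>, which is \<open>E\<close> after \<open>A\<close>, depends on
  \<open>R n x\<close> only, so it acts between spaces of dimensions \<open>card F\<close> and
  \<open>card W\<close>. Its kernel and cokernel correspond to those of \<open>A\<close>, which
  leaves a count of dimensions.\<close>

theorem regularizer_index:
	assumes reg: "regularizer A n B W om" and co: "coordinates n F e"
	shows "fredholm Y A" "fredholm_index Y A = int (card F) - int (card W)"
proof -
	note r = regularizerD[OF reg] and c = coordinatesD[OF co]
	have Aop: "A : ops Y" and Bop: "B : ops Y" using r(1,2) by (auto intro: po_opsD)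
	note [simp] = bop_in[OF Aop] bop_in[OF Bop]
	define E where "E = (%y. SUM w:W. om w y *C w)"
	have Ey: "y = A (B y) + E y" if "y : pY" for y using r(12)[OF that] by (simp add: E_def)
	have Espan: "E y : cspan W" for y unfolding E_def
		by (intro cspan_sum cspan_scale cspan_base)
	have Ein [simp]: "E y : pY" for y using Espan cspan_subset_pts[OF r(6)] by blast
	have Esum: "E (SUM i:I. t i *C x i) = (SUM i:I. t i *C E (x i))" if "!!i. i : I ==> x i : pY"
		for I :: "'a set" and t x
	proof -
		have "E (SUM i:I. t i *C x i) = (SUM w:W. SUM i:I. (t i * om w (x i)) *C w)"
			unfolding E_def using that
			by (subst op_sum[OF r(9)]) (auto simp: bop_scale[OF r(9)] scaleC_complex_def complex_vector.scale_sum_left)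
		also have "... = (SUM i:I. t i *C E (x i))"
			unfolding E_def by (subst sum.swap) (simp add: complex_vector.scale_sum_right)
		finally show ?thesis .
	qed
	have Eadd: "E (x + y) = E x + E y" if "x : pY" "y : pY" for x y
		using that by (simp add: E_def bop_add[OF r(9)] cscale_left_distrib sum.distrib)
	have EA: "E (A x) = 0" if "x : tail_space n" for x using r(11)[OF _ that] by (simp add: E_def)
	have EW: "E u = u" if u: "u : cspan W" for u
	proof -
		obtain t where t: "u = (SUM w:W. t w *C w)" using u r(5) by (auto simp: cspan_finite)
		have "E w = w" if w: "w : W" for w
		proof -
			have "E w = (SUM v:W. if v = w then w else 0)" unfolding E_def using w by (intro sum.cong) (auto simp: r(10))
			then show ?thesis using r(5) w by simp
		qed
		then show ?thesis unfolding t using r(6) by (subst Esum) (auto simp: subset_iff)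
	qed
	define Z where "Z = (%u. E (A u))"
	have ZR: "Z x = Z (R n x)" if x: "x : pY" for x
		using tail_split[OF Aop x, of n] x Eadd[of "A (R n x)" "A (x - R n x)"] EA by (simp add: Z_def)
	have kerD: "x : pY" "A x = 0" if "x : ker Y A" for x using that by (auto simp: ker_def)
	\<comment> \<open>A kernel vector annihilated by \<open>R n\<close> lies in the tail space, where
	  \<open>B\<close> inverts \<open>A\<close>; so \<open>R n\<close> embeds the kernel of
	  \<open>A\<close>.\<close>
	have kerR: "x = 0" if x: "x : ker Y A" "R n x = 0" for x
		using r(4)[of x] kerD[OF x(1)] x(2) bop_zero[OF Bop] by (simp add: tail_space_def)
	have kersub: "csubspace (ker Y A)"
		by (rule complex_vector.subspaceI) (auto simp: ker_def bop_zero[OF Aop] bop_add[OF Aop] bop_scale[OF Aop])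
	obtain N where N: "N \<subseteq> ker Y A" "cindependent N" "ker Y A \<subseteq> cspan N"
		using complex_vector.maximal_independent_subset by blast
	have Nin: "x : pY" if "x : N" for x using N(1) kerD that by blast
	have RN: "inj_on (R n) N'" "cindependent (R n ` N')" if N': "finite N'" "N' \<subseteq> N" for N'
	proof -
		have zero: "t x = 0" if t: "(SUM x:N'. t x *C R n x) = 0" and x: "x : N'" for t x
		proof -
			have "(SUM x:N'. t x *C x) : ker Y A"
				using N' N(1) kersub by (intro complex_vector.subspace_sum csubspace_scale) auto
			moreover have "R n (SUM x:N'. t x *C x) = 0"
				using t Nin N'(2) by (subst op_sum[OF R_ops]) (auto simp: R_scale subset_iff)
			ultimately have "(SUM x:N'. t x *C x) = 0" by (rule kerR)
			then show ?thesis using complex_vector.independentD[OF N(2) N'] x by blast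
		qed
		show "inj_on (R n) N'" "cindependent (R n ` N')"
			using independent_family[OF N'(1), of "R n"] zero by auto
	qed
	have RF: "R n x : cspan F" if "x : pY" for x
		unfolding c(6)[OF that, symmetric]
		by (intro cspan_sum cspan_scale cspan_base)
	have FR: "F \<subseteq> R n ` pY"
	proof
		fix b assume b: "b : F"
		then have "b = R n b" "b : pY" using c(2,4) by auto
		then show "b : R n ` pY" by (rule image_eqI)
	qed
	have Nfin: "finite N"
	proof (rule ccontr)
		assume "infinite N"
		then obtain N' where N': "finite N'" "card N' = Suc (card F)" "N' \<subseteq> N"
			by (meson infinite_arbitrarily_large)
		have "R n ` N' \<subseteq> cspan F" using N'(3) Nin RF by blast
		then have "card (R n ` N') <= card F"
			using cindependent_span_bound[OF c(1) RN(2)[OF N'(1,3)]] by blast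
		then show False using N'(2) card_image[OF RN(1)[OF N'(1,3)]] by simp
	qed
	define T where "T = R n ` N"
	have Tind: "cindependent T" unfolding T_def by (rule RN(2)[OF Nfin order_refl])
	have Tcard: "card T = card N" unfolding T_def by (rule card_image[OF RN(1)[OF Nfin order_refl]])
	have TR: "T \<subseteq> R n ` pY" unfolding T_def using Nin by blast
	obtain Bs where Bs: "T \<subseteq> Bs" "Bs \<subseteq> R n ` pY" "cindependent Bs" "R n ` pY \<subseteq> cspan Bs"
		using complex_vector.maximal_independent_subset_extend[OF TR Tind] by blast
	have "card Bs = cdim (R n ` pY)" "card F = cdim (R n ` pY)"
		using complex_vector.basis_card_eq_dim[OF Bs(2,4,3)] complex_vector.basis_card_eq_dim[OF FR _ c(3)] RF by auto
	then have Bscard: "card Bs = card F" by simp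
	have Bsfin: "finite Bs"
		using cindependent_span_bound[OF c(1) Bs(3)] Bs(2) RF by blast
	have Bsin: "b : pY" "R n b = b" if b: "b : Bs" for b using Bs(2) b by (auto simp: R_R)
	define G where "G = Bs - T"
	have Gfin: "finite G" using Bsfin by (simp add: G_def)
	have Gcard: "card G + card N = card F"
		unfolding G_def using card_Diff_subset[OF finite_subset[OF Bs(1) Bsfin] Bs(1)] card_mono[OF Bsfin Bs(1)] Bscard Tcard
		by simp
	have Gin: "g : pY" "R n g = g" if "g : G" for g using Bsin that by (auto simp: G_def)
	have ZT: "Z u = 0" if u: "u : T" for u
	proof -
		obtain k where k: "k : N" "u = R n k" using u unfolding T_def by blast
		then have "Z u = Z k" using ZR[OF Nin[OF k(1)]] by simp
		also have "Z k = 0" using kerD[of k] N(1) k(1) r(9) bop_zero[OF r(9)] by (auto simp: Z_def E_def)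
		finally show ?thesis .
	qed
	have kerT: "R n x : cspan T" if x: "x : ker Y A" for x
	proof -
		have "x : cspan N" using N(3) x by blast
		then obtain t where t: "x = (SUM k:N. t k *C k)" using Nfin by (auto simp: cspan_finite)
		have "R n x = (SUM k:N. t k *C R n k)" unfolding t using Nin by (subst op_sum[OF R_ops]) (auto simp: R_scale)
		also have "... : cspan T"
			by (intro cspan_sum cspan_scale cspan_base) (auto simp: T_def)
		finally show ?thesis .
	qed
	\<comment> \<open>If \<open>Z u = 0\<close> then \<open>u - B (A u)\<close> is in the kernel of
	  \<open>A\<close>. The correction \<open>B (A u)\<close> lies in the tail space and is invisible
	  to \<open>R n\<close>, so \<open>u\<close> itself comes from the kernel.\<close>
	have Zzero: "t g = 0" if t: "(SUM g:G. t g *C Z g) = 0" and g: "g : G" for t g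
	proof -
		define u where "u = (SUM g:G. t g *C g)"
		have u: "u : pY" unfolding u_def using Gin by (intro sum_in) auto
		have Ru: "R n u = u" unfolding u_def using Gin by (subst op_sum[OF R_ops]) (auto simp: R_scale)
		have "A u = (SUM g:G. t g *C A g)" unfolding u_def using Gin by (subst op_sum[OF Aop]) (auto simp: bop_scale[OF Aop])
		then have "Z u = 0" using t Gin Esum[of G "%g. A g" t] by (simp add: Z_def)
		then have "A (u - B (A u)) = 0" using Ey[of "A u"] u by (simp add: op_diff[OF Aop] Z_def)
		then have "R n (u - B (A u)) : cspan T" using u by (intro kerT) (simp add: ker_def)
		then have "u : cspan T" using u Ru r(3)[of "A u"] by (simp add: R_diff)
		then obtain s where s: "u = (SUM x:T. s x *C x)"
			using finite_subset[OF Bs(1) Bsfin] by (auto simp: cspan_finite)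
		define v where "v = (%x. if x : T then - s x else t x)"
		have "(SUM x:Bs. v x *C x) = (SUM x:G. v x *C x) + (SUM x:T. v x *C x)"
			unfolding G_def by (rule sum.subset_diff[OF Bs(1) Bsfin])
		also have "(SUM x:G. v x *C x) = u" unfolding u_def by (rule sum.cong) (auto simp: v_def G_def)
		also have "(SUM x:T. v x *C x) = - u" unfolding s by (simp add: v_def sum_negf)
		finally have "(SUM x:Bs. v x *C x) = 0" by simp
		then have "v g = 0" using complex_vector.independentD[OF Bs(3) Bsfin order_refl] g by (auto simp: G_def)
		then show ?thesis using g by (simp add: v_def G_def)
	qed
	define H0 where "H0 = Z ` G"
	have H0: "inj_on Z G" "cindependent H0"
		unfolding H0_def using independent_family[OF Gfin, of Z] Zzero by auto
	have H0card: "card H0 = card G" unfolding H0_def by (rule card_image[OF H0(1)])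
	have H0W: "H0 \<subseteq> cspan W" unfolding H0_def Z_def using Espan by blast
	obtain Hs where Hs: "H0 \<subseteq> Hs" "Hs \<subseteq> cspan W" "cindependent Hs" "cspan W \<subseteq> cspan Hs"
		using complex_vector.maximal_independent_subset_extend[OF H0W H0(2)] by blast
	have Wind: "cindependent W"
	proof (rule complex_vector.independent_if_scalars_zero[OF r(5)])
		fix t w assume t: "(SUM w:W. t w *C w) = 0" and w: "w : W"
		have "om w (SUM w:W. t w *C w) = (SUM v:W. t v * om w v)"
			using r(6) by (subst op_sum[OF r(9)]) (auto simp: bop_scale[OF r(9)] scaleC_complex_def subset_iff)
		also have "... = (SUM v:W. if v = w then t w else 0)" using w by (intro sum.cong) (auto simp: r(10))
		also have "... = t w" using w r(5) by simp
		finally show "t w = 0" using t bop_zero[OF r(9)] by simp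
	qed
	have "card Hs = cdim (cspan W)" "card W = cdim (cspan W)"
		using complex_vector.basis_card_eq_dim[OF Hs(2,4,3)]
			complex_vector.basis_card_eq_dim[OF cspan_superset order_refl Wind] by auto
	then have Hscard: "card Hs = card W" by simp
	have Hsfin: "finite Hs" using cindependent_span_bound[OF r(5) Hs(3,2)] by blast
	define H where "H = Hs - H0"
	have Hfin: "finite H" using Hsfin by (simp add: H_def)
	have Hcard: "card H + card G = card W"
		unfolding H_def using card_Diff_subset[OF finite_subset[OF Hs(1) Hsfin] Hs(1)] card_mono[OF Hsfin Hs(1)] Hscard H0card
		by simp
	have Hin: "H \<subseteq> pY" using Hs(2) cspan_subset_pts[OF r(6)] by (auto simp: H_def)
	have Asub: "csubspace (A ` pY)"
	proof (rule complex_vector.subspaceI)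
		show "0 : A ` pY" by (rule image_eqI[of _ _ 0]) (simp_all add: bop_zero[OF Aop])
		fix x y t assume "x : A ` pY" "y : A ` pY"
		then obtain u v where uv: "u : pY" "v : pY" "x = A u" "y = A v" by blast
		have "x + y = A (u + v)" "t *C x = A (t *C u)" using uv by (auto simp: bop_add[OF Aop] bop_scale[OF Aop])
		then show "x + y : A ` pY" "t *C x : A ` pY" using uv by auto
	qed
	have spanH: "pY \<subseteq> cspan (A ` pY \<union> H)"
	proof
		fix y assume y: "y : pY"
		have "Hs \<subseteq> cspan (A ` pY \<union> H)"
		proof
			fix x assume x: "x : Hs"
			show "x : cspan (A ` pY \<union> H)"
			proof (cases "x : H0")
				case True
				then obtain g where g: "g : G" "x = Z g" by (auto simp: H0_def)
				have "x = A g - A (B (A g))" using Ey[of "A g"] Gin[OF g(1)] g(2) by (simp add: Z_def algebra_simps)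
				then have "x = A (g - B (A g))" using Gin[OF g(1)] by (simp add: op_diff[OF Aop])
				then have "x : A ` pY" using Gin[OF g(1)] by simp
				then show ?thesis by (intro cspan_base) simp
			next
				case False
				then show ?thesis using x by (intro cspan_base) (simp add: H_def)
			qed
		qed
		then have "cspan Hs \<subseteq> cspan (A ` pY \<union> H)" by (intro cspan_minimal) auto
		then have "E y : cspan (A ` pY \<union> H)" using Hs(4) Espan by blast
		moreover have "A (B y) : cspan (A ` pY \<union> H)" using y by (intro cspan_base) simp
		ultimately show "y : cspan (A ` pY \<union> H)" using Ey[OF y] cspan_add by metis
	qed
	\<comment> \<open>A combination lying in the range of \<open>A\<close> equals \<open>Z x\<close>,
	  because \<open>E\<close> fixes the span of \<open>W\<close>; so the quotient by the range can be
	  read off inside that span.\<close>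
	have Hindep: "t h = 0" if t: "(SUM h:H. t h *C h) : A ` pY" and h: "h : H" for t h
	proof -
		obtain x where x: "x : pY" "(SUM h:H. t h *C h) = A x" using t by blast
		have "(SUM h:H. t h *C h) : cspan W"
			using Hs(2) by (intro cspan_sum cspan_scale) (auto simp: H_def)
		then have "(SUM h:H. t h *C h) = Z x" using EW x(2) by (simp add: Z_def)
		also have "... = Z (R n x)" by (rule ZR[OF x(1)])
		finally have eq: "(SUM h:H. t h *C h) = Z (R n x)" .
		have "R n x : cspan Bs" using Bs(4) x(1) by blast
		then obtain s where s: "R n x = (SUM b:Bs. s b *C b)" using Bsfin by (auto simp: cspan_finite)
		have "A (R n x) = (SUM b:Bs. s b *C A b)" unfolding s using Bsin by (subst op_sum[OF Aop]) (auto simp: bop_scale[OF Aop])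
		then have "Z (R n x) = (SUM b:Bs. s b *C Z b)" using Bsin Esum[of Bs "%b. A b" s] by (simp add: Z_def)
		also have "... = (SUM b:G. s b *C Z b)"
			by (rule sum.mono_neutral_right[OF Bsfin]) (auto simp: G_def ZT)
		also have "... : cspan H0"
			by (intro cspan_sum cspan_scale cspan_base) (auto simp: H0_def)
		finally have "(SUM h:H. t h *C h) : cspan H0" unfolding eq .
		then obtain s' where s': "(SUM h:H. t h *C h) = (SUM x:H0. s' x *C x)"
			using finite_subset[OF Hs(1) Hsfin] by (auto simp: cspan_finite)
		define v where "v = (%x. if x : H0 then - s' x else t x)"
		have "(SUM x:Hs. v x *C x) = (SUM x:H. v x *C x) + (SUM x:H0. v x *C x)"
			unfolding H_def by (rule sum.subset_diff[OF Hs(1) Hsfin])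
		also have "(SUM x:H. v x *C x) = (SUM h:H. t h *C h)" by (rule sum.cong) (auto simp: v_def H_def)
		also have "(SUM x:H0. v x *C x) = - (SUM h:H. t h *C h)" unfolding s' by (simp add: v_def sum_negf)
		finally have "(SUM x:Hs. v x *C x) = 0" by simp
		then have "v h = 0" using complex_vector.independentD[OF Hs(3) Hsfin order_refl] h by (auto simp: H_def)
		then show ?thesis using h by (simp add: v_def H_def)
	qed
	have quot: "quot_dim (pY) (A ` pY) = card H"
		unfolding quot_dim_def
	proof (rule Least_equality)
		show "\<exists>B\<subseteq>pY. finite B & card B = card H & pY \<subseteq> cspan (A ` pY \<union> B)"
			using Hin Hfin spanH by blast
		fix d assume "\<exists>B\<subseteq>pY. finite B & card B = d & pY \<subseteq> cspan (A ` pY \<union> B)"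
		then obtain B' where B': "finite B'" "card B' = d" "pY \<subseteq> cspan (A ` pY \<union> B')" by blast
		have "card H <= card B'"
		proof (rule independent_mod_bound[OF Asub B'(1) Hfin])
			show "H \<subseteq> cspan (A ` pY \<union> B')" using Hin B'(3) by blast
			show "t h = 0" if "(SUM h:H. t h *C h) : A ` pY" "h : H" for t h by (rule Hindep[OF that])
		qed
		then show "card H <= d" using B'(2) by simp
	qed
	have "cdim (ker Y A) = card N" using complex_vector.basis_card_eq_dim[OF N(1,3,2)] by simp
	then show "fredholm_index Y A = int (card F) - int (card W)"
		unfolding fredholm_index_def quot using Gcard Hcard by simp
	show "fredholm Y A"
		unfolding fredholm_def fin_dim_def fin_codim_def using Aop Nfin N(3) Hin Hfin spanH by blast
qed

end

lemma sum_Pair: "(SUM i:I. (a i, b i)) = (SUM i:I. a i, SUM i:I. b i)"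
	by (induction I rule: infinite_finite_induct) (auto simp: zero_prod_def)

section \<open>Cancellation of the index on the direct sum\<close>

context lp_like
begin

text \<open>The gap \<open>W\<close> left by \<open>A\<close> is filled with the values of the
  functional component at \<open>W\<close>, and the gap spanned by the \<open>e b\<close> that the
  adjoint leaves is filled with the coordinates \<open>e b x\<close> of the vector component. Each
  finite set is matched with its own dual set, so the cardinalities of \<open>F\<close> and
  \<open>W\<close> need not agree.\<close>

lemma sum_invertible_perturbation:
	fixes A
	defines "XX == sum_space Y DY" and "S == %n. sum_op Y DY (R n) (adj Y (R n))"
		and "AA == sum_op Y DY A (adj Y A)"
	assumes reg: "regularizer A n B W om"
	obtains L G where "L : proj_compact_ops XX S" "G : ops XX"
		"!!z. z : pts XX ==> AA (G z) + L (G z) = z" "!!z. z : pts XX ==> G (AA z + L z) = z"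
proof -
	obtain F e where co: "coordinates n F e" using coordinates_exist by blast
	note r = regularizerD[OF reg] and c = coordinatesD[OF co]
	have Aop: "A : ops Y" and Bop: "B : ops Y" using r(1,2) by (auto intro: po_opsD)
	note [simp] = bop_in[OF Aop] bop_in[OF Bop]
	have ps: "proj_space XX S" unfolding XX_def S_def by (rule sum_proj_space[OF proj_space_axioms dual_proj_space])
	interpret D: proj_space "dual Y" "%n. adj Y (R n)" by (rule dual_proj_space)
	interpret S: proj_space XX S by (rule ps)
	have pts [simp]: "(x, f) : pts XX \<longleftrightarrow> x : pY & f : FY" for x f by (simp add: XX_def)
	have nrm [simp]: "nrm XX (x, f) = max (nY x) (nD f)" for x f by (simp add: XX_def)
	have S_apply [simp]: "S i (x, f) = (R i x, f o R i)" if "x : pY" "f : FY" for i x f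
		using that by (simp add: S_def adj_apply)
	have fc [simp]: "f o T : FY" if "f : FY" "T : ops Y" for f T
		using that by (rule functionals_comp)
	have bF: "b : pY" if "b : F" for b using c(2) that by blast
	have wW: "w : pY" if "w : W" for w using r(6) that by blast
	\<comment> \<open>Evaluation of the functional component at a vector, and of a fixed functional at
	  the vector component; these are the coordinates for the finite rank corrections.\<close>
	define \<phi> where "\<phi> = (%v p. if p : pts XX then snd p v else (0 :: complex))"
	define \<psi> where "\<psi> = (%(g :: 'a => complex) p. if p : pts XX then g (fst p) else 0)"
	have \<phi>: "\<phi> v : bounded_ops XX scalars" if v: "v : pY" for v
	proof (rule bopI[where c = "nY v"])
		fix p assume p: "p : pts XX"
		obtain x f where xf: "p = (x, f)" by (cases p)
		have "cmod (f v) <= nD f * nY v" using p xf v by (intro dual_bound) auto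
		also have "... <= max (nY x) (nD f) * nY v" using v by (intro mult_right_mono) auto
		finally show "nrm scalars (\<phi> v p) <= nY v * nrm XX p"
			using p by (simp add: xf \<phi>_def scalars_def mult.commute)
		show "\<phi> v p : pts scalars" by (simp add: scalars_def)
		show "\<phi> v (a *C p) = a *C \<phi> v p" for a
			using p S.scale_in[OF p, of a] by (simp add: \<phi>_def scaleC_prod_def scaleC_fun_def)
		show "\<phi> v (p + q) = \<phi> v p + \<phi> v q" if "q : pts XX" for q
			using p that S.add_in[OF p that] by (simp add: \<phi>_def)
	qed (simp add: \<phi>_def)
	have \<psi>: "\<psi> g : bounded_ops XX scalars" if g: "g : FY" for g
	proof (rule bopI[where c = "nD g"])
		have gn: "nD g >= 0" using D.nrm_nonneg[of g] g by simp
		fix p assume p: "p : pts XX"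
		obtain x f where xf: "p = (x, f)" by (cases p)
		have x: "x : pY" using p by (simp add: xf)
		have "cmod (g x) <= nD g * nY x" using x g by (intro dual_bound) auto
		also have "... <= nD g * max (nY x) (nD f)" using gn by (intro mult_left_mono) auto
		finally show "nrm scalars (\<psi> g p) <= nD g * nrm XX p"
			using p by (simp add: xf \<psi>_def scalars_def)
		show "\<psi> g p : pts scalars" by (simp add: scalars_def)
		show "\<psi> g (a *C p) = a *C \<psi> g p" for a
			using p S.scale_in[OF p, of a] x by (simp add: \<psi>_def scaleC_prod_def bop_scale[OF g] xf)
		show "\<psi> g (p + q) = \<psi> g p + \<psi> g q" if q: "q : pts XX" for q
		proof -
			obtain y h where yh: "q = (y, h)" by (cases q)
			show ?thesis using p q S.add_in[OF p q] by (simp add: \<psi>_def bop_add[OF g] xf yh)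
		qed
	qed (simp add: \<psi>_def)
	have ap: "\<phi> v (x, f) = f v" "\<psi> g (x, f) = g x" if "x : pY" "f : FY" for v g x f
		using that by (auto simp: \<phi>_def \<psi>_def)
	have zin: "(v, 0) : pts XX" "(0, g) : pts XX" if "v : pY" "g : FY" for v g
		using that functionals_zero by auto
	have \<phi>pc: "(%p. \<phi> w p *C (w, 0)) : proj_compact_ops XX S" if w: "w : W" for w
	proof -
		obtain l where l: "R l w = w" using r(8)[OF w] by blast
		have z: "(w, 0) : pts XX" using wW[OF w] functionals_zero by simp
		show ?thesis
		proof (rule S.pc_rank_one[OF \<phi>[OF wW[OF w]] z])
			show "S l (w, 0) = (w, 0)" using wW[OF w] functionals_zero l by (simp add: fun_eq_iff)
			have "\<phi> w (p - S l p) = 0" if p: "p : pts XX" for p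
				using p S.diff_in[OF p S.R_in[OF p], of l] wW[OF w] l by (cases p) (simp add: \<phi>_def R_ops)
			then show "EX i. ALL p:pts XX. cmod (\<phi> w (p - S i p)) <= eps * nrm XX p" if "eps > 0" for eps
				using that by (intro exI[of _ l]) simp
		qed
	qed
	have \<psi>pc: "(%p. \<psi> (e b) p *C (0, e b)) : proj_compact_ops XX S" for b
	proof -
		have z: "(0, e b) : pts XX" using c(5) by simp
		have "e b o R n = e b" by (rule bop_eqI[OF fc[OF c(5) R_ops] c(5)]) (simp add: c(8))
		show ?thesis
		proof (rule S.pc_rank_one[OF \<psi>[OF c(5)] z])
			show "S n (0, e b) = (0, e b)" using c(5) \<open>e b o R n = e b\<close> by simp
			have "\<psi> (e b) (p - S n p) = 0" if p: "p : pts XX" for p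
				using p S.diff_in[OF p S.R_in[OF p], of n]
				by (cases p) (simp add: \<psi>_def op_diff[OF c(5)] c(8))
			then show "EX i. ALL p:pts XX. cmod (\<psi> (e b) (p - S i p)) <= eps * nrm XX p" if "eps > 0" for eps
				using that by (intro exI[of _ n]) simp
		qed
	qed
	\<comment> \<open>A + T vanishes on the image of \<open>R n\<close>, which frees it for the finite
	  rank terms of \<open>L\<close>.\<close>
	define T where "T = - (A o R n)"
	have T: "T : KY" unfolding T_def by (intro pc_neg po_pc r(1) R_pc)
	define L where "L = sum_op Y DY T (adj Y T)
		+ ((SUM w:W. (%p. \<phi> w p *C (w, 0))) + (SUM b:F. (%p. \<psi> (e b) p *C (0, e b))))"
	define G where "G = sum_op Y DY B (adj Y B)
		+ ((SUM b:F. (%p. \<phi> b p *C (b, 0))) + (SUM w:W. (%p. \<psi> (om w) p *C (0, om w))))"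
	have L: "L : proj_compact_ops XX S"
		unfolding L_def
	proof (intro S.pc_plus S.pc_sum \<phi>pc \<psi>pc)
		show "sum_op Y DY T (adj Y T) : proj_compact_ops XX S"
			unfolding XX_def S_def by (rule sum_op_pc[OF proj_space_axioms dual_proj_space T adj_pc[OF T]])
	qed
	have G: "G : ops XX"
		unfolding G_def
	proof (intro S.ops_plus S.ops_sum)
		show "sum_op Y DY B (adj Y B) : ops XX"
			unfolding XX_def by (rule sum_op_ops[OF norm_space D.norm_space Bop adj_ops[OF Bop]])
		show "(%p. \<phi> b p *C (b, 0)) : ops XX" if "b : F" for b
			by (rule S.rank_one_ops[OF \<phi>[OF bF[OF that]]]) (simp add: bF[OF that] functionals_zero)
		show "(%p. \<psi> (om w) p *C (0, om w)) : ops XX" for w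
			by (rule S.rank_one_ops[OF \<psi>[OF r(9)]]) (simp add: r(9))
	qed
	have fsum: "(SUM i:I. t i *C h i) : FY"
		if "!!i. h i : FY" for t and h :: "'a => 'a => complex" and I
		using D.sum_in[of I "%i. t i *C h i"] functionals_cscale[OF that] by simp
	have Aap: "(AA + L) (x, f) = (A (x - R n x) + (SUM w:W. f w *C w),
			(f o (A o (id_op Y - R n))) + (SUM b:F. e b x *C e b))"
		if x: "x : pY" and f: "f : FY" for x f
	proof -
		have "(f o A) + (f o T) = f o (A o (id_op Y - R n))"
		proof (rule bop_eqI[OF functionals_plus[OF fc[OF f Aop] fc[OF f pc_opsD[OF T]]] fc[OF f ops_comp[OF Aop tail_op]]])
			fix y assume y: "y : pY"
			show "((f o A) + (f o T)) y = (f o (A o (id_op Y - R n))) y"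
				using y by (simp add: T_def op_diff[OF Aop] op_diff[OF f] bop_uminus[OF f])
		qed
		then show ?thesis
			unfolding AA_def L_def using x f
			by (simp add: sum_fun_apply ap adj_apply scaleC_prod_def sum_Pair T_def op_diff[OF Aop] add.assoc[symmetric] sum.neutral)
	qed
	have Gap: "G (x, f) = (B x + (SUM b:F. f b *C b), (f o B) + (SUM w:W. om w x *C om w))"
		if x: "x : pY" and f: "f : FY" for x f
		unfolding G_def using x f
		by (simp add: sum_fun_apply ap adj_apply scaleC_prod_def sum_Pair)
	have eF: "e b (SUM v:F. t v *C v) = t b" if b: "b : F" for b t
	proof -
		have "e b (SUM v:F. t v *C v) = (SUM v:F. if v = b then t b else 0)"
			using b bF c(7)[OF b] by (subst op_sum[OF c(5)]) (auto intro!: sum.cong simp: bop_scale[OF c(5)] scaleC_complex_def)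
		then show ?thesis using c(1) b by simp
	qed
	have omW: "om w (SUM v:W. t v *C v) = t w" if w: "w : W" for w t
	proof -
		have "om w (SUM v:W. t v *C v) = (SUM v:W. if v = w then t w else 0)"
			using w wW r(10)[OF w] by (subst op_sum[OF r(9)]) (auto intro!: sum.cong simp: bop_scale[OF r(9)] scaleC_complex_def)
		then show ?thesis using r(5) w by simp
	qed
	have BW: "B (SUM v:W. t v *C v) = 0" for t
		using wW r(7) by (subst op_sum[OF Bop]) (auto simp: bop_scale[OF Bop])
	have eB: "e b (B y) = 0" if "y : pY" for b y
		using c(8)[of "B y" b] r(3)[OF that] that bop_zero[OF c(5)] by simp
	have RF: "R n (SUM b:F. t b *C b) = (SUM b:F. t b *C b)" for t
		using bF c(4) by (subst op_sum[OF R_ops]) (auto simp: R_scale)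
	have Fin: "(SUM b:F. t b *C b) : pY" for t using bF by (intro sum_in) auto
	have Win: "(SUM b:W. t b *C b) : pY" for t using wW by (intro sum_in) auto
	have tl: "x - R n x : tail_space n" if "x : pY" for x by (rule tail_split(2)[OF Aop that])
	have lin: "(SUM i:I. t i *C h i) y = (SUM i:I. t i * h i y)" for t and h :: "'a => 'a => complex" and I y
		by (simp add: sum_fun_apply scaleC_fun_def scaleC_complex_def)
	have fs: "f (SUM i:I. t i *C i) = (SUM i:I. t i * f i)" if "f : FY" "I \<subseteq> pY" for f t I
		using that by (subst op_sum[OF that(1)]) (auto simp: bop_scale[OF that(1)] scaleC_complex_def subset_iff)
	show ?thesis
	proof (rule that[OF L G])
		fix z assume z: "z : pts XX"
		obtain y g where yg: "z = (y, g)" by (cases z)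
		have y: "y : pY" and g: "g : FY" using z yg by auto
		let ?x = "B y + (SUM b:F. g b *C b)" and ?f = "(g o B) + (SUM w:W. om w y *C om w)"
		have x: "?x : pY" using y Fin by simp
		have f: "?f : FY" by (intro functionals_plus fc fsum r(9) g Bop)
		have fw: "?f w = om w y" if w: "w : W" for w
		proof -
			have "(SUM v:W. om v y * om v w) = (SUM v:W. if v = w then om w y else 0)"
				using w by (intro sum.cong) (auto simp: r(10))
			then show ?thesis using w r(5,7) bop_zero[OF g] by (simp add: lin)
		qed
		have tx: "?x - R n ?x = B y" using y Fin RF r(3)[OF y] by (simp add: R_add)
		have 1: "A (?x - R n ?x) + (SUM w:W. ?f w *C w) = y" unfolding tx using fw r(12)[OF y] by simp
		have 2: "(?f o (A o (id_op Y - R n))) + (SUM b:F. e b ?x *C e b) = g"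
		proof (rule bop_eqI[OF functionals_plus[OF fc[OF f ops_comp[OF Aop tail_op]] fsum[OF c(5)]] g])
			fix u assume u: "u : pY"
			have eb: "e b ?x = g b" if "b : F" for b using eF[OF that] eB[OF y] y Fin by (simp add: bop_add[OF c(5)])
			have "?f (A (u - R n u)) = g (u - R n u)"
				using r(4)[OF tl[OF u]] r(11)[OF _ tl[OF u]] by (simp add: lin)
			moreover have "(SUM b:F. e b ?x *C e b) u = g (SUM b:F. e b u *C b)"
				unfolding fs[OF g c(2)] lin using eb by (intro sum.cong) (auto simp: mult.commute)
			ultimately show "((?f o (A o (id_op Y - R n))) + (SUM b:F. e b ?x *C e b)) u = g u"
				using u c(6)[OF u] by (simp add: op_diff[OF g])
		qed
		show "AA (G z) + L (G z) = z"
			unfolding yg Gap[OF y g] using Aap[OF x f] 1 2 by simp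
	next
		fix z assume z: "z : pts XX"
		obtain x f where xf: "z = (x, f)" by (cases z)
		have x: "x : pY" and f: "f : FY" using z xf by auto
		let ?y = "A (x - R n x) + (SUM w:W. f w *C w)"
			and ?g = "(f o (A o (id_op Y - R n))) + (SUM b:F. e b x *C e b)"
		have y: "?y : pY" using x Win by simp
		have g: "?g : FY" by (intro functionals_plus fc fsum c(5) f ops_comp Aop tail_op)
		have gb: "?g b = e b x" if b: "b : F" for b
		proof -
			have "(SUM v:F. e v x * e v b) = (SUM v:F. if v = b then e b x else 0)"
				using b by (intro sum.cong) (auto simp: c(7))
			then show ?thesis using b c(1) c(4)[OF b] bF[OF b] bop_zero[OF f] bop_zero[OF Aop] by (simp add: lin)
		qed
		have 1: "B ?y + (SUM b:F. ?g b *C b) = x"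
			using x gb c(6)[OF x] r(4)[OF tl[OF x]] BW Win by (simp add: bop_add[OF Bop])
		have omy: "om w ?y = f w" if w: "w : W" for w
			using r(11)[OF w tl[OF x]] omW[OF w, of f] Win x by (simp add: bop_add[OF r(9)])
		have 2: "(?g o B) + (SUM w:W. om w ?y *C om w) = f"
		proof (rule bop_eqI[OF functionals_plus[OF fc[OF g Bop] fsum[OF r(9)]] f])
			fix u assume u: "u : pY"
			have "?g (B u) = f (A (B u))" using u r(3)[OF u] eB[OF u] by (simp add: lin)
			moreover have "(SUM w:W. om w ?y *C om w) u = f (SUM w:W. om w u *C w)"
				unfolding fs[OF f r(6)] lin using omy by (intro sum.cong) (auto simp: mult.commute)
			ultimately have "((?g o B) + (SUM w:W. om w ?y *C om w)) u = f (A (B u)) + f (SUM w:W. om w u *C w)"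
				by simp
			also have "... = f u" using r(12)[OF u] bop_add[OF f, of "A (B u)" "SUM w:W. om w u *C w"] u Win by simp
			finally show "((?g o B) + (SUM w:W. om w ?y *C om w)) u = f u" .
		qed
		have "AA z + L z = (?y, ?g)" using Aap[OF x f] xf by simp
		then show "G (AA z + L z) = z" using Gap[OF y g] 1 2 xf by simp
	qed
qed

end

section \<open>Lower norms and quotient norms\<close>

context cnorm_space
begin

lemma lower_norm_on_bound:
	assumes T: "T : ops Y" and M: "M \<subseteq> pY" "!!a x. x : M ==> a *C x : M" and x: "x : M"
	shows "lower_norm_on Y M T * nY x <= nY (T x)"
proof (cases "x = 0")
	case True
	then show ?thesis by (simp add: bop_zero[OF T])
next
	case False
	have xp: "x : pY" using M(1) x by blast
	then have pos: "nY x > 0" using False nrm_pos_iff by blast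
	let ?u = "complex_of_real (1 / nY x) *C x"
	have "lower_norm_on Y M T <= nY (T ?u)"
		unfolding lower_norm_on_def
	proof (rule cINF_lower)
		show "bdd_below ((%x. nY (T x)) ` {x : M. nY x = 1})"
			using M(1) bop_in[OF T] by (intro bdd_belowI[of _ 0]) (auto intro: nrm_nonneg)
		show "?u : {x : M. nY x = 1}" using M(2)[OF x] nrm_normalize[OF xp False] by simp
	qed
	also have "... = nY (T x) / nY x"
		using xp bop_in[OF T xp] by (simp add: bop_scale[OF T] nrm_scale norm_divide)
	finally show ?thesis using pos by (simp add: pos_le_divide_eq)
qed

text \<open>The nonzero vector guards against an infimum over the empty set.\<close>

lemma lower_norm_on_ge:
	assumes M: "M \<subseteq> pY" "!!a x. x : M ==> a *C x : M" "EX x:M. x ~= 0"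
		and c: "!!x. x : M ==> c * nY x <= nY (T x)"
	shows "c <= lower_norm_on Y M T"
	unfolding lower_norm_on_def
proof (rule cINF_greatest)
	obtain x where "x : M" "x ~= 0" using M(3) by blast
	then have "complex_of_real (1 / nY x) *C x : {x : M. nY x = 1}"
		using M nrm_normalize[of x] by blast
	then show "{x : M. nY x = 1} ~= {}" by blast
	show "c <= nY (T x)" if "x : {x : M. nY x = 1}" for x using c[of x] that by simp
qed

lemma lower_norm_bound: "T : ops Y ==> x : pY ==> lower_norm Y T * nY x <= nY (T x)"
	unfolding lower_norm_def by (rule lower_norm_on_bound) auto

text \<open>Translates the supremum of infima into a test with inequalities. Positive constants
  suffice, because 0 is a trivial lower bound for \<open>K = 0\<close>.\<close>

lemma sup_lower_norm_eqI:
	assumes T: "T : ops Y" and \<K>: "!!K. K : \<K> ==> K : ops Y" "0 : \<K>" and nt: "EX x:pY. x ~= 0"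
		and b: "b >= 0"
		and up: "!!K c. K : \<K> ==> c > 0 ==> (!!x. x : pY ==> c * nY x <= nY (T x + K x)) ==> c <= b"
		and low: "!!c. 0 < c ==> c < b ==> EX K:\<K>. ALL x:pY. c * nY x <= nY (T x + K x)"
	shows "(SUP K\<in>\<K>. lower_norm Y (T + K)) = b"
proof -
	have le: "lower_norm Y (T + K) <= b" if K: "K : \<K>" for K
	proof (cases "lower_norm Y (T + K) > 0")
		case True
		show ?thesis
			by (rule up[OF K True]) (use lower_norm_bound[OF ops_plus[OF T \<K>(1)[OF K]]] in simp)
	qed (use b in simp)
	have bdd: "bdd_above ((%K. lower_norm Y (T + K)) ` \<K>)" using le by (intro bdd_aboveI[of _ b]) auto
	have ge: "c <= (SUP K\<in>\<K>. lower_norm Y (T + K))"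
		if K: "K : \<K>" and c: "!!x. x : pY ==> c * nY x <= nY (T x + K x)" for K c
	proof -
		have "c <= lower_norm Y (T + K)"
			unfolding lower_norm_def by (rule lower_norm_on_ge) (use nt c in auto)
		also have "... <= (SUP K\<in>\<K>. lower_norm Y (T + K))" by (rule cSUP_upper[OF K bdd])
		finally show ?thesis .
	qed
	show ?thesis
	proof (rule antisym)
		show "(SUP K\<in>\<K>. lower_norm Y (T + K)) <= b" using \<K>(2) le by (intro cSUP_least) auto
		show "b <= (SUP K\<in>\<K>. lower_norm Y (T + K))"
		proof (cases "b = 0")
			case True
			then show ?thesis using bop_in[OF T] by (intro ge[OF \<K>(2)]) simp
		next
			case False
			then have "0 < b" using b by simp
			then show ?thesis by (rule dense_le_bounded) (use low ge in blast)
		qed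
	qed
qed

lemma sup_lower_norm_pos:
	assumes T: "T : ops Y" and \<K>: "!!K. K : \<K> ==> K : ops Y" "0 : \<K>"
		and pos: "(SUP K\<in>\<K>. lower_norm Y (T + K)) > 0"
	obtains K c where "K : \<K>" "c > 0" "!!x. x : pY ==> c * nY x <= nY (T x + K x)"
proof -
	obtain K where K: "K : \<K>" "lower_norm Y (T + K) > 0"
	proof (rule ccontr)
		assume "~ thesis"
		then have "lower_norm Y (T + K) <= 0" if "K : \<K>" for K using that \<open>!!K. K : \<K> ==> 0 < lower_norm Y (T + K) ==> thesis\<close> by force
		then have "(SUP K\<in>\<K>. lower_norm Y (T + K)) <= 0" using \<K>(2) by (intro cSUP_least) auto
		then show False using pos by simp
	qed
	show ?thesis
		by (rule that[OF K]) (use lower_norm_bound[OF ops_plus[OF T \<K>(1)[OF K(1)]]] in simp)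
qed

end

section \<open>Limits of lower norms on tails\<close>

context proj_space
begin

lemma tail_image:
	assumes "!!x. x : pY ==> Q x = x - R m x"
	shows "Q ` pY = {x : pY. R m x = 0}"
	using assms by (auto simp: R_tail intro!: image_eqI)

text \<open>\<open>mu_tilde\<close> is defined by \<open>lim\<close>, which is informative only once
  convergence is known: the lower norms increase with \<open>m\<close> and are bounded by a bound of
  \<open>T\<close> because every tail space is nontrivial.\<close>

lemma mu_tilde_limit:
	assumes T: "T : ops Y" and Q: "!!m x. x : pY ==> Q m x = x - R m x"
		and nt: "!!m. EX x:pY. R m x = 0 & x ~= 0"
	defines "a == %m. lower_norm_on Y (Q m ` pY) T"
	shows "a ----> mu_tilde Y Q T" "a m <= mu_tilde Y Q T" "0 <= a m"
		"x : pY ==> R m x = 0 ==> a m * nY x <= nY (T x)"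
		"(!!x. x : pY ==> R m x = 0 ==> c * nY x <= nY (T x)) ==> c <= a m"
proof -
	have a: "a m = lower_norm_on Y {x : pY. R m x = 0} T" for m
		unfolding a_def by (simp add: tail_image[OF Q])
	show bound: "a m * nY x <= nY (T x)" if "x : pY" "R m x = 0" for m x
		unfolding a by (rule lower_norm_on_bound[OF T]) (use that in \<open>auto simp: R_scale\<close>)
	show ge: "c <= a m" if "!!x. x : pY ==> R m x = 0 ==> c * nY x <= nY (T x)" for m c
		unfolding a by (rule lower_norm_on_ge) (use that nt in \<open>auto simp: R_scale\<close>)
	show "0 <= a m" for m using bop_in[OF T] by (intro ge) simp
	have mono: "a m <= a l" if "m <= l" for m l
	proof (rule ge)
		fix x assume x: "x : pY" "R l x = 0"
		then have "R m x = 0" using R_R[of x m l] that by (simp add: min_absorb1)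
		then show "a m * nY x <= nY (T x)" by (rule bound[OF x(1)])
	qed
	obtain g where g: "g > 0" "!!x. x : pY ==> nY (T x) <= g * nY x"
		using bop_bound[OF norm_space T] by blast
	have "a m <= g" for m
	proof -
		obtain x where x: "x : pY" "R m x = 0" "x ~= 0" using nt by blast
		have "a m * nY x <= g * nY x" using bound[OF x(1,2)] g(2)[OF x(1)] by linarith
		then show ?thesis using x nrm_pos_iff[of x] by simp
	qed
	then obtain l where l: "a ----> l" "!!m. a m <= l"
		using incseq_convergent[of a g] mono by (auto simp: incseq_def)
	have "mu_tilde Y Q T = l" unfolding mu_tilde_def a_def[symmetric] using l(1) by (simp add: limI)
	then show "a ----> mu_tilde Y Q T" "a m <= mu_tilde Y Q T" using l by auto
qed

lemma mu_tilde_eqI: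
	assumes T: "T : ops Y" and Q: "!!m x. x : pY ==> Q m x = x - R m x"
		and nt: "!!m. EX x:pY. R m x = 0 & x ~= 0" and b: "b >= 0"
		and up: "!!m c. c > 0 ==> (!!x. x : pY ==> R m x = 0 ==> c * nY x <= nY (T x)) ==> c <= b"
		and low: "!!c. 0 < c ==> c < b ==> EX m. ALL x:pY. R m x = 0 --> c * nY x <= nY (T x)"
	shows "mu_tilde Y Q T = b"
proof (rule antisym)
	note l = mu_tilde_limit[where Q = Q, OF T Q nt]
	have "lower_norm_on Y (Q m ` pY) T <= b" for m
	proof (cases "lower_norm_on Y (Q m ` pY) T > 0")
		case True
		show ?thesis by (rule up[OF True, of m]) (rule l(4))
	qed (use b in simp)
	then show "mu_tilde Y Q T <= b" using LIMSEQ_le_const2[OF l(1)] by blast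
	show "b <= mu_tilde Y Q T"
	proof (cases "b = 0")
		case True
		then show ?thesis using l(2)[of 0] l(3)[of 0] by simp
	next
		case False
		then have "0 < b" using b by simp
		then show ?thesis
		proof (rule dense_le_bounded)
			fix c assume "0 < c" "c < b"
			then obtain m where "ALL x:pY. R m x = 0 --> c * nY x <= nY (T x)" using low by blast
			then have "c <= lower_norm_on Y (Q m ` pY) T" by (intro l(5)) simp_all
			then show "c <= mu_tilde Y Q T" using l(2)[of m] by linarith
		qed
	qed
qed

lemma mu_tilde_pos:
	assumes T: "T : ops Y" and Q: "!!m x. x : pY ==> Q m x = x - R m x"
		and nt: "!!m. EX x:pY. R m x = 0 & x ~= 0"
	shows "mu_tilde Y Q T >= 0"
		"mu_tilde Y Q T > 0 ==> EX m c. c > 0 & (ALL x:pY. R m x = 0 --> c * nY x <= nY (T x))"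
proof -
	note l = mu_tilde_limit[where Q = Q, OF T Q nt]
	show "mu_tilde Y Q T >= 0" using l(2)[of 0] l(3)[of 0] by linarith
	assume "mu_tilde Y Q T > 0"
	from order_tendstoD(1)[OF l(1) this] obtain m where "lower_norm_on Y (Q m ` pY) T > 0"
		by (auto simp: eventually_sequentially)
	then show "EX m c. c > 0 & (ALL x:pY. R m x = 0 --> c * nY x <= nY (T x))" using l(4) by blast
qed

end

text \<open>Covers both quotients, L(X, P) by K(X, P) and all bounded operators by the compact
  ones.\<close>

locale op_algebra = cnorm_space Y for Y :: "'a::complex_vector cnspace" +
	fixes L J :: "('a => 'a) set"
	assumes L_ops: "T : L ==> T : ops Y" and L_plus: "T : L ==> S : L ==> T + S : L"
		and L_neg: "T : L ==> - T : L" and L_comp: "T : L ==> S : L ==> T o S : L"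
		and L_id: "id_op Y : L" and J_L: "K : J ==> K : L" and J_zero: "0 : J"
		and J_plus: "K : J ==> K' : J ==> K + K' : J" and J_neg: "K : J ==> - K : J"
		and J_left: "T : L ==> K : J ==> T o K : J" and J_right: "T : L ==> K : J ==> K o T : J"
begin

lemma op_ring_simps [simp]:
	"carrier (op_ring Y L) = L" "one (op_ring Y L) = id_op Y" "zero (op_ring Y L) = 0"
	"mult (op_ring Y L) S T = S o T" "add (op_ring Y L) S T = S + T"
	by (simp_all add: op_ring_def)

lemma comp_id: assumes "T : ops Y" shows "id_op Y o T = T" "T o id_op Y = T"
	using bop_in[OF assms] bop_out[OF assms] bop_zero[OF assms] zero_in by (auto simp: fun_eq_iff id_op_def)

lemma ring: "ring (op_ring Y L)"
proof (rule ringI)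
	show "abelian_group (op_ring Y L)"
		by (rule abelian_groupI)
			(auto simp: L_plus J_L J_zero add_ac intro!: bexI[of _ "- _"] L_neg)
	show "monoid (op_ring Y L)"
		by (rule monoidI) (auto simp: L_comp L_id comp_id L_ops comp_assoc)
	fix S T U assume S: "S : carrier (op_ring Y L)" "T : carrier (op_ring Y L)" "U : carrier (op_ring Y L)"
	then have o: "S : ops Y" "T : ops Y" "U : ops Y" by (auto simp: L_ops)
	show "(S \<oplus>\<^bsub>op_ring Y L\<^esub> T) \<otimes>\<^bsub>op_ring Y L\<^esub> U = S \<otimes>\<^bsub>op_ring Y L\<^esub> U \<oplus>\<^bsub>op_ring Y L\<^esub> T \<otimes>\<^bsub>op_ring Y L\<^esub> U"
		by (simp add: fun_eq_iff)
	have "U (S x + T x) = U (S x) + U (T x)" for x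
		using bop_add[OF o(3) bop_in[OF o(1)] bop_in[OF o(2)], of x x] bop_out[OF o(1), of x] bop_out[OF o(2), of x] bop_zero[OF o(3)]
		by (cases "x : pY") auto
	then show "U \<otimes>\<^bsub>op_ring Y L\<^esub> (S \<oplus>\<^bsub>op_ring Y L\<^esub> T) = U \<otimes>\<^bsub>op_ring Y L\<^esub> S \<oplus>\<^bsub>op_ring Y L\<^esub> U \<otimes>\<^bsub>op_ring Y L\<^esub> T"
		by (simp add: fun_eq_iff)
qed

lemma ideal: "ideal J (op_ring Y L)"
proof -
	interpret ring "op_ring Y L" by (rule ring)
	show ?thesis
	proof (rule idealI[OF ring])
		show "subgroup J (add_monoid (op_ring Y L))"
		proof
			fix K assume K: "K : J"
			have "inv\<^bsub>add_monoid (op_ring Y L)\<^esub> K = - K"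
				using minus_equality[of "- K" K] J_L[OF K] L_neg[OF J_L[OF K]] by (simp add: a_inv_def)
			then show "inv\<^bsub>add_monoid (op_ring Y L)\<^esub> K : J" using J_neg[OF K] by simp
		qed (auto simp: J_L J_zero J_plus)
	qed (auto simp: J_left J_right)
qed

lemma in_coset: "T' : J +>\<^bsub>op_ring Y L\<^esub> T \<longleftrightarrow> T' - T : J"
	by (auto simp: a_r_coset_def' intro: bexI[of _ "T' - T"])

lemma coset_eq: "J +>\<^bsub>op_ring Y L\<^esub> S = J +>\<^bsub>op_ring Y L\<^esub> T \<longleftrightarrow> S - T : J"
proof
	assume "J +>\<^bsub>op_ring Y L\<^esub> S = J +>\<^bsub>op_ring Y L\<^esub> T"
	then show "S - T : J" using in_coset[of S S] in_coset[of S T] J_zero by simp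
next
	assume ST: "S - T : J"
	have "X - S : J \<longleftrightarrow> X - T : J" for X
		using J_plus[OF _ ST, of "X - S"] J_plus[OF _ J_neg[OF ST], of "X - T"] by auto
	then show "J +>\<^bsub>op_ring Y L\<^esub> S = J +>\<^bsub>op_ring Y L\<^esub> T" by (auto simp: in_coset)
qed

text \<open>The inverse coset consists of exactly the inverses of \<open>A\<close> modulo
  \<open>J\<close>, so the quotient norm is an infimum over them. Inequalities in product form avoid
  dividing by norms and include the noninvertible case as \<open>b = 0\<close>.\<close>

lemma inv_coset_norm_inv_eqI:
	assumes A: "A : L" and b: "b >= 0"
		and up: "!!C c. C : L ==> (C o A) - id_op Y : J ==> (A o C) - id_op Y : J ==> c > 0 ==>
			(!!x. x : pY ==> c * nY (C x) <= nY x) ==> c <= b"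
		and low: "!!c. 0 < c ==> c < b ==> EX C:L. (C o A) - id_op Y : J & (A o C) - id_op Y : J &
			(ALL x:pY. c * nY (C x) <= nY x)"
	shows "inv_coset_norm_inv Y L J A = b"
proof -
	interpret I: ideal J "op_ring Y L" by (rule ideal)
	define Q where "Q = op_ring Y L Quot J"
	define q where "q = (%T. J +>\<^bsub>op_ring Y L\<^esub> T)"
	interpret Q: ring Q unfolding Q_def by (rule I.quotient_is_ring)
	have carrier: "carrier Q = q ` L" by (auto simp: Q_def FactRing_def A_RCOSETS_def' q_def)
	have mult: "q S \<otimes>\<^bsub>Q\<^esub> q T = q (S o T)" if "S : L" "T : L" for S T
		using ring_hom_mult[OF I.rcos_ring_hom, of S T] that by (simp add: Q_def q_def)
	have one: "\<one>\<^bsub>Q\<^esub> = q (id_op Y)" using ring_hom_one[OF I.rcos_ring_hom] by (simp add: Q_def q_def)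
	have q_eq: "q S = q T \<longleftrightarrow> S - T : J" for S T by (simp add: q_def coset_eq)
	have le: "1 / b <= op_norm Y Y C & 0 < b"
		if C: "C : L" "(C o A) - id_op Y : J" "(A o C) - id_op Y : J" for C
	proof -
		\<comment> \<open>Adding \<open>t\<close> keeps the denominator positive before the norm is known
		  to be.\<close>
		have le: "1 / (op_norm Y Y C + t) <= b" if t: "t > 0" for t
		proof (rule up[OF C])
			have pos: "op_norm Y Y C + t > 0" using opn_nonneg[OF L_ops[OF C(1)]] t by simp
			then show "0 < 1 / (op_norm Y Y C + t)" by simp
			fix x assume x: "x : pY"
			have "t * nY x >= 0" using t x by simp
			then have "nY (C x) <= (op_norm Y Y C + t) * nY x"
				using opn_bound[OF L_ops[OF C(1)] x] by (simp add: distrib_right)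
			then show "1 / (op_norm Y Y C + t) * nY (C x) <= nY x"
				using pos by (simp add: pos_divide_le_eq mult.commute)
		qed
		have "0 < 1 / (op_norm Y Y C + 1)" using opn_nonneg[OF L_ops[OF C(1)]] by simp
		then have bpos: "0 < b" using le[of 1] by linarith
		have "1 / b <= op_norm Y Y C + t" if "t > 0" for t
		proof -
			have "op_norm Y Y C + t > 0" using opn_nonneg[OF L_ops[OF C(1)]] that by simp
			then show ?thesis using le[OF that] bpos by (simp add: field_simps)
		qed
		then have "1 / b <= op_norm Y Y C" by (rule field_le_epsilon)
		with bpos show ?thesis by simp
	qed
	have unit: "D : L & (D o A) - id_op Y : J & (A o D) - id_op Y : J ==> q A : Units Q & inv\<^bsub>Q\<^esub> q A = q D" for D
	proof -
		assume D: "D : L & (D o A) - id_op Y : J & (A o D) - id_op Y : J"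
		have c: "q A : carrier Q" "q D : carrier Q" using A D carrier by auto
		have "q D \<otimes>\<^bsub>Q\<^esub> q A = \<one>\<^bsub>Q\<^esub>" "q A \<otimes>\<^bsub>Q\<^esub> q D = \<one>\<^bsub>Q\<^esub>" using D A by (auto simp: mult one q_eq)
		then show ?thesis using c Q.inv_unique'[of "q A" "q D"] by (auto simp: Units_def)
	qed
	have val: "inv_coset_norm_inv Y L J A = (if q A : Units Q then inverse (coset_norm Y (inv\<^bsub>Q\<^esub> q A)) else 0)"
		by (simp add: inv_coset_norm_inv_def Let_def q_def Q_def)
	show ?thesis
	proof (cases "q A : Units Q")
		case True
		then obtain D0 where D0: "D0 : carrier Q" "D0 \<otimes>\<^bsub>Q\<^esub> q A = \<one>\<^bsub>Q\<^esub>" "q A \<otimes>\<^bsub>Q\<^esub> D0 = \<one>\<^bsub>Q\<^esub>" by (auto simp: Units_def)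
		then obtain D where D: "D : L" "D0 = q D" by (auto simp: carrier)
		have D': "D : L & (D o A) - id_op Y : J & (A o D) - id_op Y : J"
			using D0 D A by (simp add: mult one q_eq)
		have bpos: "b > 0" using le[of D] D' by blast
		\<comment> \<open>Uniqueness of inverses in the quotient ring identifies the members of the
		  coset.\<close>
		have mem: "C : q D \<longleftrightarrow> C : L & (C o A) - id_op Y : J & (A o C) - id_op Y : J" for C
		proof
			assume "C : q D"
			then have CD: "C - D : J" by (simp add: q_def in_coset)
			have C: "C : L" using L_plus[OF J_L[OF CD] D(1)] by simp
			have "q C = q D" using CD q_eq by simp
			then have "q (C o A) = q (id_op Y)" "q (A o C) = q (id_op Y)"
				using D0 D A C by (simp_all add: mult[symmetric] one)
			then show "C : L & (C o A) - id_op Y : J & (A o C) - id_op Y : J" using C by (simp add: q_eq)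
		next
			assume "C : L & (C o A) - id_op Y : J & (A o C) - id_op Y : J"
			then have "q C = q D" using unit[of C] unit[OF D'] by simp
			then show "C : q D" by (simp add: q_eq) (simp add: q_def in_coset)
		qed
		have N: "(INF C\<in>q D. op_norm Y Y C) = 1 / b"
		proof (rule antisym)
			show "1 / b <= (INF C\<in>q D. op_norm Y Y C)" using mem D' le by (intro cINF_greatest) blast+
			have bdd: "bdd_below (op_norm Y Y ` q D)" using mem le by (intro bdd_belowI[of _ "1 / b"]) blast
			have N0: "(INF C\<in>q D. op_norm Y Y C) <= 1 / c" if c: "0 < c" "c < b" for c
			proof -
				obtain C where C: "C : L" "(C o A) - id_op Y : J" "(A o C) - id_op Y : J"
					"!!x. x : pY ==> c * nY (C x) <= nY x" using low[OF c] by blast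
				have "op_norm Y Y C <= 1 / c"
					using C(4) c(1) by (intro opn_le) (auto simp: pos_le_divide_eq mult.commute)
				then show ?thesis using cINF_lower[OF bdd, of C] mem[of C] C by force
			qed
			show "(INF C\<in>q D. op_norm Y Y C) <= 1 / b"
			proof (rule ccontr)
				assume "~ ?thesis"
				then have lt: "1 / b < (INF C\<in>q D. op_norm Y Y C)" (is "_ < ?N") by simp
				then have Npos: "?N > 0" using bpos by (meson less_trans zero_less_divide_1_iff)
				have "1 / ?N < b" using lt bpos Npos by (simp add: field_simps)
				then obtain c where c: "1 / ?N < c" "c < b" using dense by blast
				have "0 < 1 / ?N" using Npos by simp
				then have "0 < c" using c(1) by linarith
				then have "?N <= 1 / c" using N0 c(2) by blast
				then show False using c(1) \<open>0 < c\<close> Npos by (simp add: field_simps)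
			qed
		qed
		show ?thesis using True unit[OF D'] bpos unfolding val coset_norm_def by (simp add: N)
	next
		case False
		have "~ 0 < b"
		proof
			assume "0 < b"
			then obtain c where "0 < c" "c < b" using dense by blast
			then obtain C where "C : L & (C o A) - id_op Y : J & (A o C) - id_op Y : J" using low by blast
			then show False using unit False by blast
		qed
		then show ?thesis using False b by (simp add: val)
	qed
qed

end

lemma (in proj_space) proj_algebra: "op_algebra Y (LY) (KY)"
	by unfold_locales (auto intro: po_opsD po_plus po_neg po_comp po_id pc_subset_po pc_zero pc_plus pc_neg po_pc pc_po)

lemma (in banach_cn) compact_ops_neg: "K : compact_ops Y ==> - K : compact_ops Y"
	using compact_ops_cscale[of K "-1"] by (simp add: complex_vector.scale_minus_left)

lemma (in banach_cn) compact_algebra: "op_algebra Y (ops Y) (compact_ops Y)"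
	by unfold_locales (auto intro: ops_plus ops_neg ops_comp ops_id compact_opsD compact_ops_zero
		compact_ops_plus compact_ops_neg compact_ops_comp_left compact_ops_comp_right)

section \<open>The essential lower norm\<close>

context proj_space
begin

text \<open>On far out vectors C T is within \<open>e\<close> of the identity, so a bound for
  \<open>C\<close> becomes a lower bound for \<open>T\<close>.\<close>

lemma tail_bound:
	assumes T: "T : ops Y" and C: "C : ops Y" and CT: "(C o T) - id_op Y : KY"
		and c: "c > 0" "!!x. x : pY ==> c * nY (C x) <= nY x" and e: "e > 0"
	shows "EX m. ALL x:pY. R m x = 0 --> c * (1 - e) * nY x <= nY (T x)"
proof -
	let ?K = "(C o T) - id_op Y"
	obtain N where N: "!!n x. n >= N ==> x : pY ==> nY (?K x - R n (?K x)) <= e * nY x"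
		"!!n x. n >= N ==> x : pY ==> nY (?K (x - R n x)) <= e * nY x"
		using pcD[OF CT e] by blast
	have "c * (1 - e) * nY x <= nY (T x)" if x: "x : pY" "R N x = 0" for x
	proof -
		have in': "T x : pY" "C (T x) : pY" "?K x : pY"
			using bop_in[OF T x(1)] bop_in[OF C] bop_in[OF pc_opsD[OF CT] x(1)] by auto
		have "nY (C (T x) - ?K x) <= nY (C (T x)) + nY (?K x)" by (rule nrm_diff[OF in'(2,3)])
		then have "nY x <= nY (C (T x)) + e * nY x" using N(2)[of N x] x by simp
		then have "c * nY x <= c * (nY (C (T x)) + e * nY x)" using c(1) by (intro mult_left_mono) auto
		then show ?thesis using c(2)[OF in'(1)] by (simp add: algebra_simps)
	qed
	then show ?thesis by blast
qed

text \<open>The part of \<open>x\<close> under \<open>R m\<close>, where no lower bound is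
  available, is absorbed into a gauge of finite rank.\<close>

lemma tail_gauge:
	assumes T: "T : ops Y" and c: "c > 0" "!!x. x : pY ==> R m x = 0 ==> c * nY x <= nY (T x)"
	obtains k where "compact_gauge Y k" "!!x. x : pY ==> c * nY x <= nY (T x) + k x"
proof -
	note [simp] = bop_in[OF T]
	obtain g where g: "g > 0" "!!x. x : pY ==> nY (T x) <= g * nY x"
		using bop_bound[OF norm_space T] by blast
	show ?thesis
	proof (rule that[of "%x. (c + g) * nY (R m x)"])
		show "compact_gauge Y (%x. (c + g) * nY (R m x))"
			by (rule compact_gauge_mono[OF gauge_R, of "c + g" _ m]) (use c g in auto)
		fix x assume x: "x : pY"
		have "nY ((x - R m x) + R m x) <= nY (x - R m x) + nY (R m x)" using x by (intro nrm_add) auto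
		then have "c * nY x <= c * nY (x - R m x) + c * nY (R m x)"
			using c(1) by (simp add: distrib_left[symmetric])
		moreover have "c * nY (x - R m x) <= nY (T (x - R m x))" using x R_tail[OF x order_refl] by (intro c(2)) auto
		moreover have "nY (T (x - R m x)) <= nY (T x) + nY (T (R m x))"
			using x nrm_diff[of "T x" "T (R m x)"] by (simp add: op_diff[OF T])
		moreover have "nY (T (R m x)) <= g * nY (R m x)" using x by (intro g) simp
		ultimately show "c * nY x <= nY (T x) + (c + g) * nY (R m x)" by (simp add: distrib_right)
	qed
qed

lemma adj_comp_diff:
	assumes "C : ops Y" "T : ops Y"
	shows "(adj Y T o adj Y C) - id_op DY = adj Y ((C o T) - id_op Y)"
proof -
	interpret D: proj_space "dual Y" "%n. adj Y (R n)" by (rule dual_proj_space)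
	have CT: "(C o T) - id_op Y : ops Y" by (intro ops_minus ops_comp ops_id assms)
	show ?thesis
	proof (rule bop_eqI)
		show "(adj Y T o adj Y C) - id_op DY : ops DY" "adj Y ((C o T) - id_op Y) : ops DY"
			by (intro D.ops_minus D.ops_comp adj_ops D.ops_id assms CT)+
		fix f assume f: "f : pD"
		then have f': "f : FY" by simp
		have "f o id_op Y = f" by (rule ext) (auto simp: id_op_def bop_zero[OF f'] bop_out[OF f'])
		then show "((adj Y T o adj Y C) - id_op DY) f = adj Y ((C o T) - id_op Y) f"
			using f adj_diff_apply[OF f' ops_comp[OF assms] ops_id] functionals_comp[OF f' assms(1)]
			by (simp add: adj_apply comp_assoc)
	qed
qed

lemma adj_inverse_bound:
	assumes C: "C : ops Y" and c: "c > 0" "!!x. x : pY ==> c * nY (C x) <= nY x"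
		and f: "f : FY"
	shows "c * nD (f o C) <= nD f"
proof -
	have "nD (adj Y C f) <= 1 / c * nD f"
		unfolding adj_apply[OF f]
		by (rule adj_bound[OF f]) (use c bop_in[OF C] in \<open>auto simp: pos_le_divide_eq mult.commute\<close>)
	then show ?thesis using c(1) by (simp add: adj_apply[OF f] pos_le_divide_eq mult.commute)
qed

end

section \<open>The common value \<open>ess_bound\<close>\<close>

context lp_like
begin

definition inverse_bounds :: "('a => 'a) => real set"
	where "inverse_bounds A = {c. c > 0 & (EX C:LY. (C o A) - id_op Y : KY &
		(A o C) - id_op Y : KY & (ALL x:pY. c * nY (C x) <= nY x))}"

text \<open>The reciprocal norm of the inverse coset modulo K(X, P), expressed without quotient
  norms; inserting 0 implements the convention for noninvertible cosets.\<close>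

definition ess_bound :: "('a => 'a) => real"
	where "ess_bound A = Sup (insert 0 (inverse_bounds A))"

context
	fixes A assumes A: "A : LY"
begin

lemma Aop: "A : ops Y" using A by (rule po_opsD)

text \<open>Half of any admissible constant is a lower bound of \<open>A\<close> on some nontrivial
  tail space, hence at most a bound of \<open>A\<close>.\<close>

lemma inverse_bounds_bdd: "bdd_above (insert 0 (inverse_bounds A))"
proof -
	obtain g where g: "g > 0" "!!x. x : pY ==> nY (A x) <= g * nY x"
		using bop_bound[OF norm_space Aop] by blast
	have "c <= 2 * g" if c: "c : inverse_bounds A" for c
	proof -
		obtain C where C: "c > 0" "C : LY" "(C o A) - id_op Y : KY"
			"ALL x:pY. c * nY (C x) <= nY x" using c by (auto simp: inverse_bounds_def)
		obtain m where m: "ALL x:pY. R m x = 0 --> c * (1 - 1 / 2) * nY x <= nY (A x)"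
			using tail_bound[OF Aop po_opsD[OF C(2)] C(3,1), of "1 / 2"] C(4) by auto
		obtain x where x: "x : pY" "R m x = 0" "x ~= 0" using tail_nontrivial by blast
		then have "c * (1 - 1 / 2) * nY x <= g * nY x" using m g(2)[OF x(1)] by force
		then show ?thesis using x nrm_pos_iff[of x] by simp
	qed
	then show ?thesis using g(1) by (intro bdd_aboveI[of _ "2 * g"]) auto
qed

lemma ess_bound_nonneg: "ess_bound A >= 0"
	unfolding ess_bound_def by (rule cSup_upper[OF _ inverse_bounds_bdd]) simp

lemma ess_bound_ge: "c : inverse_bounds A ==> c <= ess_bound A"
	unfolding ess_bound_def by (rule cSup_upper[OF _ inverse_bounds_bdd]) simp

lemma ess_bound_inverse:
	assumes c: "0 < c" "c < ess_bound A"
	obtains C where "C : LY" "(C o A) - id_op Y : KY"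
		"(A o C) - id_op Y : KY" "!!x. x : pY ==> c * nY (C x) <= nY x"
proof -
	obtain c' where c': "c' : insert 0 (inverse_bounds A)" "c < c'"
		using c(2) less_cSup_iff[OF _ inverse_bounds_bdd, of c] unfolding ess_bound_def by blast
	then have "c' : inverse_bounds A" using c(1) by auto
	then obtain C where C: "C : LY" "(C o A) - id_op Y : KY"
		"(A o C) - id_op Y : KY" "ALL x:pY. c' * nY (C x) <= nY x"
		by (auto simp: inverse_bounds_def)
	have "c * nY (C x) <= nY x" if x: "x : pY" for x
	proof -
		have "c * nY (C x) <= c' * nY (C x)"
			using c'(2) bop_in[OF po_opsD[OF C(1)] x] by (intro mult_right_mono) auto
		then show ?thesis using C(4) x by force
	qed
	then show ?thesis using that[OF C(1-3)] by blast
qed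

lemma regularizer_if_ess_bound_pos:
	assumes "ess_bound A > 0"
	obtains n B W om where "regularizer A n B W om"
proof -
	obtain c where "0 < c" "c < ess_bound A" using dense assms by blast
	then obtain C where C: "C : LY" "(C o A) - id_op Y : KY"
		"(A o C) - id_op Y : KY" by (rule ess_bound_inverse)
	show ?thesis
		by (rule regularizer_compact_inverse[OF A po_opsD[OF C(1)] pc_compact[OF C(2)] pc_compact[OF C(3)]]) (rule that)
qed

lemma near_regularizer:
	assumes reg: "regularizer A n B W om" and C: "C : LY" "C - B : KY"
	shows "(C o A) - id_op Y : KY" "(A o C) - id_op Y : KY"
proof -
	note r = regularizer_inverse[OF reg]
	have B: "B : LY" by (rule regularizerD(2)[OF reg])
	have "(C o A) - id_op Y = ((B o A) - id_op Y) + ((C - B) o A)" by (simp add: fun_eq_iff)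
	then show "(C o A) - id_op Y : KY" using pc_plus[OF r(2) pc_po[OF A C(2)]] by (simp only:)
	have "(A o C) - id_op Y = ((A o B) - id_op Y) + (A o (C - B))"
	proof (rule bop_eqI[where Y = Y and Z = Y])
		have Cop: "C : ops Y" and Bop: "B : ops Y" using C(1) B by (auto intro: po_opsD)
		show "(A o C) - id_op Y : ops Y" "((A o B) - id_op Y) + (A o (C - B)) : ops Y"
			by (intro ops_minus ops_plus ops_comp ops_id Aop Cop Bop)+
		show "((A o C) - id_op Y) x = (((A o B) - id_op Y) + (A o (C - B))) x" if "x : pY" for x
			using that bop_in[OF Cop] bop_in[OF Bop] by (simp add: op_diff[OF Aop])
	qed
	then show "(A o C) - id_op Y : KY" using pc_plus[OF r(1) po_pc[OF A C(2)]] by (simp only:)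
qed

lemma ess_bound_pos:
	assumes reg: "regularizer A n B W om"
	shows "ess_bound A > 0"
proof -
	have B: "B : LY" by (rule regularizerD(2)[OF reg])
	obtain g where g: "g > 0" "!!x. x : pY ==> nY (B x) <= g * nY x"
		using bop_bound[OF norm_space po_opsD[OF B]] by blast
	have "1 / g * nY (B x) <= nY x" if "x : pY" for x
		using g(2)[OF that] g(1) by (simp add: pos_divide_le_eq mult.commute)
	then have "1 / g : inverse_bounds A"
		unfolding inverse_bounds_def using B g(1) near_regularizer[OF reg B] pc_zero by auto
	moreover have "0 < 1 / g" using g(1) by simp
	ultimately show ?thesis using ess_bound_ge[of "1 / g"] by linarith
qed

text \<open>\<open>1 / d + (1 / c' - 1 / d)\<close> is \<open>1 / c'\<close>, kept in the form in
  which the norm bounds for regularizers deliver it: a reciprocal plus a positive error.\<close>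

lemma ess_bound_upper:
	assumes c: "c > 0" and near: "!!c' d. 0 < c' ==> c' < d ==> d < c ==> EX C:LY. C - B : KY &
			(ALL x:pY. nY (C x) <= (1 / d + (1 / c' - 1 / d)) * nY x)"
		and reg: "regularizer A n B W om"
	shows "c <= ess_bound A"
	using c
proof (rule dense_le_bounded)
	fix c' assume c': "0 < c'" "c' < c"
	then obtain d where d: "c' < d" "d < c" using dense by blast
	obtain C where C: "C : LY" "C - B : KY"
		"ALL x:pY. nY (C x) <= (1 / d + (1 / c' - 1 / d)) * nY x" using near[OF c'(1) d] by blast
	have "c' * nY (C x) <= nY x" if "x : pY" for x
		using C(3) that c'(1) by (auto simp: pos_le_divide_eq mult.commute)
	then have "c' : inverse_bounds A"
		unfolding inverse_bounds_def using C(1) c'(1) near_regularizer[OF reg C(1,2)] by auto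
	then show "c' <= ess_bound A" by (rule ess_bound_ge)
qed

text \<open>A lower bound up to a gauge persists on far out finitely supported vectors, and there it
  yields a cut off regularizer of almost reciprocal norm. Upper estimates for operators on X end
  here.\<close>

lemma ess_bound_gauge:
	assumes reg: "regularizer A n B W om" and k: "compact_gauge Y k"
		and c: "c > 0" "!!x. x : pY ==> c * nY x <= nY (A x) + k x"
	shows "c <= ess_bound A"
proof (rule ess_bound_upper[OF c(1) _ reg])
	fix c' d assume d: "0 < c'" "c' < d" "d < c"
	then have dl: "c - d > 0" and eps: "1 / c' - 1 / d > 0" and d0: "d > 0" by (auto simp: field_simps)
	obtain m where m: "!!z b. z : pY ==> R m z = 0 ==> R b z = z ==> (c - (c - d)) * nY z <= nY (A z)"
		by (rule gauge_lower_bound[where c = c and k = k, OF A k _ dl]) (use c(2) in blast)+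
	show "EX C:LY. C - B : KY &
			(ALL x:pY. nY (C x) <= (1 / d + (1 / c' - 1 / d)) * nY x)"
		by (rule regularizer_norm[where m = m, OF A regularizerD(2)[OF reg] regularizer_inverse(1)[OF reg] d0 _ eps])
			(use m in auto)
qed

lemma ess_bound_dual_gauge:
	assumes reg: "regularizer A n B W om" and k: "compact_gauge DY k"
		and c: "c > 0" "!!f. f : pD ==> c * nD f <= nD (adj Y A f) + k f"
	shows "c <= ess_bound A"
proof (rule ess_bound_upper[OF c(1) _ reg])
	interpret D: proj_kappa "dual Y" "%n. adj Y (R n)" "2 / ka" by (rule dual_kappa)
	fix c' d assume d: "0 < c'" "c' < d" "d < c"
	then have dl: "c - d > 0" and eps: "1 / c' - 1 / d > 0" and d0: "d > 0" by (auto simp: field_simps)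
	obtain m where m: "!!z b. z : pD ==> adj Y (R m) z = 0 ==> adj Y (R b) z = z ==>
			(c - (c - d)) * nD z <= nD (adj Y A z)"
		by (rule D.gauge_lower_bound[where c = c and k = k, OF adj_po[OF A] k _ dl]) (use c(2) in blast)+
	show "EX C:LY. C - B : KY &
			(ALL x:pY. nY (C x) <= (1 / d + (1 / c' - 1 / d)) * nY x)"
		by (rule regularizer_norm_dual[where m = m, OF A regularizerD(2)[OF reg] regularizer_inverse(2)[OF reg] d0 _ eps])
			(use m in auto)
qed

text \<open>An inverse modulo compact operators gives a lower bound for \<open>A\<close> whose error
  is a gauge. Hence such inverses cannot have smaller norms than those modulo K(X, P) allow.\<close>

lemma ess_bound_quotient:
	assumes reg: "regularizer A n B W om" and C: "C : ops Y" "(C o A) - id_op Y : compact_ops Y"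
		and c: "c > 0" "!!x. x : pY ==> c * nY (C x) <= nY x"
	shows "c <= ess_bound A"
proof (rule ess_bound_gauge[OF reg _ c(1)])
	let ?K = "(C o A) - id_op Y"
	show "compact_gauge Y (%x. c * nY (?K x))"
		by (rule compact_gauge_mono[where k = "%x. nY (?K x)" and a = c])
			(use C(2) c(1) in \<open>auto simp: compact_ops_gauge\<close>)
	fix x assume x: "x : pY"
	have in': "A x : pY" "C (A x) : pY" "?K x : pY"
		using x bop_in[OF Aop] bop_in[OF C(1)] bop_in[OF compact_opsD[OF C(2)]] by auto
	have "nY (C (A x) - ?K x) <= nY (C (A x)) + nY (?K x)" by (rule nrm_diff[OF in'(2,3)])
	then have "c * nY x <= c * (nY (C (A x)) + nY (?K x))" using x c(1) by (intro mult_left_mono) auto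
	then show "c * nY x <= nY (A x) + c * nY (?K x)" using c(2)[OF in'(1)] by (simp add: distrib_left)
qed

lemma quotient_norms:
	"inv_coset_norm_inv Y (LY) (KY) A = ess_bound A"
	"inv_coset_norm_inv Y (ops Y) (compact_ops Y) A = ess_bound A"
proof -
	show "inv_coset_norm_inv Y (ops Y) (compact_ops Y) A = ess_bound A"
	proof (rule op_algebra.inv_coset_norm_inv_eqI[OF compact_algebra Aop ess_bound_nonneg])
		fix C c assume C: "C : ops Y" "(C o A) - id_op Y : compact_ops Y" "(A o C) - id_op Y : compact_ops Y"
			and c: "0 < c" "!!x. x : pY ==> c * nY (C x) <= nY x"
		obtain n B W om where "regularizer A n B W om" by (rule regularizer_compact_inverse[OF A C]) (rule that)
		then show "c <= ess_bound A" by (rule ess_bound_quotient[OF _ C(1,2) c])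
	next
		fix c assume "0 < c" "c < ess_bound A"
		then obtain C where C: "C : LY" "(C o A) - id_op Y : KY"
			"(A o C) - id_op Y : KY" "!!x. x : pY ==> c * nY (C x) <= nY x"
			by (rule ess_bound_inverse) (rule that)
		then show "EX C:ops Y. (C o A) - id_op Y : compact_ops Y & (A o C) - id_op Y : compact_ops Y &
			(ALL x:pY. c * nY (C x) <= nY x)"
			using po_opsD[OF C(1)] pc_compact[OF C(2)] pc_compact[OF C(3)] by blast
	qed
	show "inv_coset_norm_inv Y (LY) (KY) A = ess_bound A"
	proof (rule op_algebra.inv_coset_norm_inv_eqI[OF proj_algebra A ess_bound_nonneg])
		fix C c assume C: "C : LY" "(C o A) - id_op Y : KY" "(A o C) - id_op Y : KY"
			and c: "0 < c" "!!x. x : pY ==> c * nY (C x) <= nY x"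
		obtain n B W om where "regularizer A n B W om"
			by (rule regularizer_compact_inverse[OF A po_opsD[OF C(1)] pc_compact[OF C(2)] pc_compact[OF C(3)]]) (rule that)
		then show "c <= ess_bound A" by (rule ess_bound_quotient[OF _ po_opsD[OF C(1)] pc_compact[OF C(2)] c])
	next
		fix c assume "0 < c" "c < ess_bound A"
		then obtain C where "C : LY" "(C o A) - id_op Y : KY"
			"(A o C) - id_op Y : KY" "!!x. x : pY ==> c * nY (C x) <= nY x"
			by (rule ess_bound_inverse) (rule that)
		then show "EX C:LY. (C o A) - id_op Y : KY & (A o C) - id_op Y : KY &
			(ALL x:pY. c * nY (C x) <= nY x)" by blast
	qed
qed

lemma dual_tail_nontrivial: "EX f:pD. adj Y (R m) f = 0 & f ~= 0"
proof -
	obtain x where x: "x : pY" "R m x = 0" "x ~= 0" using tail_nontrivial by blast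
	obtain f where f: "f : FY" "nY x <= cmod (f x)" by (rule norming_functional[OF x(1)])
	define g where "g = f o (id_op Y - R m)"
	have g: "g : FY" unfolding g_def by (rule functionals_comp[OF f(1) tail_op])
	have "adj Y (R m) g = 0"
		unfolding adj_apply[OF g]
		by (rule bop_eqI[OF functionals_comp[OF g R_ops] functionals_zero]) (simp add: g_def R_R bop_zero[OF f(1)])
	moreover have "g x ~= 0" using f(2) x nrm_pos_iff[of x] by (auto simp: g_def)
	ultimately show ?thesis using g by (intro bexI[of _ g]) auto
qed

lemma ess_below_tail:
	assumes "c > 0" "!!x. x : pY ==> R m x = 0 ==> c * nY x <= nY (A x)"
	shows "ess_below Y A"
	unfolding ess_below_def by (rule tail_gauge[OF Aop assms]) (use assms(1) in blast)+

context
	fixes Q :: "nat => 'a => 'a" assumes Q: "!!m. Q m = id_op Y - R m"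
begin

lemma Q_apply: "x : pY ==> Q m x = x - R m x" by (simp add: Q)

lemma adj_Q_apply: assumes "f : pD" shows "adj Y (Q m) f = f - adj Y (R m) f"
	using assms adj_tail[of f m] by (simp add: Q adj_apply)

lemma mu_tilde_eq:
	assumes reg: "regularizer A n B W om"
	shows "mu_tilde Y Q A = ess_bound A" "mu_tilde DY (%m. adj Y (Q m)) (adj Y A) = ess_bound A"
proof -
	interpret D: proj_space "dual Y" "%n. adj Y (R n)" by (rule dual_proj_space)
	show "mu_tilde Y Q A = ess_bound A"
	proof (rule mu_tilde_eqI[OF Aop Q_apply tail_nontrivial ess_bound_nonneg])
		fix m c assume c: "0 < c" "!!x. x : pY ==> R m x = 0 ==> c * nY x <= nY (A x)"
		show "c <= ess_bound A"
			by (rule tail_gauge[OF Aop c]) (use ess_bound_gauge[OF reg _ c(1)] in blast)+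
	next
		fix c assume c: "0 < c" "c < ess_bound A"
		obtain c' where c': "c < c'" "c' < ess_bound A" using dense[OF c(2)] by blast
		\<comment> \<open>\<open>tail_bound\<close> loses a factor \<open>1 - e\<close>; with
		  \<open>e = 1 - c / c'\<close> the constant \<open>c'\<close> becomes exactly
		  \<open>c\<close>.\<close>
		have c0: "0 < c'" "1 - c / c' > 0" using c c' by auto
		obtain C where C: "C : LY" "(C o A) - id_op Y : KY"
			"!!x. x : pY ==> c' * nY (C x) <= nY x"
			by (rule ess_bound_inverse[OF c0(1) c'(2)]) (rule that)
		show "EX m. ALL x:pY. R m x = 0 --> c * nY x <= nY (A x)"
			using tail_bound[OF Aop po_opsD[OF C(1)] C(2) c0(1) C(3) c0(2)] c0(1) by simp
	qed auto
	show "mu_tilde DY (%m. adj Y (Q m)) (adj Y A) = ess_bound A"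
	proof (rule D.mu_tilde_eqI[OF adj_ops[OF Aop] adj_Q_apply dual_tail_nontrivial ess_bound_nonneg])
		fix m c assume c: "0 < c" "!!f. f : pD ==> adj Y (R m) f = 0 ==> c * nD f <= nD (adj Y A f)"
		show "c <= ess_bound A"
			by (rule D.tail_gauge[OF adj_ops[OF Aop] c]) (use ess_bound_dual_gauge[OF reg _ c(1)] in blast)+
	next
		fix c assume c: "0 < c" "c < ess_bound A"
		obtain c' where c': "c < c'" "c' < ess_bound A" using dense[OF c(2)] by blast
		have c0: "0 < c'" "1 - c / c' > 0" using c c' by auto
		obtain C where C: "C : LY" "(A o C) - id_op Y : KY"
			"!!x. x : pY ==> c' * nY (C x) <= nY x"
			by (rule ess_bound_inverse[OF c0(1) c'(2)]) (rule that)
		have Cop: "C : ops Y" by (rule po_opsD[OF C(1)])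
		have CA: "(adj Y C o adj Y A) - id_op DY : proj_compact_ops DY (%n. adj Y (R n))"
			unfolding adj_comp_diff[OF Aop Cop] by (rule adj_pc[OF C(2)])
		have Cb: "c' * nD (adj Y C f) <= nD f" if "f : pD" for f
			using adj_inverse_bound[OF Cop c0(1) C(3), of f] that by (simp add: adj_apply)
		show "EX m. ALL f:pD. adj Y (R m) f = 0 --> c * nD f <= nD (adj Y A f)"
			using D.tail_bound[OF adj_ops[OF Aop] adj_ops[OF Cop] CA c0(1) Cb c0(2)] c0(1) by simp
	qed auto
qed

text \<open>If both one-sided numbers are positive, the two tail bounds produce a regularizer. So
  without a regularizer the minimum is 0, which is then also the value of \<open>ess_bound\<close>;
  with one, both numbers agree with it.\<close>

lemma mu_min_eq: "min (mu_tilde Y Q A) (mu_tilde DY (%m. adj Y (Q m)) (adj Y A)) = ess_bound A"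
proof (cases "EX n B W om. regularizer A n B W om")
	case True
	then show ?thesis using mu_tilde_eq by force
next
	case False
	interpret D: proj_space "dual Y" "%n. adj Y (R n)" by (rule dual_proj_space)
	let ?m = "mu_tilde Y Q A" and ?m' = "mu_tilde DY (%m. adj Y (Q m)) (adj Y A)"
	have "~ ess_bound A > 0"
	proof
		assume pos: "ess_bound A > 0"
		show False by (rule regularizer_if_ess_bound_pos[OF pos]) (use False in blast)
	qed
	then have "ess_bound A = 0" using ess_bound_nonneg by linarith
	moreover have "?m >= 0" by (rule mu_tilde_pos(1)[OF Aop Q_apply tail_nontrivial]) simp_all
	moreover have "?m' >= 0" by (rule D.mu_tilde_pos(1)[OF adj_ops[OF Aop] adj_Q_apply dual_tail_nontrivial]) simp_all
	moreover have "~ (?m > 0 & ?m' > 0)"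
	proof
		assume pos: "?m > 0 & ?m' > 0"
		have "EX m c. c > 0 & (ALL x:pY. R m x = 0 --> c * nY x <= nY (A x))"
			by (rule mu_tilde_pos(2)[OF Aop Q_apply tail_nontrivial]) (use pos in auto)
		then obtain m c where m: "c > 0" "!!x. x : pY ==> R m x = 0 ==> c * nY x <= nY (A x)" by blast
		have "EX m c. c > 0 & (ALL f:pD. adj Y (R m) f = 0 --> c * nD f <= nD (adj Y A f))"
			by (rule D.mu_tilde_pos(2)[OF adj_ops[OF Aop] adj_Q_apply dual_tail_nontrivial]) (use pos in auto)
		then obtain l d where l: "d > 0" "!!f. f : pD ==> adj Y (R l) f = 0 ==> d * nD f <= nD (adj Y A f)"
			by blast
		have e: "ess_below DY (adj Y A)"
			unfolding ess_below_def by (rule D.tail_gauge[OF adj_ops[OF Aop] l]) (use l(1) in blast)+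
		show False
			by (rule regularizer_ess_below[OF A ess_below_tail[OF m] e]) (use False in auto)
	qed
	ultimately show ?thesis by linarith
qed

end

text \<open>For the upper bound, vectors with one zero component give lower bounds up to gauges for
  \<open>A\<close> and its adjoint together, which is what a regularizer requires. For the lower
  bound, \<open>C\<close> summed with its adjoint keeps the norm bound of \<open>C\<close>, and the
  invertible perturbation on the sum lets \<open>inverse_with_norm\<close> start.\<close>

lemma sum_space_nu:
	defines "XX == sum_space Y DY" and "S == %n. sum_op Y DY (R n) (adj Y (R n))"
		and "AA == sum_op Y DY A (adj Y A)"
	shows "nu_ess_c XX AA = ess_bound A" "nu_ess XX S AA = ess_bound A"
proof -
	interpret D: proj_space "dual Y" "%n. adj Y (R n)" by (rule dual_proj_space)
	have ps: "proj_space XX S" unfolding XX_def S_def by (rule sum_proj_space[OF proj_space_axioms dual_proj_space])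
	interpret S: proj_space XX S by (rule ps)
	have AAop: "AA : ops XX" unfolding AA_def XX_def by (rule sum_op_ops[OF norm_space D.norm_space Aop adj_ops[OF Aop]])
	have AApo: "AA : proj_ops XX S"
		unfolding AA_def XX_def S_def by (rule sum_op_po[OF proj_space_axioms dual_proj_space A adj_po[OF A]])
	have nt: "EX z:pts XX. z ~= 0"
	proof -
		obtain x where "x : pY" "x ~= 0" using tail_nontrivial by blast
		then show ?thesis using functionals_zero by (intro bexI[of _ "(x, 0)"]) (auto simp: XX_def zero_prod_def)
	qed
	have up: "c <= ess_bound A"
		if K: "K : compact_ops XX" and c: "c > 0" "!!z. z : pts XX ==> c * nrm XX z <= nrm XX (AA z + K z)" for K c
	proof -
		have kg: "compact_gauge XX (%z. nrm XX (K z))" and Kop: "K : ops XX" using K by (simp_all add: S.compact_ops_gauge)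
		have tri: "c * nrm XX z <= nrm XX (AA z) + nrm XX (K z)" if "z : pts XX" for z
			using c(2)[OF that] S.nrm_add[OF bop_in[OF AAop that] bop_in[OF Kop that]] by linarith
		have g1: "compact_gauge Y (%x. nrm XX (K (x, 0)))"
			unfolding compact_gauge_def
		proof (intro allI impI)
			fix x :: "nat => 'a" and M assume x: "ALL n. x n : pY & nY (x n) <= M"
			have M: "0 <= M" by (rule order_trans[OF nrm_nonneg[of "x 0"]]) (use x in auto)
			obtain r :: "nat => nat" where r: "strict_mono r"
				"!!e. e > 0 ==> EX N. ALL i>=N. ALL j>=N. nrm XX (K ((x (r i), 0) - (x (r j), 0))) < e"
				by (rule compact_gaugeD[OF kg, of "%n. (x n, 0)" M])
					(use x M functionals_zero D.nrm_zero in \<open>auto simp: XX_def\<close>)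
			show "EX r :: nat => nat. strict_mono r & (ALL e>0. EX N. ALL i>=N. ALL j>=N. nrm XX (K (x (r i) - x (r j), 0)) < e)"
				by (intro exI[of _ r]) (use r in simp)
		qed
		have g2: "compact_gauge DY (%f. nrm XX (K (0, f)))"
			unfolding compact_gauge_def
		proof (intro allI impI)
			fix x :: "nat => 'a => complex" and M assume x: "ALL n. x n : pD & nD (x n) <= M"
			have M: "0 <= M" by (rule order_trans[OF D.nrm_nonneg[of "x 0"]]) (use x in auto)
			obtain r :: "nat => nat" where r: "strict_mono r"
				"!!e. e > 0 ==> EX N. ALL i>=N. ALL j>=N. nrm XX (K ((0, x (r i)) - (0, x (r j)))) < e"
				by (rule compact_gaugeD[OF kg, of "%n. (0, x n)" M]) (use x M in \<open>auto simp: XX_def\<close>)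
			show "EX r :: nat => nat. strict_mono r & (ALL e>0. EX N. ALL i>=N. ALL j>=N. nrm XX (K (0, x (r i) - x (r j))) < e)"
				by (intro exI[of _ r]) (use r in simp)
		qed
		have b1: "c * nY x <= nY (A x) + nrm XX (K (x, 0))" if x: "x : pY" for x
			using tri[of "(x, 0)"] x functionals_zero bop_zero[OF adj_ops[OF Aop]] D.nrm_zero bop_in[OF Aop x]
			by (simp add: XX_def AA_def max_absorb1)
		have b2: "c * nD f <= nD (adj Y A f) + nrm XX (K (0, f))" if f: "f : pD" for f
			using tri[of "(0, f)"] f bop_zero[OF Aop] D.nrm_nonneg[OF f] D.nrm_nonneg[OF bop_in[OF adj_ops[OF Aop] f]]
			by (simp add: XX_def AA_def max_absorb2)
		have e1: "ess_below Y A" unfolding ess_below_def using c(1) g1 b1 by blast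
		have e2: "ess_below DY (adj Y A)" unfolding ess_below_def using c(1) g2 b2 by blast
		obtain n B W om where reg: "regularizer A n B W om" by (rule regularizer_ess_below[OF A e1 e2]) (rule that)
		show ?thesis by (rule ess_bound_gauge[OF reg g1 c(1) b1])
	qed
	have low: "EX K:proj_compact_ops XX S. ALL z:pts XX. c * nrm XX z <= nrm XX (AA z + K z)"
		if c: "0 < c" "c < ess_bound A" for c
	proof -
		obtain n B W om where reg: "regularizer A n B W om"
			by (rule regularizer_if_ess_bound_pos) (use c that in auto)
		obtain c' where c': "c < c'" "c' < ess_bound A" using dense[OF c(2)] by blast
		\<comment> \<open>The error added to \<open>1 / c'\<close> is chosen so that the corrected inverse
		  is bounded by exactly \<open>1 / c\<close>.\<close>
		have c0: "0 < c'" "1 / c - 1 / c' > 0" using c c' by (auto simp: field_simps)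
		obtain C where C: "C : LY" "(C o A) - id_op Y : KY"
			"(A o C) - id_op Y : KY" "!!x. x : pY ==> c' * nY (C x) <= nY x"
			by (rule ess_bound_inverse[OF c0(1) c'(2)]) (rule that)
		have Cop: "C : ops Y" by (rule po_opsD[OF C(1)])
		obtain L G where L: "L : proj_compact_ops XX S" "G : ops XX"
			"!!z. z : pts XX ==> AA (G z) + L (G z) = z" "!!z. z : pts XX ==> G (AA z + L z) = z"
			by (rule sum_invertible_perturbation[OF reg, folded XX_def S_def AA_def]) (rule that)
		define CC where "CC = sum_op Y DY C (adj Y C)"
		have CCpo: "CC : proj_ops XX S"
			unfolding CC_def XX_def S_def by (rule sum_op_po[OF proj_space_axioms dual_proj_space C(1) adj_po[OF C(1)]])
		let ?H = "sum_op Y DY ((C o A) - id_op Y) (adj Y ((A o C) - id_op Y))"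
		have H: "?H : proj_compact_ops XX S"
			unfolding XX_def S_def by (rule sum_op_pc[OF proj_space_axioms dual_proj_space C(2) adj_pc[OF C(3)]])
		have "(CC o AA) - id_op XX = ?H"
		proof (rule bop_eqI)
			show "(CC o AA) - id_op XX : ops XX" "?H : ops XX"
				by (intro S.ops_minus S.ops_comp S.ops_id AAop S.po_opsD[OF CCpo] S.pc_opsD[OF H])+
			fix z assume z: "z : pts XX"
			obtain x f where xf: "z = (x, f)" by (cases z)
			have x: "x : pY" and f: "f : pD" using z by (auto simp: xf XX_def)
			have "adj Y C (adj Y A f) - f = adj Y ((A o C) - id_op Y) f"
				using f by (simp add: adj_comp_diff[OF Aop Cop, symmetric])
			then show "((CC o AA) - id_op XX) z = ?H z"
				using x f z bop_in[OF Aop x] bop_in[OF adj_ops[OF Aop] f] by (simp add: xf CC_def AA_def)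
		qed
		then have CA: "(CC o AA) - id_op XX : proj_compact_ops XX S" using H by simp
		have Cn: "nrm XX (CC z) <= 1 / c' * nrm XX z" if z: "z : pts XX" for z
		proof -
			obtain x f where xf: "z = (x, f)" by (cases z)
			have x: "x : pY" and f: "f : FY" using z by (auto simp: xf XX_def)
			have "nY (C x) <= 1 / c' * nY x" "nD (f o C) <= 1 / c' * nD f"
				using C(4)[OF x] adj_inverse_bound[OF Cop c0(1) C(4) f] c0(1) by (auto simp: pos_le_divide_eq mult.commute)
			moreover have "1 / c' * nY x <= 1 / c' * max (nY x) (nD f)"
				"1 / c' * nD f <= 1 / c' * max (nY x) (nD f)"
				using c0(1) by (auto intro!: mult_left_mono divide_right_mono)
			ultimately have "max (nY (C x)) (nD (f o C)) <= 1 / c' * max (nY x) (nD f)" by linarith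
			then show ?thesis using x f by (simp add: xf XX_def CC_def adj_apply)
		qed
		obtain K E where K: "K : proj_compact_ops XX S" "E : ops XX" "!!z. z : pts XX ==> E (AA z + K z) = z"
			"!!z. z : pts XX ==> nrm XX (E z) <= (1 / c' + (1 / c - 1 / c')) * nrm XX z"
			by (rule S.inverse_with_norm[where gam = "1 / c'" and eps = "1 / c - 1 / c'", OF AApo L CCpo CA Cn c0(2)]) (assumption | rule that)+
		have "c * nrm XX z <= nrm XX (AA z + K z)" if z: "z : pts XX" for z
			using K(4)[of "AA z + K z"] K(3)[OF z] S.add_in[OF bop_in[OF AAop z] bop_in[OF S.pc_opsD[OF K(1)] z]] c(1)
			by (simp add: pos_le_divide_eq mult.commute)
		then show ?thesis using K(1) by blast
	qed
	show "nu_ess_c XX AA = ess_bound A"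
		unfolding nu_ess_c_def
		by (rule S.sup_lower_norm_eqI[OF AAop S.compact_opsD S.compact_ops_zero nt ess_bound_nonneg up])
			(use low S.pc_compact in blast)+
	show "nu_ess XX S AA = ess_bound A"
		unfolding nu_ess_def
		by (rule S.sup_lower_norm_eqI[OF AAop S.pc_opsD S.pc_zero nt ess_bound_nonneg up])
			(use low S.pc_compact in blast)+
qed

text \<open>Index zero means equally many vectors in \<open>F\<close> and \<open>W\<close>, so
  \<open>A\<close> itself has invertible perturbations of nearly optimal inverse norm, and their
  adjoints settle the dual quantities.\<close>

lemma index_zero_nu:
	assumes F: "fredholm Y A" "fredholm_index Y A = 0"
	shows "nu_ess_c Y A = ess_bound A" "nu_ess Y R A = ess_bound A"
		"nu_ess_c DY (adj Y A) = ess_bound A"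
		"nu_ess DY (%n. adj Y (R n)) (adj Y A) = ess_bound A"
proof -
	interpret D: proj_space "dual Y" "%n. adj Y (R n)" by (rule dual_proj_space)
	note adjA = adj_ops[OF Aop]
	obtain n B W om where reg: "regularizer A n B W om" by (rule regularizer_fredholm[OF A F(1)]) (rule that)
	obtain H e where co: "coordinates n H e" using coordinates_exist by blast
	have card: "card H = card W" using regularizer_index(2)[OF reg co] F(2) by simp
	obtain L G where L: "L : KY" "G : ops Y"
		"!!x. x : pY ==> A (G x) + L (G x) = x" "!!x. x : pY ==> G (A x + L x) = x"
		by (rule invertible_perturbation_if_card_eq[OF reg co card]) (rule that)
	have nt: "EX x:pY. x ~= 0" "EX f:pD. f ~= 0" using tail_nontrivial dual_tail_nontrivial by blast+
	\<comment> \<open>One \<open>K\<close> serves both sides, because the adjoint of the inverse of A +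
	  K inverts the adjoint of A + K.\<close>
	have inv: "EX K:KY. (ALL x:pY. c * nY x <= nY (A x + K x)) &
			(ALL f:pD. c * nD f <= nD (adj Y A f + adj Y K f))"
		if c: "0 < c" "c < ess_bound A" for c
	proof -
		obtain c' where c': "c < c'" "c' < ess_bound A" using dense[OF c(2)] by blast
		have c0: "0 < c'" "1 / c - 1 / c' > 0" using c c' by (auto simp: field_simps)
		obtain C where C: "C : LY" "(C o A) - id_op Y : KY"
			"!!x. x : pY ==> c' * nY (C x) <= nY x"
			by (rule ess_bound_inverse[OF c0(1) c'(2)]) (rule that)
		have Cn: "nY (C x) <= 1 / c' * nY x" if "x : pY" for x
			using C(3)[OF that] c0(1) by (simp add: pos_le_divide_eq mult.commute)
		obtain K E where K: "K : KY" "E : ops Y" "!!x. x : pY ==> A (E x) + K (E x) = x"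
			"!!x. x : pY ==> E (A x + K x) = x"
			"!!x. x : pY ==> nY (E x) <= (1 / c' + (1 / c - 1 / c')) * nY x"
			by (rule inverse_with_norm[where gam = "1 / c'" and eps = "1 / c - 1 / c'", OF A L C(1,2) Cn c0(2)]) (assumption | rule that)+
		have Kop: "K : ops Y" by (rule pc_opsD[OF K(1)])
		have E: "c * nY (E x) <= nY x" if "x : pY" for x
			using K(5)[OF that] c(1) by (simp add: pos_le_divide_eq mult.commute)
		have "c * nY x <= nY (A x + K x)" if x: "x : pY" for x
			using E[of "A x + K x"] K(4)[OF x] add_in[OF bop_in[OF Aop x] bop_in[OF Kop x]] by simp
		moreover have "c * nD f <= nD (adj Y A f + adj Y K f)" if f: "f : pD" for f
		proof -
			let ?g = "adj Y A f + adj Y K f"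
			have f': "f : FY" using f by simp
			have g: "?g : FY"
				using D.add_in[OF bop_in[OF adjA f] bop_in[OF adj_ops[OF Kop] f]] by simp
			have "?g o E = f"
			proof (rule bop_eqI[OF functionals_comp[OF g K(2)] f'])
				fix x assume x: "x : pY"
				have Ex: "E x : pY" by (rule bop_in[OF K(2) x])
				have "f (A (E x)) + f (K (E x)) = f (A (E x) + K (E x))"
					by (rule bop_add[OF f' bop_in[OF Aop Ex] bop_in[OF Kop Ex], symmetric])
				then show "(?g o E) x = f x" using K(3)[OF x] by (simp add: adj_apply[OF f'])
			qed
			then show ?thesis using adj_inverse_bound[OF K(2) c(1) E g] by simp
		qed
		ultimately show ?thesis using K(1) by blast
	qed
	have up: "c <= ess_bound A"
		if K: "K : compact_ops Y" and c: "c > 0" "!!x. x : pY ==> c * nY x <= nY (A x + K x)" for K c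
	proof (rule ess_bound_gauge[OF reg _ c(1)])
		show "compact_gauge Y (%x. nY (K x))" using K by (simp add: compact_ops_gauge)
		show "c * nY x <= nY (A x) + nY (K x)" if x: "x : pY" for x
			using c(2)[OF x] nrm_add[OF bop_in[OF Aop x] bop_in[OF compact_opsD[OF K] x]] by linarith
	qed
	have up': "c <= ess_bound A"
		if K: "K : compact_ops DY"
			and c: "c > 0" "!!f. f : pD ==> c * nD f <= nD (adj Y A f + K f)" for K c
	proof (rule ess_bound_dual_gauge[OF reg _ c(1)])
		show "compact_gauge DY (%f. nD (K f))" using K by (simp add: D.compact_ops_gauge)
		show "c * nD f <= nD (adj Y A f) + nD (K f)" if f: "f : pD" for f
			using c(2)[OF f] D.nrm_add[OF bop_in[OF adjA f] bop_in[OF D.compact_opsD[OF K] f]] by linarith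
	qed
	show "nu_ess_c Y A = ess_bound A"
		unfolding nu_ess_c_def
		by (rule sup_lower_norm_eqI[OF Aop compact_opsD compact_ops_zero nt(1) ess_bound_nonneg up])
			(use inv pc_compact in blast)+
	show "nu_ess Y R A = ess_bound A"
		unfolding nu_ess_def
		by (rule sup_lower_norm_eqI[OF Aop pc_opsD pc_zero nt(1) ess_bound_nonneg up])
			(use inv pc_compact in blast)+
	show "nu_ess_c DY (adj Y A) = ess_bound A"
		unfolding nu_ess_c_def
		by (rule D.sup_lower_norm_eqI[OF adjA D.compact_opsD D.compact_ops_zero nt(2) ess_bound_nonneg up'])
			(use inv D.pc_compact adj_pc in blast)+
	show "nu_ess DY (%n. adj Y (R n)) (adj Y A) = ess_bound A"
		unfolding nu_ess_def
		by (rule D.sup_lower_norm_eqI[OF adjA D.pc_opsD D.pc_zero nt(2) ess_bound_nonneg up'])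
			(use inv D.pc_compact adj_pc in blast)+
qed

text \<open>The two lower bounds first produce a regularizer, and then exclude a surplus on either
  side of the matching between \<open>F\<close> and \<open>W\<close>.\<close>

lemma fredholm_index_zero_if_nu_pos:
	assumes pos: "nu_ess_c Y A > 0" "nu_ess_c DY (adj Y A) > 0"
	shows "fredholm Y A" "fredholm_index Y A = 0"
proof -
	interpret D: proj_space "dual Y" "%n. adj Y (R n)" by (rule dual_proj_space)
	note adjA = adj_ops[OF Aop]
	obtain K c where K: "K : compact_ops Y" "c > 0" "!!x. x : pY ==> c * nY x <= nY (A x + K x)"
		by (rule sup_lower_norm_pos[OF Aop compact_opsD compact_ops_zero pos(1)[unfolded nu_ess_c_def]]) (assumption | rule that)+
	obtain K' d where K': "K' : compact_ops DY" "d > 0"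
		"!!f. f : pD ==> d * nD f <= nD (adj Y A f + K' f)"
		by (rule D.sup_lower_norm_pos[OF adjA D.compact_opsD D.compact_ops_zero pos(2)[unfolded nu_ess_c_def]]) (assumption | rule that)+
	have "c * nY x <= nY (A x) + nY (K x)" if x: "x : pY" for x
		using K(3)[OF x] nrm_add[OF bop_in[OF Aop x] bop_in[OF compact_opsD[OF K(1)] x]] by linarith
	then have e1: "ess_below Y A"
		unfolding ess_below_def using K(1,2) by (intro exI[of _ c] conjI exI[of _ "%x. nY (K x)"]) (simp_all add: compact_ops_gauge)
	have "d * nD f <= nD (adj Y A f) + nD (K' f)" if f: "f : pD" for f
		using K'(3)[OF f] D.nrm_add[OF bop_in[OF adjA f] bop_in[OF D.compact_opsD[OF K'(1)] f]] by linarith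
	then have e2: "ess_below DY (adj Y A)"
		unfolding ess_below_def using K'(1,2)
		by (intro exI[of _ d] conjI exI[of _ "%f. nD (K' f)"]) (simp_all add: D.compact_ops_gauge)
	obtain n B W om where reg: "regularizer A n B W om" by (rule regularizer_ess_below[OF A e1 e2]) (rule that)
	obtain H e where co: "coordinates n H e" using coordinates_exist by blast
	have "card H = card W"
		using card_le_if_bounded_below[OF reg co K] card_ge_if_dual_bounded_below[OF reg co K'] by simp
	then show "fredholm Y A" "fredholm_index Y A = 0" using regularizer_index[OF reg co] by simp_all
qed

end

end

section \<open>The sequence spaces\<close>

lemma powr_le_cancel:
	fixes a b s :: real
	assumes "s > 0" "0 <= b" "a powr s <= b powr s"
	shows "a <= b"
	using powr_less_mono2[of s b a] assms by linarith

text \<open>Zero arguments are handled by scaling alone, since \<open>r powr s <= r\<close> for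
  \<open>r\<close> between 0 and 1.\<close>

lemma powr_convex_nonneg:
	fixes x y s t :: real
	assumes s: "1 <= s" and xy: "0 <= x" "0 <= y" and t: "0 <= t" "t <= 1"
	shows "((1 - t) * x + t * y) powr s <= (1 - t) * x powr s + t * y powr s"
proof -
	have scale: "(r * z) powr s <= r * z powr s" if "0 <= r" "r <= 1" "0 <= z" for r z :: real
		using powr_mono'[of 1 s r] that s by (simp add: powr_mult mult_right_mono)
	show ?thesis
	proof (cases "x = 0 \<or> y = 0")
		case True
		then show ?thesis using scale[of t y] scale[of "1 - t" x] xy t s by auto
	next
		case False
		then show ?thesis using convex_onD[OF powr_convex[OF s], of t x y] xy t by simp
	qed
qed

text \<open>Convexity is applied to \<open>u i / a\<close> and \<open>v i / b\<close> with weights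
  \<open>a / (a + b)\<close> and \<open>b / (a + b)\<close>. Bounds for finite sums in place of
  norms fit the predicate \<open>bnd\<close> and keep infinite sums away.\<close>

lemma powr_minkowski:
	fixes u v :: "'i => real"
	assumes s: "1 <= s" and ab: "0 <= a" "0 <= b" and F: "finite F" and nn: "!!i. 0 <= u i" "!!i. 0 <= v i"
		and u: "(SUM i:F. u i powr s) <= a powr s" and v: "(SUM i:F. v i powr s) <= b powr s"
	shows "(SUM i:F. (u i + v i) powr s) <= (a + b) powr s"
proof (cases "a = 0 \<or> b = 0")
	case True
	have "w i = 0" if "(SUM i:F. w i powr s) <= 0 powr s" "i : F" for w :: "'i => real" and i
		using sum_nonneg_eq_0_iff[OF F, of "%i. w i powr s"] sum_nonneg[of F "%i. w i powr s"] that s by force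
	then have "(ALL i:F. u i = 0) & a = 0 \<or> (ALL i:F. v i = 0) & b = 0" using True u v by blast
	then show ?thesis
	proof (elim disjE conjE)
		assume "ALL i:F. u i = 0" "a = 0"
		then show ?thesis using v by (simp cong: sum.cong)
	next
		assume "ALL i:F. v i = 0" "b = 0"
		then show ?thesis using u by (simp cong: sum.cong)
	qed
next
	case False
	then have pos: "a > 0" "b > 0" using ab by auto
	define t where "t = b / (a + b)"
	have t: "0 <= t" "t <= 1" "1 - t = a / (a + b)" using pos by (auto simp: t_def field_simps)
	have le: "(u i + v i) powr s <= (a + b) powr s * ((1 - t) * (u i powr s / a powr s) + t * (v i powr s / b powr s))" for i
	proof -
		have "(u i + v i) = (a + b) * ((1 - t) * (u i / a) + t * (v i / b))"
		proof -
			have "(1 - t) * (u i / a) = u i / (a + b)" "t * (v i / b) = v i / (a + b)"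
				unfolding t(3) using pos by (simp_all add: t_def)
			then show ?thesis using pos by (simp add: add_divide_distrib[symmetric])
		qed
		then have "(u i + v i) powr s = (a + b) powr s * ((1 - t) * (u i / a) + t * (v i / b)) powr s"
			using pos nn t by (simp add: powr_mult)
		also have "... <= (a + b) powr s * ((1 - t) * (u i / a) powr s + t * (v i / b) powr s)"
			using pos nn t s by (intro mult_left_mono powr_convex_nonneg) auto
		finally show ?thesis using pos nn by (simp add: powr_divide)
	qed
	have "(SUM i:F. (u i + v i) powr s)
			<= (SUM i:F. (a + b) powr s * ((1 - t) * (u i powr s / a powr s) + t * (v i powr s / b powr s)))"
		by (intro sum_mono le)
	also have "... = (a + b) powr s * ((1 - t) * ((SUM i:F. u i powr s) / a powr s) + t * ((SUM i:F. v i powr s) / b powr s))"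
		by (simp only: sum_distrib_left[symmetric] sum.distrib sum_divide_distrib)
	also have "... <= (a + b) powr s * ((1 - t) * 1 + t * 1)"
		using u v pos t by (intro mult_left_mono add_mono) auto
	finally show ?thesis by simp
qed

definition cube :: "nat => (int ^ 'n::finite) set"
	where "cube n = {i. ALL k. i $ k : {- int n..int n}}"

lemma cube_mono: assumes "m <= n" shows "(cube m :: (int ^ 'n::finite) set) \<subseteq> cube n"
proof
	fix i :: "int ^ 'n" assume "i : cube m"
	then have i: "- int m <= i $ k & i $ k <= int m" for k by (simp add: cube_def)
	have "- int n <= i $ k & i $ k <= int n" for k using i[of k] assms by linarith
	then show "i : cube n" by (simp add: cube_def)
qed

lemma finite_cube: "finite (cube n :: (int ^ 'n::finite) set)"
proof (rule finite_subset)
	show "finite (vec_lambda ` (UNIV \<rightarrow>\<^sub>E {- int n..int n}) :: (int ^ 'n) set)"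
		by (intro finite_imageI finite_PiE) auto
	show "(cube n :: (int ^ 'n) set) \<subseteq> vec_lambda ` (UNIV \<rightarrow>\<^sub>E {- int n..int n})"
	proof
		fix i :: "int ^ 'n" assume "i : cube n"
		then show "i : vec_lambda ` (UNIV \<rightarrow>\<^sub>E {- int n..int n})"
			by (intro image_eqI[of _ _ "($) i"]) (auto simp: cube_def)
	qed
qed

lemma finite_subset_cube:
	fixes F :: "(int ^ 'n::finite) set"
	assumes "finite F" shows "EX n. F \<subseteq> cube n"
	using assms
proof induction
	case (insert i F)
	then obtain n where n: "F \<subseteq> cube n" by blast
	define m where "m = nat (SUM k:UNIV. \<bar>i $ k\<bar>)"
	have "\<bar>i $ k\<bar> <= int m" for k
		unfolding m_def using member_le_sum[of k UNIV "%k. \<bar>i $ k\<bar>"] by (simp add: sum_nonneg)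
	then have "i : cube m" by (simp add: cube_def abs_le_iff minus_le_iff)
	then have "insert i F \<subseteq> cube (max m n)" using n cube_mono[of m "max m n"] cube_mono[of n "max m n"] by auto
	then show ?case by blast
qed simp

lemma not_in_cube: "EX i. i ~: (cube n :: (int ^ 'n::finite) set)"
	by (rule exI[of _ "\<chi> k. int n + 1"]) (simp add: cube_def)

section \<open>Truncations and norm bounds for sequences\<close>

definition trunc :: "nat => ('n::finite, 'x::complex_normed_vector) sq => ('n, 'x) sq"
	where "trunc n x = (%i. if i : cube n then x i else 0)"

text \<open>For bounded sequences this is membership in the closure of the finitely supported ones;
  see \<open>vanishing_iff\<close>.\<close>

definition vanishing :: "('n::finite, 'x::complex_normed_vector) sq => bool"
	where "vanishing x \<longleftrightarrow> (ALL e>0. EX n. ALL i. i ~: cube n --> norm (x i) <= e)"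

lemma pts_lp [simp]: "pts (lp p) = lp_pts p" and nrm_lp [simp]: "nrm (lp p) = lp_norm p"
	by (simp_all add: lp_def)

lemma P_op_trunc: "P_op p n x = (if x : lp_pts p then trunc n x else 0)"
	by (simp add: P_op_def trunc_def cube_def)

locale exponent =
	fixes p :: ennreal
	assumes p: "p = 0 \<or> 1 <= p"
begin

text \<open>The relation "norm at most c" for arbitrary sequences, members of the space or not. It
  involves finite sums or single entries only, so it passes to entrywise limits and can be used to
  prove membership.\<close>

definition bnd :: "real => ('n::finite, 'x::complex_normed_vector) sq => bool"
	where "bnd c x \<longleftrightarrow> (if p = 0 \<or> p = \<infinity> then ALL i. norm (x i) <= c
		else ALL F. finite F --> (SUM i:F. norm (x i) powr enn2real p) <= c powr enn2real p)"

lemma s_ge_1: "~ (p = 0 \<or> p = \<infinity>) ==> 1 <= enn2real p"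
	using enn2real_mono[of 1 p] p by (auto simp: less_top)

lemma bnd_dominated:
	assumes "bnd c x" "0 <= c" "c <= d" "!!i. norm (y i) <= norm (x i)"
	shows "bnd d y"
proof (cases "p = 0 \<or> p = \<infinity>")
	case True
	then show ?thesis using assms by (auto simp: bnd_def) (meson order_trans)+
next
	case False
	note s = s_ge_1[OF False]
	have "(SUM i:F. norm (y i) powr enn2real p) <= d powr enn2real p" if "finite F" for F
	proof -
		have "(SUM i:F. norm (y i) powr enn2real p) <= (SUM i:F. norm (x i) powr enn2real p)"
			using assms(4) s by (intro sum_mono powr_mono2) auto
		also have "... <= c powr enn2real p" using assms(1) False that by (simp add: bnd_def)
		also have "... <= d powr enn2real p" using assms s by (intro powr_mono2) auto
		finally show ?thesis .
	qed
	then show ?thesis using False by (simp add: bnd_def)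
qed

lemma bnd_add:
	assumes "bnd a x" "bnd b y" "0 <= a" "0 <= b"
	shows "bnd (a + b) (x + y)"
proof (cases "p = 0 \<or> p = \<infinity>")
	case True
	then show ?thesis using assms by (auto simp: bnd_def intro!: norm_triangle_le add_mono)
next
	case False
	note s = s_ge_1[OF False]
	have "(SUM i:F. norm (x i + y i) powr enn2real p) <= (a + b) powr enn2real p" if F: "finite F" for F
	proof -
		have "(SUM i:F. norm (x i + y i) powr enn2real p) <= (SUM i:F. (norm (x i) + norm (y i)) powr enn2real p)"
			using s by (intro sum_mono powr_mono2 norm_triangle_ineq) auto
		also have "... <= (a + b) powr enn2real p"
			using assms False F by (intro powr_minkowski s) (auto simp: bnd_def)
		finally show ?thesis .
	qed
	then show ?thesis using False by (simp add: bnd_def)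
qed

lemma bnd_scale:
	assumes "bnd c x" "0 <= c"
	shows "bnd (cmod t * c) (t *C x)"
	using assms
	by (auto simp: bnd_def scaleC_fun_def norm_scaleC powr_mult sum_distrib_left[symmetric] intro!: mult_left_mono)

text \<open>Fatou's lemma in elementary form: each entry and each finite sum converges.\<close>

lemma bnd_limit:
	assumes x: "!!n. bnd c (x n)" and lim: "!!i. (%n::nat. x n i) ----> y i"
	shows "bnd c y"
proof (cases "p = 0 \<or> p = \<infinity>")
	case True
	then have "norm (y i) <= c" for i
		using x by (intro LIMSEQ_le_const2[OF tendsto_norm[OF lim]]) (auto simp: bnd_def)
	then show ?thesis using True by (simp add: bnd_def)
next
	case False
	note s = s_ge_1[OF False]
	have "(SUM i:F. norm (y i) powr enn2real p) <= c powr enn2real p" if "finite F" for F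
	proof (rule LIMSEQ_le_const2)
		show "(%n. SUM i:F. norm (x n i) powr enn2real p) ----> (SUM i:F. norm (y i) powr enn2real p)"
			using s by (intro tendsto_sum tendsto_powr' tendsto_norm lim tendsto_const) auto
		show "EX N. ALL n>=N. (SUM i:F. norm (x n i) powr enn2real p) <= c powr enn2real p"
			using x False that by (auto simp: bnd_def)
	qed
	then show ?thesis using False by (simp add: bnd_def)
qed

lemma bnd_entry:
	assumes "bnd c x" "0 <= c"
	shows "norm (x i) <= c"
proof (cases "p = 0 \<or> p = \<infinity>")
	case False
	note s = s_ge_1[OF False]
	have "(SUM i:{i}. norm (x i) powr enn2real p) <= c powr enn2real p" using assms(1) False by (simp add: bnd_def del: sum.insert)
	then show ?thesis using powr_le_cancel[of "enn2real p" c "norm (x i)"] assms(2) s by simp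
qed (use assms in \<open>auto simp: bnd_def\<close>)

lemma bnd_trunc:
	fixes x :: "('n::finite, 'x::complex_normed_vector) sq"
	assumes "!!n. bnd c (trunc n x)"
	shows "bnd c x"
proof (rule bnd_limit[OF assms])
	fix i :: "int ^ 'n"
	obtain m where "i : cube m" using finite_subset_cube[of "{i}"] by auto
	then have "trunc n x i = x i" if "n >= m" for n using cube_mono[OF that] by (auto simp: trunc_def)
	then show "(%n. trunc n x i) ----> x i"
		by (intro tendsto_eventually) (auto simp: eventually_sequentially)
qed

lemma lp_infsum:
	assumes "~ (p = 0 \<or> p = \<infinity>)" "x : lp_pts p"
	shows "(%i. norm (x i) powr enn2real p) summable_on UNIV"
		"lp_norm p x powr enn2real p = (\<Sum>\<^sub>\<infinity>i. norm (x i) powr enn2real p)" "lp_norm p x >= 0"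
	using assms s_ge_1[OF assms(1)] by (auto simp: lp_pts_def lp_norm_def powr_powr infsum_nonneg)

lemma lp_bounded: "x : lp_pts p ==> p = 0 \<or> p = \<infinity> ==> bdd_above (range (%i. norm (x i)))"
	by (auto simp: lp_pts_def bounded_iff bdd_above_def split: if_splits)

lemma lp_norm_le_iff:
	assumes x: "x : lp_pts p" and c: "0 <= c"
	shows "lp_norm p x <= c \<longleftrightarrow> bnd c x"
proof (cases "p = 0 \<or> p = \<infinity>")
	case True
	then have "lp_norm p x = (SUP i. norm (x i))" by (simp add: lp_norm_def)
	then show ?thesis using cSUP_le_iff[OF _ lp_bounded[OF x True], of c] True by (simp add: bnd_def)
next
	case False
	note s = s_ge_1[OF False]
	note l = lp_infsum[OF False x]
	have "lp_norm p x <= c \<longleftrightarrow> lp_norm p x powr enn2real p <= c powr enn2real p"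
		using powr_le_cancel[of "enn2real p" c] powr_mono2[of "enn2real p" "lp_norm p x" c] s c l(3) by auto
	also have "... \<longleftrightarrow> bnd c x"
		unfolding l(2) using False infsum_le_finite_sums[OF l(1), of "c powr enn2real p"]
			finite_sum_le_infsum[OF l(1)] by (auto simp: bnd_def intro: order_trans)
	finally show ?thesis .
qed

lemma lp_norm_nonneg: "x : lp_pts p ==> 0 <= lp_norm p x"
proof (cases "p = 0 \<or> p = \<infinity>")
	case True
	assume x: "x : lp_pts p"
	have "norm (x undefined) <= (SUP i. norm (x i))" by (rule cSUP_upper[OF _ lp_bounded[OF x True]]) simp
	then show ?thesis using True norm_ge_zero[of "x undefined"] by (simp add: lp_norm_def del: norm_ge_zero)
qed (rule lp_infsum)

lemma bnd_norm: "x : lp_pts p ==> bnd (lp_norm p x) x"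
	using lp_norm_le_iff[OF _ lp_norm_nonneg] by blast

text \<open>Truncation to a large cube provides the finitely supported approximation; conversely the
  support of an approximation fits into a cube.\<close>

lemma vanishing_iff:
	assumes "bounded (range x)"
	shows "(ALL e>0. EX y. finite {i. y i ~= 0} & lp_norm \<infinity> (x - y) < e) \<longleftrightarrow> vanishing x"
proof
	assume L: "ALL e>0. EX y. finite {i. y i ~= 0} & lp_norm \<infinity> (x - y) < e"
	show "vanishing x"
		unfolding vanishing_def
	proof (intro allI impI)
		fix e :: real assume "e > 0"
		then obtain y where y: "finite {i. y i ~= 0}" "lp_norm \<infinity> (x - y) < e" using L by blast
		obtain n where n: "{i. y i ~= 0} \<subseteq> cube n" using finite_subset_cube[OF y(1)] by blast
		have "range y \<subseteq> insert 0 (y ` {i. y i ~= 0})" by auto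
		then have "bounded (range y)" using y(1) by (meson bounded_subset finite.insertI finite_imageI finite_imp_bounded)
		then have "bounded ((%i. x i - y i) ` UNIV)" by (intro bounded_minus_comp assms)
		then have bdd: "bdd_above (range (%i. norm ((x - y) i)))" by (auto simp: bounded_iff bdd_above_def)
		have "norm (x i) <= e" if "i ~: cube n" for i
		proof -
			have "norm ((x - y) i) <= lp_norm \<infinity> (x - y)" using cSUP_upper[OF _ bdd, of i] by (simp add: lp_norm_def)
			moreover have "y i = 0" using n that by blast
			ultimately show ?thesis using y(2) by simp
		qed
		then show "EX n. ALL i. i ~: cube n --> norm (x i) <= e" by blast
	qed
next
	assume v: "vanishing x"
	show "ALL e>0. EX y. finite {i. y i ~= 0} & lp_norm \<infinity> (x - y) < e"
	proof (intro allI impI)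
		fix e :: real assume e: "e > 0"
		then obtain n where n: "ALL i. i ~: cube n --> norm (x i) <= e / 2" using v unfolding vanishing_def by (meson half_gt_zero)
		have "(SUP i. norm ((x - trunc n x) i)) <= e / 2"
			by (rule cSUP_least) (use n e in \<open>auto simp: trunc_def\<close>)
		then have "lp_norm \<infinity> (x - trunc n x) <= e / 2" by (simp add: lp_norm_def)
		moreover have "finite {i. trunc n x i ~= 0}" by (rule finite_subset[OF _ finite_cube[of n]]) (auto simp: trunc_def)
		ultimately show "EX y. finite {i. y i ~= 0} & lp_norm \<infinity> (x - y) < e" using e by (intro exI[of _ "trunc n x"]) auto
	qed
qed

lemma lp_pts_iff: "x : lp_pts p \<longleftrightarrow> (EX c>=0. bnd c x) & (p = 0 --> vanishing x)"
proof (cases "p = 0 \<or> p = \<infinity>")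
	case True
	have "bounded (range x) \<longleftrightarrow> (EX c>=0. bnd c x)"
	proof
		assume "bounded (range x)"
		then obtain c where "ALL i. norm (x i) <= c" by (auto simp: bounded_iff)
		moreover have "0 <= c" using calculation norm_ge_zero order_trans by blast
		ultimately show "EX c>=0. bnd c x" using True by (auto simp: bnd_def)
	qed (use True in \<open>auto simp: bnd_def bounded_iff\<close>)
	then show ?thesis using True vanishing_iff[of x] by (auto simp: lp_pts_def)
next
	case False
	note s = s_ge_1[OF False]
	have "(%i. norm (x i) powr enn2real p) summable_on UNIV" if c: "bnd c x" for c
		using c False by (intro nonneg_bdd_above_summable_on bdd_aboveI[of _ "c powr enn2real p"]) (auto simp: bnd_def)
	then show ?thesis using False bnd_norm[of x] lp_norm_nonneg[of x] by (auto simp: lp_pts_def)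
qed

lemma lp_dominated:
	assumes "x : lp_pts p" "!!i. norm (y i) <= norm (x i)"
	shows "y : lp_pts p" "lp_norm p y <= lp_norm p x"
proof -
	have b: "bnd (lp_norm p x) y" by (rule bnd_dominated[OF bnd_norm]) (use assms lp_norm_nonneg in auto)
	have "vanishing y" if "vanishing x" using that assms(2) unfolding vanishing_def by (meson order_trans)
	then show y: "y : lp_pts p" using assms(1) b lp_norm_nonneg by (auto simp: lp_pts_iff)
	show "lp_norm p y <= lp_norm p x" using lp_norm_le_iff[OF y] b assms(1) lp_norm_nonneg by blast
qed

lemma lp_cnorm_space: "cnorm_space (lp p :: ('n::finite, 'x::complex_normed_vector) sq cnspace)"
proof
	fix a and x y :: "('n, 'x) sq"
	show "0 : pts (lp p)"
		by (auto simp: lp_pts_iff bnd_def vanishing_def intro!: exI[of _ "0::real"])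
	assume x: "x : pts (lp p)"
	then have x': "x : lp_pts p" by simp
	show "0 <= nrm (lp p) x" using lp_norm_nonneg[OF x'] by simp
	show "x = 0" if "nrm (lp p) x = 0"
		using bnd_entry[OF bnd_norm[OF x'] lp_norm_nonneg[OF x']] that by (simp add: fun_eq_iff)
	have sc: "t *C z : lp_pts p & lp_norm p (t *C z) <= cmod t * lp_norm p z" if z: "z : lp_pts p" for t and z :: "('n, 'x) sq"
	proof -
		have b: "bnd (cmod t * lp_norm p z) (t *C z)" by (rule bnd_scale[OF bnd_norm[OF z] lp_norm_nonneg[OF z]])
		have n: "0 <= cmod t * lp_norm p z" using lp_norm_nonneg[OF z] by simp
		have "vanishing (t *C z)" if v: "vanishing z"
			unfolding vanishing_def
		proof (intro allI impI)
			fix e :: real assume e: "e > 0"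
			have "e / (cmod t + 1) > 0" using e by (simp add: add_nonneg_pos)
			then obtain m where m: "ALL i. i ~: cube m --> norm (z i) <= e / (cmod t + 1)" using v unfolding vanishing_def by blast
			have "norm ((t *C z) i) <= e" if "i ~: cube m" for i
			proof -
				have "cmod t * norm (z i) <= (cmod t + 1) * (e / (cmod t + 1))" using m that by (intro mult_mono) auto
				also have "... = e" by (simp add: add_nonneg_eq_0_iff)
				finally show ?thesis by (simp add: scaleC_fun_def norm_scaleC)
			qed
			then show "EX n. ALL i. i ~: cube n --> norm ((t *C z) i) <= e" by blast
		qed
		then have "t *C z : lp_pts p" using b n z by (auto simp: lp_pts_iff)
		then show ?thesis using b n lp_norm_le_iff by blast
	qed
	show "a *C x : pts (lp p)" using sc[OF x'] by simp
	show "nrm (lp p) (a *C x) = cmod a * nrm (lp p) x"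
	proof (cases "a = 0")
		case True
		then show ?thesis using sc[OF x', of 0] lp_norm_nonneg[of "0 *C x"] by simp
	next
		case False
		have "lp_norm p (inverse a *C a *C x) <= cmod (inverse a) * lp_norm p (a *C x)" using sc sc[OF x'] by blast
		then have "lp_norm p x <= inverse (cmod a) * lp_norm p (a *C x)" using False by (simp add: norm_inverse)
		then have "cmod a * lp_norm p x <= cmod a * (inverse (cmod a) * lp_norm p (a *C x))" by (rule mult_left_mono) simp
		also have "... = lp_norm p (a *C x)" using False by simp
		finally have "cmod a * lp_norm p x <= lp_norm p (a *C x)" .
		then show ?thesis using sc[OF x', of a] by simp
	qed
	assume y: "y : pts (lp p)"
	then have y': "y : lp_pts p" by simp
	have b: "bnd (lp_norm p x + lp_norm p y) (x + y)"
		by (rule bnd_add[OF bnd_norm[OF x'] bnd_norm[OF y'] lp_norm_nonneg[OF x'] lp_norm_nonneg[OF y']])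
	have n: "0 <= lp_norm p x + lp_norm p y" using lp_norm_nonneg[OF x'] lp_norm_nonneg[OF y'] by simp
	have "vanishing (x + y)" if v: "vanishing x" "vanishing y"
		unfolding vanishing_def
	proof (intro allI impI)
		fix e :: real assume e: "e > 0"
		then obtain k l where kl: "ALL i. i ~: cube k --> norm (x i) <= e / 2" "ALL i. i ~: cube l --> norm (y i) <= e / 2"
			using v unfolding vanishing_def by (meson half_gt_zero)
		have "norm ((x + y) i) <= e" if "i ~: cube (max k l)" for i
		proof -
			have "i ~: cube k" "i ~: cube l" using that cube_mono[of k "max k l"] cube_mono[of l "max k l"] by auto
			then have "norm (x i) + norm (y i) <= e" using kl by (metis add_mono field_sum_of_halves)
			then show ?thesis using norm_triangle_ineq[of "x i" "y i"] by simp
		qed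
		then show "EX n. ALL i. i ~: cube n --> norm ((x + y) i) <= e" by blast
	qed
	then have xy: "x + y : lp_pts p" using b n x' y' by (auto simp: lp_pts_iff)
	then show "x + y : pts (lp p)" by simp
	show "nrm (lp p) (x + y) <= nrm (lp p) x + nrm (lp p) y" using lp_norm_le_iff[OF xy n] b by simp
qed

end

text \<open>Each truncation has finite rank, so a diagonal sequence makes all truncations Cauchy.
  This is the source of entrywise limits in \<open>lp_locally_compact\<close>.\<close>

lemma (in proj_space) local_cauchy_subsequence:
	fixes x :: "nat => 'a"
	assumes x: "!!n. x n : pY" "!!n. nY (x n) <= M"
	obtains d :: "nat => nat" where "strict_mono d"
		"!!n e. e > 0 ==> EX N. ALL i>=N. ALL j>=N. nY (R n (x (d i) - x (d j))) < e"
proof -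
	define P where "P = (%n (s :: nat => nat). ALL e>0. EX N. ALL i>=N. ALL j>=N. nY (R n (x (s i) - x (s j))) < (e::real))"
	have "EX r. strict_mono r & P n (s o r)" if "strict_mono s" for n and s :: "nat => nat"
	proof -
		obtain r :: "nat => nat" where "strict_mono r"
			"!!e. e > 0 ==> EX N. ALL i>=N. ALL j>=N. nY (R n (x (s (r i)) - x (s (r j)))) < e"
			using compact_gaugeD[OF gauge_R[of n], of "%i. x (s i)" M] x by blast
		then show ?thesis unfolding P_def by (intro exI[of _ r]) simp
	qed
	moreover have "P n (s o r)" if r: "strict_mono r" and P: "P n s" for n and r s :: "nat => nat"
		unfolding P_def
	proof (intro allI impI)
		fix e :: real assume "e > 0"
		with P obtain N where N: "ALL i>=N. ALL j>=N. nY (R n (x (s i) - x (s j))) < e" unfolding P_def by blast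
		have "nY (R n (x (s (r i)) - x (s (r j)))) < e" if "i >= N" "j >= N" for i j
			using N that seq_suble[OF r, of i] seq_suble[OF r, of j] by simp
		then show "EX N. ALL i>=N. ALL j>=N. nY (R n (x ((s o r) i) - x ((s o r) j))) < e" by (intro exI[of _ N]) simp
	qed
	ultimately obtain d where d: "strict_mono d" "!!n. P n (d o (+) (Suc n))"
		using diagonal_subsequence[of P] by blast
	show ?thesis
	proof (rule that[OF d(1)])
		fix n and e :: real assume "e > 0"
		then obtain N where N: "ALL i>=N. ALL j>=N. nY (R n (x (d (Suc n + i)) - x (d (Suc n + j)))) < e"
			using d(2)[of n] unfolding P_def o_def by blast
		have "nY (R n (x (d i) - x (d j))) < e" if "i >= Suc n + N" "j >= Suc n + N" for i j
			using N[rule_format, of "i - Suc n" "j - Suc n"] that by simp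
		then show "EX N. ALL i>=N. ALL j>=N. nY (R n (x (d i) - x (d j))) < e" by blast
	qed
qed

section \<open>Sequence spaces as instances of the abstract setting\<close>

context exponent
begin

lemma bnd_cauchy_limit:
	assumes "!!i j. i >= N ==> j >= N ==> bnd e (z i - z j)" "!!l. (%n. z n l) ----> w l" "i >= N"
	shows "bnd e (z i - w)"
proof (rule bnd_limit[where x = "%k. z i - z (N + k)"])
	show "bnd e (z i - z (N + k))" for k using assms(1,3) by simp
	show "(%k. (z i - z (N + k)) l) ----> (z i - w) l" for l
		using LIMSEQ_ignore_initial_segment[OF assms(2)[of l], of N]
		by (simp add: add.commute tendsto_diff)
qed

lemma lp_banach: "banach_cn (lp p :: ('n::finite, 'x::{complex_normed_vector, banach}) sq cnspace)"
proof -
	interpret Y: cnorm_space "lp p :: ('n, 'x) sq cnspace" by (rule lp_cnorm_space)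
	show ?thesis
	proof
		fix x :: "nat => ('n, 'x) sq"
		assume x: "!!n. x n : pts (lp p)"
			and c: "!!e. e > 0 ==> EX N. ALL i>=N. ALL j>=N. nrm (lp p) (x i - x j) < e"
		have x': "x n : lp_pts p" "x m - x n : lp_pts p" for m n using x Y.diff_in[OF x x] by auto
		have c': "EX N. ALL i>=N. ALL j>=N. bnd e (x i - x j)" if e: "e > 0" for e
		proof -
			obtain N where N: "ALL i>=N. ALL j>=N. nrm (lp p) (x i - x j) < e" using c[OF e] by blast
			have "bnd e (x i - x j)" if "i >= N" "j >= N" for i j
				using less_imp_le[OF N[rule_format, OF that]] lp_norm_le_iff[OF x'(2)[of i j], of e] e by simp
			then show ?thesis by blast
		qed
		have "EX l. (%n. x n i) ----> l" for i
		proof -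
			have "Cauchy (%n. x n i)"
			proof (rule metric_CauchyI)
				fix e :: real assume e: "e > 0"
				obtain N where N: "ALL m>=N. ALL n>=N. bnd (e / 2) (x m - x n)" using c'[of "e / 2"] e by auto
				have "dist (x m i) (x n i) < e" if "m >= N" "n >= N" for m n
					using bnd_entry[OF N[rule_format, OF that], of i] e by (simp add: dist_norm)
				then show "EX N. ALL m>=N. ALL n>=N. dist (x m i) (x n i) < e" by blast
			qed
			then show ?thesis by (simp add: Cauchy_convergent_iff convergent_def)
		qed
		then obtain y where y: "!!i. (%n. x n i) ----> y i" by metis
		have lim: "EX N. ALL n>=N. bnd e (x n - y)" if "e > 0" for e
			using c'[OF that] bnd_cauchy_limit[of _ e x y] y by blast
		have "y : lp_pts p"
			unfolding lp_pts_iff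
		proof
			obtain N where N: "bnd 1 (x N - y)" using lim[of 1] by auto
			have "bnd 1 (y - x N)" by (rule bnd_dominated[OF N]) (simp_all add: norm_minus_commute)
			then have "bnd (1 + lp_norm p (x N)) ((y - x N) + x N)"
				using bnd_norm[OF x'(1)] lp_norm_nonneg[OF x'(1)] by (intro bnd_add) auto
			then show "EX c>=0. bnd c y"
				using lp_norm_nonneg[OF x'(1)[of N]] by (intro exI[of _ "1 + lp_norm p (x N)"]) simp
			show "p = 0 --> vanishing y"
				unfolding vanishing_def
			proof (intro impI allI)
				fix e :: real assume p0: "p = 0" and e: "e > 0"
				obtain N where N: "bnd (e / 2) (x N - y)" using lim[of "e / 2"] e by auto
				have "vanishing (x N)" using x'(1)[of N] p0 lp_pts_iff[of "x N"] by blast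
				then obtain m where m: "ALL i. i ~: cube m --> norm (x N i) <= e / 2" using e unfolding vanishing_def by (meson half_gt_zero)
				have "norm (y i) <= e" if "i ~: cube m" for i
					using m[rule_format, OF that] bnd_entry[OF N, of i] e norm_triangle_ineq2[of "y i" "x N i"]
					by (simp add: norm_minus_commute)
				then show "EX n. ALL i. i ~: cube n --> norm (y i) <= e" by blast
			qed
		qed
		then have yp: "y : pts (lp p)" by simp
		have "(%n. nrm (lp p) (x n - y)) ----> 0"
		proof (rule LIMSEQ_I)
			fix e :: real assume e: "e > 0"
			obtain N where N: "ALL n>=N. bnd (e / 2) (x n - y)" using lim[of "e / 2"] e by auto
			have "norm (nrm (lp p) (x n - y) - 0) < e" if n: "n >= N" for n
			proof -
				have d: "x n - y : lp_pts p" using Y.diff_in[OF x yp] by simp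
				show ?thesis using lp_norm_le_iff[OF d, of "e / 2"] N n e lp_norm_nonneg[OF d] by simp
			qed
			then show "EX N. ALL n>=N. norm (nrm (lp p) (x n - y) - 0) < e" by blast
		qed
		then show "EX y:pts (lp p). (%n. nrm (lp p) (x n - y)) ----> 0" using yp by blast
	qed
qed

lemma trunc_add: "trunc n (x + y) = trunc n x + trunc n y"
	and trunc_scale: "trunc n (a *C x) = a *C trunc n x"
	by (auto simp: trunc_def scaleC_fun_def fun_eq_iff)

lemma trunc_trunc: "trunc m (trunc n x) = trunc (min m n) x"
	using cube_mono[of m n] cube_mono[of n m] by (cases "m <= n") (auto simp: trunc_def fun_eq_iff min_def)

lemma trunc_lp:
	assumes "x : lp_pts p"
	shows "trunc n x : lp_pts p" "lp_norm p (trunc n x) <= lp_norm p x"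
		"x - trunc n x : lp_pts p" "lp_norm p (x - trunc n x) <= lp_norm p x"
	by (rule lp_dominated[OF assms]; simp add: trunc_def)+

lemma finite_support_lp: assumes "finite F" "!!i. i ~: F ==> x i = 0" shows "x : lp_pts p"
proof -
	obtain n where n: "F \<subseteq> cube n" using finite_subset_cube[OF assms(1)] by blast
	have "vanishing x" unfolding vanishing_def using assms(2) n by (metis less_imp_le norm_zero subsetD)
	moreover have "EX c>=0. bnd c x"
	proof (cases "p = 0 \<or> p = \<infinity>")
		case True
		have "norm (x i) <= (SUM i:F. norm (x i))" for i
			using assms member_le_sum[of i F "%i. norm (x i)"] by (cases "i : F") (auto simp: sum_nonneg)
		then show ?thesis using True by (intro exI[of _ "SUM i:F. norm (x i)"]) (simp add: bnd_def sum_nonneg)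
	next
		case False
		let ?S = "SUM i:F. norm (x i) powr enn2real p"
		have S: "(?S powr (1 / enn2real p)) powr enn2real p = ?S"
			using s_ge_1[OF False] by (simp add: powr_powr sum_nonneg)
		have "(SUM i:G. norm (x i) powr enn2real p) <= ?S" if "finite G" for G
		proof -
			have "(SUM i:G. norm (x i) powr enn2real p) = (SUM i:G \<inter> F. norm (x i) powr enn2real p)"
				using that assms(2) by (intro sum.mono_neutral_right) auto
			also have "... <= ?S" using assms(1) by (intro sum_mono2) auto
			finally show ?thesis .
		qed
		then show ?thesis using False S by (intro exI[of _ "?S powr (1 / enn2real p)"]) (simp add: bnd_def)
	qed
	ultimately show ?thesis by (simp add: lp_pts_iff)
qed

lemma lp_proj_space:
	assumes fd: "fin_dim (UNIV :: 'x::{complex_normed_vector, banach} set)"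
	shows "proj_space (lp p :: ('n::finite, 'x) sq cnspace) (P_op p)"
proof -
	interpret Y: banach_cn "lp p :: ('n, 'x) sq cnspace" by (rule lp_banach)
	have in': "x + y : lp_pts p" "a *C x : lp_pts p"
		if "x : lp_pts p" "y : lp_pts p" for x y :: "('n, 'x) sq" and a
		using Y.add_in[of x y] Y.scale_in[of x a] that by auto
	show ?thesis
	proof
		show "P_op p n : ops (lp p :: ('n, 'x) sq cnspace)" for n
			by (rule bopI[where c = 1])
				(auto simp: P_op_trunc trunc_lp in' trunc_add trunc_scale)
	next
		fix x :: "('n, 'x) sq" and m n assume "x : pts (lp p)"
		then show "P_op p m (P_op p n x) = P_op p (min m n) x"
			by (simp add: P_op_trunc trunc_lp trunc_trunc)
	next
		fix x :: "('n, 'x) sq" and n assume "x : pts (lp p)"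
		then show "nrm (lp p) (P_op p n x) <= nrm (lp p) x" "nrm (lp p) (x - P_op p n x) <= nrm (lp p) x"
			by (simp_all add: P_op_trunc trunc_lp)
	next
		fix n
		obtain B0 :: "'x set" where B0: "finite B0" "UNIV \<subseteq> cspan B0" using fd unfolding fin_dim_def by blast
		\<comment> \<open>\<open>dl i v\<close> has the single entry \<open>v\<close> at \<open>i\<close>;
		  those with \<open>i\<close> in the cube and \<open>v\<close> in \<open>B0\<close> span the
		  truncations.\<close>
		define dl where "dl = (%(i :: int ^ 'n) (v :: 'x) j. if j = i then v else 0)"
		let ?B = "(%(i, b). dl i b) ` (cube n \<times> B0)"
		have "trunc n x : cspan ?B" for x :: "('n, 'x) sq"
		proof -
			have "trunc n x j = (SUM i:cube n. dl i (x i) j)" for j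
				by (simp add: trunc_def dl_def finite_cube)
			then have eq: "trunc n x = (SUM i:cube n. dl i (x i))" by (simp add: fun_eq_iff sum_fun_apply)
			have "dl i v : cspan ?B" if i: "i : cube n" for i v
			proof -
				have "v : cspan B0" using B0(2) by blast
				then obtain t where t: "v = (SUM b:B0. t b *C b)" using B0(1) by (auto simp: cspan_finite)
				have "dl i v = (SUM b:B0. t b *C dl i b)"
					by (rule ext) (simp add: t dl_def sum_fun_apply scaleC_fun_def)
				also have "... : cspan ?B"
					using i by (intro cspan_sum cspan_scale cspan_base) auto
				finally show ?thesis .
			qed
			then show ?thesis unfolding eq by (intro cspan_sum)
		qed
		then have 1: "P_op p n ` pts (lp p) \<subseteq> cspan ?B" by (auto simp: P_op_trunc)
		have "dl i b : lp_pts p" for i b by (rule finite_support_lp[of "{i}"]) (auto simp: dl_def)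
		then have 2: "?B \<subseteq> pts (lp p)" by auto
		have 3: "finite ?B" using B0(1) finite_cube by blast
		show "EX B :: ('n, 'x) sq set. finite B & B \<subseteq> pts (lp p) & P_op p n ` pts (lp p) \<subseteq> cspan B"
			by (rule exI[of _ ?B]) (intro conjI 1 2 3)
	qed
qed

lemma lp_tails_vanish:
	assumes "p ~= \<infinity>" shows "tails_vanish (lp p :: ('n::finite, 'x::complex_normed_vector) sq cnspace) (P_op p)"
	unfolding tails_vanish_def
proof
	fix x :: "('n, 'x) sq" assume "x : pts (lp p)"
	then have x: "x : lp_pts p" by simp
	have small: "EX n. bnd e (x - trunc n x)" if e: "e > 0" for e
	proof (cases "p = 0")
		case True
		then have "vanishing x" using x lp_pts_iff[of x] by blast
		then obtain n where "ALL i. i ~: cube n --> norm (x i) <= e" using e unfolding vanishing_def by blast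
		then show ?thesis unfolding bnd_def using True e by (intro exI[of _ n]) (simp add: trunc_def)
	next
		case False
		then have f: "~ (p = 0 \<or> p = \<infinity>)" using assms by simp
		let ?f = "%i. norm (x i) powr enn2real p"
		note l = lp_infsum[OF f x]
		\<comment> \<open>If all finite sums stayed below the total by \<open>e powr enn2real p\<close>,
		  so would the total. A finite set exceeding this leaves less than that amount for everything
		  outside.\<close>
		have "~ (ALL F. finite F --> F \<subseteq> UNIV --> sum ?f F <= infsum ?f UNIV - e powr enn2real p)"
		proof
			assume "ALL F. finite F --> F \<subseteq> UNIV --> sum ?f F <= infsum ?f UNIV - e powr enn2real p"
			then have "infsum ?f UNIV <= infsum ?f UNIV - e powr enn2real p" by (intro infsum_le_finite_sums l(1)) auto
			moreover have "e powr enn2real p > 0" using e by simp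
			ultimately show False by linarith
		qed
		then obtain F0 where F0: "finite F0" "sum ?f F0 > infsum ?f UNIV - e powr enn2real p" by (auto simp: not_le)
		obtain n where n: "F0 \<subseteq> cube n" using finite_subset_cube[OF F0(1)] by blast
		have "(SUM i:F. norm ((x - trunc n x) i) powr enn2real p) <= e powr enn2real p" if F: "finite F" for F
		proof -
			have "(SUM i:F. norm ((x - trunc n x) i) powr enn2real p) = sum ?f (F - cube n)"
				using F by (intro sum.mono_neutral_cong_right) (auto simp: trunc_def)
			also have "sum ?f (F - cube n) + sum ?f F0 = sum ?f ((F - cube n) \<union> F0)"
				using F F0(1) n by (intro sum.union_disjoint[symmetric]) auto
			then have "sum ?f (F - cube n) = sum ?f ((F - cube n) \<union> F0) - sum ?f F0" by simp
			also have "sum ?f ((F - cube n) \<union> F0) <= infsum ?f UNIV"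
				using F F0(1) by (intro finite_sum_le_infsum l(1)) auto
			finally show ?thesis using F0(2) by linarith
		qed
		then show ?thesis using f by (intro exI[of _ n]) (simp add: bnd_def)
	qed
	show "(%n. nrm (lp p) (x - P_op p n x)) ----> 0"
	proof (rule LIMSEQ_I)
		fix e :: real assume e: "e > 0"
		obtain N where N: "bnd (e / 2) (x - trunc N x)" using small[of "e / 2"] e by auto
		have "norm (nrm (lp p) (x - P_op p n x) - 0) < e" if n: "n >= N" for n
		proof -
			have "bnd (e / 2) (x - trunc n x)"
				by (rule bnd_dominated[OF N]) (use e cube_mono[OF n] in \<open>auto simp: trunc_def\<close>)
			then show ?thesis
				using lp_norm_le_iff[OF trunc_lp(3)[OF x, of n], of "e / 2"] lp_norm_nonneg[OF trunc_lp(3)[OF x, of n]] e x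
				by (simp add: P_op_trunc)
		qed
		then show "EX N. ALL n>=N. norm (nrm (lp p) (x - P_op p n x) - 0) < e" by blast
	qed
qed

text \<open>Norm bounds survive entrywise limits and give membership; for p = 0 they do not, because
  the limit may fail to vanish at infinity.\<close>

lemma lp_locally_compact:
	assumes fd: "fin_dim (UNIV :: 'x::{complex_normed_vector, banach} set)" and p0: "p ~= 0"
	shows "locally_compact (lp p :: ('n::finite, 'x) sq cnspace) (P_op p)"
	unfolding locally_compact_def
proof (intro allI impI)
	interpret Y: proj_space "lp p :: ('n, 'x) sq cnspace" "P_op p" by (rule lp_proj_space[OF fd])
	fix x :: "nat => ('n, 'x) sq" and M assume x: "ALL n. x n : pts (lp p) & nrm (lp p) (x n) <= M"
	then have x': "x n : lp_pts p" "lp_norm p (x n) <= M" "x n - x m : lp_pts p" for n m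
		using Y.diff_in[of "x n" "x m"] by auto
	have M: "0 <= M" using lp_norm_nonneg[OF x'(1)] x'(2) order_trans by blast
	obtain d :: "nat => nat" where d: "strict_mono d"
		"!!n e. e > 0 ==> EX N. ALL i>=N. ALL j>=N. nrm (lp p) (P_op p n (x (d i) - x (d j))) < e"
		by (rule Y.local_cauchy_subsequence[of x M]) (use x in auto)
	have c: "EX N. ALL i>=N. ALL j>=N. bnd e (trunc n (x (d i)) - trunc n (x (d j)))" if e: "e > 0" for e n
	proof -
		obtain N where N: "ALL i>=N. ALL j>=N. nrm (lp p) (P_op p n (x (d i) - x (d j))) < e" using d(2)[OF e] by blast
		have "bnd e (trunc n (x (d i)) - trunc n (x (d j)))" if "i >= N" "j >= N" for i j
		proof -
			have "bnd e (trunc n (x (d i) - x (d j)))"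
				using less_imp_le[OF N[rule_format, OF that]] lp_norm_le_iff[OF trunc_lp(1)[OF x'(3)[of "d i" "d j"]], of e n] e
				by (simp add: P_op_trunc x')
			moreover have "trunc n (x (d i) - x (d j)) = trunc n (x (d i)) - trunc n (x (d j))"
				by (auto simp: trunc_def fun_eq_iff)
			ultimately show ?thesis by simp
		qed
		then show ?thesis by blast
	qed
	have "EX l. (%n. x (d n) i) ----> l" for i
	proof -
		obtain m where "{i} \<subseteq> cube m" using finite_subset_cube[of "{i}"] by blast
		then have i: "i : cube m" by simp
		have "Cauchy (%n. x (d n) i)"
		proof (rule metric_CauchyI)
			fix e :: real assume e: "e > 0"
			obtain N where N: "ALL k>=N. ALL l>=N. bnd (e / 2) (trunc m (x (d k)) - trunc m (x (d l)))" using c[of "e / 2" m] e by auto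
			have "dist (x (d k) i) (x (d l) i) < e" if "k >= N" "l >= N" for k l
				using bnd_entry[OF N[rule_format, OF that], of i] e i by (simp add: dist_norm trunc_def)
			then show "EX N. ALL k>=N. ALL l>=N. dist (x (d k) i) (x (d l) i) < e" by blast
		qed
		then show ?thesis by (simp add: Cauchy_convergent_iff convergent_def)
	qed
	then obtain y where y: "!!i. (%n. x (d n) i) ----> y i" by metis
	have "bnd M y" by (rule bnd_limit[OF _ y]) (use lp_norm_le_iff[OF x'(1) M] x'(2) in blast)
	then have yp: "y : lp_pts p" using M p0 by (auto simp: lp_pts_iff)
	have "(%n. nrm (lp p) (P_op p j (x (d n)) - P_op p j y)) ----> 0" for j
	proof (rule LIMSEQ_I)
		fix e :: real assume e: "e > 0"
		obtain N where N: "ALL k>=N. ALL l>=N. bnd (e / 2) (trunc j (x (d k)) - trunc j (x (d l)))" using c[of "e / 2" j] e by auto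
		have "norm (nrm (lp p) (P_op p j (x (d n)) - P_op p j y) - 0) < e" if n: "n >= N" for n
		proof -
			have "bnd (e / 2) (trunc j (x (d n)) - trunc j y)"
				by (rule bnd_cauchy_limit[where z = "%n. trunc j (x (d n))" and N = N, OF _ _ n])
					(use N y in \<open>auto simp: trunc_def\<close>)
			moreover have t: "trunc j (x (d n)) - trunc j y : lp_pts p"
				using Y.diff_in[of "trunc j (x (d n))" "trunc j y"] by (simp add: trunc_lp x' yp)
			ultimately show ?thesis
				using lp_norm_le_iff[OF t, of "e / 2"] lp_norm_nonneg[OF t] e by (simp add: P_op_trunc x' yp)
		qed
		then show "EX N. ALL n>=N. norm (nrm (lp p) (P_op p j (x (d n)) - P_op p j y) - 0) < e" by blast
	qed
	then show "EX (r :: nat => nat) y. strict_mono r & y : pts (lp p) &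
			(ALL j. (%n. nrm (lp p) (P_op p j (x (r n)) - P_op p j y)) ----> 0)"
		using d(1) yp by (intro exI[of _ d] exI[of _ y]) simp
qed

lemma disjoint_supports:
	assumes "u : lp_pts p" "v : lp_pts p" "P_op p n u = u" "P_op p n v = 0"
	shows "u i = 0 \<or> v i = 0"
proof -
	have "trunc n u i = u i" "trunc n v i = 0" using assms by (auto simp: P_op_trunc fun_eq_iff)
	then show ?thesis by (cases "i : cube n") (auto simp: trunc_def)
qed

lemma lp_max_norm: "p = 0 \<or> p = \<infinity> ==> max_norm (lp p :: ('n::finite, 'x::{complex_normed_vector, banach}) sq cnspace) (P_op p)"
	unfolding max_norm_def
proof (intro allI ballI impI)
	interpret Y: banach_cn "lp p :: ('n, 'x) sq cnspace" by (rule lp_banach)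
	fix n and u v :: "('n, 'x) sq"
	assume p0: "p = 0 \<or> p = \<infinity>" and uv: "u : pts (lp p)" "v : pts (lp p)" and R: "P_op p n u = u" "P_op p n v = 0"
	have d: "u i = 0 \<or> v i = 0" for i using disjoint_supports[of u v n i] uv R by simp
	have b: "norm (u i) <= lp_norm p u" "norm (v i) <= lp_norm p v" for i
		using bnd_entry[OF bnd_norm lp_norm_nonneg] uv by auto
	have "norm (u i + v i) <= max (lp_norm p u) (lp_norm p v)" for i
		using d[of i] b[of i] by auto
	then have "bnd (max (lp_norm p u) (lp_norm p v)) (u + v)" using p0 by (simp add: bnd_def)
	then show "nrm (lp p) (u + v) <= max (nrm (lp p) u) (nrm (lp p) v)"
		using lp_norm_le_iff[of "u + v"] Y.add_in[OF uv] lp_norm_nonneg[of u] uv by (simp add: max_def)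
qed

text \<open>On disjoint supports p-th powers of norms add, so two vectors of equal norm gain the
  factor \<open>2 powr (1 / enn2real p)\<close>; for the maximum norm the factor is 1.\<close>

lemma lp_lp_like:
	assumes fd: "fin_dim (UNIV :: 'x::{complex_normed_vector, banach} set)" and nz: "(UNIV :: 'x set) ~= {0}"
	obtains ka where "lp_like (lp p :: ('n::finite, 'x) sq cnspace) (P_op p) ka"
proof -
	interpret Y: proj_space "lp p :: ('n, 'x) sq cnspace" "P_op p" by (rule lp_proj_space[OF fd])
	define ka where "ka = (if p = 0 \<or> p = \<infinity> then 1 else 2 powr (1 / enn2real p))"
	let ?s = "enn2real p"
	have pw: "lp_norm p (u + v) powr ?s = lp_norm p u powr ?s + lp_norm p v powr ?s"
		if f: "~ (p = 0 \<or> p = \<infinity>)" and uv: "u : lp_pts p" "v : lp_pts p" and R: "P_op p n u = u" "P_op p n v = 0"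
		for u v :: "('n, 'x) sq" and n
	proof -
		have "u + v : lp_pts p" using Y.add_in[of u v] uv by simp
		then have "lp_norm p (u + v) powr ?s = (\<Sum>\<^sub>\<infinity>i. norm (u i + v i) powr ?s)" using lp_infsum(2)[OF f, of "u + v"] by simp
		also have "... = (\<Sum>\<^sub>\<infinity>i. norm (u i) powr ?s + norm (v i) powr ?s)"
		proof (rule infsum_cong)
			show "norm (u i + v i) powr ?s = norm (u i) powr ?s + norm (v i) powr ?s" for i
				using disjoint_supports[OF uv R, of i] by auto
		qed
		also have "... = lp_norm p u powr ?s + lp_norm p v powr ?s"
			by (simp add: infsum_add lp_infsum[OF f uv(1)] lp_infsum[OF f uv(2)])
		finally show ?thesis .
	qed
	have kas: "ka powr ?s = 2" "ka > 0" if "~ (p = 0 \<or> p = \<infinity>)"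
		using that s_ge_1[OF that] by (auto simp: ka_def powr_powr)
	have "lp_like (lp p :: ('n, 'x) sq cnspace) (P_op p) ka"
	proof
		show "1 <= ka" "ka <= 2"
			using s_ge_1 powr_mono[of "1 / ?s" 1 2] by (auto simp: ka_def ge_one_powr_ge_zero)
	next
		fix u v :: "('n, 'x) sq" and n
		assume uv: "u : pts (lp p)" "v : pts (lp p)" and R: "P_op p n u = u" "P_op p n v = 0"
		have uv': "u : lp_pts p" "v : lp_pts p" "u + v : lp_pts p" using uv Y.add_in[OF uv] by auto
		have n: "0 <= lp_norm p u" "0 <= lp_norm p v" "0 <= lp_norm p (u + v)" using uv' lp_norm_nonneg by auto
		show "nrm (lp p) (u + v) <= ka * max (nrm (lp p) u) (nrm (lp p) v)"
		proof (cases "p = 0 \<or> p = \<infinity>")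
			case True
			then show ?thesis using lp_max_norm[OF True, unfolded max_norm_def] uv R by (auto simp: ka_def)
		next
			case False
			note s = s_ge_1[OF False]
			let ?m = "max (lp_norm p u) (lp_norm p v)"
			have "lp_norm p u powr ?s <= ?m powr ?s" "lp_norm p v powr ?s <= ?m powr ?s"
				using n s by (auto intro!: powr_mono2)
			then have "lp_norm p (u + v) powr ?s <= (ka * ?m) powr ?s"
				using pw[OF False uv'(1,2) R] n kas[OF False] by (simp add: powr_mult)
			then show ?thesis using powr_le_cancel[of ?s "ka * ?m"] s n kas[OF False] by (simp add: max_def)
		qed
		show "ka * (nrm (lp p) u + nrm (lp p) v) <= 2 * nrm (lp p) (u + v)"
		proof (cases "p = 0 \<or> p = \<infinity>")
			case True
			have "norm (u i) <= norm ((u + v) i)" "norm (v i) <= norm ((u + v) i)" for i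
				using disjoint_supports[OF uv'(1,2) R, of i] by auto
			then have "lp_norm p u <= lp_norm p (u + v)" "lp_norm p v <= lp_norm p (u + v)" using lp_dominated(2)[OF uv'(3)] by blast+
			then show ?thesis using True by (simp add: ka_def)
		next
			case False
			note s = s_ge_1[OF False]
			\<comment> \<open>The lower estimate is convexity of the power at the midpoint of the two
			  norms.\<close>
			let ?a = "(lp_norm p u + lp_norm p v) / 2"
			have "?a powr ?s <= (lp_norm p u powr ?s + lp_norm p v powr ?s) / 2"
				using powr_convex_nonneg[OF s n(1,2), of "1 / 2"] by (simp add: field_simps)
			then have "2 * ?a powr ?s <= lp_norm p (u + v) powr ?s" using pw[OF False uv'(1,2) R] by simp
			moreover have "(ka * ?a) powr ?s = ka powr ?s * ?a powr ?s"
				by (rule powr_mult)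
			ultimately have "(ka * ?a) powr ?s <= lp_norm p (u + v) powr ?s" unfolding kas(1)[OF False] by linarith
			from powr_le_cancel[OF _ n(3) this] have "ka * ?a <= lp_norm p (u + v)" using s by simp
			then show ?thesis by simp
		qed
	next
		fix x :: "('n, 'x) sq" and c
		assume "x : pts (lp p)" and le: "!!j. nrm (lp p) (P_op p j x) <= c"
		then have x: "x : lp_pts p" by simp
		have le': "lp_norm p (trunc j x) <= c" for j using le[of j] x by (simp add: P_op_trunc)
		then have c: "0 <= c" using lp_norm_nonneg[OF trunc_lp(1)[OF x, of 0]] order_trans by blast
		have "bnd c x" by (rule bnd_trunc) (use le' lp_norm_le_iff[OF trunc_lp(1)[OF x] c] in blast)
		then show "nrm (lp p) x <= c" using lp_norm_le_iff[OF x c] by simp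
	next
		fix n
		obtain v :: 'x where v: "v ~= 0" using nz by blast
		obtain i where i: "i ~: (cube n :: (int ^ 'n) set)" using not_in_cube by blast
		let ?x = "%j. if j = i then v else 0"
		have x: "?x : lp_pts p" by (rule finite_support_lp[of "{i}"]) auto
		have "trunc n ?x = 0" "?x ~= 0" using i v by (auto simp: trunc_def fun_eq_iff)
		then show "EX x:pts (lp p :: ('n, 'x) sq cnspace). P_op p n x = 0 & x ~= 0"
			using x by (intro bexI[of _ ?x]) (auto simp: P_op_trunc)
	next
		show "locally_compact (lp p :: ('n, 'x) sq cnspace) (P_op p) \<or>
				tails_vanish (lp p :: ('n, 'x) sq cnspace) (P_op p) & max_norm (lp p :: ('n, 'x) sq cnspace) (P_op p)"
			using lp_locally_compact[OF fd] lp_tails_vanish lp_max_norm by (cases "p = 0") auto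
		show "tails_vanish (lp p :: ('n, 'x) sq cnspace) (P_op p) \<or>
				locally_compact (lp p :: ('n, 'x) sq cnspace) (P_op p) & max_norm (lp p :: ('n, 'x) sq cnspace) (P_op p)"
			using lp_locally_compact[OF fd] lp_tails_vanish lp_max_norm by (cases "p = \<infinity>") auto
	qed
	then show ?thesis by (rule that)
qed

end

theorem theorem5p24:
  fixes p :: ennreal
    and A :: "('n::finite, 'x::{complex_normed_vector, banach}) sq \<Rightarrow> ('n, 'x) sq"
  defines "X \<equiv> (lp p :: ('n, 'x) sq cnspace)"
  defines "X' \<equiv> dual X"
  defines "P \<equiv> (P_op p :: nat \<Rightarrow> ('n, 'x) sq \<Rightarrow> ('n, 'x) sq)"
  defines "P' \<equiv> (\<lambda>n. adj X (P n))"
  defines "A' \<equiv> adj X A"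
  defines "XX' \<equiv> sum_space X X'"
  defines "PP' \<equiv> (\<lambda>n. sum_op X X' (P n) (P' n))"
  defines "AA' \<equiv> sum_op X X' A A'"
  defines "m \<equiv> mu_tilde X (Q_op p) A"
  defines "m' \<equiv> mu_tilde X' (\<lambda>n. adj X (Q_op p n)) A'"
  assumes p: "p = 0 \<or> 1 \<le> p"
    and X_nonzero: "(UNIV :: 'x set) \<noteq> {0}"
    and X_fin_dim: "fin_dim (UNIV :: 'x set)"
    and A: "A \<in> proj_ops X P"
  shows
    "(nu_ess_c XX' AA' = nu_ess XX' PP' AA' \<and>
      nu_ess XX' PP' AA' = mu p A \<and>
      mu p A = inv_coset_norm_inv X (proj_ops X P) (proj_compact_ops X P) A \<and>
      inv_coset_norm_inv X (proj_ops X P) (proj_compact_ops X P) A =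
        inv_coset_norm_inv X (ops X) (compact_ops X) A)
   \<and> (fredholm X A \<and> fredholm_index X A = 0 \<longrightarrow>
       nu_ess_c X A = nu_ess_c X' A' \<and>
       nu_ess_c X' A' = nu_ess X P A \<and>
       nu_ess X P A = nu_ess X' P' A' \<and>
       nu_ess X' P' A' = mu p A \<and>
       mu p A = m \<and>
       m = m' \<and>
       m' > 0)
   \<and> (nu_ess_c X A > 0 \<and> nu_ess_c X' A' > 0 \<longrightarrow>
       fredholm X A \<and> fredholm_index X A = 0)"
proof -
  interpret exponent p by unfold_locales (rule p)
  obtain \<kappa> where "lp_like X P \<kappa>" unfolding X_def P_def by (rule lp_lp_like[OF X_fin_dim X_nonzero])
  then interpret lp_like X P \<kappa> .
  have Q: "Q_op p n = id_op X - P n" for n by (simp add: Q_op_def X_def P_def)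
  \<comment> \<open>Every quantity of the statement is identified with \<open>ess_bound A\<close>,
    so the chains of equalities become reflexivity.\<close>
  have 1: "nu_ess_c XX' AA' = ess_bound A" "nu_ess XX' PP' AA' = ess_bound A"
    unfolding XX'_def PP'_def AA'_def P'_def A'_def X'_def by (rule sum_space_nu[OF A])+
  have 2: "mu p A = ess_bound A"
    using mu_min_eq[OF A Q] by (simp add: mu_def X_def)
  \<comment> \<open>The one-sided numbers agree with \<open>ess_bound A\<close> in the presence of a
    regularizer, which the Fredholm property provides.\<close>
  have 3: "m = ess_bound A \<and> m' = ess_bound A \<and> ess_bound A > 0" if F: "fredholm X A"
  proof -
    obtain n B W \<omega> where reg: "regularizer A n B W \<omega>" by (rule regularizer_fredholm[OF A F]) (rule that)
    show ?thesis
      unfolding m_def m'_def X'_def A'_def using mu_tilde_eq[OF A Q reg] ess_bound_pos[OF A reg] by simp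
  qed
  have 4: "nu_ess_c X A = ess_bound A \<and> nu_ess X P A = ess_bound A \<and>
      nu_ess_c X' A' = ess_bound A \<and> nu_ess X' P' A' = ess_bound A"
    if F: "fredholm X A \<and> fredholm_index X A = 0"
    unfolding X'_def A'_def P'_def using index_zero_nu[OF A conjunct1[OF F] conjunct2[OF F]] by blast
  have 5: "fredholm X A \<and> fredholm_index X A = 0" if pos: "nu_ess_c X A > 0 \<and> nu_ess_c X' A' > 0"
    using fredholm_index_zero_if_nu_pos[OF A conjunct1[OF pos] conjunct2[OF pos, unfolded X'_def A'_def]] by blast
  show ?thesis
  proof (rule conjI[OF _ conjI[OF impI impI]])
    show "nu_ess_c XX' AA' = nu_ess XX' PP' AA' \<and> nu_ess XX' PP' AA' = mu p A \<and>
        mu p A = inv_coset_norm_inv X (proj_ops X P) (proj_compact_ops X P) A \<and>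
        inv_coset_norm_inv X (proj_ops X P) (proj_compact_ops X P) A = inv_coset_norm_inv X (ops X) (compact_ops X) A"
      unfolding 1 2 quotient_norms[OF A] by (intro conjI refl)
    show "fredholm X A \<and> fredholm_index X A = 0" if "nu_ess_c X A > 0 \<and> nu_ess_c X' A' > 0" by (rule 5[OF that])
    assume F: "fredholm X A \<and> fredholm_index X A = 0"
    note 4 = 4[OF F] and 3 = 3[OF conjunct1[OF F]]
    show "nu_ess_c X A = nu_ess_c X' A' \<and> nu_ess_c X' A' = nu_ess X P A \<and> nu_ess X P A = nu_ess X' P' A' \<and>
        nu_ess X' P' A' = mu p A \<and> mu p A = m \<and> m = m' \<and> m' > 0"
      unfolding 2 4[THEN conjunct1] 4[THEN conjunct2, THEN conjunct1] 4[THEN conjunct2, THEN conjunct2, THEN conjunct1]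
        4[THEN conjunct2, THEN conjunct2, THEN conjunct2] 3[THEN conjunct1] 3[THEN conjunct2, THEN conjunct1]
      by (intro conjI refl 3[THEN conjunct2, THEN conjunct2])
  qed
qed

end
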